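(* Let $n\ge 2$ and let $m$ be a continuous, positive, piecewise smooth function on the unit sphere $S^{n-1}\subset\mathbb{R}^n$, and let $D=\{r\theta:\ \theta\in S^{n-1},\ 0\le r\le m(\theta)^{1/n}\}$, i.e. the compact body whose boundary is given in polar coordinates by $r=m(\theta)^{1/n}$. Assume that $D$ is convex and that $\partial D$ is real-analytic. Let $f$ be a smooth function on $S^{n-1}$. For $\gamma\in\mathbf{SO}(n)$ and $\rho>0$ put \[N_D(\rho,\gamma)=\sum_{N\in\gamma\mathbb{Z}^n\setminus\{0\},\ N\in\rho D} f\big(N/|N|\big),\qquad R_D(\rho,\gamma)=\int_{S^{n-1}} f(\theta)\,m(\theta)\,d\theta-\frac{n}{\rho^n}N_D(\rho,\gamma).\] Then, as $\rho\to\infty$, \[\int_{\mathbf{SO}(n)}|R_D(\rho,\gamma)|\,d\gamma \ll \rho^{-2n/(n+1)},\] where $d\gamma$ is Haar measure on $\mathbf{SO}(n)$ and the implied constant is independent of $\rho$.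
   Context: $d\theta$ denotes the standard (Lebesgue) surface measure on $S^{n-1}$. $\gamma\mathbb{Z}^n$ is the image of the integer lattice under the rotation $\gamma$. Equivalently, $N_D(\rho,\gamma)$ is the action on $f$ of the discrete measure on $S^{n-1}$ obtained by placing unit masses at the radial projections $N/|N|$ of the nonzero points of the rotated lattice lying in the dilate $\rho D$. The notation $A\ll B$ means $|A|\le CB$ for a constant $C$. *)

theory Defs
  imports "HOL-Analysis.Analysis" "HOL-Probability.Probability"
begin

fun Ck_on :: "nat \<Rightarrow> (real^'n) set \<Rightarrow> (real^'n \<Rightarrow> real) \<Rightarrow> bool" where
  "Ck_on 0 S g = continuous_on S g"
| "Ck_on (Suc k) S g =
     (continuous_on S g \<and> (\<forall>x\<in>S. g differentiable (at x)) \<and>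
      (\<forall>i. Ck_on k S (\<lambda>x. frechet_derivative g (at x) (axis i 1))))"

definition smooth_on :: "(real^'n) set \<Rightarrow> (real^'n \<Rightarrow> real) \<Rightarrow> bool" where
  "smooth_on S g \<longleftrightarrow> open S \<and> (\<forall>k. Ck_on k S g)"

definition smooth_on_sphere :: "(real^'n \<Rightarrow> real) \<Rightarrow> bool" where
  "smooth_on_sphere f \<longleftrightarrow>
     (\<exists>U g. sphere 0 1 \<subseteq> U \<and> smooth_on U g \<and> (\<forall>x\<in>sphere 0 1. f x = g x))"

(* piecewise smooth on the sphere: the sphere is covered by finitely many closed
   pieces, each the closure of its relative interior, on each of which the
   function is the restriction of a smooth function defined near the piece *)
definition piecewise_smooth_on_sphere :: "(real^'n \<Rightarrow> real) \<Rightarrow> bool" where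
  "piecewise_smooth_on_sphere f \<longleftrightarrow>
     (\<exists>\<K>. finite \<K> \<and> \<Union>\<K> = sphere 0 1 \<and>
        (\<forall>K\<in>\<K>. closed K \<and> K = closure (K \<inter> (- closure (sphere 0 1 - K))) \<and>
            (\<exists>U g. K \<subseteq> U \<and> smooth_on U g \<and> (\<forall>x\<in>K. f x = g x))))"

definition real_analytic_on :: "(real^'n) set \<Rightarrow> (real^'n \<Rightarrow> real) \<Rightarrow> bool" where
  "real_analytic_on U F \<longleftrightarrow> open U \<and>
     (\<forall>p\<in>U. \<exists>c :: ('n \<Rightarrow> nat) \<Rightarrow> real. \<exists>r>0. ball p r \<subseteq> U \<and>
        (\<forall>x\<in>ball p r.
           ((\<lambda>\<alpha>. c \<alpha> * (\<Prod>i\<in>UNIV. (x$i - p$i) ^ \<alpha> i)) has_sum F x) UNIV))"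

definition real_analytic_hypersurface :: "(real^'n) set \<Rightarrow> bool" where
  "real_analytic_hypersurface M \<longleftrightarrow>
     (\<forall>p\<in>M. \<exists>U F. p \<in> U \<and> real_analytic_on U F \<and>
        (\<forall>x\<in>U. (F has_derivative frechet_derivative F (at x)) (at x)
                 \<and> frechet_derivative F (at x) \<noteq> (\<lambda>v. 0)) \<and>
        M \<inter> U = {x\<in>U. F x = 0})"

(* Lebesgue surface measure integral on S^{n-1}, via polar coordinates:
   int_{S^{n-1}} g d theta = n * int_{unit ball} g(x/|x|) dx *)
definition sphere_integral :: "(real^'n \<Rightarrow> real) \<Rightarrow> real" where
  "sphere_integral g = real CARD('n) * (LINT x : ball 0 1 | lborel. g (x /\<^sub>R norm x))"

definition SOn :: "(real^'n^'n) set" where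
  "SOn = {A. orthogonal_matrix A \<and> det A = 1}"

definition int_lattice :: "(real^'n) set" where
  "int_lattice = {x. \<forall>i. x $ i \<in> \<int>}"

definition haar_SO :: "(real^'n^'n) measure \<Rightarrow> bool" where
  "haar_SO \<mu> \<longleftrightarrow> prob_space \<mu> \<and> sets \<mu> = sets borel \<and> emeasure \<mu> SOn = 1 \<and>
     (\<forall>g\<in>SOn. distr \<mu> borel (\<lambda>A. g ** A) = \<mu>)"

definition body :: "(real^'n \<Rightarrow> real) \<Rightarrow> (real^'n) set" where
  "body m = {r *\<^sub>R \<theta> | r \<theta>. \<theta> \<in> sphere 0 1 \<and> 0 \<le> r \<and> r \<le> m \<theta> powr (1 / real CARD('n))}"

definition N_D :: "(real^'n \<Rightarrow> real) \<Rightarrow> (real^'n) set \<Rightarrow> real \<Rightarrow> real^'n^'n \<Rightarrow> real" where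
  "N_D f D \<rho> \<gamma> = (\<Sum>N \<in> {N. N \<in> (\<lambda>k. \<gamma> *v k) ` int_lattice \<and> N \<noteq> 0 \<and> N \<in> (\<lambda>x. \<rho> *\<^sub>R x) ` D}.
                      f (N /\<^sub>R norm N))"

definition R_D :: "(real^'n \<Rightarrow> real) \<Rightarrow> (real^'n \<Rightarrow> real) \<Rightarrow> real \<Rightarrow> real^'n^'n \<Rightarrow> real" where
  "R_D f m \<rho> \<gamma> = sphere_integral (\<lambda>\<theta>. f \<theta> * m \<theta>)
                    - real CARD('n) / \<rho> ^ CARD('n) * N_D f (body m) \<rho> \<gamma>"

end

theory Submission
  imports Defs
begin

text \<open>
  The lattice sum over \<open>\<rho> D\<close> is smoothed at scale \<open>eps\<close> with a product of triangle functions whose Fourier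
  coefficients are nonnegative and explicit. By convexity of \<open>D\<close> the smoothed sums over \<open>(\<rho> \<plusminus> c eps) D\<close> enclose
  the true one, up to \<open>O(eps \<rho>^(n-1))\<close>. By Poisson summation, the smoothed sum minus its mean is a combination of
  values of the Fourier transform of \<open>f(x/|x|) 1\<^sub>D\<close> at the points \<open>\<rho> \<gamma> k\<close>. On average over directions this transform
  decays like \<open>R powr (-(n+1)/2)\<close> even where the boundary is flat: writing the integral over \<open>D\<close> in polar coordinates and
  integrating by parts radially, the \<open>L\<^sup>2\<close> norm over directions becomes a double integral over boundary points whose
  kernel, an oscillatory integral over the sphere of directions, is controlled by nonstationary phase, because
  \<open>q - q'\<close> is transversal to the directions that are close to the normal. Choosing \<open>eps\<close> to balance the two errors gives the exponent.
\<close>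

text \<open>The averaged decay is a matter of dimension, not of curvature. The kernel between two
  boundary points decays like (1 + R |q - q'|)^(-n) while the boundary has dimension n - 1, so the
  double integral has size R^(-(n-1)); the radial integration by parts contributes R^(-2) after
  squaring. The weight f(x/|x|) is in general not smooth at the origin, which blocks integration by
  parts there. It is invariant under doubling, and this yields a recursion for the transform of the
  part near the origin whose factor 2 powr ((n+1)/2 - n) is below 1. Enclosing the sum between two
  smoothed sums presupposes f >= 0; a general f is written as the difference of f + B and the
  constant B. Measurability of the remainder in \<gamma> is not established. Each estimate is
  carried by a measurable majorant built from a liminf of partial Fourier sums, the form in which
  Fatou's lemma applies. Integration by parts is abstracted from the measure, so that the interior
  of the body, its boundary region and the sphere share one argument.\<close>

section \<open>Families of functions with uniform \<open>C^k\<close> bounds\<close>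

text \<open>One bound serves all parameters \<open>w \<in> W\<close>, for the functions and their
  derivatives up to order k; this is what makes later constants independent of directions and of
  pairs of boundary points. The gradient is an existential witness, so that each closure property
  can exhibit it. Derivatives are taken \<open>at x\<close> in the whole space, so \<open>S\<close>
  may be a sphere as well as an open set.\<close>

fun UC :: "nat \<Rightarrow> 'w set \<Rightarrow> (real^'n) set \<Rightarrow> ('w \<Rightarrow> real^'n \<Rightarrow> real) \<Rightarrow> bool" where
 "UC 0 W S h = ((\<forall>w\<in>W. continuous_on S (h w)) \<and> (\<exists>M. \<forall>w\<in>W. \<forall>x\<in>S. \<bar>h w x\<bar> \<le> M))"
| "UC (Suc k) W S h = ((\<exists>M. \<forall>w\<in>W. \<forall>x\<in>S. \<bar>h w x\<bar> \<le> M) \<and>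
   (\<exists>D. (\<forall>w\<in>W. \<forall>x\<in>S. (h w has_derivative (\<lambda>v. D w x \<bullet> v)) (at x)) \<and>
     (\<forall>i. UC k W S (\<lambda>w x. D w x $ i))))"

declare UC.simps(2) [simp del]

lemma UC_bounded: "UC k W S h \<Longrightarrow> \<exists>M. \<forall>w\<in>W. \<forall>x\<in>S. \<bar>h w x\<bar> \<le> M"
 by (cases k) (auto simp: UC.simps)

lemma UC_SucI:
 assumes "\<And>w x. w \<in> W \<Longrightarrow> x \<in> S \<Longrightarrow> \<bar>h w x\<bar> \<le> M"
  and "\<And>w x. w \<in> W \<Longrightarrow> x \<in> S \<Longrightarrow> (h w has_derivative (\<lambda>v. D w x \<bullet> v)) (at x)"
  and "\<And>i. UC k W S (\<lambda>w x. D w x $ i)"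
 shows "UC (Suc k) W S h"
 unfolding UC.simps using assms(1) by (intro conjI exI[of _ D] exI[of _ M]) (auto intro: assms(2,3))

lemma UC_SucE:
 assumes "UC (Suc k) W S h"
 obtains D where "\<And>w x. w \<in> W \<Longrightarrow> x \<in> S \<Longrightarrow> (h w has_derivative (\<lambda>v. D w x \<bullet> v)) (at x)"
  and "\<And>i. UC k W S (\<lambda>w x. D w x $ i)"
 using assms unfolding UC.simps by blast

lemma UC_continuous:
 assumes "UC k W S h" "w \<in> W" shows "continuous_on S (h w)"
proof (cases k)
 case 0 then show ?thesis using assms by auto
next
 case (Suc j)
 then obtain D where "\<And>w x. w \<in> W \<Longrightarrow> x \<in> S \<Longrightarrow> (h w has_derivative (\<lambda>v. D w x \<bullet> v)) (at x)"
  using UC_SucE assms by metis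
 then show ?thesis using assms(2)
  by (meson continuous_at_imp_continuous_on has_derivative_continuous)
qed

lemma UC_0: "UC k W S h \<Longrightarrow> UC 0 W S h"
 using UC_bounded UC_continuous by (metis UC.simps(1))

lemma UC_SucD: "UC (Suc k) W S h \<Longrightarrow> UC k W S h"
proof (induction k arbitrary: h)
 case 0 then show ?case using UC_0 by blast
next
 case (Suc k)
 then obtain D where D: "\<And>w x. w \<in> W \<Longrightarrow> x \<in> S \<Longrightarrow> (h w has_derivative (\<lambda>v. D w x \<bullet> v)) (at x)"
  "\<And>i. UC (Suc k) W S (\<lambda>w x. D w x $ i)" using UC_SucE by metis
 show ?case
  using UC_bounded[OF Suc.prems] by (auto intro!: UC_SucI[OF _ D(1)] Suc.IH[OF D(2)])
qed

lemma UC_mono_k: "UC k W S h \<Longrightarrow> j \<le> k \<Longrightarrow> UC j W S h"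
 by (induction k) (auto simp: le_Suc_eq simp del: UC.simps dest: UC_SucD)

lemma UC_subset: "UC k W S h \<Longrightarrow> W' \<subseteq> W \<Longrightarrow> T \<subseteq> S \<Longrightarrow> UC k W' T h"
proof (induction k arbitrary: h)
 case 0 then show ?case by (auto intro: continuous_on_subset) (meson subset_iff)
next
 case (Suc k)
 then obtain D where D: "\<And>w x. w \<in> W \<Longrightarrow> x \<in> S \<Longrightarrow> (h w has_derivative (\<lambda>v. D w x \<bullet> v)) (at x)"
  "\<And>i. UC k W S (\<lambda>w x. D w x $ i)" using UC_SucE by metis
 obtain M where "\<forall>w\<in>W. \<forall>x\<in>S. \<bar>h w x\<bar> \<le> M" using UC_bounded[OF Suc.prems(1)] by blast
 then show ?case
  by (intro UC_SucI[where D=D and M=M]) (use D(1) Suc.IH[OF D(2)] Suc.prems in \<open>auto dest!: subsetD\<close>)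
qed

lemma UC_reindex: "UC k W S h \<Longrightarrow> (\<And>w. w \<in> W' \<Longrightarrow> \<sigma> w \<in> W) \<Longrightarrow> UC k W' S (\<lambda>w. h (\<sigma> w))"
proof (induction k arbitrary: h)
 case 0 then show ?case by auto meson
next
 case (Suc k)
 then obtain D where D: "\<And>w x. w \<in> W \<Longrightarrow> x \<in> S \<Longrightarrow> (h w has_derivative (\<lambda>v. D w x \<bullet> v)) (at x)"
  "\<And>i. UC k W S (\<lambda>w x. D w x $ i)" using UC_SucE by metis
 obtain M where "\<forall>w\<in>W. \<forall>x\<in>S. \<bar>h w x\<bar> \<le> M" using UC_bounded[OF Suc.prems(1)] by blast
 then show ?case
  by (intro UC_SucI[where D="\<lambda>w. D (\<sigma> w)" and M=M]) (use D Suc.IH[OF D(2)] Suc.prems in auto)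
qed

text \<open>Openness of \<open>S\<close> turns equality on \<open>S\<close> into equality near each
  point, which is what the derivatives see.\<close>

lemma UC_cong:
 assumes "UC k W S h" "open S" "\<And>w x. w \<in> W \<Longrightarrow> x \<in> S \<Longrightarrow> h w x = g w x"
 shows "UC k W S g"
proof (cases k)
 case 0 then show ?thesis using assms by (auto cong: continuous_on_cong)
next
 case (Suc j)
 obtain M where M: "\<forall>w\<in>W. \<forall>x\<in>S. \<bar>h w x\<bar> \<le> M" using UC_bounded assms by blast
 obtain D where D: "\<And>w x. w \<in> W \<Longrightarrow> x \<in> S \<Longrightarrow> (h w has_derivative (\<lambda>v. D w x \<bullet> v)) (at x)"
  "\<And>i. UC j W S (\<lambda>w x. D w x $ i)" using UC_SucE assms(1) Suc by metis
 have "(g w has_derivative (\<lambda>v. D w x \<bullet> v)) (at x)" if "w \<in> W" "x \<in> S" for w x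
  using D(1)[OF that] by (rule has_derivative_transform_within_open) (use assms that in auto)
 then show ?thesis unfolding Suc
  by (intro UC_SucI[where D=D and M=M]) (use D M assms in auto)
qed

lemma UC_const:
 assumes "\<And>w. w \<in> W \<Longrightarrow> \<bar>c w\<bar> \<le> M" shows "UC k W S (\<lambda>w x. c w)"
 using assms
proof (induction k arbitrary: c M)
 case 0 then show ?case by auto
next
 case (Suc k)
 show ?case
  by (rule UC_SucI[where D="\<lambda>_ _. 0" and M=M]) (use Suc in \<open>auto intro: Suc.IH[where M=0]\<close>)
qed

lemma UC_add: "UC k W S h \<Longrightarrow> UC k W S g \<Longrightarrow> UC k W S (\<lambda>w x. h w x + g w x)"
proof (induction k arbitrary: h g)
 case 0
 then obtain A B where "\<forall>w\<in>W. \<forall>x\<in>S. \<bar>h w x\<bar> \<le> A" "\<forall>w\<in>W. \<forall>x\<in>S. \<bar>g w x\<bar> \<le> B" by auto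
 then have "\<forall>w\<in>W. \<forall>x\<in>S. \<bar>h w x + g w x\<bar> \<le> A + B" by (smt (verit))
 then show ?case using 0 by (auto intro!: continuous_intros)
next
 case (Suc k)
 obtain D where D: "\<And>w x. w \<in> W \<Longrightarrow> x \<in> S \<Longrightarrow> (h w has_derivative (\<lambda>v. D w x \<bullet> v)) (at x)"
  "\<And>i. UC k W S (\<lambda>w x. D w x $ i)" using UC_SucE Suc.prems(1) by metis
 obtain E where E: "\<And>w x. w \<in> W \<Longrightarrow> x \<in> S \<Longrightarrow> (g w has_derivative (\<lambda>v. E w x \<bullet> v)) (at x)"
  "\<And>i. UC k W S (\<lambda>w x. E w x $ i)" using UC_SucE Suc.prems(2) by metis
 obtain A B where "\<forall>w\<in>W. \<forall>x\<in>S. \<bar>h w x\<bar> \<le> A" "\<forall>w\<in>W. \<forall>x\<in>S. \<bar>g w x\<bar> \<le> B"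
  using UC_bounded Suc.prems by metis
 then have "\<forall>w\<in>W. \<forall>x\<in>S. \<bar>h w x + g w x\<bar> \<le> A + B" by (smt (verit))
 moreover have "((\<lambda>x. h w x + g w x) has_derivative (\<lambda>v. (D w x + E w x) \<bullet> v)) (at x)"
  if "w \<in> W" "x \<in> S" for w x
  unfolding inner_add_left by (intro derivative_intros D E that)
 ultimately show ?case
  by (intro UC_SucI[where D="\<lambda>w x. D w x + E w x" and M="A+B"])
   (auto intro: Suc.IH[OF D(2) E(2)])
qed

lemma UC_mult: "UC k W S h \<Longrightarrow> UC k W S g \<Longrightarrow> UC k W S (\<lambda>w x. h w x * g w x)"
proof (induction k arbitrary: h g)
 case 0
 then obtain A B where "\<forall>w\<in>W. \<forall>x\<in>S. \<bar>h w x\<bar> \<le> A" "\<forall>w\<in>W. \<forall>x\<in>S. \<bar>g w x\<bar> \<le> B" by auto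
 then have "\<forall>w\<in>W. \<forall>x\<in>S. \<bar>h w x * g w x\<bar> \<le> A * B"
  by (auto simp: abs_mult intro!: mult_mono order_trans[OF abs_ge_zero])
 then show ?case using 0 by (auto intro!: continuous_intros)
next
 case (Suc k)
 obtain D where D: "\<And>w x. w \<in> W \<Longrightarrow> x \<in> S \<Longrightarrow> (h w has_derivative (\<lambda>v. D w x \<bullet> v)) (at x)"
  "\<And>i. UC k W S (\<lambda>w x. D w x $ i)" using UC_SucE Suc.prems(1) by metis
 obtain E where E: "\<And>w x. w \<in> W \<Longrightarrow> x \<in> S \<Longrightarrow> (g w has_derivative (\<lambda>v. E w x \<bullet> v)) (at x)"
  "\<And>i. UC k W S (\<lambda>w x. E w x $ i)" using UC_SucE Suc.prems(2) by metis
 obtain A B where "\<forall>w\<in>W. \<forall>x\<in>S. \<bar>h w x\<bar> \<le> A" "\<forall>w\<in>W. \<forall>x\<in>S. \<bar>g w x\<bar> \<le> B"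
  using UC_bounded Suc.prems by metis
 then have "\<forall>w\<in>W. \<forall>x\<in>S. \<bar>h w x * g w x\<bar> \<le> A * B"
  by (auto simp: abs_mult intro!: mult_mono order_trans[OF abs_ge_zero])
 moreover have "((\<lambda>x. h w x * g w x) has_derivative (\<lambda>v. (g w x *\<^sub>R D w x + h w x *\<^sub>R E w x) \<bullet> v)) (at x)"
  if "w \<in> W" "x \<in> S" for w x
  by (rule has_derivative_eq_rhs[OF has_derivative_mult[OF D(1)[OF that] E(1)[OF that]]])
    (auto simp: inner_add_left algebra_simps)
 moreover have "UC k W S (\<lambda>w x. (g w x *\<^sub>R D w x + h w x *\<^sub>R E w x) $ i)" for i
  using UC_add[OF Suc.IH[OF UC_SucD[OF Suc.prems(2)] D(2)] Suc.IH[OF UC_SucD[OF Suc.prems(1)] E(2)]] by simp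
 ultimately show ?case
  by (intro UC_SucI[where D="\<lambda>w x. g w x *\<^sub>R D w x + h w x *\<^sub>R E w x" and M="A*B"]) auto
qed

lemma UC_cmult: "UC k W S h \<Longrightarrow> UC k W S (\<lambda>w x. c * h w x)"
 by (rule UC_mult[OF UC_const[where M="\<bar>c\<bar>"]]) auto

lemma UC_minus: "UC k W S h \<Longrightarrow> UC k W S (\<lambda>w x. - h w x)"
 using UC_cmult[where c="-1"] by fastforce

lemma UC_diff: "UC k W S h \<Longrightarrow> UC k W S g \<Longrightarrow> UC k W S (\<lambda>w x. h w x - g w x)"
 using UC_add[OF _ UC_minus] by fastforce

lemma UC_sum: "finite A \<Longrightarrow> (\<And>a. a \<in> A \<Longrightarrow> UC k W S (h a)) \<Longrightarrow> UC k W S (\<lambda>w x. \<Sum>a\<in>A. h a w x)"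
 by (induction A rule: finite_induct) (auto intro!: UC_add UC_const[where M=0] simp del: UC.simps)

lemma UC_coord:
 fixes S :: "(real^'n) set"
 assumes "bounded S" shows "UC k W S (\<lambda>w x. x $ i)"
proof -
 obtain B where B: "\<And>x. x \<in> S \<Longrightarrow> norm x \<le> B" using assms bounded_iff by blast
 have b: "\<exists>M. \<forall>w\<in>W. \<forall>x\<in>S. \<bar>x $ i\<bar> \<le> M"
  using order_trans[OF component_le_norm_cart B] by blast
 show ?thesis
 proof (cases k)
  case 0 then show ?thesis using b by (auto intro!: continuous_intros)
 next
  case (Suc j)
  have "((\<lambda>x. x $ i) has_derivative (\<lambda>v. axis i 1 \<bullet> v)) (at x)" for x :: "real^'n"
   by (simp add: inner_axis' bounded_linear_imp_has_derivative bounded_linear_vec_nth)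
  then show ?thesis unfolding Suc
   by (intro UC_SucI[where D="\<lambda>_ _. axis i 1" and M=B]) (auto intro!: UC_const[where M=1] order_trans[OF component_le_norm_cart B] simp: axis_def)
 qed
qed

lemma UC_inner:
 assumes "bounded S" "\<And>w. w \<in> W \<Longrightarrow> norm (v w) \<le> B"
 shows "UC k W S (\<lambda>w x. v w \<bullet> x)"
proof -
 have "UC k W S (\<lambda>w x. \<Sum>i\<in>UNIV. v w $ i * x $ i)"
  by (intro UC_sum UC_mult UC_coord assms UC_const[where M=B])
    (use assms component_le_norm_cart order_trans in \<open>auto\<close>, blast)
 then show ?thesis by (simp add: inner_vec_def)
qed

text \<open>The gradient of 1/h is -(1/h)^2 times that of h, so the induction closes under products;
  the uniform lower bound \<open>c\<close> enters only through the bound 1/c on the quotient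
  itself.\<close>

lemma UC_inverse:
 assumes "c > 0"
 shows "UC k W S h \<Longrightarrow> (\<And>w x. w \<in> W \<Longrightarrow> x \<in> S \<Longrightarrow> \<bar>h w x\<bar> \<ge> c) \<Longrightarrow> UC k W S (\<lambda>w x. 1 / h w x)"
proof (induction k arbitrary: h)
 case 0
 have "\<bar>1 / h w x\<bar> \<le> 1 / c" if "w \<in> W" "x \<in> S" for w x
  using 0(2)[OF that] assms by (simp add: frac_le)
 moreover have "h w x \<noteq> 0" if "w \<in> W" "x \<in> S" for w x using 0(2)[OF that] assms by auto
 ultimately show ?case using 0(1) by (auto intro!: continuous_intros exI[of _ "1/c"])
next
 case (Suc k)
 have nz: "h w x \<noteq> 0" if "w \<in> W" "x \<in> S" for w x using Suc(3)[OF that] assms by auto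
 have b: "\<bar>1 / h w x\<bar> \<le> 1 / c" if "w \<in> W" "x \<in> S" for w x
  using Suc(3)[OF that] assms by (simp add: frac_le)
 obtain D where D: "\<And>w x. w \<in> W \<Longrightarrow> x \<in> S \<Longrightarrow> (h w has_derivative (\<lambda>v. D w x \<bullet> v)) (at x)"
  "\<And>i. UC k W S (\<lambda>w x. D w x $ i)" using UC_SucE Suc.prems(1) by metis
 have i: "UC k W S (\<lambda>w x. 1 / h w x)" using Suc UC_SucD by blast
 have "((\<lambda>x. 1 / h w x) has_derivative (\<lambda>v. ((- (1 / h w x * (1 / h w x))) *\<^sub>R D w x) \<bullet> v)) (at x)"
  if "w \<in> W" "x \<in> S" for w x
  by (rule has_derivative_eq_rhs[OF has_derivative_divide[OF has_derivative_const D(1)[OF that]]])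
    (use nz[OF that] in \<open>auto simp: field_simps\<close>)
 moreover have "UC k W S (\<lambda>w x. ((- (1 / h w x * (1 / h w x))) *\<^sub>R D w x) $ j)" for j
  using UC_mult[OF UC_minus[OF UC_mult[OF i i]] D(2)[of j]] by simp
 ultimately show ?case
  by (intro UC_SucI[where D="\<lambda>w x. (- (1 / h w x * (1 / h w x))) *\<^sub>R D w x" and M="1/c"]) (use b in blast)+
qed

text \<open>The exponent is written \<open>Suc (Suc K)\<close> because the formula needs exponent at
  least 2: only then is the difference quotient at 0 killed by a remaining factor.\<close>

lemma max_power_has_derivative:
 fixes t :: real
 shows "((\<lambda>t. max 0 t ^ Suc (Suc K)) has_real_derivative (real (Suc (Suc K)) * max 0 t ^ Suc K)) (at t)"
proof (cases "t = 0")
 case False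
 show ?thesis
 proof (cases "t > 0")
  case True
  have "((\<lambda>t. t ^ Suc (Suc K)) has_real_derivative (real (Suc (Suc K)) * t ^ Suc K)) (at t)"
   using DERIV_pow[of "Suc (Suc K)" t UNIV] by simp
  then have "((\<lambda>t. max 0 t ^ Suc (Suc K)) has_real_derivative (real (Suc (Suc K)) * t ^ Suc K)) (at t)"
   by (rule has_field_derivative_transform_within_open[where S="{0<..}"]) (use True in auto)
  then show ?thesis using True by simp
 next
  case f: False
  have "((\<lambda>t::real. 0) has_real_derivative 0) (at t)" by auto
  then have "((\<lambda>t. max 0 t ^ Suc (Suc K)) has_real_derivative 0) (at t)"
   by (rule has_field_derivative_transform_within_open[where S="{..<0}"]) (use f False in auto)
  then show ?thesis using f False by simp
 qed
next
 case True
 have "((\<lambda>h. max 0 h ^ Suc (Suc K) / h) \<longlongrightarrow> 0) (at (0::real))"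
 proof (rule Lim_null_comparison)
  show "\<forall>\<^sub>F h in at (0::real). norm (max 0 h ^ Suc (Suc K) / h) \<le> \<bar>h\<bar> ^ Suc K"
   by (intro always_eventually) (auto simp: max_def power_abs zero_le_mult_iff mult_nonpos_nonneg)
  show "((\<lambda>h::real. \<bar>h\<bar> ^ Suc K) \<longlongrightarrow> 0) (at 0)" by (auto intro!: tendsto_eq_intros)
 qed
 then show ?thesis using True by (simp add: DERIV_def)
qed

text \<open>Each differentiation lowers the exponent of the truncated power by one, so k of them are
  affordable when k < K.\<close>

lemma UC_maxpow: "UC k W S h \<Longrightarrow> k < K \<Longrightarrow> UC k W S (\<lambda>w x. max 0 (h w x) ^ K)"
proof (induction k arbitrary: K)
 case 0
 obtain A where A: "\<forall>w\<in>W. \<forall>x\<in>S. \<bar>h w x\<bar> \<le> A" using 0 by auto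
 have "\<bar>max 0 (h w x) ^ K\<bar> \<le> A ^ K" if "w \<in> W" "x \<in> S" for w x
 proof -
  have "\<bar>h w x\<bar> \<le> A" using A that by auto
  then have "\<bar>max 0 (h w x)\<bar> \<le> A" by auto
  then show ?thesis by (simp add: power_abs power_mono)
 qed
 then have "\<exists>M. \<forall>w\<in>W. \<forall>x\<in>S. \<bar>max 0 (h w x) ^ K\<bar> \<le> M" by blast
 then show ?case using 0 unfolding UC.simps by (intro conjI ballI continuous_intros) auto
next
 case (Suc k)
 obtain A where A: "\<forall>w\<in>W. \<forall>x\<in>S. \<bar>h w x\<bar> \<le> A" using Suc.prems UC_bounded by blast
 have b: "\<bar>max 0 (h w x) ^ K\<bar> \<le> A ^ K" if "w \<in> W" "x \<in> S" for w x
 proof -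
  have "\<bar>h w x\<bar> \<le> A" using A that by auto
  then have "\<bar>max 0 (h w x)\<bar> \<le> A" by auto
  then show ?thesis by (simp add: power_abs power_mono)
 qed
 obtain J where J: "K = Suc (Suc J)" 
  using Suc.prems by (intro that[of "K - 2"]) simp
 obtain D where D: "\<And>w x. w \<in> W \<Longrightarrow> x \<in> S \<Longrightarrow> (h w has_derivative (\<lambda>v. D w x \<bullet> v)) (at x)"
  "\<And>i. UC k W S (\<lambda>w x. D w x $ i)" using UC_SucE Suc.prems(1) by metis
 have "((\<lambda>x. max 0 (h w x) ^ K) has_derivative (\<lambda>v. ((real K * max 0 (h w x) ^ Suc J) *\<^sub>R D w x) \<bullet> v)) (at x)"
  if "w \<in> W" "x \<in> S" for w x
  unfolding J
  by (rule has_derivative_eq_rhs[OF has_derivative_compose[OF D(1)[OF that]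
      max_power_has_derivative[unfolded has_field_derivative_def]]]) (auto simp: mult_ac)
 moreover have "UC k W S (\<lambda>w x. ((real K * max 0 (h w x) ^ Suc J) *\<^sub>R D w x) $ i)" for i
  using UC_mult[OF UC_cmult[OF Suc.IH[OF UC_SucD[OF Suc.prems(1)], of "Suc J"], of "real K"] D(2)[of i]] Suc.prems J by simp
 ultimately show ?case
  by (intro UC_SucI[where D="\<lambda>w x. (real K * max 0 (h w x) ^ Suc J) *\<^sub>R D w x" and M="A^K"]) (use b in auto)
qed

text \<open>Chain rule, with the inner map controlled componentwise. The target set \<open>T\<close>
  may be thin: it will be the unit sphere when a function of x/|x| is differentiated.\<close>

lemma UC_compose:
 fixes T :: "(real^'n) set"
 assumes "\<And>w x. w \<in> W \<Longrightarrow> x \<in> S \<Longrightarrow> \<pi> w x \<in> T"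
 shows "UC k W T g \<Longrightarrow> (\<And>i. UC k W S (\<lambda>w x. \<pi> w x $ i)) \<Longrightarrow> UC k W S (\<lambda>w x. g w (\<pi> w x))"
proof (induction k arbitrary: g)
 case 0
 obtain A where A: "\<forall>w\<in>W. \<forall>x\<in>T. \<bar>g w x\<bar> \<le> A" using 0 by auto
 have "continuous_on S (\<lambda>x. g w (\<pi> w x))" if "w \<in> W" for w
 proof (rule continuous_on_compose2[of T "g w"])
  show "continuous_on T (g w)" using 0 that by auto
  have "continuous_on S (\<lambda>x. \<chi> i. \<pi> w x $ i)"
   using 0(2) that by (intro continuous_on_vec_lambda) auto
  then show "continuous_on S (\<pi> w)" by simp
 qed (use assms that in auto)
 then show ?case using A assms by (auto intro!: exI[of _ A])
next
 case (Suc k)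
 obtain A where A: "\<forall>w\<in>W. \<forall>x\<in>T. \<bar>g w x\<bar> \<le> A" using Suc.prems UC_bounded by blast
 obtain D where D: "\<And>w x. w \<in> W \<Longrightarrow> x \<in> T \<Longrightarrow> (g w has_derivative (\<lambda>v. D w x \<bullet> v)) (at x)"
  "\<And>i. UC k W T (\<lambda>w x. D w x $ i)" using UC_SucE Suc.prems(1) by metis
 have "\<forall>l. \<exists>E. (\<forall>w\<in>W. \<forall>x\<in>S. ((\<lambda>x. \<pi> w x $ l) has_derivative (\<lambda>v. E w x \<bullet> v)) (at x)) \<and> (\<forall>i. UC k W S (\<lambda>w x. E w x $ i))"
  using Suc.prems(2) by (simp add: UC.simps)
 then obtain E where E: "\<And>l w x. w \<in> W \<Longrightarrow> x \<in> S \<Longrightarrow> ((\<lambda>x. \<pi> w x $ l) has_derivative (\<lambda>v. E l w x \<bullet> v)) (at x)"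
   "\<And>l i. UC k W S (\<lambda>w x. E l w x $ i)" by metis
 let ?G = "\<lambda>w x. \<Sum>l\<in>UNIV. D w (\<pi> w x) $ l *\<^sub>R E l w x"
 have "((\<lambda>x. g w (\<pi> w x)) has_derivative (\<lambda>v. ?G w x \<bullet> v)) (at x)" if "w \<in> W" "x \<in> S" for w x
 proof -
  have "((\<lambda>x. \<chi> l. \<pi> w x $ l) has_derivative (\<lambda>v. \<chi> l. E l w x \<bullet> v)) (at x)"
  proof (subst has_derivative_componentwise_within, intro ballI)
   fix b :: "real^'n" assume "b \<in> Basis"
   then obtain l where b: "b = axis l 1" by (auto simp: Basis_vec_def)
   show "((\<lambda>x. (\<chi> l. \<pi> w x $ l) \<bullet> b) has_derivative (\<lambda>v. (\<chi> l. E l w x \<bullet> v) \<bullet> b)) (at x)"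
    unfolding b inner_axis using E(1)[OF that, of l] by simp
  qed
  then have "(\<pi> w has_derivative (\<lambda>v. \<chi> l. E l w x \<bullet> v)) (at x)" by simp
  from has_derivative_compose[OF this D(1)[OF that(1) assms[OF that]]]
  show ?thesis by (rule has_derivative_eq_rhs) (auto simp: inner_vec_def[of "D w (\<pi> w x)"] inner_sum_left)
 qed
 moreover have "UC k W S (\<lambda>w x. ?G w x $ i)" for i
 proof -
  have "UC k W S (\<lambda>w x. \<Sum>l\<in>UNIV. D w (\<pi> w x) $ l * E l w x $ i)"
   by (intro UC_sum UC_mult E Suc.IH[OF D(2)] UC_SucD[OF Suc.prems(2)]) auto
  then show ?thesis by (simp add: sum_component)
 qed
 ultimately show ?case using A assms
  by (intro UC_SucI[where D="?G" and M=A]) auto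
qed

text \<open>The open sets \<open>S\<close> and \<open>- Q\<close> cover the space and
  \<open>h\<close> vanishes on the second. In this way quotients whose denominator is controlled
  only on \<open>S\<close> become global amplitudes once multiplied by a cutoff.\<close>

lemma UC_extend:
 assumes "open S" "closed Q" "Q \<subseteq> S"
 shows "UC k W S h \<Longrightarrow> (\<And>w x. w \<in> W \<Longrightarrow> x \<notin> Q \<Longrightarrow> h w x = 0) \<Longrightarrow> UC k W UNIV h"
proof (induction k arbitrary: h)
 case 0
 obtain M where M: "\<forall>w\<in>W. \<forall>x\<in>S. \<bar>h w x\<bar> \<le> M" using 0 by auto
 have "\<forall>w\<in>W. \<forall>x. \<bar>h w x\<bar> \<le> max M 0" using M 0(2) assms(3)
  by (metis abs_zero max.coboundedI1 max.cobounded2 subsetD)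
 moreover have "continuous_on UNIV (h w)" if "w \<in> W" for w
 proof -
  have "continuous_on (- Q) (h w)" by (rule continuous_on_eq[of _ "\<lambda>_. 0"]) (use 0(2) that in auto)
  then have "continuous_on (S \<union> - Q) (h w)" using 0 that assms
   by (intro continuous_on_open_Un) auto
  moreover have "S \<union> - Q = UNIV" using assms by auto
  ultimately show ?thesis by simp
 qed
 ultimately show ?case by auto
next
 case (Suc k)
 obtain M where M: "\<forall>w\<in>W. \<forall>x\<in>S. \<bar>h w x\<bar> \<le> M" using Suc.prems UC_bounded by blast
 have M': "\<forall>w\<in>W. \<forall>x. \<bar>h w x\<bar> \<le> max M 0" using M Suc.prems(2) assms(3)
  by (metis abs_zero max.coboundedI1 max.cobounded2 subsetD)
 obtain D where D: "\<And>w x. w \<in> W \<Longrightarrow> x \<in> S \<Longrightarrow> (h w has_derivative (\<lambda>v. D w x \<bullet> v)) (at x)"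
  "\<And>i. UC k W S (\<lambda>w x. D w x $ i)" using UC_SucE Suc.prems(1) by metis
 \<comment> \<open>\<open>D\<close> is unspecified outside \<open>S\<close>, hence it is set to 0
   off \<open>Q\<close>. On \<open>S - Q\<close> nothing changes, by uniqueness of the
   derivative.\<close>
 let ?D = "\<lambda>w x. if x \<in> Q then D w x else 0"
 have z: "(h w has_derivative (\<lambda>v. 0)) (at x)" if "w \<in> W" "x \<notin> Q" for w x
  by (rule has_derivative_transform_within_open[OF has_derivative_const[of 0], where s="-Q"])
    (use Suc.prems(2) assms that in auto)
 have d: "(h w has_derivative (\<lambda>v. ?D w x \<bullet> v)) (at x)" if "w \<in> W" for w x
  using D(1)[OF that, of x] z[OF that, of x] assms by auto
 have eq: "?D w x = D w x" if "w \<in> W" "x \<in> S" for w x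
 proof (cases "x \<in> Q")
  case False
  have "(\<lambda>v. D w x \<bullet> v) = (\<lambda>v. 0)" by (rule has_derivative_unique[OF D(1)[OF that] z[OF that(1) False]])
  then have "D w x \<bullet> D w x = 0" by metis
  then show ?thesis by auto
 qed auto
 have "UC k W S (\<lambda>w x. ?D w x $ i)" for i
  by (rule UC_cong[OF D(2)[of i] assms(1)]) (use eq in auto)
 then have "UC k W UNIV (\<lambda>w x. ?D w x $ i)" for i by (rule Suc.IH) auto
 then show ?case using M' d by (intro UC_SucI[where D="?D" and M="max M 0"]) auto
qed

lemma Ck_on_imp_UC:
 assumes "compact K" "K \<subseteq> U" "S \<subseteq> K"
 shows "Ck_on k U g \<Longrightarrow> UC k W S (\<lambda>_. g)"
proof (induction k arbitrary: g)
 case 0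
 have "bounded (g ` K)" using 0 assms
  by (metis Ck_on.simps(1) compact_continuous_image compact_imp_bounded continuous_on_subset)
 then obtain M where "\<And>x. x \<in> K \<Longrightarrow> \<bar>g x\<bar> \<le> M" unfolding bounded_iff by auto
 then show ?case using 0 assms by (auto intro: continuous_on_subset)
next
 case (Suc k)
 have "bounded (g ` K)" using Suc.prems assms
  by (metis Ck_on.simps(2) compact_continuous_image compact_imp_bounded continuous_on_subset)
 then obtain M where M: "\<And>x. x \<in> K \<Longrightarrow> \<bar>g x\<bar> \<le> M" unfolding bounded_iff by auto
 let ?D = "\<lambda>_ x. \<chi> i. frechet_derivative g (at x) (axis i 1)"
 have "(g has_derivative (\<lambda>v. ?D w x \<bullet> v)) (at x)" if "x \<in> S" for w x
 proof -
  have d: "(g has_derivative frechet_derivative g (at x)) (at x)"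
   using Suc.prems that assms frechet_derivative_works[of g "at x"] by auto
  then interpret l: linear "frechet_derivative g (at x)" by (rule has_derivative_linear)
  have "frechet_derivative g (at x) v = ?D w x \<bullet> v" for v
  proof -
   have "frechet_derivative g (at x) v = frechet_derivative g (at x) (\<Sum>i\<in>UNIV. v $ i *\<^sub>R axis i 1)"
    using basis_expansion[of v] by (simp add: scalar_mult_eq_scaleR)
   then show ?thesis by (simp add: l.sum l.scaleR inner_vec_def mult.commute)
  qed
  then show ?thesis using d by (metis (no_types, lifting) ext)
 qed
 then show ?case using M Suc assms
  by (intro UC_SucI[where D="?D" and M=M]) auto
qed

lemma UC_norm:
 assumes "bounded S" "c > 0" "\<And>x. x \<in> S \<Longrightarrow> norm x \<ge> c"
 shows "UC k W S (\<lambda>w x. norm x)"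
proof (induction k)
 case 0
 show ?case using assms(1) unfolding bounded_iff by (auto intro!: continuous_intros)
next
 case (Suc k)
 obtain B where B: "\<And>x. x \<in> S \<Longrightarrow> norm x \<le> B" using assms(1) unfolding bounded_iff by auto
 have "UC k W S (\<lambda>w x. 1 / norm x)" by (rule UC_inverse[OF assms(2) Suc]) (use assms in auto)
 then have "UC k W S (\<lambda>w x. (1 / norm x) * x $ i)" for i
  by (intro UC_mult UC_coord assms)
 moreover have "(norm has_derivative (\<lambda>v. ((1 / norm x) *\<^sub>R x) \<bullet> v)) (at x)" if "x \<in> S" for x
 proof -
  have "x \<noteq> 0" using assms that by fastforce
  then show ?thesis using has_derivative_norm[of x]
   by (auto simp: sgn_div_norm inverse_eq_divide inner_commute)
 qed
 ultimately show ?case using B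
  by (intro UC_SucI[where D="\<lambda>w x. (1 / norm x) *\<^sub>R x" and M=B]) auto
qed

section \<open>Cutoff functions of finite smoothness\<close>

text \<open>Equal to 1 within distance \<open>s\<close> of \<open>p\<close> and to 0 beyond
  \<open>2 * s\<close>. Truncated powers of the squared distance replace the usual exponentials: the
  result has fewer than \<open>K\<close> derivatives, and \<open>K\<close> is taken as n + 1 because
  at most n integrations by parts are made. The explicit form also gives an exact scaling
  law.\<close>

definition cutoff :: "nat \<Rightarrow> real^'n \<Rightarrow> real \<Rightarrow> real^'n \<Rightarrow> real" where
 "cutoff K p s x = max 0 (4 * s\<^sup>2 - (norm (x - p))\<^sup>2) ^ K /
   (max 0 (4 * s\<^sup>2 - (norm (x - p))\<^sup>2) ^ K + max 0 ((norm (x - p))\<^sup>2 - s\<^sup>2) ^ K)"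

text \<open>The two truncated arguments add up to 3 s^2 before truncation, so one of them is at
  least half of that.\<close>

lemma cutoff_denom:
 fixes s t :: real
 assumes "s > 0"
 shows "max 0 (4 * s\<^sup>2 - t) ^ K + max 0 (t - s\<^sup>2) ^ K \<ge> (3/2 * s\<^sup>2) ^ K"
proof (cases "t \<le> 5/2 * s\<^sup>2")
 case True
 have "(3/2 * s\<^sup>2) ^ K \<le> max 0 (4 * s\<^sup>2 - t) ^ K" using True by (intro power_mono) (auto simp: le_max_iff_disj)
 then show ?thesis by (smt (verit) zero_le_power max.cobounded1)
next
 case False
 have "(3/2 * s\<^sup>2) ^ K \<le> max 0 (t - s\<^sup>2) ^ K" using False by (intro power_mono) (auto simp: le_max_iff_disj)
 then show ?thesis by (smt (verit) zero_le_power max.cobounded1)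
qed

lemma cutoff_denom_pos:
 fixes s t :: real
 assumes "s > 0"
 shows "max 0 (4 * s\<^sup>2 - t) ^ K + max 0 (t - s\<^sup>2) ^ K > 0"
proof -
 have "(3/2 * s\<^sup>2) ^ K > 0" using assms by simp
 then show ?thesis using cutoff_denom[OF assms, of K t] by linarith
qed

lemma cutoff_range: "s > 0 \<Longrightarrow> 0 \<le> cutoff K p s x \<and> cutoff K p s x \<le> 1"
 using cutoff_denom_pos[of s "(norm (x - p))\<^sup>2" K] unfolding cutoff_def
 by (auto simp: divide_le_eq_1)

lemma cutoff_1: "s > 0 \<Longrightarrow> K > 0 \<Longrightarrow> norm (x - p) \<le> s \<Longrightarrow> cutoff K p s x = 1"
proof -
 assume a: "s > 0" "K > 0" "norm (x - p) \<le> s"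
 then have "(norm (x - p))\<^sup>2 \<le> s\<^sup>2" by (intro power_mono) auto
 then have "max 0 ((norm (x - p))\<^sup>2 - s\<^sup>2) ^ K = 0" using a by (auto simp: max_def)
 then show ?thesis using cutoff_denom_pos[of s "(norm (x - p))\<^sup>2" K] a unfolding cutoff_def by auto
qed

lemma cutoff_0: "s > 0 \<Longrightarrow> K > 0 \<Longrightarrow> norm (x - p) \<ge> 2 * s \<Longrightarrow> cutoff K p s x = 0"
proof -
 assume a: "s > 0" "K > 0" "norm (x - p) \<ge> 2 * s"
 then have "(2 * s)\<^sup>2 \<le> (norm (x - p))\<^sup>2" by (intro power_mono) auto
 then show ?thesis using a unfolding cutoff_def by (auto simp: max_def power_mult_distrib)
qed

lemma UC_cutoff:
 fixes p :: "real^'n"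
 assumes "s > 0" "k < K"
 shows "UC k W UNIV (\<lambda>_. cutoff K p s)"
proof -
 \<comment> \<open>Coordinates are uniformly bounded only on a bounded set. The ball of radius
   \<open>3 * s\<close> leaves room around the support, whose radius is \<open>2 * s\<close>, and
   the extension by zero does the rest.\<close>
 let ?S = "ball p (3 * s)"
 have q: "UC k W ?S (\<lambda>w x. (norm (x - p))\<^sup>2)"
 proof -
  have "UC k W ?S (\<lambda>w x. \<Sum>i\<in>UNIV. (x $ i - p $ i) * (x $ i - p $ i))"
   by (intro UC_sum UC_mult UC_diff UC_coord UC_const[where M="\<bar>p $ _\<bar>"]) auto
  then show ?thesis by (simp add: power2_norm_eq_inner inner_vec_def)
 qed
 have c: "UC k W ?S (\<lambda>w x. t)" for t by (rule UC_const[where M="\<bar>t\<bar>"]) auto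
 let ?a = "\<lambda>w x. max 0 (4 * s\<^sup>2 - (norm (x - p))\<^sup>2) ^ K"
 let ?b = "\<lambda>w x. max 0 ((norm (x - p))\<^sup>2 - s\<^sup>2) ^ K"
 have a: "UC k W ?S ?a" by (intro UC_maxpow UC_diff q c assms)
 have b: "UC k W ?S ?b" by (intro UC_maxpow UC_diff q c assms)
 have "UC k W ?S (\<lambda>w x. 1 / (?a w x + ?b w x))"
  by (rule UC_inverse[OF _ UC_add[OF a b], of "(3/2 * s\<^sup>2) ^ K"])
   (use assms cutoff_denom[OF assms(1)] in \<open>auto intro: order_trans[OF _ abs_ge_self]\<close>)
 from UC_mult[OF a this] have "UC k W ?S (\<lambda>_. cutoff K p s)"
  by (simp add: cutoff_def[abs_def])
 then show ?thesis
  by (rule UC_extend[of ?S "cball p (2 * s)", rotated 3])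
    (use assms cutoff_0[of s K _ p] in \<open>auto simp: dist_norm norm_minus_commute\<close>)
qed

subsection \<open>Power series\<close>

definition mono :: "('n \<Rightarrow> nat) \<Rightarrow> real^'n \<Rightarrow> real" where
 "mono \<alpha> y = (\<Prod>i\<in>UNIV. (y $ i) ^ \<alpha> i)"

definition psum :: "(('n \<Rightarrow> nat) \<Rightarrow> real) \<Rightarrow> real^'n \<Rightarrow> real" where
 "psum c y = (\<Sum>\<^sub>\<infinity>\<alpha>. c \<alpha> * mono \<alpha> y)"

text \<open>Absolute convergence at the corner (s, ..., s) of the polydisc, which dominates the
  series wherever all coordinates are at most \<open>s\<close> in modulus.\<close>

definition PS :: "real \<Rightarrow> (('n::finite \<Rightarrow> nat) \<Rightarrow> real) \<Rightarrow> bool" where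
 "PS s c \<longleftrightarrow> (\<lambda>\<alpha>. \<bar>c \<alpha>\<bar> * s ^ (\<Sum>i\<in>UNIV. \<alpha> i)) summable_on UNIV"

definition cube :: "real \<Rightarrow> (real^'n) set" where
 "cube s = {y. \<forall>i. \<bar>y $ i\<bar> < s}"

definition up :: "'n \<Rightarrow> ('n \<Rightarrow> nat) \<Rightarrow> ('n \<Rightarrow> nat)" where
 "up i \<alpha> = \<alpha>(i := Suc (\<alpha> i))"

text \<open>The coefficients of the formal partial derivative in the variable
  \<open>i\<close>.\<close>

definition dc :: "'n \<Rightarrow> (('n \<Rightarrow> nat) \<Rightarrow> real) \<Rightarrow> (('n \<Rightarrow> nat) \<Rightarrow> real)" where
 "dc i c \<alpha> = real (Suc (\<alpha> i)) * c (up i \<alpha>)"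

text \<open>The partial derivative of a monomial. The truncated subtraction in the exponent is
  harmless, since the factor \<open>real (\<alpha> i)\<close> vanishes exactly when truncation
  occurs.\<close>

definition dmono :: "'n::finite \<Rightarrow> ('n \<Rightarrow> nat) \<Rightarrow> real^'n \<Rightarrow> real" where
 "dmono i \<alpha> y = real (\<alpha> i) * (y $ i) ^ (\<alpha> i - 1) * (\<Prod>j\<in>UNIV - {i}. (y $ j) ^ \<alpha> j)"

lemma open_cube: "open (cube s :: (real^'n) set)"
proof -
 have "cube s = (\<Inter>i. {y::real^'n. \<bar>y $ i\<bar> < s})" by (auto simp: cube_def)
 then show ?thesis by (auto intro!: open_INT open_Collect_less continuous_intros)
qed

lemma convex_cube: "convex (cube s :: (real^'n) set)"
proof -
 have "cube s = (\<Inter>i. {y::real^'n. axis i 1 \<bullet> y < s} \<inter> {y. axis i 1 \<bullet> y > - s})"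
  by (auto simp: cube_def abs_less_iff inner_axis') (smt (verit))+
 then show ?thesis by (auto intro!: convex_INT convex_Int convex_halfspace_lt convex_halfspace_gt)
qed

lemma mono_le:
 assumes "\<And>i. \<bar>y $ i\<bar> \<le> s" shows "\<bar>mono \<alpha> y\<bar> \<le> s ^ (\<Sum>i\<in>UNIV. \<alpha> i)"
proof -
 have "\<bar>mono \<alpha> y\<bar> = (\<Prod>i\<in>UNIV. \<bar>y $ i\<bar> ^ \<alpha> i)" by (simp add: mono_def abs_prod power_abs)
 also have "\<dots> \<le> (\<Prod>i\<in>UNIV. s ^ \<alpha> i)" using assms by (intro prod_mono) (auto intro!: power_mono)
 finally show ?thesis by (simp add: power_sum)
qed

lemma dmono_le:
 assumes "\<And>i. \<bar>y $ i\<bar> \<le> s" shows "\<bar>dmono i \<alpha> y\<bar> \<le> dmono i \<alpha> (\<chi> i. s)"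
proof -
 have s: "0 \<le> s" using assms[of i] by linarith
 have "\<bar>dmono i \<alpha> y\<bar> = real (\<alpha> i) * \<bar>y $ i\<bar> ^ (\<alpha> i - 1) * (\<Prod>j\<in>UNIV - {i}. \<bar>y $ j\<bar> ^ \<alpha> j)"
  by (simp add: dmono_def abs_prod power_abs abs_mult)
 also have "\<dots> \<le> real (\<alpha> i) * s ^ (\<alpha> i - 1) * (\<Prod>j\<in>UNIV - {i}. s ^ \<alpha> j)"
  using assms s by (intro mult_mono prod_mono power_mono mult_nonneg_nonneg prod_nonneg) (auto intro!: power_mono)
 finally show ?thesis by (simp add: dmono_def)
qed

lemma PS_has_sum:
 assumes "PS s c" "\<And>i. \<bar>y $ i\<bar> \<le> s"
 shows "((\<lambda>\<alpha>. c \<alpha> * mono \<alpha> y) has_sum psum c y) UNIV"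
  and "(\<lambda>\<alpha>. \<bar>c \<alpha> * mono \<alpha> y\<bar>) summable_on UNIV"
proof -
 show 1: "(\<lambda>\<alpha>. \<bar>c \<alpha> * mono \<alpha> y\<bar>) summable_on UNIV"
  using assms(1) unfolding PS_def
  by (rule summable_on_comparison_test) (auto simp: abs_mult intro!: mult_left_mono mono_le[OF assms(2)])
 then have "(\<lambda>\<alpha>. c \<alpha> * mono \<alpha> y) summable_on UNIV"
  by (subst summable_on_iff_abs_summable_on_real) simp
 then show "((\<lambda>\<alpha>. c \<alpha> * mono \<alpha> y) has_sum psum c y) UNIV"
  unfolding psum_def by (rule has_sum_infsum)
qed

lemma sum_up: "(\<Sum>j\<in>UNIV. up i \<alpha> j) = Suc (\<Sum>j\<in>(UNIV::'n::finite set). \<alpha> j)"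
proof -
 have "(\<Sum>j\<in>UNIV. up i \<alpha> j) = up i \<alpha> i + (\<Sum>j\<in>UNIV - {i}. up i \<alpha> j)"
  by (rule sum.remove) auto
 also have "(\<Sum>j\<in>UNIV - {i}. up i \<alpha> j) = (\<Sum>j\<in>UNIV - {i}. \<alpha> j)"
  by (intro sum.cong) (auto simp: up_def)
 finally show ?thesis using sum.remove[of UNIV i \<alpha>] by (simp add: up_def)
qed

lemma inj_up: "inj (up i)"
 by (rule inj_on_inverseI[where g="\<lambda>\<alpha>. \<alpha>(i := \<alpha> i - 1)"]) (auto simp: up_def)

text \<open>Differentiation brings down a factor of at most the total degree plus one, and m
  (s'/s)^m is bounded; the loss is absorbed by shrinking the radius.\<close>

lemma PS_dc:
 fixes c :: "('n::finite \<Rightarrow> nat) \<Rightarrow> real"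
 assumes "PS s c" "0 < s'" "s' < s" shows "PS s' (dc i c)"
proof -
 have "(\<lambda>m. real m * (s' / s) ^ m) \<longlonglongrightarrow> 0" using powser_times_n_limit_0[of "s' / s"] assms by auto
 then have "Bseq (\<lambda>m. real m * (s' / s) ^ m)" using convergentI convergent_imp_Bseq by blast
 then obtain B where B: "\<And>m. \<bar>real m * (s' / s) ^ m\<bar> \<le> B" unfolding Bseq_def by auto
 have K: "real (Suc m) * s' ^ m \<le> (B / s') * s ^ Suc m" for m
 proof -
  have "real (Suc m) * s' ^ Suc m \<le> B * s ^ Suc m"
   using B[of "Suc m"] assms by (simp add: power_divide field_simps del: of_nat_Suc power_Suc)
  then show ?thesis using assms by (simp add: field_simps del: of_nat_Suc)
 qed
 have "(\<lambda>\<alpha>. \<bar>c \<alpha>\<bar> * s ^ (\<Sum>i\<in>UNIV. \<alpha> i)) summable_on (range (up i))"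
  using assms(1) unfolding PS_def by (rule summable_on_subset_banach) auto
 then have "(\<lambda>\<alpha>. \<bar>c (up i \<alpha>)\<bar> * s ^ Suc (\<Sum>i\<in>UNIV. \<alpha> i)) summable_on UNIV"
  using summable_on_reindex[OF inj_up[of i], of "\<lambda>\<alpha>. \<bar>c \<alpha>\<bar> * s ^ (\<Sum>i\<in>UNIV. \<alpha> i)"]
  by (simp add: o_def sum_up)
 then have "(\<lambda>\<alpha>. (B / s') * (\<bar>c (up i \<alpha>)\<bar> * s ^ Suc (\<Sum>i\<in>UNIV. \<alpha> i))) summable_on UNIV"
  by (rule summable_on_cmult_right)
 then show ?thesis unfolding PS_def
 proof (rule summable_on_comparison_test)
  fix \<alpha> :: "'n \<Rightarrow> nat"
  let ?m = "\<Sum>i\<in>UNIV. \<alpha> i"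
  have "\<alpha> i \<le> ?m" by (rule member_le_sum) auto
  then have "real (Suc (\<alpha> i)) * s' ^ ?m \<le> real (Suc ?m) * s' ^ ?m" 
   using assms by (intro mult_right_mono of_nat_mono) auto
  also note K[of ?m]
  finally have "\<bar>c (up i \<alpha>)\<bar> * (real (Suc (\<alpha> i)) * s' ^ ?m) \<le> \<bar>c (up i \<alpha>)\<bar> * ((B / s') * s ^ Suc ?m)"
   by (rule mult_left_mono) auto
  then show "\<bar>dc i c \<alpha>\<bar> * s' ^ ?m \<le> (B / s') * (\<bar>c (up i \<alpha>)\<bar> * s ^ Suc ?m)"
   by (simp add: dc_def abs_mult mult_ac del: of_nat_Suc)
 qed (use assms in auto)
qed

lemma dmono_up: "c (up i \<alpha>) * dmono i (up i \<alpha>) y = dc i c \<alpha> * mono \<alpha> y"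
proof -
 have "mono \<alpha> y = (y $ i) ^ \<alpha> i * (\<Prod>j\<in>UNIV - {i}. (y $ j) ^ \<alpha> j)"
  unfolding mono_def by (rule prod.remove) auto
 moreover have "(\<Prod>j\<in>UNIV - {i}. (y $ j) ^ up i \<alpha> j) = (\<Prod>j\<in>UNIV - {i}. (y $ j) ^ \<alpha> j)"
  by (intro prod.cong) (auto simp: up_def)
 ultimately show ?thesis by (simp add: dmono_def dc_def up_def)
qed

text \<open>The terms with \<open>\<alpha> i = 0\<close> vanish, and the others are the image of all
  multi-indices under the shift \<open>up i\<close>.\<close>

lemma dmono_has_sum:
 assumes "PS s c" "0 < s'" "s' < s" "\<And>i. \<bar>y $ i\<bar> \<le> s'"
 shows "((\<lambda>\<alpha>. c \<alpha> * dmono i \<alpha> y) has_sum psum (dc i c) y) UNIV"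
proof -
 have "((\<lambda>\<alpha>. c (up i \<alpha>) * dmono i (up i \<alpha>) y) has_sum psum (dc i c) y) UNIV"
  unfolding dmono_up using PS_has_sum(1)[OF PS_dc[OF assms(1-3)] assms(4)] .
 then have "((\<lambda>\<alpha>. c \<alpha> * dmono i \<alpha> y) has_sum psum (dc i c) y) (range (up i))"
  using has_sum_reindex[OF inj_up[of i], of "\<lambda>\<alpha>. c \<alpha> * dmono i \<alpha> y"] by (simp add: o_def)
 moreover have "c \<alpha> * dmono i \<alpha> y = 0" if "\<alpha> \<notin> range (up i)" for \<alpha>
 proof -
  have "\<alpha> i = 0"
  proof (rule ccontr)
   assume "\<alpha> i \<noteq> 0"
   then have "\<alpha> = up i (\<alpha>(i := \<alpha> i - 1))" by (auto simp: up_def)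
   then show False using that by blast
  qed
  then show ?thesis by (simp add: dmono_def)
 qed
 ultimately show ?thesis
  by (subst has_sum_cong_neutral[where T="range (up i)" and g="\<lambda>\<alpha>. c \<alpha> * dmono i \<alpha> y"]) auto
qed

lemma mono_has_derivative:
 "(mono \<alpha> has_derivative (\<lambda>v. \<Sum>i\<in>UNIV. dmono i \<alpha> y * v $ i)) (at y)"
proof -
 have "((\<lambda>y. (y $ i) ^ \<alpha> i) has_derivative (\<lambda>v. real (\<alpha> i) * v $ i * (y $ i) ^ (\<alpha> i - 1))) (at y)" for i
  by (rule has_derivative_eq_rhs[OF has_derivative_power[OF bounded_linear_imp_has_derivative[OF bounded_linear_vec_nth]]]) auto
 then have "((\<lambda>y. \<Prod>i\<in>UNIV. (y $ i) ^ \<alpha> i) has_derivative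
   (\<lambda>v. \<Sum>i\<in>UNIV. (real (\<alpha> i) * v $ i * (y $ i) ^ (\<alpha> i - 1)) * (\<Prod>j\<in>UNIV - {i}. (y $ j) ^ \<alpha> j))) (at y)"
  by (intro has_derivative_prod) auto
 then show ?thesis unfolding mono_def[abs_def] dmono_def
  by (rule has_derivative_eq_rhs) (auto simp: mult_ac)
qed

text \<open>Termwise differentiation: the differentiated series converges uniformly on the smaller
  cube by the M-test, its majorant being its own absolute value at the corner (s', ..., s').\<close>

lemma psum_has_derivative:
 fixes c :: "('n::finite \<Rightarrow> nat) \<Rightarrow> real"
 assumes "PS s c" "0 < s'" "s' < s" "y \<in> cube s'"
 shows "(psum c has_derivative (\<lambda>v. (\<chi> i. psum (dc i c) y) \<bullet> v)) (at y)"
proof -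
 have inf: "infinite (UNIV :: ('n \<Rightarrow> nat) set)"
 proof
  assume "finite (UNIV :: ('n \<Rightarrow> nat) set)"
  then have "finite (range (\<lambda>k::nat. (\<lambda>_::'n. k)))" by (rule rev_finite_subset) simp
  then have "finite (UNIV::nat set)" by (rule finite_imageD) (auto simp: inj_def fun_eq_iff)
  then show False by simp
 qed
 \<comment> \<open>Multi-indices are enumerated by the naturals, so that results on sequential
   series apply; absolute convergence makes the order irrelevant.\<close>
 define e where "e = from_nat_into (UNIV :: ('n \<Rightarrow> nat) set)"
 have e: "bij_betw e UNIV UNIV" unfolding e_def by (rule bij_betw_from_nat_into) (use inf in auto)
 have sm: "(\<lambda>j. g (e j)) sums l" if "(g has_sum l) UNIV" for g :: "('n \<Rightarrow> nat) \<Rightarrow> real" and l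
  using has_sum_reindex_bij_betw[OF e, of g l] that has_sum_imp_sums by blast
 let ?S = "cube s' :: (real^'n) set"
 have y: "\<bar>y $ i\<bar> \<le> s'" if "y \<in> ?S" for y i using that by (auto simp: cube_def less_imp_le)
 have y2: "\<bar>y $ i\<bar> \<le> s" if "y \<in> ?S" for y i using y[OF that, of i] assms by linarith
 let ?f' = "\<lambda>j y v. c (e j) * (\<Sum>i\<in>UNIV. dmono i (e j) y * v $ i)"
 have "\<exists>g. \<forall>x\<in>?S. (\<lambda>j. c (e j) * mono (e j) x) sums g x \<and>
   (g has_derivative (\<lambda>v. (\<chi> i. psum (dc i c) x) \<bullet> v)) (at x within ?S)"
 proof (rule has_derivative_series[OF convex_cube, where f'="?f'"])
  show "((\<lambda>x. c (e j) * mono (e j) x) has_derivative ?f' j x) (at x within ?S)" for j x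
   by (rule has_derivative_mult_right[OF has_derivative_at_withinI[OF mono_has_derivative]])
  show "(\<lambda>j. c (e j) * mono (e j) y) sums psum c y"
   using sm[OF PS_has_sum(1)[OF assms(1) y2[OF assms(4)]]] .
  show "y \<in> ?S" by fact
  fix eps :: real assume eps: "eps > 0"
  have ul: "uniform_limit ?S (\<lambda>n x. \<Sum>j<n. c (e j) * dmono i (e j) x) (\<lambda>x. psum (dc i c) x) sequentially" for i
  proof -
   have M: "summable (\<lambda>j. \<bar>c (e j)\<bar> * dmono i (e j) (\<chi> i. s'))"
   proof -
    have "((\<lambda>\<alpha>. c \<alpha> * dmono i \<alpha> (\<chi> i. s')) has_sum psum (dc i c) (\<chi> i. s')) UNIV"
     by (rule dmono_has_sum[OF assms(1-3)]) (use assms in auto)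
    then have "(\<lambda>\<alpha>. c \<alpha> * dmono i \<alpha> (\<chi> i. s')) summable_on UNIV" by (rule has_sum_imp_summable)
    then have "(\<lambda>\<alpha>. \<bar>c \<alpha> * dmono i \<alpha> (\<chi> i. s')\<bar>) summable_on UNIV"
     by (subst (asm) summable_on_iff_abs_summable_on_real) simp
    moreover have "\<bar>c \<alpha> * dmono i \<alpha> (\<chi> i. s')\<bar> = \<bar>c \<alpha>\<bar> * dmono i \<alpha> (\<chi> i. s')" for \<alpha>
     using dmono_le[of "\<chi> i. s'" s' i \<alpha>] assms by (simp add: abs_mult)
    ultimately have "(\<lambda>\<alpha>. \<bar>c \<alpha>\<bar> * dmono i \<alpha> (\<chi> i. s')) summable_on UNIV" by simp
    from sums_summable[OF sm[OF has_sum_infsum[OF this]]] show ?thesis .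
   qed
   have "uniform_limit ?S (\<lambda>n x. \<Sum>j<n. c (e j) * dmono i (e j) x) (\<lambda>x. \<Sum>j. c (e j) * dmono i (e j) x) sequentially"
    by (rule Weierstrass_m_test[OF _ M])
      (use dmono_le y in \<open>auto simp: abs_mult intro!: mult_left_mono dmono_le\<close>)
   moreover have "(\<Sum>j. c (e j) * dmono i (e j) x) = psum (dc i c) x" if "x \<in> ?S" for x
    by (rule sums_unique[symmetric, OF sm[OF dmono_has_sum[OF assms(1-3)]]]) (use y that in auto)
   ultimately show ?thesis by (auto cong: uniform_limit_cong')
  qed
  let ?n = "real CARD('n)"
  have "\<forall>\<^sub>F n in sequentially. \<forall>i. \<forall>x\<in>?S. dist (\<Sum>j<n. c (e j) * dmono i (e j) x) (psum (dc i c) x) < eps / ?n"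
   using eps ul by (intro eventually_all_finite) (auto simp: uniform_limit_iff)
  then show "\<forall>\<^sub>F n in sequentially. \<forall>x\<in>?S. \<forall>h.
    norm ((\<Sum>j<n. ?f' j x h) - (\<chi> i. psum (dc i c) x) \<bullet> h) \<le> eps * norm h"
  proof eventually_elim
   case (elim n)
   show ?case
   proof (intro ballI allI)
    fix x h assume x: "x \<in> ?S"
    let ?d = "\<lambda>i. (\<Sum>j<n. c (e j) * dmono i (e j) x) - psum (dc i c) x"
    have "(\<Sum>j<n. ?f' j x h) = (\<Sum>i\<in>UNIV. (\<Sum>j<n. c (e j) * dmono i (e j) x) * h $ i)"
     by (simp add: sum_distrib_left sum_distrib_right mult_ac sum.swap[of _ UNIV])
    then have "(\<Sum>j<n. ?f' j x h) - (\<chi> i. psum (dc i c) x) \<bullet> h = (\<Sum>i\<in>UNIV. ?d i * h $ i)"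
     by (simp add: inner_vec_def sum_subtractf left_diff_distrib)
    also have "norm \<dots> \<le> (\<Sum>i\<in>UNIV. \<bar>?d i\<bar> * \<bar>h $ i\<bar>)"
     by (rule order_trans[OF norm_sum]) (simp add: abs_mult)
    also have "\<dots> \<le> (\<Sum>i\<in>(UNIV::'n set). eps / ?n * norm h)"
     using elim x eps by (intro sum_mono mult_mono) (auto simp: dist_real_def component_le_norm_cart less_imp_le)
    also have "\<dots> = eps * norm h" by simp
    finally show "norm ((\<Sum>j<n. ?f' j x h) - (\<chi> i. psum (dc i c) x) \<bullet> h) \<le> eps * norm h" .
   qed
  qed
 qed
 then obtain g where g: "\<And>x. x \<in> ?S \<Longrightarrow> (\<lambda>j. c (e j) * mono (e j) x) sums g x"
   "\<And>x. x \<in> ?S \<Longrightarrow> (g has_derivative (\<lambda>v. (\<chi> i. psum (dc i c) x) \<bullet> v)) (at x within ?S)" by blast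
 have gp: "g x = psum c x" if "x \<in> ?S" for x
  using sums_unique2[OF g(1)[OF that] sm[OF PS_has_sum(1)[OF assms(1) y2[OF that]]]] .
 have "(g has_derivative (\<lambda>v. (\<chi> i. psum (dc i c) y) \<bullet> v)) (at y)"
  using g(2)[OF assms(4)] at_within_open[OF assms(4) open_cube] by simp
 then show ?thesis
  by (rule has_derivative_transform_within_open[OF _ open_cube assms(4)]) (use gp in auto)
qed

lemma UC_psum:
 fixes c :: "('n::finite \<Rightarrow> nat) \<Rightarrow> real"
 shows "PS s c \<Longrightarrow> 0 < s' \<Longrightarrow> s' < s \<Longrightarrow> UC k W (cube s') (\<lambda>_. psum c)"
proof (induction k arbitrary: c s)
 case (0 c s)
 let ?M = "\<Sum>\<^sub>\<infinity>\<alpha>. \<bar>c \<alpha>\<bar> * s ^ (\<Sum>i\<in>UNIV. \<alpha> i)"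
 have "\<bar>psum c y\<bar> \<le> ?M" if "y \<in> cube s'" for y
 proof -
  have y: "\<bar>y $ i\<bar> \<le> s" for i using that 0(3) unfolding cube_def by (auto intro: less_imp_le less_trans)
  note h = PS_has_sum[OF 0(1) y]
  have "\<bar>psum c y\<bar> \<le> (\<Sum>\<^sub>\<infinity>\<alpha>. \<bar>c \<alpha> * mono \<alpha> y\<bar>)"
   using norm_infsum_bound[of "\<lambda>\<alpha>. c \<alpha> * mono \<alpha> y" UNIV] h(2) unfolding psum_def by simp
  also have "\<dots> \<le> ?M"
   using h(2) 0(1) unfolding PS_def
   by (rule infsum_mono) (auto simp: abs_mult intro!: mult_left_mono mono_le y)
  finally show ?thesis .
 qed
 moreover have "continuous_on (cube s') (psum c)"
  by (rule continuous_at_imp_continuous_on)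
    (use psum_has_derivative[OF 0] has_derivative_continuous in blast)
 ultimately show ?case by auto
next
 case (Suc k c s)
 have b: "UC 0 W (cube s') (\<lambda>_. psum c)" using Suc.IH[OF Suc.prems] UC_0 by blast
 obtain M where M: "\<forall>w\<in>W. \<forall>x\<in>cube s'. \<bar>psum c x\<bar> \<le> M" using UC_bounded[OF b] by auto
 \<comment> \<open>The differentiated series is known to converge only on a strictly smaller
   polydisc. An intermediate radius leaves room for the remaining derivatives.\<close>
 define s2 where "s2 = (s + s') / 2"
 have s2: "s' < s2" "s2 < s" "0 < s2" using Suc.prems by (auto simp: s2_def)
 have "UC k W (cube s') (\<lambda>_. psum (dc i c))" for i
  by (rule Suc.IH[OF PS_dc[OF Suc.prems(1) s2(3,2)] Suc.prems(2) s2(1)])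
 then show ?case using M
  by (intro UC_SucI[where D="\<lambda>_ y. \<chi> i. psum (dc i c) y" and M=M])
    (auto intro!: psum_has_derivative[OF Suc.prems])
qed

lemma real_analytic_UC:
 fixes F :: "real^'n \<Rightarrow> real"
 assumes "real_analytic_on U F" "p \<in> U"
 obtains \<delta> where "\<delta> > 0" "ball p \<delta> \<subseteq> U" "\<And>k. UC k (W::'w set) (ball p \<delta>) (\<lambda>_. F)"
proof -
 obtain c :: "('n \<Rightarrow> nat) \<Rightarrow> real" and r where r: "r > 0" "ball p r \<subseteq> U"
  and hs: "\<And>x. x \<in> ball p r \<Longrightarrow> ((\<lambda>\<alpha>. c \<alpha> * (\<Prod>i\<in>UNIV. (x$i - p$i) ^ \<alpha> i)) has_sum F x) UNIV"
  using assms unfolding real_analytic_on_def by blast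
 \<comment> \<open>The corner p + (s, ..., s) lies within r/2 of p. Unconditional convergence of a
   real sum is absolute, so convergence at this single point already gives
   \<open>PS s c\<close>.\<close>
 define s where "s = r / (2 * real CARD('n))"
 have s: "s > 0" using r by (simp add: s_def)
 have sr: "s \<le> r / 2" unfolding s_def using r by (intro divide_left_mono) auto
 have x: "p + (\<chi> i. s) \<in> ball p r"
 proof -
  have "norm ((\<chi> i. s) :: real^'n) \<le> (\<Sum>i\<in>UNIV. \<bar>((\<chi> i. s) :: real^'n) $ i\<bar>)" by (rule norm_le_l1_cart)
  also have "\<dots> = r / 2" using s r by (simp add: s_def)
  finally show ?thesis using r by (simp add: dist_norm)
 qed
 have "(\<lambda>\<alpha>. c \<alpha> * (\<Prod>i\<in>(UNIV::'n set). s ^ \<alpha> i)) summable_on UNIV"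
  using hs[OF x] has_sum_imp_summable by fastforce
 then have "(\<lambda>\<alpha>. \<bar>c \<alpha> * (\<Prod>i\<in>(UNIV::'n set). s ^ \<alpha> i)\<bar>) summable_on UNIV"
  by (subst (asm) summable_on_iff_abs_summable_on_real) simp
 then have PS: "PS s c" unfolding PS_def using s by (simp add: abs_mult power_sum abs_prod)
 have F: "F x = psum c (x - p)" if "x \<in> ball p r" for x
  using hs[OF that] unfolding psum_def mono_def by (auto intro!: infsumI[symmetric])
 show ?thesis
 proof
  show "s / 2 > 0" using s by simp
  show "ball p (s/2) \<subseteq> U" using r sr by (auto intro!: order_trans[OF subset_ball r(2)])
  fix k
  have b: "x - p \<in> cube (s/2)" if "x \<in> ball p (s/2)" for x
   unfolding cube_def
  proof (intro CollectI allI)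
   show "\<bar>(x - p) $ i\<bar> < s / 2" for i
    using component_le_norm_cart[of "x - p" i] that by (simp add: dist_norm norm_minus_commute)
  qed
  have "UC k W (ball p (s/2)) (\<lambda>_ x. psum c (x - p))"
  proof (rule UC_compose[where T="cube (s/2)" and g="\<lambda>_. psum c" and \<pi>="\<lambda>_ x. x - p"])
   show "UC k W (cube (s/2)) (\<lambda>_. psum c)" by (rule UC_psum[OF PS]) (use s in auto)
   show "UC k W (ball p (s/2)) (\<lambda>w x. (x - p) $ i)" for i
    by (simp, intro UC_diff UC_coord UC_const[where M="\<bar>p $ i\<bar>"]) auto
  qed (use b in auto)
  then show "UC k W (ball p (s/2)) (\<lambda>_. F)"
   by (rule UC_cong) (use F sr s in auto)
 qed
qed

subsection \<open>Nonstationary phase\<close>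

text \<open>Says that \<open>d\<close> is the divergence of the field \<open>V\<close> with respect
  to the measure \<open>M\<close>, tested against \<open>C^1\<close> functions vanishing off
  \<open>Q\<close>. It will hold for constant fields inside the body, for fields tangent to its
  boundary, and for rotation fields on the sphere.\<close>

definition null_div :: "(real^'n) measure \<Rightarrow> (real^'n) set \<Rightarrow> (real^'n \<Rightarrow> real^'n) \<Rightarrow> (real^'n \<Rightarrow> real) \<Rightarrow> bool" where
 "null_div M Q V d \<longleftrightarrow> (\<forall>\<phi> D. (\<forall>x. (\<phi> has_derivative (\<lambda>v. D x \<bullet> v)) (at x)) \<longrightarrow> continuous_on UNIV D \<longrightarrow>
   (\<forall>x. x \<notin> Q \<longrightarrow> \<phi> x = 0) \<longrightarrow> (LINT x|M. V x \<bullet> D x + d x * \<phi> x) = 0)"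

lemma gradient_zero_outside:
 fixes d :: "real^'n"
 assumes "closed Q" "\<And>x. x \<notin> Q \<Longrightarrow> \<phi> x = (0::real)" "(\<phi> has_derivative (\<lambda>v. d \<bullet> v)) (at x)" "x \<notin> Q"
 shows "d = 0"
proof -
 have "(\<phi> has_derivative (\<lambda>v. 0)) (at x)"
  by (rule has_derivative_transform_within_open[OF has_derivative_const[of 0], where s="-Q"])
    (use assms in auto)
 from has_derivative_unique[OF assms(3) this] have "d \<bullet> d = 0" by metis
 then show ?thesis by simp
qed

lemma integrable_bounded_continuous:
 fixes f :: "real^'n \<Rightarrow> real"
 assumes "finite_measure M" "sets M = sets borel" "continuous_on UNIV f" "\<And>x. \<bar>f x\<bar> \<le> B"
 shows "integrable M f"
proof -
 have "f \<in> borel_measurable M" using borel_measurable_continuous_onI[OF assms(3)] assms(2)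
  by (simp cong: measurable_cong_sets)
 then show ?thesis by (intro finite_measure.integrable_const_bound[OF assms(1), where B=B]) (use assms(4) in auto)
qed

text \<open>Integration by parts along \<open>V\<close>, once for each power of \<open>lam\<close>.
  Each step turns the cosine into a sine, which is a shift of the phase by pi/2; this is why an
  arbitrary phase \<open>ph\<close> is carried. The constant precedes measure, parameter, frequency
  and phase in the quantifiers, and only the total mass is bounded beforehand.\<close>

lemma nonstationary_phase:
 fixes V :: "real^'n \<Rightarrow> real^'n"
 assumes S: "open S" "closed Q" "Q \<subseteq> S" and c: "c > 0"
  and u: "\<And>w x. w \<in> W \<Longrightarrow> x \<in> S \<Longrightarrow> \<bar>u w \<bullet> V x\<bar> \<ge> c" "\<And>w. w \<in> W \<Longrightarrow> norm (u w) \<le> 1"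
 shows "(\<And>i. UC k W S (\<lambda>w x. V x $ i)) \<Longrightarrow> UC k W S (\<lambda>w x. d x) \<Longrightarrow>
  UC k W UNIV a \<Longrightarrow> (\<And>w x. w \<in> W \<Longrightarrow> x \<notin> Q \<Longrightarrow> a w x = 0) \<Longrightarrow>
  \<exists>C. \<forall>M w lam ph. w \<in> W \<longrightarrow> lam > 0 \<longrightarrow> sets M = sets borel \<longrightarrow> finite_measure M \<longrightarrow> measure M UNIV \<le> B \<longrightarrow>
    null_div M Q V d \<longrightarrow> \<bar>LINT x|M. a w x * cos (lam * (u w \<bullet> x) + ph)\<bar> \<le> C / lam ^ k"
proof (induction k arbitrary: a)
 case 0
 obtain A where A: "\<forall>w\<in>W. \<forall>x. \<bar>a w x\<bar> \<le> A" using 0 by auto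
 have "\<bar>LINT x|M. a w x * cos (lam * (u w \<bullet> x) + ph)\<bar> \<le> max A 0 * B"
  if w: "w \<in> W" and M: "sets M = sets borel" "finite_measure M" "measure M UNIV \<le> B" for M w lam ph
 proof -
  interpret finite_measure M by fact
  have b: "\<bar>a w x * cos (lam * (u w \<bullet> x) + ph)\<bar> \<le> max A 0" for x
  proof -
   have "\<bar>a w x\<bar> * \<bar>cos (lam * (u w \<bullet> x) + ph)\<bar> \<le> \<bar>a w x\<bar> * 1" by (intro mult_left_mono) auto
   then show ?thesis using A w by (simp add: abs_mult) (smt (verit))
  qed
  have c: "continuous_on UNIV (\<lambda>x. a w x * cos (lam * (u w \<bullet> x) + ph))"
   using 0 w by (intro continuous_intros) auto
  have i: "integrable M (\<lambda>x. a w x * cos (lam * (u w \<bullet> x) + ph))"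
   by (rule integrable_bounded_continuous[OF M(2,1) c b])
  have "\<bar>LINT x|M. a w x * cos (lam * (u w \<bullet> x) + ph)\<bar> \<le> (LINT x|M. \<bar>a w x * cos (lam * (u w \<bullet> x) + ph)\<bar>)"
   by (rule integral_abs_bound)
  also have "\<dots> \<le> (LINT x|M. max A 0)" by (rule integral_mono) (use i b in auto)
  also have "\<dots> = max A 0 * measure M UNIV" using M(1) by (simp add: sets_eq_imp_space_eq mult.commute)
  also have "\<dots> \<le> max A 0 * B" by (intro mult_left_mono M) auto
  finally show ?thesis .
 qed
 then show ?case by (intro exI[of _ "max A 0 * B"]) auto
next
 case (Suc k)
 \<comment> \<open>Tested on \<open>b\<close> times the sine of the phase, the divergence identity
   yields \<open>lam\<close> times the wanted integral plus an oscillatory integral with amplitude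
   \<open>a1\<close>.\<close>
 define b where "b = (\<lambda>w x. a w x * (1 / (u w \<bullet> V x)))"
 have uV: "UC (Suc k) W S (\<lambda>w x. u w \<bullet> V x)"
 proof -
  have "UC (Suc k) W S (\<lambda>w x. \<Sum>i\<in>UNIV. u w $ i * V x $ i)"
   by (intro UC_sum UC_mult Suc.prems UC_const[where M=1]) (auto intro: order_trans[OF component_le_norm_cart u(2)])
  then show ?thesis by (simp add: inner_vec_def)
 qed
 have b0: "b w x = 0" if "w \<in> W" "x \<notin> Q" for w x using Suc.prems(4) that by (simp add: b_def)
 have "UC (Suc k) W S b" unfolding b_def
  using UC_subset[OF Suc.prems(3)] u
  by (intro UC_mult UC_inverse[OF c uV]) auto
 then have bU: "UC (Suc k) W UNIV b" by (rule UC_extend[OF S]) (use b0 in auto)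
 then obtain D where D: "\<And>w x. w \<in> W \<Longrightarrow> (b w has_derivative (\<lambda>v. D w x \<bullet> v)) (at x)"
  "\<And>i. UC k W UNIV (\<lambda>w x. D w x $ i)" using UC_SucE by (metis UNIV_I)
 have D0: "D w x = 0" if "w \<in> W" "x \<notin> Q" for w x
  by (rule gradient_zero_outside[OF S(2) b0[OF that(1)] D(1)[OF that(1)] that(2)])
 \<comment> \<open>The amplitude handed to the induction hypothesis. It contains first derivatives
   of \<open>b\<close>, hence it has one derivative fewer than \<open>a\<close>.\<close>
 define a1 where "a1 = (\<lambda>w x. V x \<bullet> D w x + d x * b w x)"
 have a10: "a1 w x = 0" if "w \<in> W" "x \<notin> Q" for w x using b0 D0 that by (simp add: a1_def)
 have "UC k W S (\<lambda>w x. (\<Sum>i\<in>UNIV. V x $ i * D w x $ i) + d x * b w x)"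
  using UC_SucD[OF Suc.prems(1)] UC_SucD[OF Suc.prems(2)] UC_subset[OF D(2)] UC_subset[OF UC_SucD[OF bU]]
  by (intro UC_add UC_sum UC_mult) auto
 then have "UC k W S a1" by (simp add: a1_def inner_vec_def)
 then have a1U: "UC k W UNIV a1" by (rule UC_extend[OF S]) (use a10 in auto)
 obtain C where C: "\<And>M w lam ph. w \<in> W \<Longrightarrow> lam > 0 \<Longrightarrow> sets M = sets borel \<Longrightarrow> finite_measure M \<Longrightarrow>
   measure M UNIV \<le> B \<Longrightarrow> null_div M Q V d \<Longrightarrow> \<bar>LINT x|M. a1 w x * cos (lam * (u w \<bullet> x) + ph)\<bar> \<le> C / lam ^ k"
  using Suc.IH[OF UC_SucD[OF Suc.prems(1)] UC_SucD[OF Suc.prems(2)] a1U a10] by blast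
 have "\<bar>LINT x|M. a w x * cos (lam * (u w \<bullet> x) + ph)\<bar> \<le> C / lam ^ Suc k"
  if w: "w \<in> W" and lam: "lam > 0" and M: "sets M = sets borel" "finite_measure M" "measure M UNIV \<le> B"
   and nd: "null_div M Q V d" for M w lam ph
 proof -
  let ?P = "\<lambda>x. lam * (u w \<bullet> x) + ph"
  let ?E = "\<lambda>x. sin (?P x) *\<^sub>R D w x + (b w x * cos (?P x) * lam) *\<^sub>R u w"
  have Dc: "continuous_on UNIV (D w)"
  proof -
   have "continuous_on UNIV (\<lambda>x. \<chi> i. D w x $ i)"
    using UC_continuous[OF D(2) w] by (intro continuous_on_vec_lambda) auto
   then show ?thesis by simp
  qed
  have bc: "continuous_on UNIV (b w)" using UC_continuous[OF bU w] .
  have "((\<lambda>x. b w x * sin (?P x)) has_derivative (\<lambda>v. ?E x \<bullet> v)) (at x)" for x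
  proof -
   have "((\<lambda>x. sin (?P x)) has_derivative (\<lambda>v. cos (?P x) * (lam * (u w \<bullet> v)))) (at x)"
    by (auto intro!: derivative_eq_intros)
   from has_derivative_mult[OF D(1)[OF w, of x] this] show ?thesis
    by (rule has_derivative_eq_rhs) (auto simp: inner_add_left algebra_simps)
  qed
  moreover have "continuous_on UNIV ?E" using Dc bc by (intro continuous_intros)
  moreover have "b w x * sin (?P x) = 0" if "x \<notin> Q" for x using b0[OF w that] by simp
  ultimately have z: "(LINT x|M. V x \<bullet> ?E x + d x * (b w x * sin (?P x))) = 0"
   by (rule nd[unfolded null_div_def, rule_format])
  \<comment> \<open>Outside \<open>Q\<close> the denominator may vanish, but there both sides are
    0.\<close>
  have ba: "b w x * (u w \<bullet> V x) = a w x" for x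
  proof (cases "x \<in> Q")
   case True
   then have "u w \<bullet> V x \<noteq> 0" using u(1)[OF w, of x] S c by auto
   then show ?thesis by (simp add: b_def)
  qed (use Suc.prems(4)[OF w] b0[OF w] in auto)
  have eq: "V x \<bullet> ?E x + d x * (b w x * sin (?P x)) = a1 w x * cos (lam * (u w \<bullet> x) + (ph - pi/2)) + lam * (a w x * cos (?P x))" for x
  proof -
   have "V x \<bullet> ?E x + d x * (b w x * sin (?P x)) = a1 w x * sin (?P x) + lam * (b w x * (u w \<bullet> V x) * cos (?P x))"
    unfolding a1_def by (simp add: inner_add_right algebra_simps inner_commute[of "u w"])
   moreover have "sin (?P x) = cos (lam * (u w \<bullet> x) + (ph - pi/2))"
    using cos_diff[of "?P x" "pi/2"] by (simp add: algebra_simps)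
   ultimately show ?thesis using ba by simp
  qed
  obtain A1 where A1: "\<And>x. \<bar>a1 w x\<bar> \<le> A1" using UC_bounded[OF a1U] w by auto
  obtain A where A: "\<And>x. \<bar>a w x\<bar> \<le> A" using UC_bounded[OF Suc.prems(3)] w by auto
  have cb: "\<bar>t * cos s\<bar> \<le> T" if "\<bar>t\<bar> \<le> T" for t s T :: real
  proof -
   have "\<bar>t\<bar> * \<bar>cos s\<bar> \<le> \<bar>t\<bar> * 1" by (intro mult_left_mono) auto
   then show ?thesis using that by (simp add: abs_mult)
  qed
  have i1: "integrable M (\<lambda>x. a1 w x * cos (lam * (u w \<bullet> x) + (ph - pi/2)))"
   by (rule integrable_bounded_continuous[OF M(2,1) _ cb[OF A1]])
     (use UC_continuous[OF a1U w] in \<open>intro continuous_intros\<close>)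
  have i2: "integrable M (\<lambda>x. a w x * cos (?P x))"
   by (rule integrable_bounded_continuous[OF M(2,1) _ cb[OF A]])
     (use UC_continuous[OF Suc.prems(3) w] in \<open>intro continuous_intros\<close>)
  have "(LINT x|M. a1 w x * cos (lam * (u w \<bullet> x) + (ph - pi/2))) + lam * (LINT x|M. a w x * cos (?P x)) = 0"
   using z unfolding eq using i1 i2 by simp
  then have "lam * (LINT x|M. a w x * cos (?P x)) = - (LINT x|M. a1 w x * cos (lam * (u w \<bullet> x) + (ph - pi/2)))"
   by linarith
  then have "\<bar>lam * (LINT x|M. a w x * cos (?P x))\<bar> = \<bar>LINT x|M. a1 w x * cos (lam * (u w \<bullet> x) + (ph - pi/2))\<bar>"
   by simp
  then have "lam * \<bar>LINT x|M. a w x * cos (?P x)\<bar> = \<bar>LINT x|M. a1 w x * cos (lam * (u w \<bullet> x) + (ph - pi/2))\<bar>"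
   using lam by (simp add: abs_mult)
  also have "\<dots> \<le> C / lam ^ k" by (rule C[OF w lam M nd])
  finally show ?thesis using lam by (simp add: field_simps)
 qed
 then show ?case by (intro exI[of _ C]) simp
qed

section \<open>Measures that admit integration by parts\<close>

text \<open>The normalised surface measure of the sphere, described by its properties, in the form
  in which the image of Haar measure under an orbit map supplies it.\<close>

definition rotation_invariant :: "(real^'n) measure \<Rightarrow> bool" where
 "rotation_invariant Om \<longleftrightarrow> prob_space Om \<and> sets Om = sets borel \<and> (AE x in Om. norm x = 1) \<and>
   (\<forall>A\<in>SOn. distr Om borel (\<lambda>x. A *v x) = Om)"

definition uniform_on :: "'a::euclidean_space set \<Rightarrow> 'a measure" where
 "uniform_on D = density lborel (\<lambda>x. ennreal (indicator D x))"

lemma sets_uniform_on [simp, measurable_cong]: "sets (uniform_on D) = sets borel"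
 by (simp add: uniform_on_def)

lemma integral_uniform_on:
 assumes "D \<in> sets borel" "g \<in> borel_measurable borel"
 shows "(LINT x|uniform_on D. g x) = (LINT x|lborel. indicator D x * (g x :: real))"
 unfolding uniform_on_def using assms by (subst integral_real_density) auto

lemma uniform_on_finite:
 assumes "D \<in> sets borel" "bounded D"
 shows "finite_measure (uniform_on D)" "measure (uniform_on D) UNIV = measure lborel D"
proof -
 have e: "emeasure (uniform_on D) UNIV = emeasure lborel D"
  using assms(1) by (simp add: uniform_on_def emeasure_density ennreal_indicator)
 then show "finite_measure (uniform_on D)"
  using emeasure_bounded_finite[OF assms(2)] by (intro finite_measureI) (auto simp: uniform_on_def)
 show "measure (uniform_on D) UNIV = measure lborel D" using e by (simp add: measure_def)
qed

lemma has_gradient_imp_continuous: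
 assumes "\<And>x. (\<phi> has_derivative (\<lambda>v. D x \<bullet> v)) (at x)"
 shows "continuous_on UNIV \<phi>"
 by (rule continuous_at_imp_continuous_on) (auto intro: has_derivative_continuous assms)

lemma C1_compact_bounded:
 fixes D :: "real^'n \<Rightarrow> real^'n"
 assumes "compact Q" "\<And>x. x \<notin> Q \<Longrightarrow> \<phi> x = (0::real)" "\<And>x. (\<phi> has_derivative (\<lambda>v. D x \<bullet> v)) (at x)"
  "continuous_on UNIV D"
 obtains L where "L \<ge> 0" "\<And>x. norm (D x) \<le> L" "\<And>x y. \<bar>\<phi> x - \<phi> y\<bar> \<le> L * norm (x - y)"
proof -
 have z: "D x = 0" if "x \<notin> Q" for x
  by (rule gradient_zero_outside[OF compact_imp_closed[OF assms(1)] assms(2) assms(3) that])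
 have "bounded (D ` Q)" using assms by (meson compact_continuous_image compact_imp_bounded continuous_on_subset subset_UNIV)
 then obtain B where B: "\<And>x. x \<in> Q \<Longrightarrow> norm (D x) \<le> B" unfolding bounded_iff by auto
 define L where "L = max B 0"
 have L: "norm (D x) \<le> L" for x using B[of x] z[of x] by (cases "x \<in> Q") (auto simp: L_def)
 have on: "onorm (\<lambda>v. D x \<bullet> v) \<le> L" for x
 proof (rule onorm_bound)
  show "norm (D x \<bullet> v) \<le> L * norm v" for v
   using Cauchy_Schwarz_ineq2[of "D x" v] mult_right_mono[OF L[of x] norm_ge_zero[of v]] by simp
 qed (simp add: L_def)
 have "norm (\<phi> x - \<phi> y) \<le> L * norm (x - y)" for x y
  by (rule differentiable_bound[OF convex_UNIV assms(3) on]) auto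
 then show ?thesis using L by (intro that[of L]) (auto simp: L_def)
qed

lemma C1_compact_integrable:
 fixes \<phi> :: "real^'n \<Rightarrow> real"
 assumes "compact Q" "\<And>x. x \<notin> Q \<Longrightarrow> \<phi> x = 0" "continuous_on Q \<phi>"
 shows "integrable lborel \<phi>"
proof -
 have "integrable lborel (\<lambda>x. indicator Q x *\<^sub>R \<phi> x)" by (rule borel_integrable_compact[OF assms(1,3)])
 moreover have "(\<lambda>x. indicator Q x *\<^sub>R \<phi> x) = \<phi>" using assms(2) by (auto simp: fun_eq_iff indicator_def)
 ultimately show ?thesis by simp
qed

lemma difference_quotient_LIMSEQ:
 assumes "(g has_real_derivative l) (at 0)"
 shows "(\<lambda>k. real (Suc k) * (g (1 / real (Suc k)) - g 0)) \<longlonglongrightarrow> l"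
proof -
 have "((\<lambda>h. (g (0 + h) - g 0) / h) \<longlongrightarrow> l) (at 0)" using assms unfolding DERIV_def .
 moreover have "filterlim (\<lambda>k. 1 / real (Suc k)) (at 0) sequentially"
  unfolding filterlim_at using LIMSEQ_inverse_real_of_nat by (auto simp: inverse_eq_divide)
 ultimately have "((\<lambda>k. (g (0 + 1 / real (Suc k)) - g 0) / (1 / real (Suc k))) \<longlongrightarrow> l) sequentially"
  by (rule filterlim_compose)
 then show ?thesis by (simp add: mult.commute del: of_nat_Suc)
qed

text \<open>If the maps \<open>G k\<close> preserve the integral, the difference quotients integrate
  to 0, and by dominated convergence so does their limit, the derivative along the flow. Applied to
  translations and to plane rotations.\<close>

lemma flow_integral_zero:
 fixes \<phi> L :: "'a \<Rightarrow> real"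
 assumes "integrable M \<phi>" "\<And>k. integrable M (\<lambda>x. \<phi> (G k x))"
  "\<And>k. (LINT x|M. \<phi> (G k x)) = (LINT x|M. \<phi> x)"
  "AE x in M. (\<lambda>k. real (Suc k) * (\<phi> (G k x) - \<phi> x)) \<longlonglongrightarrow> L x"
  "\<And>k. AE x in M. \<bar>real (Suc k) * (\<phi> (G k x) - \<phi> x)\<bar> \<le> B x" "integrable M B" "L \<in> borel_measurable M"
 shows "(LINT x|M. L x) = 0"
proof -
 have "(\<lambda>k. LINT x|M. real (Suc k) * (\<phi> (G k x) - \<phi> x)) \<longlonglongrightarrow> (LINT x|M. L x)"
  by (rule integral_dominated_convergence[where w=B])
    (use assms in \<open>auto simp del: of_nat_Suc\<close>)
 moreover have "(LINT x|M. real (Suc k) * (\<phi> (G k x) - \<phi> x)) = 0" for k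
  using assms(1-3) by (simp del: of_nat_Suc)
 ultimately have "(\<lambda>k::nat. 0::real) \<longlonglongrightarrow> (LINT x|M. L x)" by (simp del: of_nat_Suc)
 then show ?thesis by (simp add: LIMSEQ_const_iff)
qed

lemma integral_partial_zero:
 fixes \<phi> :: "real^'n \<Rightarrow> real"
 assumes "compact Q" "\<And>x. x \<notin> Q \<Longrightarrow> \<phi> x = 0" "\<And>x. (\<phi> has_derivative (\<lambda>v. D x \<bullet> v)) (at x)"
  "continuous_on UNIV D"
 shows "(LINT x|lborel. D x $ i) = 0"
proof -
 obtain L where L: "L \<ge> 0" "\<And>x. norm (D x) \<le> L" "\<And>x y. \<bar>\<phi> x - \<phi> y\<bar> \<le> L * norm (x - y)"
  by (rule C1_compact_bounded[OF assms]) (assumption, rule that)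
 have c: "continuous_on UNIV \<phi>" 
  by (rule has_gradient_imp_continuous) (rule assms(3))
 have int: "integrable lborel \<phi>" 
  by (rule C1_compact_integrable[OF assms(1,2) continuous_on_subset[OF c]]) auto
 obtain r where r: "Q \<subseteq> cball 0 r" 
  using compact_imp_bounded[OF assms(1)] unfolding bounded_iff by (auto simp: subset_iff)
 let ?e = "\<lambda>k. (1 / real (Suc k)) *\<^sub>R (axis i 1 :: real^'n)"
 have ne: "norm (?e k) \<le> 1" for k by simp
 have dist: "distr lborel borel ((+) v) = (lborel :: (real^'n) measure)" for v by (rule lborel_distr_plus)
 have m: "\<phi> \<in> borel_measurable borel" using c by (rule borel_measurable_continuous_onI)
 show ?thesis
 \<comment> \<open>All translations have length at most 1, so every difference quotient is supported
   in the ball of radius r + 1, where the Lipschitz constant bounds it.\<close>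
 proof (rule flow_integral_zero[where M=lborel and \<phi>=\<phi> and G="\<lambda>k x. ?e k + x" and B="\<lambda>x. L * indicator (cball 0 (r + 1)) x"])
  show "integrable lborel \<phi>" by fact
  show "integrable lborel (\<lambda>x. \<phi> (?e k + x))" for k
   using integrable_distr_eq[of "(+) (?e k)" lborel borel \<phi>] int m by (simp add: dist)
  show "(LINT x|lborel. \<phi> (?e k + x)) = (LINT x|lborel. \<phi> x)" for k
   using integral_distr[of "(+) (?e k)" lborel borel \<phi>] m by (simp add: dist)
  have "(\<lambda>k. real (Suc k) * (\<phi> (?e k + x) - \<phi> x)) \<longlonglongrightarrow> D x $ i" for x
  proof -
   have 1: "((\<lambda>t. x + t *\<^sub>R axis i 1) has_derivative (\<lambda>t. t *\<^sub>R axis i 1)) (at 0)"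
    by (auto intro!: derivative_eq_intros)
   have "((\<lambda>t. \<phi> (x + t *\<^sub>R axis i 1)) has_derivative (\<lambda>t. D x \<bullet> (t *\<^sub>R axis i 1))) (at 0)"
    by (rule has_derivative_compose[OF 1]) (use assms(3)[of x] in simp)
   then have "((\<lambda>t. \<phi> (x + t *\<^sub>R axis i 1)) has_real_derivative D x $ i) (at 0)"
    unfolding has_field_derivative_def by (rule has_derivative_eq_rhs) (auto simp: inner_axis)
   from difference_quotient_LIMSEQ[OF this] show ?thesis by (simp add: add.commute del: of_nat_Suc)
  qed
  then show "AE x in lborel. (\<lambda>k. real (Suc k) * (\<phi> (?e k + x) - \<phi> x)) \<longlonglongrightarrow> D x $ i" by simp
  have "\<bar>real (Suc k) * (\<phi> (?e k + x) - \<phi> x)\<bar> \<le> L * indicator (cball 0 (r + 1)) x" for k x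
  proof (cases "norm x \<le> r + 1")
   case True
   have "\<bar>\<phi> (?e k + x) - \<phi> x\<bar> \<le> L * norm (?e k)" using L(3)[of "?e k + x" x] by simp
   also have "\<dots> = L / real (Suc k)" by (simp del: of_nat_Suc)
   finally have "real (Suc k) * \<bar>\<phi> (?e k + x) - \<phi> x\<bar> \<le> L" by (simp add: field_simps del: of_nat_Suc)
   then show ?thesis using True by (simp add: abs_mult del: of_nat_Suc)
  next
   case False
   then have "x \<notin> Q" using r unfolding subset_iff by (auto simp: not_le)
   then have "\<phi> x = 0" by (rule assms(2))
   moreover have "norm x \<le> norm (?e k + x) + norm (?e k)"
    using norm_triangle_ineq4[of "?e k + x" "?e k"] by (simp del: of_nat_Suc)
   then have "norm (?e k + x) > r" using False ne[of k] by linarith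
   then have "?e k + x \<notin> Q" using r unfolding subset_iff by (auto simp: not_le simp del: of_nat_Suc)
   then have "\<phi> (?e k + x) = 0" by (rule assms(2))
   ultimately show ?thesis using L by simp
  qed
  then show "AE x in lborel. \<bar>real (Suc k) * (\<phi> (?e k + x) - \<phi> x)\<bar> \<le> L * indicator (cball 0 (r + 1)) x" for k by simp
  show "integrable lborel (\<lambda>x. L * indicator (cball 0 (r + 1)) x :: real)"
   by (intro integrable_mult_right integrable_real_indicator) (use emeasure_bounded_finite[OF bounded_cball, of 0 "r + 1"] in auto)
  show "(\<lambda>x. D x $ i) \<in> borel_measurable lborel"
   using borel_measurable_continuous_onI[of "\<lambda>x. D x $ i"] assms(4) by (auto intro!: continuous_intros)
 qed
qed

text \<open>A constant field has divergence 0, and a test function supported in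
  \<open>Q \<subseteq> D\<close> does not see the boundary of \<open>D\<close>.\<close>

lemma null_div_interior:
 assumes "compact Q" "Q \<subseteq> D" "D \<in> sets borel"
 shows "null_div (uniform_on D) Q (\<lambda>_. axis i 1) (\<lambda>_. 0)"
 unfolding null_div_def
proof (intro allI impI)
 fix \<phi> :: "real^'a \<Rightarrow> real" and E
 assume a: "\<forall>x. (\<phi> has_derivative (\<lambda>v. E x \<bullet> v)) (at x)" "continuous_on UNIV E" "\<forall>x. x \<notin> Q \<longrightarrow> \<phi> x = 0"
 have "(\<lambda>x. E x $ i) \<in> borel_measurable borel"
  using a(2) by (intro borel_measurable_continuous_onI continuous_intros) 
 then have "(LINT x|uniform_on D. E x $ i) = (LINT x|lborel. indicator D x * E x $ i)"
  by (rule integral_uniform_on[OF assms(3)])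
 also have "\<dots> = (LINT x|lborel. E x $ i)"
 proof (rule Bochner_Integration.integral_cong)
  fix x
  have "E x = 0" if "x \<notin> Q"
   by (rule gradient_zero_outside[where \<phi>=\<phi>, OF compact_imp_closed[OF assms(1)]]) (use a that in auto)
  then show "indicator D x * E x $ i = E x $ i" using assms(2) by (cases "x \<in> Q") auto
 qed simp
 also have "\<dots> = 0" by (rule integral_partial_zero[OF assms(1), where \<phi>=\<phi>]) (use a in auto)
 finally show "(LINT x|uniform_on D. axis i 1 \<bullet> E x + 0 * \<phi> x) = 0" by (simp add: inner_axis')
qed

text \<open>The field is orthogonal to the gradient \<open>G\<close> of \<open>F\<close>, hence
  tangent to the level sets of \<open>F\<close>, so no boundary term arises although the test
  functions need not vanish on the boundary of \<open>D\<close>. The function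
  \<open>H j x $ i - H i x $ j\<close> is its divergence.\<close>

lemma null_div_boundary:
 fixes F :: "real^'n \<Rightarrow> real"
 assumes Q: "compact Q" "Q \<subseteq> S" "open S" "D \<in> sets borel"
  and F: "UC 1 {()} S (\<lambda>_. F)" and G: "\<And>i. UC 1 {()} S (\<lambda>_ x. G x $ i)"
  and H: "\<And>i j. UC 0 {()} S (\<lambda>_ x. H i x $ j)"
  and FG: "\<And>x. x \<in> S \<Longrightarrow> (F has_derivative (\<lambda>v. G x \<bullet> v)) (at x)"
  and GH: "\<And>i x. x \<in> S \<Longrightarrow> ((\<lambda>x. G x $ i) has_derivative (\<lambda>v. H i x \<bullet> v)) (at x)"
  and side: "AE x in lborel. x \<in> S \<longrightarrow> (x \<in> D \<longleftrightarrow> F x < 0)"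
 shows "null_div (uniform_on D) Q (\<lambda>x. G x $ j *\<^sub>R axis i 1 - G x $ i *\<^sub>R axis j 1) (\<lambda>x. H j x $ i - H i x $ j)"
 unfolding null_div_def
proof (intro allI impI)
 fix \<phi> :: "real^'n \<Rightarrow> real" and E
 assume a: "\<forall>x. (\<phi> has_derivative (\<lambda>v. E x \<bullet> v)) (at x)" "continuous_on UNIV E" "\<forall>x. x \<notin> Q \<longrightarrow> \<phi> x = 0"
 let ?I = "\<lambda>x. (G x $ j *\<^sub>R axis i 1 - G x $ i *\<^sub>R axis j 1) \<bullet> E x + (H j x $ i - H i x $ j) * \<phi> x"
 have clQ: "closed Q" using Q compact_imp_closed by blast
 have E0: "E x = 0" if "x \<notin> Q" for x
  by (rule gradient_zero_outside[where \<phi>=\<phi>, OF clQ]) (use a that in auto)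
 have \<phi>c: "continuous_on UNIV \<phi>" 
  by (rule has_gradient_imp_continuous) (use a(1) in auto)
 have \<phi>1: "UC 1 {()} UNIV (\<lambda>_. \<phi>)"
 proof -
  obtain L where L: "\<And>x. norm (E x) \<le> L" 
   by (rule C1_compact_bounded[OF Q(1) a(3)[rule_format] a(1)[rule_format] a(2)]) (auto intro: that)
  have "bounded (\<phi> ` Q)" using Q(1) \<phi>c by (meson compact_continuous_image compact_imp_bounded continuous_on_subset subset_UNIV)
  then obtain B where B: "\<And>x. x \<in> Q \<Longrightarrow> \<bar>\<phi> x\<bar> \<le> B" unfolding bounded_iff by auto
  have "\<bar>\<phi> x\<bar> \<le> max B 0" for x using B[of x] a(3) by (cases "x \<in> Q") auto
  moreover have "UC 0 {()} UNIV (\<lambda>_ x. E x $ l)" for l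
   using order_trans[OF component_le_norm_cart L] a(2) by (auto intro!: continuous_intros)
  ultimately show ?thesis using a(1) unfolding One_nat_def
   by (intro UC_SucI[where D="\<lambda>_. E" and M="max B 0"]) auto
 qed
 have I0: "?I x = 0" if "x \<notin> Q" for x using E0[OF that] a(3) that by simp
 have cG: "continuous_on S (\<lambda>x. G x $ l)" for l using UC_continuous[OF G, of "()"] by simp
 have cH: "continuous_on S (\<lambda>x. H k x $ l)" for k l using UC_continuous[OF H, of "()"] by simp
 have "continuous_on S (\<lambda>x. \<chi> l. G x $ l)" by (rule continuous_on_vec_lambda[OF cG])
 then have cG': "continuous_on S G" by simp
 have "continuous_on S (\<lambda>x. \<chi> l. H k x $ l)" for k by (rule continuous_on_vec_lambda[OF cH])
 then have cH': "continuous_on S (H k)" for k by simp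
 have cI: "continuous_on S ?I"
  using cG' cH' continuous_on_subset[OF \<phi>c, of S] continuous_on_subset[OF a(2), of S]
  by (intro continuous_intros) auto
 have intI: "integrable lborel ?I" by (rule C1_compact_integrable[OF Q(1) I0]) (use cI Q(2) continuous_on_subset in auto)
 \<comment> \<open>Continuously differentiable functions with values between 0 and 1 that tend to
   the indicator of the negative half-line; \<open>\<sigma> N (F x)\<close> thus approximates the
   indicator of \<open>D\<close> near \<open>Q\<close>.\<close>
 define \<sigma> :: "nat \<Rightarrow> real \<Rightarrow> real" where "\<sigma> = (\<lambda>N t. max 0 (- t) ^ 2 * (1 / (max 0 (- t) ^ 2 + 1 / real (Suc N))))"
 have den: "max 0 (- t) ^ 2 + 1 / real (Suc N) > 0" for t N
  by (simp add: add_nonneg_pos)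
 have \<sigma>d: "\<exists>s. (\<sigma> N has_real_derivative s) (at t)" for N t
 proof -
  have "((\<lambda>t::real. - t) has_real_derivative -1) (at t)" by (auto intro!: derivative_eq_intros)
  from DERIV_chain2[OF max_power_has_derivative[of 0 "- t"] this]
  have "((\<lambda>t::real. max 0 (- t) ^ 2) has_real_derivative (2 * max 0 (- t) * -1)) (at t)" by (simp add: numeral_2_eq_2)
  note d = this
  have "((\<lambda>t. 1 / (max 0 (- t) ^ 2 + 1 / real (Suc N))) has_real_derivative
    ((0 * (max 0 (- t) ^ 2 + 1 / real (Suc N)) - 1 * (2 * max 0 (- t) * -1 + 0)) /
     ((max 0 (- t) ^ 2 + 1 / real (Suc N)) * (max 0 (- t) ^ 2 + 1 / real (Suc N))))) (at t)"
   using den[of t N] by (intro DERIV_divide DERIV_add d DERIV_const) auto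
  from DERIV_mult[OF d this] show ?thesis unfolding \<sigma>_def by blast
 qed
 then obtain \<sigma>' where \<sigma>': "\<And>N t. (\<sigma> N has_real_derivative \<sigma>' N t) (at t)" by metis
 have \<sigma>F: "UC 1 {()} S (\<lambda>_ x. \<sigma> N (F x))" for N
 proof -
  have 1: "UC 1 {()} S (\<lambda>_ x. max 0 (- F x) ^ 2)" by (intro UC_maxpow UC_minus F) simp
  have 2: "UC 1 {()} S (\<lambda>_ x. max 0 (- F x) ^ 2 + 1 / real (Suc N))"
   by (intro UC_add 1 UC_const[where M=1]) auto
  have "UC 1 {()} S (\<lambda>_ x. 1 / (max 0 (- F x) ^ 2 + 1 / real (Suc N)))"
   by (rule UC_inverse[OF _ 2, of "1 / real (Suc N)"]) auto
  from UC_mult[OF 1 this] show ?thesis by (simp add: \<sigma>_def)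
 qed
 have sF: "((\<lambda>x. \<sigma> N (F x)) has_derivative (\<lambda>v. (\<sigma>' N (F x) *\<^sub>R G x) \<bullet> v)) (at x)" if "x \<in> S" for N x
  by (rule has_derivative_eq_rhs[OF has_derivative_compose[OF FG[OF that] \<sigma>'[unfolded has_field_derivative_def]]]) simp
 \<comment> \<open>The vanishing integral of the partial derivative in direction \<open>k\<close> of
   \<open>\<sigma> N (F x) * \<phi> x * G x $ l\<close>, with the derivative written out.\<close>
 have part: "(LINT x|lborel. \<sigma> N (F x) * \<phi> x * H l x $ k + \<sigma> N (F x) * G x $ l * E x $ k + \<phi> x * G x $ l * \<sigma>' N (F x) * G x $ k) = 0
   \<and> integrable lborel (\<lambda>x. \<sigma> N (F x) * \<phi> x * H l x $ k + \<sigma> N (F x) * G x $ l * E x $ k + \<phi> x * G x $ l * \<sigma>' N (F x) * G x $ k)" for N k l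
 proof -
  let ?\<Psi> = "\<lambda>x. \<sigma> N (F x) * \<phi> x * G x $ l"
  have 0: "?\<Psi> x = 0" if "x \<notin> Q" for x using a(3) that by simp
  have "UC 1 {()} S (\<lambda>_. ?\<Psi>)" by (intro UC_mult \<sigma>F G UC_subset[OF \<phi>1]) auto
  then have "UC 1 {()} UNIV (\<lambda>_. ?\<Psi>)" by (rule UC_extend[OF Q(3) clQ Q(2)]) (use 0 in auto)
  then obtain P0 where P0: "\<And>w x. w \<in> {()} \<Longrightarrow> x \<in> UNIV \<Longrightarrow> (?\<Psi> has_derivative (\<lambda>v. P0 w x \<bullet> v)) (at x)"
   "\<And>m. UC 0 {()} UNIV (\<lambda>w x. P0 w x $ m)" unfolding One_nat_def by (rule UC_SucE) blast
  define P where "P = P0 ()"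
  have P: "(?\<Psi> has_derivative (\<lambda>v. P x \<bullet> v)) (at x)" for x using P0(1)[of "()" x] by (simp add: P_def)
  have "continuous_on UNIV (\<lambda>x. \<chi> m. P x $ m)"
   using P0(2) by (intro continuous_on_vec_lambda) (auto simp: P_def)
  then have Pc: "continuous_on UNIV P" by simp
  have eq: "P x $ k = \<sigma> N (F x) * \<phi> x * H l x $ k + \<sigma> N (F x) * G x $ l * E x $ k + \<phi> x * G x $ l * \<sigma>' N (F x) * G x $ k" for x
  proof (cases "x \<in> Q")
   case True
   then have xS: "x \<in> S" using Q by auto
   have "(?\<Psi> has_derivative (\<lambda>v. (\<sigma> N (F x) * \<phi> x) * (H l x \<bullet> v) + (\<sigma> N (F x) * (E x \<bullet> v) + ((\<sigma>' N (F x) *\<^sub>R G x) \<bullet> v) * \<phi> x) * G x $ l)) (at x)"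
    using a(1) by (intro has_derivative_mult GH[OF xS] sF[OF xS]) auto
   from has_derivative_unique[OF P this] have
    "P x \<bullet> axis k 1 = (\<sigma> N (F x) * \<phi> x) * (H l x \<bullet> axis k 1) + (\<sigma> N (F x) * (E x \<bullet> axis k 1) + ((\<sigma>' N (F x) *\<^sub>R G x) \<bullet> axis k 1) * \<phi> x) * G x $ l"
    by metis
   then show ?thesis by (simp add: inner_axis algebra_simps)
  next
   case False
   have "P x = 0" by (rule gradient_zero_outside[where \<phi>="?\<Psi>", OF clQ 0 P False])
   then show ?thesis using False a(3) E0[OF False] by simp
  qed
  have "(LINT x|lborel. P x $ k) = 0" by (rule integral_partial_zero[where \<phi>="?\<Psi>", OF Q(1) 0 P Pc])
  moreover have "integrable lborel (\<lambda>x. P x $ k)"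
  proof (rule C1_compact_integrable[OF Q(1)])
   show "P x $ k = 0" if "x \<notin> Q" for x using gradient_zero_outside[where \<phi>="?\<Psi>", OF clQ 0 P that] by simp
   show "continuous_on Q (\<lambda>x. P x $ k)" using continuous_on_subset[OF Pc, of Q] by (intro continuous_intros) auto
  qed
  ultimately show ?thesis unfolding eq by simp
 qed
 \<comment> \<open>The singular terms containing \<open>\<sigma>'\<close> carry the product of
   \<open>G x $ i\<close> and \<open>G x $ j\<close>, symmetric in the indices, and cancel in the
   difference. This is tangency at work.\<close>
 have z: "(LINT x|lborel. \<sigma> N (F x) * ?I x) = 0" for N
 proof -
  have "\<sigma> N (F x) * ?I x = (\<sigma> N (F x) * \<phi> x * H j x $ i + \<sigma> N (F x) * G x $ j * E x $ i + \<phi> x * G x $ j * \<sigma>' N (F x) * G x $ i)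
    - (\<sigma> N (F x) * \<phi> x * H i x $ j + \<sigma> N (F x) * G x $ i * E x $ j + \<phi> x * G x $ i * \<sigma>' N (F x) * G x $ j)" for x
   by (simp add: inner_diff_left inner_axis' algebra_simps)
  note eq = this
  show ?thesis unfolding eq
   by (subst Bochner_Integration.integral_diff) (use part[of N j i] part[of N i j] in auto)
 qed
 have lim: "(\<lambda>N. \<sigma> N t) \<longlonglongrightarrow> (if t < 0 then 1 else 0)" for t
 proof (cases "t < 0")
  case True
  have "(\<lambda>N. t^2 * (1 / (t^2 + 1 / real (Suc N)))) \<longlonglongrightarrow> t^2 * (1 / (t^2 + 0))"
   using True LIMSEQ_inverse_real_of_nat by (intro tendsto_intros) (auto simp: inverse_eq_divide)
  then show ?thesis using True by (simp add: \<sigma>_def)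
 qed (simp add: \<sigma>_def)
 have \<sigma>1: "\<bar>\<sigma> N t\<bar> \<le> 1" for N t using den[of t N] unfolding \<sigma>_def by (simp add: abs_mult)
 have Im: "?I \<in> borel_measurable borel" using intI by (auto dest: borel_measurable_integrable)
 have meas: "(\<lambda>x. \<sigma> N (F x) * ?I x) \<in> borel_measurable lborel" for N
 proof -
  have "integrable lborel (\<lambda>x. \<sigma> N (F x) * ?I x)"
  proof (rule C1_compact_integrable[OF Q(1)])
   show "continuous_on Q (\<lambda>x. \<sigma> N (F x) * ?I x)"
    using cI Q(2) UC_continuous[OF \<sigma>F, of "()"] by (intro continuous_on_mult) (auto intro: continuous_on_subset)
  qed (use I0 in auto)
  then show ?thesis by auto
 qed
 have conv: "(\<lambda>N. \<sigma> N (F x) * ?I x) \<longlonglongrightarrow> (if F x < 0 then 1 else 0) * ?I x" for x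
  by (intro tendsto_mult lim tendsto_const)
 have "(\<lambda>N. LINT x|lborel. \<sigma> N (F x) * ?I x) \<longlonglongrightarrow> (LINT x|lborel. (if F x < 0 then 1 else 0) * ?I x)"
 proof (rule integral_dominated_convergence[where w="\<lambda>x. \<bar>?I x\<bar>"])
  show "(\<lambda>x. (if F x < 0 then 1 else 0) * ?I x) \<in> borel_measurable lborel"
   by (rule borel_measurable_LIMSEQ_real[OF conv meas])
  show "AE x in lborel. norm (\<sigma> N (F x) * ?I x) \<le> \<bar>?I x\<bar>" for N
   using mult_right_mono[OF \<sigma>1 abs_ge_zero] by (auto simp: abs_mult)
 qed (use intI meas conv in auto)
 then have "(\<lambda>N::nat. 0::real) \<longlonglongrightarrow> (LINT x|lborel. (if F x < 0 then 1 else 0) * ?I x)" unfolding z .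
 then have "(LINT x|lborel. (if F x < 0 then 1 else 0) * ?I x) = 0" by (simp only: LIMSEQ_const_iff)
 moreover have "(LINT x|lborel. (if F x < 0 then 1 else 0) * ?I x) = (LINT x|lborel. indicator D x * ?I x)"
 proof (rule integral_cong_AE)
  show "(\<lambda>x. (if F x < 0 then 1 else 0) * ?I x) \<in> borel_measurable lborel"
   by (rule borel_measurable_LIMSEQ_real[OF conv meas])
  show "(\<lambda>x. indicator D x * ?I x) \<in> borel_measurable lborel" using Im Q(4) by auto
  show "AE x in lborel. (if F x < 0 then 1 else 0) * ?I x = indicator D x * ?I x"
   using side
  proof eventually_elim
   case (elim x)
   show ?case using elim I0[of x] Q(2) by (cases "x \<in> Q") (auto simp: indicator_def)
  qed
 qed
 ultimately show "(LINT x|uniform_on D. ?I x) = 0" using integral_uniform_on[OF Q(4) Im] by simp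
qed

subsection \<open>Plane rotations\<close>

text \<open>For \<open>i \<noteq> j\<close>, rotation by the angle \<open>t\<close> in the plane of
  two coordinate axes, written as the identity plus a correction in that plane.\<close>

definition rotf :: "'n \<Rightarrow> 'n \<Rightarrow> real \<Rightarrow> real^'n \<Rightarrow> real^'n" where
 "rotf i j t x = x + ((cos t - 1) * x $ i - sin t * x $ j) *\<^sub>R axis i 1
   + (sin t * x $ i + (cos t - 1) * x $ j) *\<^sub>R axis j 1"

lemma linear_rotf: "linear (rotf i j t)"
 by (rule linearI) (auto simp: rotf_def vec_eq_iff axis_def algebra_simps)

lemma rotf_nth: "i \<noteq> j \<Longrightarrow> rotf i j t x $ a =
  (if a = i then cos t * x $ i - sin t * x $ j else if a = j then sin t * x $ i + cos t * x $ j else x $ a)"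
 by (auto simp: rotf_def axis_def algebra_simps)

lemma rotf_add: "i \<noteq> j \<Longrightarrow> rotf i j s (rotf i j t x) = rotf i j (s + t) x"
 by (auto simp: vec_eq_iff rotf_nth cos_add sin_add algebra_simps)

lemma norm_rotf: assumes "i \<noteq> j" shows "norm (rotf i j t x) = norm x"
proof -
 let ?a = "(cos t - 1) * x $ i - sin t * x $ j" and ?b = "sin t * x $ i + (cos t - 1) * x $ j"
 have ax: "axis i (1::real) $ j = 0" "axis j (1::real) $ i = 0" using assms by (auto simp: axis_def)
 have "rotf i j t x \<bullet> rotf i j t x = x \<bullet> x + 2 * (?a * x $ i + ?b * x $ j) + ?a\<^sup>2 + ?b\<^sup>2"
  using assms unfolding rotf_def
  by (simp add: inner_add_left inner_add_right inner_axis inner_axis' inner_axis_axis ax power2_eq_square algebra_simps)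
 moreover have "2 * (((c - 1) * p - s * q) * p + (s * p + (c - 1) * q) * q) + ((c - 1) * p - s * q)\<^sup>2 + (s * p + (c - 1) * q)\<^sup>2
   = (c\<^sup>2 + s\<^sup>2 - 1) * (p\<^sup>2 + q\<^sup>2)" for c s p q :: real
  by (simp add: power2_eq_square algebra_simps)
 from this[of "cos t" "x $ i" "sin t" "x $ j"]
 have "x \<bullet> x + 2 * (?a * x $ i + ?b * x $ j) + ?a\<^sup>2 + ?b\<^sup>2 = x \<bullet> x" by simp
 ultimately show ?thesis by (simp add: norm_eq_sqrt_inner)
qed

text \<open>The determinant is 1 and not -1 because the rotation is the square of the rotation by
  half the angle.\<close>

lemma matrix_rotf_SOn:
 fixes i j :: "'n::finite"
 assumes "i \<noteq> j" shows "matrix (rotf i j t) \<in> SOn"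
proof -
 have o: "orthogonal_matrix (matrix (rotf i j t))" for t
  using norm_rotf[OF assms] linear_rotf orthogonal_transformation orthogonal_transformation_matrix by blast
 have "rotf i j t = rotf i j (t/2) \<circ> rotf i j (t/2)" using rotf_add[OF assms, of "t/2" "t/2"] by (auto simp: fun_eq_iff)
 then have "det (matrix (rotf i j t)) = det (matrix (rotf i j (t/2))) * det (matrix (rotf i j (t/2)))"
  by (metis matrix_compose linear_rotf det_mul)
 then have "det (matrix (rotf i j t)) = 1" using det_orthogonal_matrix[OF o[of "t/2"]] by auto
 then show ?thesis using o by (simp add: SOn_def)
qed

lemma rotf_near: "norm (rotf i j t x - x) \<le> 4 * \<bar>t\<bar> * norm x"
proof -
 have c: "\<bar>cos t - 1\<bar> \<le> \<bar>t\<bar>"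
 proof -
  have "1 - cos t = 2 * (sin (t/2))\<^sup>2" using cos_double_sin[of "t/2"] by simp
  moreover have "(sin (t/2))\<^sup>2 \<le> \<bar>t/2\<bar> * 1"
   unfolding power2_eq_square using abs_sin_x_le_abs_x[of "t/2"] abs_sin_le_one[of "t/2"]
   by (metis abs_ge_zero abs_mult_self_eq mult_mono)
  ultimately show ?thesis using cos_le_one[of t] abs_divide[of t 2] by linarith
 qed
 have s: "\<bar>sin t\<bar> \<le> \<bar>t\<bar>" by (rule abs_sin_x_le_abs_x)
 have m: "\<bar>p * x $ k\<bar> \<le> \<bar>t\<bar> * norm x" if "\<bar>p\<bar> \<le> \<bar>t\<bar>" for p k
  unfolding abs_mult by (intro mult_mono that component_le_norm_cart) auto
 let ?a = "(cos t - 1) * x $ i - sin t * x $ j" and ?b = "sin t * x $ i + (cos t - 1) * x $ j"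
 have "norm (rotf i j t x - x) \<le> \<bar>?a\<bar> + \<bar>?b\<bar>"
  unfolding rotf_def using norm_triangle_ineq[of "?a *\<^sub>R (axis i 1 :: real^'a)" "?b *\<^sub>R axis j 1"]
  by simp
 also have "\<dots> \<le> 4 * \<bar>t\<bar> * norm x" using m[OF c, of i] m[OF c, of j] m[OF s, of i] m[OF s, of j] by linarith
 finally show ?thesis .
qed

text \<open>Plane rotations preserve \<open>Om\<close>, so their generator is divergence free for
  it. On the sphere the motion is bounded by a multiple of the angle, which dominates the difference
  quotients.\<close>

lemma null_div_rotation:
 fixes Om :: "(real^'n) measure"
 assumes "rotation_invariant Om" "compact Q" "i \<noteq> j"
 shows "null_div Om Q (\<lambda>x. x $ i *\<^sub>R axis j 1 - x $ j *\<^sub>R axis i 1) (\<lambda>_. 0)"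
 unfolding null_div_def
proof (intro allI impI)
 fix \<phi> :: "real^'n \<Rightarrow> real" and D
 assume a: "\<forall>x. (\<phi> has_derivative (\<lambda>v. D x \<bullet> v)) (at x)" "continuous_on UNIV D" "\<forall>x. x \<notin> Q \<longrightarrow> \<phi> x = 0"
 interpret prob_space Om using assms by (simp add: rotation_invariant_def)
 have so: "sets Om = sets borel" using assms by (simp add: rotation_invariant_def)
 obtain L where L: "L \<ge> 0" "\<And>x y. \<bar>\<phi> x - \<phi> y\<bar> \<le> L * norm (x - y)"
  by (rule C1_compact_bounded[OF assms(2) a(3)[rule_format] a(1)[rule_format] a(2)]) (auto intro: that)
 have c: "continuous_on UNIV \<phi>" 
  by (rule has_gradient_imp_continuous) (use a(1) in auto)
 have "bounded (\<phi> ` Q)" using assms(2) c by (meson compact_continuous_image compact_imp_bounded continuous_on_subset subset_UNIV)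
 then obtain B where B: "\<And>x. x \<in> Q \<Longrightarrow> \<bar>\<phi> x\<bar> \<le> B" unfolding bounded_iff by auto
 have bd: "\<bar>\<phi> x\<bar> \<le> max B 0" for x using B[of x] a(3) by (cases "x \<in> Q") auto
 have fm: "finite_measure Om" by unfold_locales
 let ?G = "\<lambda>k x. rotf i j (1 / real (Suc k)) x"
 let ?L = "\<lambda>x. (x $ i *\<^sub>R axis j 1 - x $ j *\<^sub>R axis i 1) \<bullet> D x"
 have cr: "continuous_on UNIV (rotf i j t)" for t using linear_rotf linear_continuous_on linear_conv_bounded_linear by blast
 have "(LINT x|Om. ?L x) = 0"
 proof (rule flow_integral_zero[where \<phi>=\<phi> and G="?G" and B="\<lambda>_. 4 * L"])
  show "integrable Om \<phi>" by (rule integrable_bounded_continuous[OF fm so c bd])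
  show "integrable Om (\<lambda>x. \<phi> (?G k x))" for k
   by (rule integrable_bounded_continuous[OF fm so _ bd]) (use continuous_on_compose2[OF c cr] in auto)
  show "(LINT x|Om. \<phi> (?G k x)) = (LINT x|Om. \<phi> x)" for k
  proof -
   have "distr Om borel (?G k) = Om"
   proof -
    have "distr Om borel (\<lambda>x. matrix (?G k) *v x) = Om"
     using assms(1) matrix_rotf_SOn[OF assms(3)] unfolding rotation_invariant_def by blast
    moreover have "(\<lambda>x. matrix (?G k) *v x) = ?G k" by (rule matrix_vector_mul(2)[OF linear_rotf])
    ultimately show ?thesis by simp
   qed
   moreover have "?G k \<in> measurable Om borel"
    using borel_measurable_continuous_onI[OF cr] so by (simp cong: measurable_cong_sets)
   moreover have "\<phi> \<in> borel_measurable borel" using c by (rule borel_measurable_continuous_onI)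
   ultimately show ?thesis using integral_distr[of "?G k" Om borel \<phi>] by simp
  qed
  have "(\<lambda>k. real (Suc k) * (\<phi> (?G k x) - \<phi> x)) \<longlonglongrightarrow> ?L x" for x
  proof -
   have 1: "((\<lambda>t. rotf i j t x) has_derivative (\<lambda>t. t *\<^sub>R (x $ i *\<^sub>R axis j 1 - x $ j *\<^sub>R axis i 1))) (at 0)"
    unfolding rotf_def
    by (auto intro!: derivative_eq_intros simp: algebra_simps)
   have "((\<lambda>t. \<phi> (rotf i j t x)) has_derivative (\<lambda>t. D x \<bullet> (t *\<^sub>R (x $ i *\<^sub>R axis j 1 - x $ j *\<^sub>R axis i 1)))) (at 0)"
    by (rule has_derivative_compose[OF 1]) (use a(1) in \<open>simp add: rotf_def\<close>)
   then have "((\<lambda>t. \<phi> (rotf i j t x)) has_real_derivative ?L x) (at 0)"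
    unfolding has_field_derivative_def by (rule has_derivative_eq_rhs) (auto simp: inner_commute)
   from difference_quotient_LIMSEQ[OF this] show ?thesis by (simp add: rotf_def del: of_nat_Suc)
  qed
  then show "AE x in Om. (\<lambda>k. real (Suc k) * (\<phi> (?G k x) - \<phi> x)) \<longlonglongrightarrow> ?L x" by simp
  have "AE x in Om. norm x = 1" using assms(1) by (simp add: rotation_invariant_def)
  then show "AE x in Om. \<bar>real (Suc k) * (\<phi> (?G k x) - \<phi> x)\<bar> \<le> 4 * L" for k
  proof eventually_elim
   case (elim x)
   have "\<bar>\<phi> (?G k x) - \<phi> x\<bar> \<le> L * norm (?G k x - x)" by (rule L(2))
   also have "\<dots> \<le> L * (4 * \<bar>1 / real (Suc k)\<bar> * norm x)" by (intro mult_left_mono rotf_near L(1))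
   also have "\<dots> = 4 * L / real (Suc k)" using elim by simp
   finally have "real (Suc k) * \<bar>\<phi> (?G k x) - \<phi> x\<bar> \<le> 4 * L" by (simp add: field_simps del: of_nat_Suc)
   then show ?case by (simp add: abs_mult del: of_nat_Suc)
  qed
  have "continuous_on UNIV ?L" using a(2) by (intro continuous_intros)
  from borel_measurable_continuous_onI[OF this] show "?L \<in> borel_measurable Om"
   using so by (simp cong: measurable_cong_sets)
 qed simp
 then show "(LINT x|Om. ?L x + 0 * \<phi> x) = 0" by simp
qed

subsection \<open>Star bodies\<close>

locale star_body =
 fixes m :: "real^'n \<Rightarrow> real"
 assumes m_cont: "continuous_on (sphere 0 1) m"
  and m_pos: "\<And>\<theta>. \<theta> \<in> sphere 0 1 \<Longrightarrow> m \<theta> > 0"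
begin

abbreviation D :: "(real^'n) set" where "D \<equiv> body m"

text \<open>The radial function of the body, extended to be constant along rays.\<close>

definition rad :: "real^'n \<Rightarrow> real" where
 "rad y = m (y /\<^sub>R norm y) powr (1 / real CARD('n))"

text \<open>The point where the ray through \<open>y\<close> leaves the body; 0 for
  \<open>y = 0\<close>.\<close>

definition q :: "real^'n \<Rightarrow> real^'n" where
 "q y = (rad y / norm y) *\<^sub>R y"

lemma unit_sphere: "y \<noteq> 0 \<Longrightarrow> y /\<^sub>R norm y \<in> sphere 0 1"
 by simp

lemma rad_pos: "y \<noteq> 0 \<Longrightarrow> rad y > 0"
 using m_pos[OF unit_sphere, of y] by (simp add: rad_def)

lemma rad_power: "y \<noteq> 0 \<Longrightarrow> rad y ^ CARD('n) = m (y /\<^sub>R norm y)"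
 using m_pos[OF unit_sphere, of y] by (simp add: rad_def powr_power)

lemma rad_scale: assumes "c > 0" shows "rad (c *\<^sub>R y) = rad y"
proof -
 have "(c *\<^sub>R y) /\<^sub>R norm (c *\<^sub>R y) = y /\<^sub>R norm y" using assms by (simp add: field_simps)
 then show ?thesis by (simp only: rad_def)
qed

lemma q_scale: "c > 0 \<Longrightarrow> q (c *\<^sub>R y) = q y"
 by (simp add: q_def rad_scale)

lemma norm_q: "y \<noteq> 0 \<Longrightarrow> norm (q y) = rad y"
 using rad_pos[of y] by (simp add: q_def)

lemma q_nonzero: "y \<noteq> 0 \<Longrightarrow> q y \<noteq> 0"
 using norm_q rad_pos by fastforce

lemma y_eq_q: "y \<noteq> 0 \<Longrightarrow> y = (norm y / rad y) *\<^sub>R q y"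
 using rad_pos[of y] by (simp add: q_def)

lemma rad_cont: "continuous_on (- {0}) rad"
proof -
 have "continuous_on (- {0}) (\<lambda>y::real^'n. m (y /\<^sub>R norm y))"
 proof (rule continuous_on_compose2[OF m_cont])
  show "continuous_on (- {0}) (\<lambda>y::real^'n. y /\<^sub>R norm y)" by (intro continuous_intros) auto
  show "(\<lambda>y::real^'n. y /\<^sub>R norm y) ` (- {0}) \<subseteq> sphere 0 1" using unit_sphere by blast
 qed
 moreover have "\<forall>y\<in>- {0}. m (y /\<^sub>R norm y) \<noteq> 0"
 proof
  fix y :: "real^'n" assume "y \<in> - {0}"
  then have "m (y /\<^sub>R norm y) > 0" by (intro m_pos unit_sphere) simp
  then show "m (y /\<^sub>R norm y) \<noteq> 0" by linarith
 qed
 ultimately show ?thesis unfolding rad_def using continuous_on_powr continuous_on_const by blast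
qed

lemma q_cont: "continuous_on (- {0}) q"
 unfolding q_def by (intro continuous_intros rad_cont) auto

lemma rad_measurable [measurable]: "rad \<in> borel_measurable borel"
proof -
 have "(\<lambda>y. if y \<in> - {0} then rad y else rad 0) \<in> borel_measurable borel"
  by (rule borel_measurable_continuous_on_if) (auto intro: rad_cont)
 moreover have "(\<lambda>y. if y \<in> - {0} then rad y else rad 0) = rad" by auto
 ultimately show ?thesis by simp
qed

lemma q_measurable [measurable]: "q \<in> borel_measurable borel"
 unfolding q_def by measurable

lemma rad_bounds:
 obtains r R where "r > 0" "R > 0" "\<And>y. y \<noteq> 0 \<Longrightarrow> r \<le> rad y" "\<And>y. y \<noteq> 0 \<Longrightarrow> rad y \<le> R"
proof -
 have s: "sphere (0::real^'n) 1 \<subseteq> - {0}" by auto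
 have c: "continuous_on (sphere 0 1) rad" using rad_cont s continuous_on_subset by blast
 have ne: "sphere (0::real^'n) 1 \<noteq> {}" by simp
 obtain a where a: "a \<in> sphere 0 1" "\<And>y. y \<in> sphere 0 1 \<Longrightarrow> rad a \<le> rad y"
  using continuous_attains_inf[OF compact_sphere ne c] by auto
 obtain b where b: "b \<in> sphere 0 1" "\<And>y. y \<in> sphere 0 1 \<Longrightarrow> rad y \<le> rad b"
  using continuous_attains_sup[OF compact_sphere ne c] by auto
 have red: "rad y = rad (y /\<^sub>R norm y)" if "y \<noteq> 0" for y using rad_scale[of "inverse (norm y)" y] that by simp
 show ?thesis
 proof (rule that[of "rad a" "rad b"])
  show "rad a > 0" "rad b > 0" using a b by (auto intro!: rad_pos)
  show "rad a \<le> rad y" if "y \<noteq> 0" for y using a(2)[OF unit_sphere[OF that]] red[OF that] by simp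
  show "rad y \<le> rad b" if "y \<noteq> 0" for y using b(2)[OF unit_sphere[OF that]] red[OF that] by simp
 qed
qed

lemma zero_in_body: "0 \<in> D"
proof -
 have "(axis undefined 1 :: real^'n) \<in> sphere 0 1" by simp
 then show ?thesis unfolding body_def by (auto intro!: exI[of _ 0] exI[of _ "axis undefined 1"])
qed

lemma mem_body: assumes "y \<noteq> 0" shows "y \<in> D \<longleftrightarrow> norm y \<le> rad y"
proof
 assume "y \<in> D"
 then obtain r \<theta> where r: "y = r *\<^sub>R \<theta>" "norm \<theta> = 1" "0 \<le> r" "r \<le> m \<theta> powr (1 / real CARD('n))"
  unfolding body_def by auto
 then have "r > 0" using assms by (cases "r = 0") auto
 then have "rad y = rad \<theta>" using r rad_scale by simp
 also have "\<dots> = m \<theta> powr (1 / real CARD('n))" using r by (simp add: rad_def)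
 finally show "norm y \<le> rad y" using r by simp
next
 assume "norm y \<le> rad y"
 then show "y \<in> D" unfolding body_def using unit_sphere[OF assms] assms
  by (auto intro!: exI[of _ "norm y"] exI[of _ "y /\<^sub>R norm y"] simp: rad_def)
qed

lemma body_eq_image: "D = (\<lambda>(t, \<theta>). (t * rad \<theta>) *\<^sub>R \<theta>) ` ({0..1} \<times> sphere 0 1)"
proof (rule set_eqI)
 fix y :: "real^'n"
 show "y \<in> D \<longleftrightarrow> y \<in> (\<lambda>(t, \<theta>). (t * rad \<theta>) *\<^sub>R \<theta>) ` ({0..1} \<times> sphere 0 1)" (is "_ = (y \<in> ?I)")
 proof
  assume y: "y \<in> D"
  show "y \<in> ?I"
  proof (cases "y = 0")
   case True
   have "(axis undefined 1 :: real^'n) \<in> sphere 0 1" by simp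
   then show ?thesis using True by (auto intro!: image_eqI[of _ _ "(0, axis undefined 1)"])
  next
   case False
   have "norm y \<le> rad y" using y mem_body[OF False] by simp
   then show ?thesis using False rad_pos[OF False] rad_scale[of "inverse (norm y)" y]
    by (intro image_eqI[of _ _ "(norm y / rad y, y /\<^sub>R norm y)"]) (auto simp: divide_simps)
  qed
 next
  assume "y \<in> ?I"
  then obtain t \<theta> where t: "y = (t * rad \<theta>) *\<^sub>R \<theta>" "0 \<le> t" "t \<le> 1" "norm \<theta> = 1" by auto
  show "y \<in> D"
  proof (cases "t = 0")
   case False
   have \<theta>: "\<theta> \<noteq> 0" using t by auto
   have p: "t * rad \<theta> > 0" using False t rad_pos[OF \<theta>] by simp
   then have y0: "y \<noteq> 0" using t \<theta> by auto
   have "rad y = rad \<theta>" using rad_scale[OF p] t by simp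
   moreover have "norm y = t * rad \<theta>" using t p by simp
   moreover have "t * rad \<theta> \<le> 1 * rad \<theta>" using t rad_pos[OF \<theta>] by (intro mult_right_mono) auto
   ultimately show ?thesis using mem_body[OF y0] by simp
  qed (use t zero_in_body in auto)
 qed
qed

lemma compact_body: "compact D"
 unfolding body_eq_image
proof (rule compact_continuous_image)
 have "continuous_on ({0..1} \<times> sphere 0 1) (\<lambda>x. rad (snd x))"
  by (rule continuous_on_compose2[OF rad_cont]) (auto intro!: continuous_intros)
 then show "continuous_on ({0..1} \<times> sphere 0 1) (\<lambda>(t, \<theta>). (t * rad \<theta>) *\<^sub>R \<theta>)"
  unfolding case_prod_unfold by (intro continuous_intros)
 show "compact ({0..1::real} \<times> sphere (0::real^'n) 1)" by (intro compact_Times) auto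
qed

lemma closed_body: "closed D" and bounded_body: "bounded D"
 using compact_body compact_imp_closed compact_imp_bounded by auto

lemma body_borel [measurable]: "D \<in> sets borel"
 using closed_body by simp

lemma interior_body_I: assumes "y \<noteq> 0" "norm y < rad y" shows "y \<in> interior D"
proof -
 have "continuous_on (- {0}) (\<lambda>y. rad y - norm y)" by (intro continuous_intros rad_cont)
 then have "open ((\<lambda>y. rad y - norm y) -` {0<..} \<inter> - {0})"
  by (rule continuous_on_open_vimage[THEN iffD1, rule_format, rotated]) auto
 moreover have "(\<lambda>y. rad y - norm y) -` {0<..} \<inter> - {0} \<subseteq> D" using mem_body by force
 ultimately show ?thesis using assms by (intro interiorI[of "(\<lambda>y. rad y - norm y) -` {0<..} \<inter> - {0}"]) auto
qed

lemma ball_in_body: obtains r where "r > 0" "cball 0 r \<subseteq> D"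
proof -
 obtain r R where r: "r > 0" "\<And>y. y \<noteq> 0 \<Longrightarrow> r \<le> rad y" using rad_bounds by metis
 have "y \<in> D" if "norm y \<le> r" for y using mem_body[of y] r(2)[of y] that zero_in_body by (cases "y = 0") auto
 then show ?thesis using r(1) by (intro that[of r]) auto
qed

lemma zero_interior: "0 \<in> interior D"
proof -
 obtain r where r: "r > 0" "cball 0 r \<subseteq> D" by (rule ball_in_body)
 then show ?thesis using mem_interior_cball by blast
qed

lemma frontier_body_D: assumes "p \<in> frontier D" shows "p \<noteq> 0" "norm p = rad p" "q p = p" "p \<in> D"
proof -
 have p: "p \<in> D" "p \<notin> interior D" using assms closed_body by (auto simp: frontier_def)
 show "p \<in> D" by fact
 show p0: "p \<noteq> 0" using p zero_interior by auto
 show n: "norm p = rad p" using p mem_body[OF p0] interior_body_I[OF p0] by force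
 show "q p = p" using p0 by (simp add: q_def n[symmetric])
qed

lemma q_frontier: assumes "y \<noteq> 0" shows "q y \<in> frontier D"
proof -
 have q0: "q y \<noteq> 0" using assms q_nonzero by auto
 have rq: "rad (q y) = rad y" using assms rad_pos[OF assms] unfolding q_def by (intro rad_scale) auto
 have "q y \<in> D" using mem_body[OF q0] norm_q[OF assms] rq by simp
 moreover have "q y \<notin> interior D"
 proof
  assume "q y \<in> interior D"
  then obtain e where e: "e > 0" "cball (q y) e \<subseteq> D" unfolding mem_interior_cball by blast
  define t where "t = e / rad y"
  have t: "t > 0" using e rad_pos[OF assms] by (simp add: t_def)
  have "dist (q y) ((1 + t) *\<^sub>R q y) = e"
   using norm_q[OF assms] e(1) rad_pos[OF assms] by (simp add: dist_norm scaleR_add_left t_def)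
  then have "(1 + t) *\<^sub>R q y \<in> D" using e by auto
  moreover have "(1 + t) *\<^sub>R q y \<noteq> 0" using q0 t by simp
  ultimately have "norm ((1 + t) *\<^sub>R q y) \<le> rad ((1 + t) *\<^sub>R q y)" using mem_body by blast
  then have "(1 + t) * rad y \<le> rad y" using t rad_scale[of "1 + t" "q y"] norm_q[OF assms] rq by simp
  then show False using t rad_pos[OF assms] by (simp add: distrib_right mult_le_0_iff)
 qed
 ultimately show ?thesis using closure_subset by (auto simp: frontier_def)
qed

subsection \<open>Polar coordinates\<close>

text \<open>The density of polar coordinates \<open>(y, s) \<mapsto> s *\<^sub>R q y\<close>. The
  direction is carried by a point \<open>y\<close> of the unit ball, in agreement with
  \<open>sphere_integral\<close>, and \<open>s\<close> is the fraction of the way to the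
  boundary.\<close>

definition pw :: "real^'n \<Rightarrow> real \<Rightarrow> real" where
 "pw y s = (if norm y < 1 \<and> 0 \<le> s \<and> s \<le> 1 then real CARD('n) * s ^ (CARD('n) - 1) * rad y ^ CARD('n) else 0)"

lemma pw_nonneg: "pw y s \<ge> 0"
proof -
 have "rad y \<ge> 0" by (simp add: rad_def)
 then show ?thesis unfolding pw_def by auto
qed

lemma pw_measurable [measurable]: "(\<lambda>x. pw (fst x) (snd x)) \<in> borel_measurable (borel \<Otimes>\<^sub>M borel)"
 unfolding pw_def by measurable

lemma nn_integral_lborel_scale:
 fixes G :: "real^'n \<Rightarrow> ennreal"
 assumes "G \<in> borel_measurable borel" "u > 0"
 shows "(\<integral>\<^sup>+y. G (u *\<^sub>R y) \<partial>lborel) = ennreal (1 / u ^ CARD('n)) * (\<integral>\<^sup>+x. G x \<partial>lborel)"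
proof -
 have "(\<integral>\<^sup>+x. G x \<partial>lborel) = ennreal (u ^ CARD('n)) * (\<integral>\<^sup>+y. G (u *\<^sub>R y) \<partial>lborel)"
  using assms by (subst lborel_affine[of u 0])
   (auto simp: nn_integral_density nn_integral_distr nn_integral_cmult ennreal_power)
 then show ?thesis using assms(2) by (simp add: mult.assoc[symmetric] ennreal_mult[symmetric])
qed

lemma nn_integral_inverse_power:
 fixes a :: real and N :: nat
 assumes "a > 0" "N > 0"
 shows "(\<integral>\<^sup>+u. ennreal (real N / u ^ Suc N) * indicator {a<..} u \<partial>lborel) = ennreal (1 / a ^ N)"
proof -
 have "(\<integral>\<^sup>+u. ennreal (real N / u ^ Suc N) * indicator {a<..} u \<partial>lborel) =
    (\<integral>\<^sup>+u. ennreal (real N / u ^ Suc N) * indicator {a..} u \<partial>lborel)"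
  by (rule nn_integral_cong_AE)
    (use AE_lborel_singleton[of a] in eventually_elim, auto simp: indicator_def)
 also have "\<dots> = ennreal (0 - (- (1 / a ^ N)))"
 proof (rule nn_integral_FTC_atLeast)
  fix x assume x: "a \<le> x"
  have x0: "x > 0" using x assms by simp
  have "((\<lambda>u. - (1 / u ^ N)) has_real_derivative - ((0 * x ^ N - 1 * (real N * x ^ (N - 1))) / (x ^ N * x ^ N))) (at x)"
   using x0 DERIV_pow[of N x UNIV] by (intro DERIV_minus DERIV_divide DERIV_const) auto
  moreover have "- ((0 * x ^ N - 1 * (real N * x ^ (N - 1))) / (x ^ N * x ^ N)) = real N / x ^ Suc N"
  proof -
   obtain K where K: "N = Suc K" using assms(2) gr0_implies_Suc by blast
   show ?thesis using x0 unfolding K by (simp add: field_simps)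
  qed
  ultimately show "((\<lambda>u. - (1 / u ^ N)) has_real_derivative real N / x ^ Suc N) (at x)" by simp
  show "0 \<le> real N / x ^ Suc N" using x0 by simp
 next
  have "((\<lambda>u::real. - inverse (u ^ N)) \<longlongrightarrow> - 0) at_top"
   by (intro tendsto_minus tendsto_inverse_0_at_top filterlim_pow_at_top filterlim_ident) (use assms in auto)
  then show "((\<lambda>u::real. - (1 / u ^ N)) \<longlongrightarrow> 0) at_top" by (simp add: inverse_eq_divide)
 qed auto
 finally show ?thesis by simp
qed

text \<open>For fixed \<open>y\<close> substitute s = u |y| / rad y, under which
  \<open>s *\<^sub>R q y\<close> becomes \<open>u *\<^sub>R y\<close>; exchange the integrals and
  put x = u y. What remains is the integral of n |x|^n / u^(n+1) over u > |x|, which is 1.\<close>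

lemma polar_nn_integral:
 fixes H :: "real^'n \<Rightarrow> ennreal"
 assumes [measurable]: "H \<in> borel_measurable borel"
 shows "(\<integral>\<^sup>+y. \<integral>\<^sup>+s. ennreal (pw y s) * H (s *\<^sub>R q y) \<partial>lborel \<partial>lborel) = (\<integral>\<^sup>+x. indicator D x * H x \<partial>lborel)"
proof -
 let ?N = "CARD('n)"
 \<comment> \<open>The density after the substitution s = u |y| / rad y.\<close>
 define K :: "real^'n \<Rightarrow> real \<Rightarrow> real" where
  "K = (\<lambda>y u. if y \<noteq> 0 \<and> norm y < 1 \<and> 0 < u \<and> u * norm y \<le> rad y then real ?N * u ^ (?N - 1) * norm y ^ ?N else 0)"
 have N0: "?N > 0" by simp
 have K0: "K y u \<ge> 0" for y u unfolding K_def by auto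
 have [measurable]: "(\<lambda>x. K (fst x) (snd x)) \<in> borel_measurable (borel \<Otimes>\<^sub>M borel)"
  unfolding K_def by measurable
 have inner: "(\<integral>\<^sup>+s. ennreal (pw y s) * H (s *\<^sub>R q y) \<partial>lborel) = (\<integral>\<^sup>+u. ennreal (K y u) * H (u *\<^sub>R y) \<partial>lborel)" if y: "y \<noteq> 0" for y
 proof -
  define \<tau> where "\<tau> = norm y / rad y"
  have t: "\<tau> > 0" using y rad_pos[OF y] by (simp add: \<tau>_def)
  have "(\<integral>\<^sup>+s. ennreal (pw y s) * H (s *\<^sub>R q y) \<partial>lborel) = ennreal \<bar>\<tau>\<bar> * (\<integral>\<^sup>+u. ennreal (pw y (0 + \<tau> * u)) * H ((0 + \<tau> * u) *\<^sub>R q y) \<partial>lborel)"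
   by (rule nn_integral_real_affine) (use t in \<open>auto simp: pw_def\<close>)
  also have "\<dots> = (\<integral>\<^sup>+u. ennreal \<tau> * (ennreal (pw y (\<tau> * u)) * H ((\<tau> * u) *\<^sub>R q y)) \<partial>lborel)"
   using t by (subst nn_integral_cmult) (auto simp: pw_def)
  also have "\<dots> = (\<integral>\<^sup>+u. ennreal (K y u) * H (u *\<^sub>R y) \<partial>lborel)"
  proof (rule nn_integral_cong_AE)
   show "AE u in lborel. ennreal \<tau> * (ennreal (pw y (\<tau> * u)) * H ((\<tau> * u) *\<^sub>R q y)) = ennreal (K y u) * H (u *\<^sub>R y)"
    using AE_lborel_singleton[of 0]
   proof eventually_elim
    case (elim u)
    have e1: "(\<tau> * u) *\<^sub>R q y = u *\<^sub>R y" using y_eq_q[OF y] unfolding \<tau>_def by (metis mult.commute scaleR_scaleR)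
    have "\<tau> * pw y (\<tau> * u) = K y u"
    proof -
     have a: "(0 \<le> \<tau> * u \<and> \<tau> * u \<le> 1) \<longleftrightarrow> (0 < u \<and> u * norm y \<le> rad y)"
      using t elim rad_pos[OF y] by (auto simp: \<tau>_def field_simps zero_le_mult_iff)
     have "\<tau> * (real ?N * (\<tau> * u) ^ (?N - 1) * rad y ^ ?N) = real ?N * u ^ (?N - 1) * ((\<tau> ^ (?N - 1) * \<tau>) * rad y ^ ?N)"
      by (simp add: power_mult_distrib mult_ac)
     also have "\<tau> ^ (?N - 1) * \<tau> = \<tau> ^ ?N" by (rule power_minus_mult) simp
     also have "\<tau> ^ ?N * rad y ^ ?N = norm y ^ ?N"
      using rad_pos[OF y] by (simp add: \<tau>_def power_mult_distrib[symmetric])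
     finally have b: "\<tau> * (real ?N * (\<tau> * u) ^ (?N - 1) * rad y ^ ?N) = real ?N * u ^ (?N - 1) * norm y ^ ?N" .
     show ?thesis using a b y unfolding pw_def K_def by auto
    qed
    then show ?case using t pw_nonneg by (simp add: e1 mult.assoc[symmetric] ennreal_mult[symmetric])
   qed
  qed
  finally show ?thesis .
 qed
 have "(\<integral>\<^sup>+y. \<integral>\<^sup>+s. ennreal (pw y s) * H (s *\<^sub>R q y) \<partial>lborel \<partial>lborel) = (\<integral>\<^sup>+y. \<integral>\<^sup>+u. ennreal (K y u) * H (u *\<^sub>R y) \<partial>lborel \<partial>lborel)"
  by (rule nn_integral_cong_AE) (use AE_lborel_singleton[of 0] in eventually_elim, use inner in auto)
 also have "\<dots> = (\<integral>\<^sup>+u. \<integral>\<^sup>+y. ennreal (K y u) * H (u *\<^sub>R y) \<partial>lborel \<partial>lborel)"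
  by (rule lborel_pair.Fubini'[symmetric]) measurable
 also have "\<dots> = (\<integral>\<^sup>+u. \<integral>\<^sup>+x. ennreal (indicator {0<..<u} (norm x) * indicator D x * (real ?N / u ^ Suc ?N * norm x ^ ?N)) * H x \<partial>lborel \<partial>lborel)"
 proof (rule nn_integral_cong)
  fix u :: real
  show "(\<integral>\<^sup>+y. ennreal (K y u) * H (u *\<^sub>R y) \<partial>lborel) =
    (\<integral>\<^sup>+x. ennreal (indicator {0<..<u} (norm x) * indicator D x * (real ?N / u ^ Suc ?N * norm x ^ ?N)) * H x \<partial>lborel)"
  proof (cases "u > 0")
   case False
   then have "K y u = 0" for y by (simp add: K_def)
   moreover have "indicator {0<..<u} (norm x) = (0::real)" for x :: "real^'n" using False
    by (auto simp: indicator_def)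
   ultimately show ?thesis by simp
  next
   case True
   let ?G = "\<lambda>x::real^'n. ennreal (indicator {0<..<u} (norm x) * indicator D x * (real ?N * u ^ (?N - 1) * (norm x / u) ^ ?N)) * H x"
   have "ennreal (K y u) * H (u *\<^sub>R y) = ?G (u *\<^sub>R y)" for y
   proof -
    have "K y u = indicator {0<..<u} (norm (u *\<^sub>R y)) * indicator D (u *\<^sub>R y) * (real ?N * u ^ (?N - 1) * (norm (u *\<^sub>R y) / u) ^ ?N)"
    proof (cases "y = 0")
     case False
     then have "u *\<^sub>R y \<noteq> 0" using True by simp
     then have "u *\<^sub>R y \<in> D \<longleftrightarrow> u * norm y \<le> rad y"
      using mem_body[of "u *\<^sub>R y"] rad_scale[OF True] True by simp
     moreover have "norm (u *\<^sub>R y) \<in> {0<..<u} \<longleftrightarrow> norm y < 1"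
      using True False by auto
     ultimately show ?thesis using True False by (simp add: K_def indicator_def)
    qed (simp add: K_def)
    then show ?thesis by simp
   qed
   then have "(\<integral>\<^sup>+y. ennreal (K y u) * H (u *\<^sub>R y) \<partial>lborel) = (\<integral>\<^sup>+y. ?G (u *\<^sub>R y) \<partial>lborel)" by simp
   also have "\<dots> = ennreal (1 / u ^ ?N) * (\<integral>\<^sup>+x. ?G x \<partial>lborel)"
    by (rule nn_integral_lborel_scale[OF _ True]) measurable
   also have "\<dots> = (\<integral>\<^sup>+x. ennreal (1 / u ^ ?N) * ?G x \<partial>lborel)"
    by (rule nn_integral_cmult[symmetric]) measurable
   also have "\<dots> = (\<integral>\<^sup>+x. ennreal (indicator {0<..<u} (norm x) * indicator D x * (real ?N / u ^ Suc ?N * norm x ^ ?N)) * H x \<partial>lborel)"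
   proof (rule nn_integral_cong)
    fix x :: "real^'n"
    obtain k where k: "?N = Suc k" using N0 gr0_implies_Suc by blast
    have "1 / u ^ ?N * (real ?N * u ^ (?N - 1) * (norm x / u) ^ ?N) = real ?N / u ^ Suc ?N * norm x ^ ?N"
     using True unfolding k by (simp add: field_simps)
    then have "1 / u ^ ?N * (indicator {0<..<u} (norm x) * indicator D x * (real ?N * u ^ (?N - 1) * (norm x / u) ^ ?N))
      = indicator {0<..<u} (norm x) * indicator D x * (real ?N / u ^ Suc ?N * norm x ^ ?N)"
     by (simp only: mult.left_commute[of "1 / u ^ ?N"])
    then show "ennreal (1 / u ^ ?N) * ?G x = ennreal (indicator {0<..<u} (norm x) * indicator D x * (real ?N / u ^ Suc ?N * norm x ^ ?N)) * H x"
     using True by (simp add: mult.assoc[symmetric] ennreal_mult'[symmetric])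
   qed
   finally show ?thesis .
  qed
 qed
 also have "\<dots> = (\<integral>\<^sup>+x. \<integral>\<^sup>+u. ennreal (indicator {0<..<u} (norm x) * indicator D x * (real ?N / u ^ Suc ?N * norm x ^ ?N)) * H x \<partial>lborel \<partial>lborel)"
 proof (rule lborel_pair.Fubini')
  show "(\<lambda>(x, u). ennreal (indicator {0<..<u} (norm x) * indicator D x * (real ?N / u ^ Suc ?N * norm x ^ ?N)) * H x) \<in> borel_measurable (lborel \<Otimes>\<^sub>M lborel)"
   unfolding case_prod_unfold indicator_def greaterThanLessThan_iff by measurable
 qed
 also have "\<dots> = (\<integral>\<^sup>+x. indicator D x * H x \<partial>lborel)"
 proof (rule nn_integral_cong_AE)
  show "AE x in lborel. (\<integral>\<^sup>+u. ennreal (indicator {0<..<u} (norm x) * indicator D x * (real ?N / u ^ Suc ?N * norm x ^ ?N)) * H x \<partial>lborel) = indicator D x * H x"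
   using AE_lborel_singleton[of 0]
  proof eventually_elim
   case (elim x)
   have n0: "norm x > 0" using elim by simp
   have "ennreal (indicator {0<..<u} (norm x) * indicator D x * (real ?N / u ^ Suc ?N * norm x ^ ?N)) * H x
     = (ennreal (norm x ^ ?N) * indicator D x * H x) * (ennreal (real ?N / u ^ Suc ?N) * indicator {norm x<..} u)" for u
    using n0 by (auto simp: indicator_def ennreal_mult'[symmetric] mult_ac ennreal_mult''[symmetric])
   then have "(\<integral>\<^sup>+u. ennreal (indicator {0<..<u} (norm x) * indicator D x * (real ?N / u ^ Suc ?N * norm x ^ ?N)) * H x \<partial>lborel)
    = (ennreal (norm x ^ ?N) * indicator D x * H x) * (\<integral>\<^sup>+u. ennreal (real ?N / u ^ Suc ?N) * indicator {norm x<..} u \<partial>lborel)"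
    by (simp add: nn_integral_cmult)
   also have "\<dots> = (ennreal (norm x ^ ?N) * ennreal (1 / norm x ^ ?N)) * (indicator D x * H x)"
    unfolding nn_integral_inverse_power[OF n0 N0] by (simp add: mult_ac)
   also have "ennreal (norm x ^ ?N) * ennreal (1 / norm x ^ ?N) = 1"
    using n0 by (simp add: ennreal_mult[symmetric])
   finally show ?case by simp
  qed
 qed
 finally show ?thesis .
qed

text \<open>Stated as an equality of measures, so that integrability and integrals of signed
  functions transfer at once.\<close>

lemma polar_distr:
 "distr (density (lborel \<Otimes>\<^sub>M lborel) (\<lambda>x. ennreal (pw (fst x) (snd x)))) borel (\<lambda>x. snd x *\<^sub>R q (fst x)) = uniform_on D"
proof (rule measure_eqI)
 fix A assume "A \<in> sets (distr (density (lborel \<Otimes>\<^sub>M lborel) (\<lambda>x. ennreal (pw (fst x) (snd x)))) borel (\<lambda>x. snd x *\<^sub>R q (fst x)))"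
 then have A[measurable]: "A \<in> sets borel" by simp
 have "emeasure (distr (density (lborel \<Otimes>\<^sub>M lborel) (\<lambda>x. ennreal (pw (fst x) (snd x)))) borel (\<lambda>x. snd x *\<^sub>R q (fst x))) A
  = (\<integral>\<^sup>+z. indicator A z \<partial>distr (density (lborel \<Otimes>\<^sub>M lborel) (\<lambda>x. ennreal (pw (fst x) (snd x)))) borel (\<lambda>x. snd x *\<^sub>R q (fst x)))"
  by simp
 also have "\<dots> = (\<integral>\<^sup>+x. ennreal (pw (fst x) (snd x)) * indicator A (snd x *\<^sub>R q (fst x)) \<partial>(lborel \<Otimes>\<^sub>M lborel))"
  by (subst nn_integral_distr) (simp_all add: nn_integral_density)
 also have "\<dots> = (\<integral>\<^sup>+y. \<integral>\<^sup>+s. ennreal (pw y s) * indicator A (s *\<^sub>R q y) \<partial>lborel \<partial>lborel)"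
  using lborel.nn_integral_fst[of "\<lambda>x. ennreal (pw (fst x) (snd x)) * indicator A (snd x *\<^sub>R q (fst x))" lborel] by simp
 also have "\<dots> = (\<integral>\<^sup>+x. indicator D x * indicator A x \<partial>lborel)" by (rule polar_nn_integral) measurable
 also have "\<dots> = emeasure (uniform_on D) A"
  by (simp add: uniform_on_def emeasure_density ennreal_indicator)
 finally show "emeasure (distr (density (lborel \<Otimes>\<^sub>M lborel) (\<lambda>x. ennreal (pw (fst x) (snd x)))) borel (\<lambda>x. snd x *\<^sub>R q (fst x))) A = emeasure (uniform_on D) A" .
qed simp

lemma polar_integral:
 fixes H :: "real^'n \<Rightarrow> real"
 assumes [measurable]: "H \<in> borel_measurable borel" and H: "integrable (uniform_on D) H"
 shows "(LINT x|uniform_on D. H x) = (LINT y|lborel. LINT s|lborel. pw y s * H (s *\<^sub>R q y))"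
  and "integrable (lborel \<Otimes>\<^sub>M lborel) (\<lambda>x. pw (fst x) (snd x) * H (snd x *\<^sub>R q (fst x)))"
proof -
 let ?P = "density (lborel \<Otimes>\<^sub>M lborel) (\<lambda>x. ennreal (pw (fst x) (snd x)))"
 let ?\<Phi> = "\<lambda>x. snd x *\<^sub>R q (fst x)"
 have "integrable ?P (\<lambda>x. H (?\<Phi> x))"
  using H unfolding polar_distr[symmetric] by (subst (asm) integrable_distr_eq) auto
 then show i: "integrable (lborel \<Otimes>\<^sub>M lborel) (\<lambda>x. pw (fst x) (snd x) * H (?\<Phi> x))"
  by (subst (asm) integrable_real_density) (auto simp: pw_nonneg)
 have "(LINT x|uniform_on D. H x) = (LINT x|?P. H (?\<Phi> x))"
  unfolding polar_distr[symmetric] by (subst integral_distr) auto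
 also have "\<dots> = (LINT x|(lborel \<Otimes>\<^sub>M lborel). pw (fst x) (snd x) * H (?\<Phi> x))"
  by (subst integral_real_density) (auto simp: pw_nonneg)
 also have "\<dots> = (LINT y|lborel. LINT s|lborel. pw y s * H (s *\<^sub>R q y))"
  using lborel_pair.integral_fst'[OF i] by simp
 finally show "(LINT x|uniform_on D. H x) = (LINT y|lborel. LINT s|lborel. pw y s * H (s *\<^sub>R q y))" .
qed

end

section \<open>Local structure of the boundary\<close>

text \<open>\<open>UC\<close> only asserts that some gradient is controlled; uniqueness of the
  derivative identifies it with the given one.\<close>

lemma UC_gradient:
 assumes "UC (Suc k) {()} S (\<lambda>_. F)" "open S" "\<And>x. x \<in> S \<Longrightarrow> (F has_derivative (\<lambda>v. G x \<bullet> v)) (at x)"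
 shows "UC k {()} S (\<lambda>_ x. G x $ i)"
proof -
 obtain E where E: "\<And>w x. w \<in> {()} \<Longrightarrow> x \<in> S \<Longrightarrow> (F has_derivative (\<lambda>v. E w x \<bullet> v)) (at x)"
  "\<And>i. UC k {()} S (\<lambda>w x. E w x $ i)" by (rule UC_SucE[OF assms(1)]) blast
 show ?thesis
 proof (rule UC_cong[OF E(2) assms(2)])
  fix w x assume "w \<in> {()}" "x \<in> S"
  from has_derivative_unique[OF E(1)[OF this] assms(3)[OF this(2)]]
  have "E w x \<bullet> axis i 1 = G x \<bullet> axis i 1" by metis
  then show "E w x $ i = G x $ i" by (simp add: inner_axis)
 qed
qed

locale analytic_body = star_body m for m :: "real^'n \<Rightarrow> real" +
 assumes card2: "CARD('n) \<ge> 2"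
  and convex_body: "convex D"
  and analytic: "real_analytic_hypersurface (frontier D)"
begin

lemma frontier_AE: "AE x in lborel. x \<notin> frontier D"
proof -
 have "negligible (frontier D)" by (rule negligible_convex_frontier[OF convex_body])
 then have "frontier D \<in> null_sets lebesgue" by (simp add: negligible_iff_null_sets)
 then have "frontier D \<in> null_sets lborel"
  by (subst (asm) null_sets_completion_iff) auto
 then show ?thesis by (rule AE_not_in)
qed

text \<open>Otherwise the tangent plane at \<open>p\<close> contains the origin. Moving slightly
  from \<open>p\<close> towards the interior points b and -b, chosen along the gradient, makes
  \<open>F\<close> positive and negative respectively; in between it vanishes at a frontier point.
  By convexity all points in between are interior.\<close>

lemma frontier_chart_transversal:
 fixes F :: "real^'n \<Rightarrow> real"
 assumes p: "p \<in> frontier D" and r: "r > 0"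
  and FG: "\<And>x. x \<in> ball p r \<Longrightarrow> (F has_derivative (\<lambda>v. G x \<bullet> v)) (at x)"
  and G0: "G p \<noteq> 0" and z: "\<And>x. x \<in> ball p r \<Longrightarrow> x \<in> frontier D \<longleftrightarrow> F x = 0"
 shows "G p \<bullet> p \<noteq> 0"
proof
 assume Gp: "G p \<bullet> p = 0"
 obtain r0 where r0: "r0 > 0" "cball 0 r0 \<subseteq> D" by (rule ball_in_body)
 \<comment> \<open>Along the gradient, and short enough that every multiple
   \<open>l *\<^sub>R b\<close> with |l| at most 1 is interior.\<close>
 define b where "b = (r0 / 2 / norm (G p)) *\<^sub>R G p"
 have nb: "norm b = r0 / 2" using G0 r0 by (simp add: b_def)
 have Gb: "G p \<bullet> b > 0" using G0 r0 by (simp add: b_def)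
 have int: "c \<in> interior D" if "norm c < r0" for c
 proof -
  have "ball 0 r0 \<subseteq> D" using r0 by (auto simp: subset_iff)
  then show ?thesis using that interiorI[of "ball 0 r0" c D] by auto
 qed
 have Fp: "F p = 0" using z[of p] p r by simp
 have ex: "\<exists>d>0. \<forall>t. 0 < t \<and> t < d \<longrightarrow> \<sigma> * F (p + t *\<^sub>R (\<sigma> *\<^sub>R b - p)) > 0" if s: "\<sigma> = 1 \<or> \<sigma> = -1" for \<sigma> :: real
 proof -
  have 1: "((\<lambda>t. p + t *\<^sub>R (\<sigma> *\<^sub>R b - p)) has_derivative (\<lambda>t. t *\<^sub>R (\<sigma> *\<^sub>R b - p))) (at 0)"
   by (auto intro!: derivative_eq_intros)
  have "((\<lambda>t. F (p + t *\<^sub>R (\<sigma> *\<^sub>R b - p))) has_derivative (\<lambda>t. G p \<bullet> (t *\<^sub>R (\<sigma> *\<^sub>R b - p)))) (at 0)"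
   by (rule has_derivative_compose[OF 1]) (use FG[of p] r in simp)
  then have "((\<lambda>t. \<sigma> * F (p + t *\<^sub>R (\<sigma> *\<^sub>R b - p))) has_derivative (\<lambda>t. \<sigma> * (G p \<bullet> (t *\<^sub>R (\<sigma> *\<^sub>R b - p))))) (at 0)"
   by (rule has_derivative_mult_right)
  then have "((\<lambda>t. \<sigma> * F (p + t *\<^sub>R (\<sigma> *\<^sub>R b - p))) has_real_derivative (G p \<bullet> b)) (at 0)"
   unfolding has_field_derivative_def
   by (rule has_derivative_eq_rhs) (use s Gp in \<open>auto simp: inner_diff_right algebra_simps\<close>)
  from DERIV_pos_inc_right[OF this Gb] show ?thesis using Fp by auto
 qed
 obtain d1 where d1: "d1 > 0" "\<And>t. 0 < t \<Longrightarrow> t < d1 \<Longrightarrow> F (p + t *\<^sub>R (b - p)) > 0" using ex[of 1] by auto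
 obtain d2 where d2: "d2 > 0" "\<And>t. 0 < t \<Longrightarrow> t < d2 \<Longrightarrow> F (p + t *\<^sub>R (- b - p)) < 0" using ex[of "-1"] by auto
 \<comment> \<open>Small enough for both sign statements, below 1 so that convexity applies, and
   such that the whole segment stays in the chart.\<close>
 define t where "t = min (min (d1 / 2) (d2 / 2)) (min (1/2) (r / (2 * (norm b + norm p + 1))))"
 have t: "0 < t" "t < d1" "t < d2" "t < 1" "t \<le> r / (2 * (norm b + norm p + 1))"
  using d1(1) d2(1) r by (auto simp: t_def add_nonneg_pos)
 have near: "p + t *\<^sub>R (l *\<^sub>R b - p) \<in> ball p r" if "\<bar>l\<bar> \<le> 1" for l
 proof -
  have "norm (l *\<^sub>R b - p) \<le> norm b + norm p"
   using norm_triangle_ineq4[of "l *\<^sub>R b" p] mult_right_mono[OF that norm_ge_zero[of b]] by simp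
  then have "t * norm (l *\<^sub>R b - p) \<le> r / (2 * (norm b + norm p + 1)) * (norm b + norm p + 1)"
   using t by (intro mult_mono) auto
  also have "\<dots> = r / 2" 
  proof -
   have "norm b + norm p + 1 > 0" using norm_ge_zero[of b] norm_ge_zero[of p] by linarith
   moreover have "r / (2 * s) * s = r / 2" if "s > 0" for s :: real using that by simp
   ultimately show ?thesis by blast
  qed
  finally show ?thesis using r t(1) by (simp add: dist_norm)
 qed
 let ?g = "\<lambda>l. F (p + t *\<^sub>R (l *\<^sub>R b - p))"
 have Fc: "continuous_on (ball p r) F"
  by (intro continuous_at_imp_continuous_on ballI) (rule has_derivative_continuous[OF FG])
 have "continuous_on {-1..1} ?g"
  by (rule continuous_on_compose2[OF Fc]) (use near in \<open>auto intro!: continuous_intros simp: abs_le_iff\<close>)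
 moreover have "?g (-1) \<le> 0" "?g 1 \<ge> 0" using d1(2)[OF t(1,2)] d2(2)[OF t(1,3)] by auto
 ultimately obtain l where l: "-1 \<le> l" "l \<le> 1" "?g l = 0" using IVT'[of ?g "-1" 0 1] by auto
 let ?x = "p + t *\<^sub>R (l *\<^sub>R b - p)"
 have "?x \<in> frontier D" using z[OF near] l by (auto simp: abs_le_iff)
 moreover have "?x \<in> interior D"
 proof -
  have "norm (l *\<^sub>R b) < r0"
  proof -
   have "\<bar>l\<bar> * norm b \<le> 1 * norm b" using l by (intro mult_right_mono) auto
   then show ?thesis unfolding norm_scaleR using nb r0(1) by linarith
  qed
  then have "l *\<^sub>R b \<in> interior D" by (rule int)
  then have "p - t *\<^sub>R (p - l *\<^sub>R b) \<in> interior D"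
   using frontier_body_D(4)[OF p] t by (intro mem_interior_convex_shrink[OF convex_body]) auto
  then show ?thesis by (simp add: algebra_simps)
 qed
 ultimately show False by (simp add: frontier_def)
qed

text \<open>Transversality allows the sign of \<open>F\<close> to be chosen so that \<open>F\<close>
  increases along rays near \<open>p\<close>. On each such ray it vanishes at \<open>q x\<close>, so
  its sign tells inside from outside; the frontier itself is a null set, whence the statement almost
  everywhere.\<close>

lemma frontier_chart:
 assumes p: "p \<in> frontier D"
 obtains F G H r where "r > 0"
  "\<And>k. UC k {()} (ball p r) (\<lambda>_. F)" "\<And>k i. UC k {()} (ball p r) (\<lambda>_ x. G x $ i)"
  "\<And>k i j. UC k {()} (ball p r) (\<lambda>_ x. H i x $ j)"
  "\<And>x. x \<in> ball p r \<Longrightarrow> (F has_derivative (\<lambda>v. G x \<bullet> v)) (at x)"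
  "\<And>i x. x \<in> ball p r \<Longrightarrow> ((\<lambda>x. G x $ i) has_derivative (\<lambda>v. H i x \<bullet> v)) (at x)"
  "G p \<bullet> p \<noteq> 0" "\<And>x. x \<in> ball p r \<Longrightarrow> x \<in> frontier D \<Longrightarrow> F x = 0"
  "AE x in lborel. x \<in> ball p r \<longrightarrow> (x \<in> D \<longleftrightarrow> F x < 0)"
proof -
 have "\<exists>U F. p \<in> U \<and> real_analytic_on U F \<and>
    (\<forall>x\<in>U. (F has_derivative frechet_derivative F (at x)) (at x)
         \<and> frechet_derivative F (at x) \<noteq> (\<lambda>v. 0)) \<and>
    frontier D \<inter> U = {x\<in>U. F x = 0}"
  using analytic[unfolded real_analytic_hypersurface_def, THEN bspec, OF p] .
 then obtain U F0 where UF: "p \<in> U \<and> real_analytic_on U F0 \<and>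
    (\<forall>x\<in>U. (F0 has_derivative frechet_derivative F0 (at x)) (at x)
         \<and> frechet_derivative F0 (at x) \<noteq> (\<lambda>v. 0)) \<and>
    frontier D \<inter> U = {x\<in>U. F0 x = 0}" by (elim exE) (rule that)
 have U: "p \<in> U" "real_analytic_on U F0"
  "\<And>x. x \<in> U \<Longrightarrow> (F0 has_derivative frechet_derivative F0 (at x)) (at x) \<and> frechet_derivative F0 (at x) \<noteq> (\<lambda>v. 0)"
  "frontier D \<inter> U = {x\<in>U. F0 x = 0}"
  using UF by auto
 obtain r0 where r0: "r0 > 0" "ball p r0 \<subseteq> U" "\<And>k. UC k {()} (ball p r0) (\<lambda>_. F0)"
  by (rule real_analytic_UC[OF U(2,1), where W="{()}"]) (rule that)
 obtain G0' where G0': "\<And>w x. w \<in> {()} \<Longrightarrow> x \<in> ball p r0 \<Longrightarrow> (F0 has_derivative (\<lambda>v. G0' w x \<bullet> v)) (at x)"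
  by (rule UC_SucE[OF r0(3)[of "Suc 0"]]) blast
 define G0 where "G0 = G0' ()"
 have FG0: "(F0 has_derivative (\<lambda>v. G0 x \<bullet> v)) (at x)" if "x \<in> ball p r0" for x using G0'[of "()" x] that by (simp add: G0_def)
 have G0p: "G0 p \<noteq> 0"
 proof
  assume "G0 p = 0"
  then have "(F0 has_derivative (\<lambda>v. 0)) (at p)" using FG0[of p] r0 by simp
  then show False using U(3)[OF U(1)] has_derivative_unique by blast
 qed
 have zero: "x \<in> frontier D \<longleftrightarrow> F0 x = 0" if "x \<in> ball p r0" for x using U(4) r0(2) that by blast
 have tr: "G0 p \<bullet> p \<noteq> 0" by (rule frontier_chart_transversal[OF p r0(1) FG0 G0p zero])
 define \<sigma> where "\<sigma> = sgn (G0 p \<bullet> p)"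
 have \<sigma>: "\<sigma> * \<sigma> = 1" using tr by (simp add: \<sigma>_def sgn_if)
 define F where "F = (\<lambda>x. \<sigma> * F0 x)"
 define G where "G = (\<lambda>x. \<sigma> *\<^sub>R G0 x)"
 have FU: "UC k {()} (ball p r0) (\<lambda>_. F)" for k unfolding F_def by (rule UC_cmult[OF r0(3)])
 have FG: "(F has_derivative (\<lambda>v. G x \<bullet> v)) (at x)" if "x \<in> ball p r0" for x
  unfolding F_def G_def inner_scaleR_left by (rule has_derivative_mult_right[OF FG0[OF that]])
 have GU: "UC k {()} (ball p r0) (\<lambda>_ x. G x $ i)" for k i by (rule UC_gradient[OF FU _ FG]) auto
 have "\<exists>E. \<forall>x\<in>ball p r0. ((\<lambda>x. G x $ i) has_derivative (\<lambda>v. E x \<bullet> v)) (at x)" for i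
 proof -
  obtain E where "\<And>w x. w \<in> {()} \<Longrightarrow> x \<in> ball p r0 \<Longrightarrow> ((\<lambda>x. G x $ i) has_derivative (\<lambda>v. E w x \<bullet> v)) (at x)"
   by (rule UC_SucE[OF GU[of "Suc 0" i]]) blast
  then show ?thesis by blast
 qed
 then obtain H where GH: "\<And>i x. x \<in> ball p r0 \<Longrightarrow> ((\<lambda>x. G x $ i) has_derivative (\<lambda>v. H i x \<bullet> v)) (at x)" by metis
 have HU: "UC k {()} (ball p r0) (\<lambda>_ x. H i x $ j)" for k i j by (rule UC_gradient[OF GU _ GH]) auto
 have Gp: "G p \<bullet> p > 0" using tr by (simp add: G_def \<sigma>_def sgn_if)
 have zF: "x \<in> frontier D \<longleftrightarrow> F x = 0" if "x \<in> ball p r0" for x using zero[OF that] \<sigma> by (auto simp: F_def)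
 have "continuous_on (ball p r0) (\<lambda>x. \<chi> i. G x $ i)"
  using UC_continuous[OF GU[of 0], of "()"] by (intro continuous_on_vec_lambda) auto
 then have "continuous_on (ball p r0) (\<lambda>x. G x \<bullet> x)" by (intro continuous_intros) simp
 then have "isCont (\<lambda>x. G x \<bullet> x) p" using r0 by (simp add: continuous_on_eq_continuous_at)
 then have "\<forall>\<^sub>F x in nhds p. G x \<bullet> x > 0" using Gp
  by (simp add: isCont_def eventually_nhds_conv_at order_tendstoD)
 then obtain r1' where r1': "r1' > 0" "\<And>x. dist x p < r1' \<Longrightarrow> G x \<bullet> x > 0" unfolding eventually_nhds_metric by blast
 define r1 where "r1 = min r0 r1'"
 have r1: "r1 > 0" "ball p r1 \<subseteq> ball p r0" "\<And>x. x \<in> ball p r1 \<Longrightarrow> G x \<bullet> x > 0"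
  using r0 r1' by (auto simp: r1_def dist_commute)
 have p0: "p \<noteq> 0" using frontier_body_D[OF p] by simp
 have "isCont q p" using q_cont p0 continuous_on_eq_continuous_at[of "- {0}" q] by auto
 then have "\<forall>\<^sub>F x in nhds p. dist (q x) (q p) < r1" using r1(1)
  by (simp add: isCont_def eventually_nhds_conv_at tendstoD)
 then obtain r2' where r2': "r2' > 0" "\<And>x. dist x p < r2' \<Longrightarrow> dist (q x) p < r1"
  unfolding eventually_nhds_metric frontier_body_D(3)[OF p] by blast
 \<comment> \<open>Both \<open>x\<close> and \<open>q x\<close> must lie where \<open>F\<close>
   increases along rays, and \<open>x\<close> must stay away from the origin.\<close>
 define r where "r = min (min r1 r2') (norm p)"
 have r: "r > 0" "ball p r \<subseteq> ball p r1" "ball p r \<subseteq> ball p r0" using r1 r2' p0 by (auto simp: r_def)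
 have nz: "x \<noteq> 0" if "x \<in> ball p r" for x using that by (auto simp: r_def)
 have qb: "q x \<in> ball p r1" if "x \<in> ball p r" for x using r2'(2)[of x] that by (auto simp: r_def dist_commute)
 have inc: "F (a *\<^sub>R x) < F (b *\<^sub>R x)" if ab: "0 < a" "a < b" and e: "a *\<^sub>R x \<in> ball p r1" "b *\<^sub>R x \<in> ball p r1" for a b x
 proof (rule DERIV_pos_imp_increasing[OF ab(2)])
  fix t assume t: "a \<le> t" "t \<le> b"
  have tx: "t *\<^sub>R x \<in> ball p r1"
  proof -
   define u where "u = (t - a) / (b - a)"
   have u: "0 \<le> u" "u \<le> 1" using t ab by (auto simp: u_def)
   have "u * (b - a) = t - a" using ab by (simp add: u_def)
   then have "t = (1 - u) * a + u * b" by (simp add: algebra_simps)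
   then have "t *\<^sub>R x = (1 - u) *\<^sub>R (a *\<^sub>R x) + u *\<^sub>R (b *\<^sub>R x)" by (simp add: scaleR_add_left)
   then show ?thesis using convexD_alt[OF convex_ball e, of u] u by simp
  qed
  have 1: "((\<lambda>t. t *\<^sub>R x) has_derivative (\<lambda>s. s *\<^sub>R x)) (at t)" by (auto intro!: derivative_eq_intros)
  have "((\<lambda>t. F (t *\<^sub>R x)) has_derivative (\<lambda>s. G (t *\<^sub>R x) \<bullet> (s *\<^sub>R x))) (at t)"
   by (rule has_derivative_compose[OF 1 FG]) (use tx r1 in auto)
  then have "((\<lambda>t. F (t *\<^sub>R x)) has_real_derivative (G (t *\<^sub>R x) \<bullet> x)) (at t)"
   unfolding has_field_derivative_def by (rule has_derivative_eq_rhs) (auto simp: mult.commute)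
  moreover have "G (t *\<^sub>R x) \<bullet> x > 0"
   using r1(3)[OF tx] t ab by (simp add: zero_less_mult_iff)
  ultimately show "\<exists>y. ((\<lambda>t. F (t *\<^sub>R x)) has_real_derivative y) (at t) \<and> 0 < y" by blast
 qed
 have side: "norm x < rad x \<longleftrightarrow> F x < 0" if x: "x \<in> ball p r" for x
 proof -
  have x0: "x \<noteq> 0" using nz[OF x] .
  define c where "c = rad x / norm x"
  have c: "c > 0" "q x = c *\<^sub>R x" using rad_pos[OF x0] x0 by (auto simp: c_def q_def)
  have Fq: "F (c *\<^sub>R x) = 0" using zF[of "q x"] qb[OF x] r1(2) q_frontier[OF x0] c by auto
  have b: "1 *\<^sub>R x \<in> ball p r1" "c *\<^sub>R x \<in> ball p r1" using x r(2) qb[OF x] c by auto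
  consider "c > 1" | "c = 1" | "c < 1" by linarith
  then show ?thesis
  proof cases
   case 1
   then have "F x < 0" using inc[of 1 c x] b Fq by simp
   moreover have "norm x < rad x" using 1 x0 by (simp add: c_def)
   ultimately show ?thesis by simp
  next
   case 2
   then have "F x = 0" using Fq by simp
   moreover have "norm x = rad x" using 2 x0 by (simp add: c_def)
   ultimately have "F x = 0" "norm x = rad x" by auto
   then show ?thesis by simp
  next
   case 3
   then have "F x > 0" using inc[of c 1 x] b Fq c by simp
   moreover have "\<not> norm x < rad x" using 3 x0 by (simp add: c_def)
   ultimately show ?thesis by simp
  qed
 qed
 have "AE x in lborel. x \<in> ball p r \<longrightarrow> (x \<in> D \<longleftrightarrow> F x < 0)"
  using frontier_AE
 proof eventually_elim
  case (elim x)
  show ?case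
  proof
   assume x: "x \<in> ball p r"
   have "norm x \<noteq> rad x"
   proof
    assume "norm x = rad x"
    then have "q x = x" using rad_pos[OF nz[OF x]] by (simp add: q_def)
    then show False using q_frontier[OF nz[OF x]] elim by simp
   qed
   then show "x \<in> D \<longleftrightarrow> F x < 0" using side[OF x] mem_body[OF nz[OF x]] by linarith
  qed
 qed
 moreover have "UC k {()} (ball p r) g" if "UC k {()} (ball p r0) g" for k g using UC_subset[OF that] r(3) by blast
 ultimately show ?thesis
  using r FU GU HU FG GH Gp zF by (intro that[of r F G H]) auto
qed

end

subsection \<open>Bounded kernels\<close>

lemma integrable_bounded_finite:
 fixes f :: "'a \<Rightarrow> real"
 assumes "finite_measure M" "f \<in> borel_measurable M" "\<And>x. \<bar>f x\<bar> \<le> B"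
 shows "integrable M f"
 using assms by (intro finite_measure.integrable_const_bound[where B=B]) auto

lemma Fubini_bounded:
 fixes f :: "'a \<Rightarrow> 'b \<Rightarrow> real"
 assumes "finite_measure M" "finite_measure N" "(\<lambda>x. f (fst x) (snd x)) \<in> borel_measurable (M \<Otimes>\<^sub>M N)" "\<And>x y. \<bar>f x y\<bar> \<le> B"
 shows "(LINT x|M. LINT y|N. f x y) = (LINT y|N. LINT x|M. f x y)"
  and "(LINT x|(M \<Otimes>\<^sub>M N). f (fst x) (snd x)) = (LINT x|M. LINT y|N. f x y)"
proof -
 interpret M: finite_measure M by fact
 interpret N: finite_measure N by fact
 interpret P: pair_sigma_finite M N by unfold_locales
 have fin: "finite_measure (M \<Otimes>\<^sub>M N)"
  using finite_measure_pair_measure[OF assms(2,1)] .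
 have i: "integrable (M \<Otimes>\<^sub>M N) (\<lambda>x. f (fst x) (snd x))" by (rule integrable_bounded_finite[OF fin assms(3)]) (rule assms(4))
 then show "(LINT x|M. LINT y|N. f x y) = (LINT y|N. LINT x|M. f x y)"
  using P.Fubini_integral[of f] by (simp add: case_prod_unfold)
 show "(LINT x|(M \<Otimes>\<^sub>M N). f (fst x) (snd x)) = (LINT x|M. LINT y|N. f x y)"
  using P.integral_fst'[OF i] by simp
qed

text \<open>Nonnegativity of the variance.\<close>

lemma square_integral_le:
 fixes f :: "'a \<Rightarrow> real"
 assumes "prob_space M" "f \<in> borel_measurable M" "\<And>x. \<bar>f x\<bar> \<le> B"
 shows "(LINT x|M. f x)\<^sup>2 \<le> (LINT x|M. (f x)\<^sup>2)"
proof -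
 interpret prob_space M by fact
 have fin: "finite_measure M" by unfold_locales
 have i: "integrable M f" by (rule integrable_bounded_finite[OF fin assms(2,3)])
 have "\<bar>(f x)\<^sup>2\<bar> \<le> B\<^sup>2" for x using power_mono[OF assms(3)[of x], of 2] by simp
 then have i2: "integrable M (\<lambda>x. (f x)\<^sup>2)" by (intro integrable_bounded_finite[OF fin, where B="B\<^sup>2"]) (use assms in auto)
 have "0 \<le> variance f" by simp
 then show ?thesis using variance_eq[OF i i2] by simp
qed

text \<open>Adding the square of the corresponding sine integral makes the common phase
  \<open>ph\<close> disappear: the sum is a double integral with cos(P - P'). Exchanging the
  integrals exposes the kernel, an integral over \<open>Om\<close> alone. As the amplitudes are
  bounded, the integral of the kernel bound suffices and no operator norm is involved.\<close>

lemma TT_star: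
 fixes A P :: "'w \<Rightarrow> 'y \<Rightarrow> real" and K :: "'y \<Rightarrow> 'y \<Rightarrow> real"
 assumes Om: "finite_measure Om" and Y: "finite_measure Y"
  and A[measurable]: "(\<lambda>x. A (fst x) (snd x)) \<in> borel_measurable (Om \<Otimes>\<^sub>M Y)" and Ab: "\<And>om y. \<bar>A om y\<bar> \<le> B"
  and P[measurable]: "(\<lambda>x. P (fst x) (snd x)) \<in> borel_measurable (Om \<Otimes>\<^sub>M Y)"
  and K[measurable]: "(\<lambda>x. K (fst x) (snd x)) \<in> borel_measurable (Y \<Otimes>\<^sub>M Y)" and Kb: "\<And>y y'. \<bar>K y y'\<bar> \<le> B'"
  and ker: "\<And>y y'. y \<in> space Y \<Longrightarrow> y' \<in> space Y \<Longrightarrow> \<bar>LINT om|Om. A om y * A om y' * cos (P om y - P om y')\<bar> \<le> K y y'"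
 shows "(LINT om|Om. (LINT y|Y. A om y * cos (P om y + ph))\<^sup>2) \<le> (LINT y|Y. LINT y'|Y. K y y')"
proof -
 interpret Om: finite_measure Om by fact
 interpret Y: finite_measure Y by fact
 have YY: "finite_measure (Y \<Otimes>\<^sub>M Y)" using finite_measure_pair_measure[OF Y Y] .
 define C where "C = (\<lambda>om. LINT y|Y. A om y * cos (P om y + ph))"
 define S where "S = (\<lambda>om. LINT y|Y. A om y * sin (P om y + ph))"
 have B0: "B \<ge> 0" using Ab order_trans[OF abs_ge_zero] by blast
 have bd: "\<bar>a * t\<bar> \<le> B" if "\<bar>a\<bar> \<le> B" "\<bar>t\<bar> \<le> 1" for a t :: real
  using mult_mono[OF that] B0 by (simp add: abs_mult)
 have mA: "(\<lambda>y. A om y) \<in> borel_measurable Y" and mP: "(\<lambda>y. P om y) \<in> borel_measurable Y" if "om \<in> space Om" for om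
  using measurable_compose[OF measurable_Pair1'[OF that] A] measurable_compose[OF measurable_Pair1'[OF that] P] by simp_all
 have mC: "C \<in> borel_measurable Om" and mS: "S \<in> borel_measurable Om"
  unfolding C_def S_def by (rule Y.borel_measurable_lebesgue_integral, simp add: case_prod_unfold)+
 \<comment> \<open>The bound is claimed for every \<open>om\<close>, also outside the space of
   \<open>Om\<close>, where measurability of the integrand is unknown; a non-integrable integrand
   has integral 0 by convention.\<close>
 have Cb: "\<bar>C om\<bar> \<le> B * measure Y (space Y)" for om
 proof -
  have "norm (C om) \<le> (LINT y|Y. B)" unfolding C_def
  proof (cases "integrable Y (\<lambda>y. A om y * cos (P om y + ph))")
   case True
   have "norm (LINT y|Y. A om y * cos (P om y + ph)) \<le> (LINT y|Y. norm (A om y * cos (P om y + ph)))" by simp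
   also have "\<dots> \<le> (LINT y|Y. B)" by (rule integral_mono) (use True bd Ab in auto)
   finally show "norm (LINT y|Y. A om y * cos (P om y + ph)) \<le> (LINT y|Y. B)" .
  qed (use B0 in \<open>simp add: not_integrable_integral_eq\<close>)
  then show ?thesis by (simp add: mult.commute)
 qed
 have Sb: "\<bar>S om\<bar> \<le> B * measure Y (space Y)" for om
 proof -
  have "norm (S om) \<le> (LINT y|Y. B)" unfolding S_def
  proof (cases "integrable Y (\<lambda>y. A om y * sin (P om y + ph))")
   case True
   have "norm (LINT y|Y. A om y * sin (P om y + ph)) \<le> (LINT y|Y. norm (A om y * sin (P om y + ph)))" by simp
   also have "\<dots> \<le> (LINT y|Y. B)" by (rule integral_mono) (use True bd Ab in auto)
   finally show "norm (LINT y|Y. A om y * sin (P om y + ph)) \<le> (LINT y|Y. B)" .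
  qed (use B0 in \<open>simp add: not_integrable_integral_eq\<close>)
  then show ?thesis by (simp add: mult.commute)
 qed
 have sq: "\<bar>x\<^sup>2\<bar> \<le> T\<^sup>2" if "\<bar>x\<bar> \<le> T" for x T :: real using power_mono[OF that, of 2] by simp
 have iC: "integrable Om (\<lambda>om. (C om)\<^sup>2)" "integrable Om (\<lambda>om. (S om)\<^sup>2)"
  by (rule integrable_bounded_finite[OF Om _ sq[OF Cb]], use mC in measurable)
    (rule integrable_bounded_finite[OF Om _ sq[OF Sb]], use mS in measurable)
 let ?f = "\<lambda>om z. A om (fst z) * A om (snd z) * cos (P om (fst z) - P om (snd z))"
 have fb: "\<bar>?f om z\<bar> \<le> B * B" for om z
 proof -
  have "\<bar>A om (snd z) * cos (P om (fst z) - P om (snd z))\<bar> \<le> B" by (rule bd[OF Ab]) simp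
  from mult_mono[OF Ab[of om "fst z"] this] B0 show ?thesis by (simp add: abs_mult mult.assoc)
 qed
 have eq: "(C om)\<^sup>2 + (S om)\<^sup>2 = (LINT z|(Y \<Otimes>\<^sub>M Y). ?f om z)" if w: "om \<in> space Om" for om
 proof -
  note [measurable] = mA[OF w] mP[OF w]
  have ic: "integrable Y (\<lambda>y. A om y * cos (P om y + ph))" "integrable Y (\<lambda>y. A om y * sin (P om y + ph))"
   by (rule integrable_bounded_finite[OF Y _ bd[OF Ab]], measurable)
     (rule integrable_bounded_finite[OF Y _ bd[OF Ab]], measurable)
  have "(LINT z|(Y \<Otimes>\<^sub>M Y). ?f om z) = (LINT y|Y. LINT y'|Y. A om y * A om y' * cos (P om y - P om y'))"
   using Fubini_bounded(2)[OF Y Y, of "\<lambda>y y'. ?f om (y, y')" "B * B"] fb[of om "(_, _)"] by simp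
  also have "\<dots> = (LINT y|Y. A om y * cos (P om y + ph) * C om + A om y * sin (P om y + ph) * S om)"
  proof (rule Bochner_Integration.integral_cong[OF refl])
   fix y
   have "A om y * A om y' * cos (P om y - P om y') = A om y * cos (P om y + ph) * (A om y' * cos (P om y' + ph)) + A om y * sin (P om y + ph) * (A om y' * sin (P om y' + ph))" for y'
    using cos_diff[of "P om y + ph" "P om y' + ph"] by (simp add: algebra_simps)
   then show "(LINT y'|Y. A om y * A om y' * cos (P om y - P om y')) = A om y * cos (P om y + ph) * C om + A om y * sin (P om y + ph) * S om"
    using ic by (simp add: C_def S_def)
  qed
  also have "\<dots> = (C om)\<^sup>2 + (S om)\<^sup>2" using ic by (simp add: C_def S_def power2_eq_square)
  finally show ?thesis by simp
 qed
 have "(LINT om|Om. (C om)\<^sup>2) \<le> (LINT om|Om. (C om)\<^sup>2 + (S om)\<^sup>2)" by (rule integral_mono) (use iC in auto)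
 also have "\<dots> = (LINT om|Om. LINT z|(Y \<Otimes>\<^sub>M Y). ?f om z)" by (rule Bochner_Integration.integral_cong[OF refl eq])
 also have "\<dots> = (LINT z|(Y \<Otimes>\<^sub>M Y). LINT om|Om. ?f om z)"
 proof (rule Fubini_bounded(1)[OF Om YY _ fb])
  have m1: "(\<lambda>x. (fst x, fst (snd x))) \<in> measurable (Om \<Otimes>\<^sub>M (Y \<Otimes>\<^sub>M Y)) (Om \<Otimes>\<^sub>M Y)"
   and m2: "(\<lambda>x. (fst x, snd (snd x))) \<in> measurable (Om \<Otimes>\<^sub>M (Y \<Otimes>\<^sub>M Y)) (Om \<Otimes>\<^sub>M Y)" by measurable
  note [measurable] = measurable_compose[OF m1 A, simplified] measurable_compose[OF m2 A, simplified]
   measurable_compose[OF m1 P, simplified] measurable_compose[OF m2 P, simplified]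
  show "(\<lambda>x. A (fst x) (fst (snd x)) * A (fst x) (snd (snd x)) * cos (P (fst x) (fst (snd x)) - P (fst x) (snd (snd x))))
    \<in> borel_measurable (Om \<Otimes>\<^sub>M (Y \<Otimes>\<^sub>M Y))" by measurable
 qed
 also have "\<dots> \<le> (LINT z|(Y \<Otimes>\<^sub>M Y). K (fst z) (snd z))"
 proof (rule integral_mono_AE')
  show "integrable (Y \<Otimes>\<^sub>M Y) (\<lambda>z. K (fst z) (snd z))" by (rule integrable_bounded_finite[OF YY K Kb])
  show "AE z in Y \<Otimes>\<^sub>M Y. (LINT om|Om. ?f om z) \<le> K (fst z) (snd z)"
   by (rule AE_I2) (auto simp: space_pair_measure intro!: abs_le_D1[OF ker])
  show "AE z in Y \<Otimes>\<^sub>M Y. 0 \<le> K (fst z) (snd z)"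
   by (rule AE_I2) (use order_trans[OF abs_ge_zero ker] in \<open>auto simp: space_pair_measure\<close>)
 qed
 also have "\<dots> = (LINT y|Y. LINT y'|Y. K y y')" by (rule Fubini_bounded(2)[OF Y Y K Kb])
 finally show ?thesis by (simp add: C_def)
qed

context star_body
begin

text \<open>These points form a thin cone around the ray through \<open>z\<close>. For small
  \<delta> it is covered by about 1/\<delta> balls of radius comparable to \<delta> placed along
  that ray, of total volume of order \<delta>^(n-1). This expresses the dimension n - 1 of the
  boundary in terms of the parameter \<open>y\<close>.\<close>

lemma cone_measure:
 obtains C where "C > 0" "\<And>z \<delta>. \<delta> > 0 \<Longrightarrow> norm z \<le> R0 \<Longrightarrow>
   emeasure lborel {y. norm y < 1 \<and> y \<noteq> 0 \<and> norm (q y - z) \<le> \<delta>} \<le> ennreal (C * \<delta> ^ (CARD('n) - 1))"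
proof -
 let ?n = "CARD('n)"
 let ?A = "\<lambda>z \<delta>. {y. norm y < 1 \<and> y \<noteq> 0 \<and> norm (q y - z) \<le> \<delta>}"
 have n0: "?n > 0" by simp
 obtain r R where r: "r > 0" "R > 0" "\<And>y. y \<noteq> 0 \<Longrightarrow> r \<le> rad y" "\<And>y. y \<noteq> 0 \<Longrightarrow> rad y \<le> R" by (rule rad_bounds) (rule that)
 \<comment> \<open>Writing y = t q(y) with t at most 1/r, the distance from y to (j \<delta>) z is
   at most t |q(y) - z| + |t - j \<delta>| |z|.\<close>
 define c1 where "c1 = 1 / r + \<bar>R0\<bar>"
 have c1: "c1 > 0" using r by (simp add: c1_def add_pos_nonneg)
 define v where "v = unit_ball_vol (real ?n)"
 have v: "v \<ge> 0" by (simp add: v_def)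
 define C where "C = (1 / r + 1) * (v * c1 ^ ?n) + v + 1"
 have "C > 0" using r v c1 by (simp add: C_def add_nonneg_pos)
 moreover have "emeasure lborel (?A z \<delta>) \<le> ennreal (C * \<delta> ^ (?n - 1))" if d: "\<delta> > 0" and z: "norm z \<le> R0" for z \<delta>
 proof (cases "\<delta> \<le> 1")
  case True
  define J where "J = nat \<lfloor>1 / (r * \<delta>)\<rfloor>"
  have sub: "?A z \<delta> \<subseteq> (\<Union>j\<in>{..J}. cball ((real j * \<delta>) *\<^sub>R z) (c1 * \<delta>))"
  proof
   fix y assume "y \<in> ?A z \<delta>"
   then have y: "norm y < 1" "y \<noteq> 0" "norm (q y - z) \<le> \<delta>" by auto
   define t where "t = norm y / rad y"
   have rp: "rad y > 0" using rad_pos[OF y(2)] .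
   have t: "0 \<le> t" "t \<le> 1 / r" using y r(3)[OF y(2)] r(1) rp by (auto simp: t_def intro!: frac_le)
   define j where "j = nat \<lfloor>t / \<delta>\<rfloor>"
   have jf: "real j = of_int \<lfloor>t / \<delta>\<rfloor>" using t d by (simp add: j_def)
   have "t / \<delta> \<le> 1 / (r * \<delta>)" using t(2) d by (simp add: field_simps)
   then have jJ: "j \<le> J" unfolding j_def J_def by (intro nat_mono floor_mono)
   have "real j \<le> t / \<delta>" "t / \<delta> < real j + 1" unfolding jf by linarith+
   then have "real j * \<delta> \<le> t" "t < (real j + 1) * \<delta>" using d by (auto simp: field_simps)
   then have jt: "\<bar>t - real j * \<delta>\<bar> \<le> \<delta>" by (auto simp: algebra_simps)
   have yq: "y = t *\<^sub>R q y" using y_eq_q[OF y(2)] by (simp add: t_def)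
   have "y - (real j * \<delta>) *\<^sub>R z = t *\<^sub>R (q y - z) + (t - real j * \<delta>) *\<^sub>R z"
    using yq by (simp add: algebra_simps)
   then have "norm (y - (real j * \<delta>) *\<^sub>R z) \<le> t * norm (q y - z) + \<bar>t - real j * \<delta>\<bar> * norm z"
    using norm_triangle_ineq[of "t *\<^sub>R (q y - z)" "(t - real j * \<delta>) *\<^sub>R z"] t by simp
   also have "\<dots> \<le> (1 / r) * \<delta> + \<delta> * \<bar>R0\<bar>"
    using t y jt z d r(1) by (intro add_mono mult_mono) auto
   also have "\<dots> = c1 * \<delta>" by (simp add: c1_def algebra_simps)
   finally show "y \<in> (\<Union>j\<in>{..J}. cball ((real j * \<delta>) *\<^sub>R z) (c1 * \<delta>))"
    using jJ by (auto simp: dist_norm norm_minus_commute)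
  qed
  have "emeasure lborel (?A z \<delta>) \<le> emeasure lborel (\<Union>j\<in>{..J}. cball ((real j * \<delta>) *\<^sub>R z) (c1 * \<delta>))"
   by (rule emeasure_mono[OF sub]) auto
  also have "\<dots> \<le> (\<Sum>j\<in>{..J}. emeasure lborel (cball ((real j * \<delta>) *\<^sub>R z) (c1 * \<delta>)))"
   by (rule emeasure_subadditive_finite) auto
  also have "\<dots> = (\<Sum>j\<in>{..J}. ennreal (v * (c1 * \<delta>) ^ ?n))"
   using c1 d by (simp add: emeasure_cball v_def)
  also have "\<dots> = ennreal (real (Suc J) * (v * (c1 * \<delta>) ^ ?n))"
   using v c1 d by (simp add: ennreal_of_nat_eq_real_of_nat ennreal_mult'[symmetric] del: of_nat_Suc)
  also have "\<dots> \<le> ennreal (C * \<delta> ^ (?n - 1))"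
  proof (rule ennreal_leI)
   have "real (Suc J) \<le> 1 / (r * \<delta>) + 1" using r d unfolding J_def by simp
   also have "\<dots> \<le> (1 / r + 1) / \<delta>" using d True r by (simp add: field_simps)
   finally have "real (Suc J) * (v * (c1 * \<delta>) ^ ?n) \<le> (1 / r + 1) / \<delta> * (v * (c1 * \<delta>) ^ ?n)"
    using v c1 d by (intro mult_right_mono) auto
   also have "\<dots> = (1 / r + 1) * (v * c1 ^ ?n) * (\<delta> ^ ?n / \<delta>)" by (simp add: power_mult_distrib)
   also have "\<delta> ^ ?n / \<delta> = \<delta> ^ (?n - 1)" using d power_minus_mult[OF n0, of \<delta>] by (simp add: field_simps)
   also have "(1 / r + 1) * (v * c1 ^ ?n) * \<delta> ^ (?n - 1) \<le> C * \<delta> ^ (?n - 1)"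
    using d v by (intro mult_right_mono) (auto simp: C_def)
   finally show "real (Suc J) * (v * (c1 * \<delta>) ^ ?n) \<le> C * \<delta> ^ (?n - 1)" .
  qed
  finally show ?thesis .
 next
  case False
  have "emeasure lborel (?A z \<delta>) \<le> emeasure lborel (cball 0 1 :: (real^'n) set)" by (rule emeasure_mono) auto
  also have "\<dots> = ennreal v" by (simp add: emeasure_cball v_def)
  also have "\<dots> \<le> ennreal (C * \<delta> ^ (?n - 1))"
  proof (rule ennreal_leI)
   have "v * 1 \<le> C * \<delta> ^ (?n - 1)"
    using False v r c1 by (intro mult_mono one_le_power) (auto simp: C_def)
   then show "v \<le> C * \<delta> ^ (?n - 1)" by simp
  qed
  finally show ?thesis .
 qed
 ultimately show ?thesis by (rule that)
qed

end

subsection \<open>Averaged decay\<close>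

lemma prob_abs_integral_le:
 fixes f :: "'a \<Rightarrow> real"
 assumes "prob_space M" "integrable M f" "\<And>x. \<bar>f x\<bar> \<le> B"
 shows "\<bar>LINT x|M. f x\<bar> \<le> B"
proof -
 interpret prob_space M by fact
 have "\<bar>LINT x|M. f x\<bar> \<le> (LINT x|M. \<bar>f x\<bar>)" by (rule integral_abs_bound)
 also have "\<dots> \<le> (LINT x|M. B)" by (rule integral_mono) (use assms in auto)
 finally show ?thesis by (simp add: prob_space)
qed

text \<open>By Lagrange's identity the squared 2 by 2 minors sum to twice 1 - (u . \<nu>)^2 over all
  ordered pairs; among n^2 terms one must be large. Strict inequality in the hypothesis forces the
  two indices to differ.\<close>

lemma exists_wedge:
 fixes u \<nu> :: "real^'n"
 assumes "norm u = 1" "norm \<nu> = 1" "(u \<bullet> \<nu>)\<^sup>2 < 1"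
 shows "\<exists>i j. i \<noteq> j \<and> (real CARD('n))\<^sup>2 * (u $ j * \<nu> $ i - u $ i * \<nu> $ j)\<^sup>2 \<ge> 1 - (u \<bullet> \<nu>)\<^sup>2"
proof (rule ccontr)
 let ?n = "real CARD('n)"
 let ?w = "\<lambda>i j. (u $ j * \<nu> $ i - u $ i * \<nu> $ j)\<^sup>2"
 assume c: "\<not> ?thesis"
 have lt: "?n\<^sup>2 * ?w i j < 1 - (u \<bullet> \<nu>)\<^sup>2" for i j
 proof (cases "i = j")
  case True
  then show ?thesis using assms(3) by simp
 qed (use c in force)
 have n: "(\<Sum>i\<in>UNIV. (x $ i)\<^sup>2) = 1" if "norm x = 1" for x :: "real^'n"
  using that by (simp add: norm_eq_1 inner_vec_def power2_eq_square)
 have ex: "?w i j = (\<nu> $ i)\<^sup>2 * (u $ j)\<^sup>2 + (u $ i)\<^sup>2 * (\<nu> $ j)\<^sup>2 - 2 * ((u $ i * \<nu> $ i) * (u $ j * \<nu> $ j))" for i j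
  by (simp add: power2_eq_square algebra_simps)
 have "(\<Sum>i\<in>UNIV. \<Sum>j\<in>UNIV. ?w i j) = (\<Sum>i\<in>UNIV. (\<nu> $ i)\<^sup>2) * (\<Sum>i\<in>UNIV. (u $ i)\<^sup>2) + (\<Sum>i\<in>UNIV. (u $ i)\<^sup>2) * (\<Sum>i\<in>UNIV. (\<nu> $ i)\<^sup>2)
   - 2 * ((\<Sum>i\<in>UNIV. u $ i * \<nu> $ i) * (\<Sum>j\<in>UNIV. u $ j * \<nu> $ j))"
  unfolding ex sum_product by (simp add: sum.distrib sum_subtractf sum_distrib_left)
 also have "\<dots> = 2 * (1 - (u \<bullet> \<nu>)\<^sup>2)" using n[OF assms(1)] n[OF assms(2)]
  by (simp add: inner_vec_def power2_eq_square)
 finally have s: "(\<Sum>i\<in>UNIV. \<Sum>j\<in>UNIV. ?w i j) = 2 * (1 - (u \<bullet> \<nu>)\<^sup>2)" .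
 have "(\<Sum>i\<in>UNIV. \<Sum>j\<in>UNIV. ?w i j) \<le> (\<Sum>i\<in>(UNIV::'n set). \<Sum>j\<in>(UNIV::'n set). (1 - (u \<bullet> \<nu>)\<^sup>2) / ?n\<^sup>2)"
  using lt by (intro sum_mono) (simp add: field_simps less_imp_le)
 also have "\<dots> = 1 - (u \<bullet> \<nu>)\<^sup>2" by (simp add: power2_eq_square)
 finally show False using s assms(3) by simp
qed

text \<open>The difference of two points of \<open>Z\<close> makes an angle of at least 60 degrees
  with \<open>\<nu>\<close>, so for directions near \<open>\<nu>\<close> some plane rotation moves
  the phase at definite speed, and nonstationary phase applies with frequency R |z - z'|. The power
  n is what the later integration over a boundary of dimension n - 1 requires.\<close>

lemma stationary_kernel:
 fixes \<nu> :: "real^'n"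
 assumes \<nu>: "norm \<nu> = 1" and \<eta>: "\<eta> > 0" "\<eta> \<le> 1 / (8 * real CARD('n))" and c: "c > 0"
  and Z: "\<And>z. z \<in> Z \<Longrightarrow> norm z \<le> R0" "\<And>z x. z \<in> Z \<Longrightarrow> x \<in> ball \<nu> \<eta> \<Longrightarrow> \<bar>z \<bullet> x\<bar> \<ge> c"
   "\<And>z z'. z \<in> Z \<Longrightarrow> z' \<in> Z \<Longrightarrow> \<bar>\<nu> \<bullet> (z - z')\<bar> \<le> norm (z - z') / 2"
 obtains C where "C \<ge> 0" "\<And>Om z z' R. rotation_invariant Om \<Longrightarrow> z \<in> Z \<Longrightarrow> z' \<in> Z \<Longrightarrow> R > 0 \<Longrightarrow>
   \<bar>LINT om|Om. (cutoff (Suc CARD('n)) \<nu> (\<eta>/4) om / (z \<bullet> om)) * (cutoff (Suc CARD('n)) \<nu> (\<eta>/4) om / (z' \<bullet> om)) *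
    cos (R * (z \<bullet> om) - R * (z' \<bullet> om))\<bar> \<le> C / (1 + R * norm (z - z')) ^ CARD('n)"
proof -
 let ?n = "CARD('n)"
 let ?K = "cutoff (Suc ?n) \<nu> (\<eta>/4)"
 let ?S = "ball \<nu> \<eta>" and ?Q = "cball \<nu> (\<eta>/2)"
 let ?a = "\<lambda>(z, z') x. ?K x * ?K x * (1 / (z \<bullet> x)) * (1 / (z' \<bullet> x))"
 have K0: "?K x = 0" if "x \<notin> ?Q" for x
  using that \<eta> by (intro cutoff_0) (auto simp: dist_norm norm_minus_commute)
 have KU: "UC ?n W UNIV (\<lambda>_. ?K)" for W :: "((real^'n) \<times> (real^'n)) set" by (rule UC_cutoff) (use \<eta> in auto)
 have zU: "UC ?n (Z \<times> Z) ?S (\<lambda>w x. 1 / (fst w \<bullet> x))" "UC ?n (Z \<times> Z) ?S (\<lambda>w x. 1 / (snd w \<bullet> x))"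
  by (rule UC_inverse[OF c UC_inner[where B=R0]], use Z in auto)+
 have KS: "UC ?n (Z \<times> Z) ?S (\<lambda>w x. ?K x)" by (rule UC_subset[OF KU[of "Z \<times> Z"]]) auto
 have "UC ?n (Z \<times> Z) ?S (\<lambda>w x. ?K x * ?K x * (1 / (fst w \<bullet> x)) * (1 / (snd w \<bullet> x)))"
  by (intro UC_mult zU KS)
 then have "UC ?n (Z \<times> Z) UNIV (\<lambda>w x. ?K x * ?K x * (1 / (fst w \<bullet> x)) * (1 / (snd w \<bullet> x)))"
  by (rule UC_extend[of ?S ?Q, rotated 3]) (use K0 \<eta> in auto)
 then have aU: "UC ?n (Z \<times> Z) UNIV ?a" by (simp add: case_prod_unfold)
 have a0: "?a w x = 0" if "x \<notin> ?Q" for w x using K0[OF that] by (simp add: case_prod_unfold)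
 define u where "u = (\<lambda>w::(real^'n)\<times>(real^'n). (fst w - snd w) /\<^sub>R norm (fst w - snd w))"
 define V where "V = (\<lambda>(i::'n) j (x::real^'n). x $ i *\<^sub>R axis j 1 - x $ j *\<^sub>R axis i (1::real))"
 \<comment> \<open>The pairs for which rotation in the plane of the axes \<open>i\<close> and
   \<open>j\<close> is usable on the whole ball. There are finitely many classes, so the constants
   can be added up.\<close>
 define Wf where "Wf = (\<lambda>i j. {w \<in> Z \<times> Z. i \<noteq> j \<and> fst w \<noteq> snd w \<and> (\<forall>x\<in>?S. \<bar>u w \<bullet> V i j x\<bar> \<ge> 1 / (4 * real ?n))})"
 have uV: "u w \<bullet> V i j x = u w $ j * x $ i - u w $ i * x $ j" for w i j x
  by (simp add: V_def inner_diff_right inner_axis mult.commute)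
 have nsp: "\<exists>C. \<forall>M w lam ph. w \<in> Wf i j \<longrightarrow> lam > 0 \<longrightarrow> sets M = sets borel \<longrightarrow> finite_measure M \<longrightarrow> measure M UNIV \<le> 1 \<longrightarrow>
    null_div M ?Q (V i j) (\<lambda>_. 0) \<longrightarrow> \<bar>LINT x|M. ?a w x * cos (lam * (u w \<bullet> x) + ph)\<bar> \<le> C / lam ^ ?n" for i j
 proof (rule nonstationary_phase[where S="?S" and c="1 / (4 * real ?n)" and W="Wf i j"])
  show "UC ?n (Wf i j) ?S (\<lambda>w x. V i j x $ k)" for k
  proof -
   have "UC ?n (Wf i j) ?S (\<lambda>w x. x $ i * axis j 1 $ k - x $ j * axis i 1 $ k)"
    by (intro UC_diff UC_mult UC_coord UC_const[where M=1]) (auto simp: axis_def)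
   then show ?thesis by (simp add: V_def)
  qed
  show "UC ?n (Wf i j) ?S (\<lambda>w x. 0)" by (rule UC_const[where M=0]) auto
  show "UC ?n (Wf i j) UNIV ?a" by (rule UC_subset[OF aU]) (auto simp: Wf_def)
 qed (use a0 \<eta> in \<open>auto simp: Wf_def u_def\<close>)
 define PP where "PP = (\<lambda>i j C. \<forall>M w lam ph. w \<in> Wf i j \<longrightarrow> lam > 0 \<longrightarrow> sets M = sets borel \<longrightarrow> finite_measure M \<longrightarrow> measure M UNIV \<le> 1 \<longrightarrow>
    null_div M ?Q (V i j) (\<lambda>_. 0) \<longrightarrow> \<bar>LINT x|M. ?a w x * cos (lam * (u w \<bullet> x) + ph)\<bar> \<le> C / lam ^ ?n)"
 have "\<exists>C. PP i j C" for i j unfolding PP_def by (rule nsp)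
 then obtain Cf where "\<And>i j. PP i j (Cf i j)" by metis
 then have Cf: "\<bar>LINT x|M. ?a w x * cos (lam * (u w \<bullet> x) + ph)\<bar> \<le> Cf i j / lam ^ ?n"
  if "w \<in> Wf i j" "lam > 0" "sets M = sets borel" "finite_measure M" "measure M UNIV \<le> 1" "null_div M ?Q (V i j) (\<lambda>_. 0)"
  for i j M w lam ph using that unfolding PP_def by blast
 define C1 where "C1 = (\<Sum>i\<in>UNIV. \<Sum>j\<in>UNIV. \<bar>Cf i j\<bar>)"
 have C1: "Cf i j \<le> C1" for i j
 proof -
  have "Cf i j \<le> \<bar>Cf i j\<bar>" by simp
  also have "\<dots> \<le> (\<Sum>j\<in>UNIV. \<bar>Cf i j\<bar>)" by (rule member_le_sum) auto
  also have "\<dots> \<le> C1" unfolding C1_def by (rule member_le_sum[of i UNIV "\<lambda>i. \<Sum>j\<in>UNIV. \<bar>Cf i j\<bar>"]) (auto intro: sum_nonneg)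
  finally show ?thesis .
 qed
 obtain A where A: "\<And>w x. w \<in> Z \<times> Z \<Longrightarrow> \<bar>?a w x\<bar> \<le> A" using UC_bounded[OF aU] by blast
 define C where "C = (max A 0 + max C1 0) * 2 ^ ?n"
 show ?thesis
 proof (rule that[of C])
  show "C \<ge> 0" by (simp add: C_def)
  fix Om :: "(real^'n) measure" and z z' and R :: real
  assume Om: "rotation_invariant Om" and z: "z \<in> Z" "z' \<in> Z" and R: "R > 0"
  let ?I = "LINT om|Om. (?K om / (z \<bullet> om)) * (?K om / (z' \<bullet> om)) * cos (R * (z \<bullet> om) - R * (z' \<bullet> om))"
  interpret prob_space Om using Om by (simp add: rotation_invariant_def)
  have so: "sets Om = sets borel" using Om by (simp add: rotation_invariant_def)
  have fin: "finite_measure Om" by unfold_locales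
  have m1: "measure Om UNIV \<le> 1" by simp
  define lam where "lam = R * norm (z - z')"
  have lam0: "lam \<ge> 0" using R by (simp add: lam_def)
  have Ieq: "?I = (LINT x|Om. ?a (z, z') x * cos (lam * (u (z, z') \<bullet> x) + 0))"
  proof (rule Bochner_Integration.integral_cong[OF refl])
   fix x
   have "lam *\<^sub>R u (z, z') = R *\<^sub>R (z - z')" by (cases "z = z'") (auto simp: lam_def u_def)
   then have "lam * (u (z, z') \<bullet> x) = R * (z \<bullet> x) - R * (z' \<bullet> x)"
    by (metis inner_scaleR_left inner_diff_left right_diff_distrib)
   then show "(?K x / (z \<bullet> x)) * (?K x / (z' \<bullet> x)) * cos (R * (z \<bullet> x) - R * (z' \<bullet> x)) = ?a (z, z') x * cos (lam * (u (z, z') \<bullet> x) + 0)"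
    by simp
  qed
  have triv: "\<bar>?I\<bar> \<le> max A 0"
  proof -
   have b: "\<bar>?a (z, z') x * cos (lam * (u (z, z') \<bullet> x) + 0)\<bar> \<le> max A 0" for x
   proof -
    have hA: "\<bar>?a (z, z') x\<bar> \<le> A" by (rule A) (use z in auto)
    have "\<bar>?a (z, z') x\<bar> * \<bar>cos (lam * (u (z, z') \<bullet> x) + 0)\<bar> \<le> A * 1"
     using order_trans[OF abs_ge_zero hA] by (intro mult_mono hA) auto
    then show ?thesis unfolding abs_mult[of "?a (z, z') x"] by linarith
   qed
   have ct: "continuous_on UNIV (\<lambda>x. ?a (z, z') x * cos (lam * (u (z, z') \<bullet> x) + 0))"
    using UC_continuous[OF aU, of "(z, z')"] z by (intro continuous_on_mult continuous_intros) auto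
   have i: "integrable Om (\<lambda>x. ?a (z, z') x * cos (lam * (u (z, z') \<bullet> x) + 0))"
    by (rule integrable_bounded_continuous[OF fin so ct b])
   have pO: "prob_space Om" by unfold_locales
   show ?thesis unfolding Ieq by (rule prob_abs_integral_le[OF pO i b])
  qed
  have dec: "\<bar>?I\<bar> \<le> max C1 0 / lam ^ ?n" if l: "lam > 0"
  proof -
   have ne: "z \<noteq> z'" using l by (auto simp: lam_def)
   let ?u = "u (z, z')"
   have nu: "norm ?u = 1" using ne by (simp add: u_def)
   have "\<bar>\<nu> \<bullet> ?u\<bar> \<le> 1/2"
   proof -
    have "\<nu> \<bullet> ?u = (\<nu> \<bullet> (z - z')) / norm (z - z')" by (simp add: u_def divide_inverse mult.commute)
    then have "\<bar>\<nu> \<bullet> ?u\<bar> = \<bar>\<nu> \<bullet> (z - z')\<bar> / norm (z - z')" by simp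
    also have "\<dots> \<le> 1/2" using Z(3)[OF z] ne by (simp add: pos_divide_le_eq)
    finally show ?thesis .
   qed
   then have dot: "(?u \<bullet> \<nu>)\<^sup>2 \<le> (1/2)\<^sup>2" by (metis inner_commute abs_ge_zero power2_abs power_mono)
   then have "(?u \<bullet> \<nu>)\<^sup>2 < 1" by (simp add: power2_eq_square)
   from exists_wedge[OF nu \<nu> this] obtain i j where ij: "i \<noteq> j"
    "(real ?n)\<^sup>2 * (?u $ j * \<nu> $ i - ?u $ i * \<nu> $ j)\<^sup>2 \<ge> 1 - (?u \<bullet> \<nu>)\<^sup>2" by blast
   have "(1/2)\<^sup>2 \<le> (real ?n * \<bar>?u $ j * \<nu> $ i - ?u $ i * \<nu> $ j\<bar>)\<^sup>2"
    using ij(2) dot unfolding power_mult_distrib power2_abs by (simp only: power_divide) simp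
   then have "1/2 \<le> real ?n * \<bar>?u $ j * \<nu> $ i - ?u $ i * \<nu> $ j\<bar>" by (rule power2_le_imp_le) simp
   then have w0: "\<bar>?u $ j * \<nu> $ i - ?u $ i * \<nu> $ j\<bar> \<ge> 1 / (2 * real ?n)" by (simp add: field_simps)
   have "(z, z') \<in> Wf i j"
   proof -
    \<comment> \<open>At \<open>\<nu>\<close> the value is at least 1/(2n); moving to
      \<open>x\<close> changes it by at most 2 \<eta>, which is at most 1/(4n) by the choice of
      \<eta>.\<close>
    have "\<bar>?u \<bullet> V i j x\<bar> \<ge> 1 / (4 * real ?n)" if "x \<in> ?S" for x
    proof -
     have d: "\<bar>x $ k - \<nu> $ k\<bar> \<le> \<eta>" for k
      using component_le_norm_cart[of "x - \<nu>" k] that by (simp add: dist_norm norm_minus_commute)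
     have uc: "\<bar>?u $ k\<bar> \<le> 1" for k using component_le_norm_cart[of ?u k] nu by simp
     have "\<bar>?u $ j * (x $ i - \<nu> $ i)\<bar> \<le> 1 * \<eta>" "\<bar>?u $ i * (x $ j - \<nu> $ j)\<bar> \<le> 1 * \<eta>"
      unfolding abs_mult by (intro mult_mono uc d; simp)+
     moreover have "?u \<bullet> V i j x = (?u $ j * \<nu> $ i - ?u $ i * \<nu> $ j) + ?u $ j * (x $ i - \<nu> $ i) - ?u $ i * (x $ j - \<nu> $ j)"
      unfolding uV by (simp add: algebra_simps)
     ultimately have "\<bar>?u \<bullet> V i j x\<bar> \<ge> 1 / (2 * real ?n) - 2 * \<eta>" using w0 by linarith
     moreover have "2 * \<eta> \<le> 2 * (1 / (8 * real ?n))" using \<eta> by simp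
     moreover have "1 / (2 * real ?n) - 2 * (1 / (8 * real ?n)) = 1 / (4 * real ?n)" by (simp add: field_simps)
     ultimately show ?thesis by linarith
    qed
    then show ?thesis using z ne ij by (auto simp: Wf_def)
   qed
   from Cf[OF this l so fin m1] have "\<bar>?I\<bar> \<le> Cf i j / lam ^ ?n"
    unfolding Ieq using null_div_rotation[OF Om compact_cball ij(1), of \<nu> "\<eta>/2"] unfolding V_def by blast
   also have "\<dots> \<le> max C1 0 / lam ^ ?n" using C1[of i j] l by (intro divide_right_mono) auto
   finally show ?thesis .
  qed
  have gen: "a / b \<le> c / d" if "a * d \<le> c * b" "b > 0" "d > 0" for a b c d :: real
   using that by (simp add: field_simps)
  \<comment> \<open>The trivial bound is used for \<open>lam \<le> 1\<close> and the decay
    otherwise; in both ranges replacing the comparison quantity by 1 + lam costs at most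
    2^n.\<close>
  have "\<bar>?I\<bar> \<le> C / (1 + lam) ^ ?n"
  proof (cases "lam \<le> 1")
   case True
   have "(1 + lam) ^ ?n \<le> 2 ^ ?n" using True lam0 by (intro power_mono) auto
   then have "max A 0 * (1 + lam) ^ ?n \<le> (max A 0 + max C1 0) * 2 ^ ?n" using lam0 by (intro mult_mono) auto
   then have "max A 0 / 1 \<le> C / (1 + lam) ^ ?n" using lam0 unfolding C_def by (intro gen) (simp_all only: mult_1_right zero_less_one zero_less_power add_pos_nonneg)
   then show ?thesis using triv by linarith
  next
   case False
   have "(1 + lam) ^ ?n \<le> (2 * lam) ^ ?n" using False by (intro power_mono) auto
   then have "max C1 0 * (1 + lam) ^ ?n \<le> (max A 0 + max C1 0) * (2 * lam) ^ ?n" using lam0 by (intro mult_mono) auto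
   also have "\<dots> = C * lam ^ ?n" by (simp add: C_def power_mult_distrib)
   finally have "max C1 0 / lam ^ ?n \<le> C / (1 + lam) ^ ?n" 
    using False by (intro gen) auto
   then show ?thesis using dec False by linarith
  qed
  then show "\<bar>?I\<bar> \<le> C / (1 + R * norm (z - z')) ^ ?n" by (simp add: lam_def)
 qed
qed

context star_body
begin

abbreviation Y :: "(real^'n) measure" where "Y \<equiv> uniform_on (ball 0 1)"

lemma finite_Y: "finite_measure Y"
 by (rule uniform_on_finite) auto

text \<open>Dyadic decomposition in R |q(y) - z|: at scale 2^j the integrand is of order 2^(-jn) and
  the set has measure of order (2^j/R)^(n-1), so the contributions form a geometric series with
  ratio 1/2. This is where the exponent n beats the dimension n - 1.\<close>

lemma schur_bound:
 obtains C where "C > 0" "\<And>R z. R > 0 \<Longrightarrow> norm z \<le> R0 \<Longrightarrow>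
   (LINT y|Y. 1 / (1 + R * norm (q y - z)) ^ CARD('n)) \<le> C / R ^ (CARD('n) - 1)"
proof -
 let ?n = "CARD('n)"
 obtain C where C: "C > 0" "\<And>z \<delta>. \<delta> > 0 \<Longrightarrow> norm z \<le> R0 \<Longrightarrow>
   emeasure lborel {y. norm y < 1 \<and> y \<noteq> 0 \<and> norm (q y - z) \<le> \<delta>} \<le> ennreal (C * \<delta> ^ (?n - 1))"
  by (rule cone_measure) (rule that)
 show ?thesis
 proof (rule that[of "2 * C * 2 ^ ?n"])
  show "2 * C * 2 ^ ?n > 0" using C by simp
  fix R :: real and z :: "real^'n" assume R: "R > 0" and z: "norm z \<le> R0"
  let ?f = "\<lambda>y. 1 / (1 + R * norm (q y - z)) ^ ?n"
  let ?A = "\<lambda>j. {y. norm y < 1 \<and> y \<noteq> 0 \<and> norm (q y - z) \<le> 2 ^ j / R}"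
  have [measurable]: "?A j \<in> sets borel" for j by measurable
  have f0: "?f y \<ge> 0" for y using R by (simp add: add_nonneg_nonneg)
  have pt: "ennreal (indicator (ball 0 1) y) * ennreal (?f y) \<le> (\<Sum>j. ennreal (2 ^ ?n / 2 ^ (j * ?n)) * indicator (?A j) y)" if "y \<noteq> 0" for y
  proof (cases "norm y < 1")
   case False
   then show ?thesis by simp
  next
   case True
   define d where "d = norm (q y - z)"
   have d0: "d \<ge> 0" by (simp add: d_def)
   obtain j0 :: nat where j0: "R * d < 2 ^ j0" using real_arch_pow[of 2 "R * d"] by auto
   \<comment> \<open>The smallest dyadic scale containing the point. Minimality gives the matching
     lower bound for R d, at the cost of a factor 2^n.\<close>
   define j where "j = (LEAST j. R * d \<le> 2 ^ j)"
   have j: "R * d \<le> 2 ^ j" unfolding j_def by (rule LeastI[of _ j0]) (use j0 in simp)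
   have fj: "?f y \<le> 2 ^ ?n / 2 ^ (j * ?n)"
   proof (cases j)
    case 0
    have "1 \<le> (1 + R * d) ^ ?n" using R d0 by (intro one_le_power) simp
    then have "?f y \<le> 1" by (simp add: d_def)
    also have "(1::real) \<le> 2 ^ ?n" by (intro one_le_power) simp
    finally show ?thesis using 0 by simp
   next
    case (Suc i)
    have "\<not> R * d \<le> 2 ^ i" using not_less_Least[of i "\<lambda>j. R * d \<le> 2 ^ j"] Suc unfolding j_def by simp
    then have "(2 ^ i) ^ ?n \<le> (1 + R * d) ^ ?n" by (intro power_mono) auto
    then have "1 / (1 + R * d) ^ ?n \<le> 1 / (2 ^ i) ^ ?n" by (intro divide_left_mono) (auto intro!: mult_pos_pos zero_less_power add_pos_nonneg simp: R[THEN less_imp_le] d0)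
    also have "1 / (2 ^ i :: real) ^ ?n = 2 ^ ?n / 2 ^ (j * ?n)"
     unfolding Suc by (simp add: power_add power_mult)
    finally show ?thesis by (simp add: d_def)
   qed
   have "y \<in> ?A j" using True that j R by (simp add: d_def field_simps)
   then have "ennreal (indicator (ball 0 1) y) * ennreal (?f y) \<le> ennreal (2 ^ ?n / 2 ^ (j * ?n)) * indicator (?A j) y"
    using fj True by (simp add: ennreal_leI)
   also have "\<dots> \<le> (\<Sum>j. ennreal (2 ^ ?n / 2 ^ (j * ?n)) * indicator (?A j) y)"
   proof -
    have "g j \<le> suminf g" for g :: "nat \<Rightarrow> ennreal" using sum_le_suminf[of g "{j}"] by simp
    then show ?thesis .
   qed
   finally show ?thesis .
  qed
  have "(\<integral>\<^sup>+y. ennreal (?f y) \<partial>Y) = (\<integral>\<^sup>+y. ennreal (indicator (ball 0 1) y) * ennreal (?f y) \<partial>lborel)"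
   unfolding uniform_on_def by (subst nn_integral_density) (auto intro!: borel_measurable_indicator)
  also have "\<dots> \<le> (\<integral>\<^sup>+y. (\<Sum>j. ennreal (2 ^ ?n / 2 ^ (j * ?n)) * indicator (?A j) y) \<partial>lborel)"
   by (rule nn_integral_mono_AE) (use AE_lborel_singleton[of 0] in eventually_elim, use pt in auto)
  also have "\<dots> = (\<Sum>j. \<integral>\<^sup>+y. ennreal (2 ^ ?n / 2 ^ (j * ?n)) * indicator (?A j) y \<partial>lborel)"
   by (rule nn_integral_suminf) measurable
  also have "\<dots> = (\<Sum>j. ennreal (2 ^ ?n / 2 ^ (j * ?n)) * emeasure lborel (?A j))"
   by (subst nn_integral_cmult_indicator) auto
  also have "\<dots> \<le> (\<Sum>j. ennreal (C * 2 ^ ?n / R ^ (?n - 1) * (1/2) ^ j))"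
  proof (rule suminf_le)
   fix j
   have "ennreal (2 ^ ?n / 2 ^ (j * ?n)) * emeasure lborel (?A j) \<le> ennreal (2 ^ ?n / 2 ^ (j * ?n)) * ennreal (C * (2 ^ j / R) ^ (?n - 1))"
    by (intro mult_left_mono C z) (use R in auto)
   also have "\<dots> = ennreal (2 ^ ?n / 2 ^ (j * ?n) * (C * (2 ^ j / R) ^ (?n - 1)))"
    using C R by (simp add: ennreal_mult[symmetric])
   also have "2 ^ ?n / 2 ^ (j * ?n) * (C * (2 ^ j / R) ^ (?n - 1)) = C * 2 ^ ?n / R ^ (?n - 1) * (1/2) ^ j"
   proof -
    have "(2 ^ j :: real) ^ (?n - 1) * 2 ^ j = 2 ^ (j * ?n)"
     using power_minus_mult[of ?n "2 ^ j :: real"] by (simp add: power_mult)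
    then have "(2::real) ^ (j * ?n) = (2 ^ j) ^ (?n - 1) * 2 ^ j" by simp
    then show ?thesis by (simp add: power_divide field_simps)
   qed
   finally show "ennreal (2 ^ ?n / 2 ^ (j * ?n)) * emeasure lborel (?A j) \<le> ennreal (C * 2 ^ ?n / R ^ (?n - 1) * (1/2) ^ j)" .
  qed auto
  also have "\<dots> = ennreal (\<Sum>j. C * 2 ^ ?n / R ^ (?n - 1) * (1/2) ^ j)"
   using C R by (intro suminf_ennreal2) (auto intro!: summable_mult)
  also have "(\<Sum>j. C * 2 ^ ?n / R ^ (?n - 1) * (1/2) ^ j) = 2 * C * 2 ^ ?n / R ^ (?n - 1)"
   by (subst suminf_mult) (auto simp: suminf_geometric)
  finally have nn: "(\<integral>\<^sup>+y. ennreal (?f y) \<partial>Y) \<le> ennreal (2 * C * 2 ^ ?n / R ^ (?n - 1))" .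
  have "(LINT y|Y. ?f y) = enn2real (\<integral>\<^sup>+y. ennreal (?f y) \<partial>Y)"
   by (rule integral_eq_nn_integral) (use f0 in auto)
  also have "\<dots> \<le> 2 * C * 2 ^ ?n / R ^ (?n - 1)" by (rule enn2real_leI) (use nn C R in auto)
  finally show "(LINT y|Y. ?f y) \<le> 2 * C * 2 ^ ?n / R ^ (?n - 1)" .
 qed
qed

text \<open>\<open>TT_star\<close> with the kernel bound of \<open>stationary_kernel\<close>, whose
  integral over one boundary point is controlled by \<open>schur_bound\<close>. The denominators
  come from the radial integration by parts; they are bounded below on the support of the cutoff
  because \<open>a\<close> lives over \<open>Z\<close>.\<close>

lemma stationary_operator:
 fixes \<nu> :: "real^'n"
 assumes \<nu>: "norm \<nu> = 1" and \<eta>: "\<eta> > 0" "\<eta> \<le> 1 / (8 * real CARD('n))" and c: "c > 0"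
  and Z: "\<And>z x. z \<in> Z \<Longrightarrow> x \<in> ball \<nu> \<eta> \<Longrightarrow> \<bar>z \<bullet> x\<bar> \<ge> c"
   "\<And>z z'. z \<in> Z \<Longrightarrow> z' \<in> Z \<Longrightarrow> \<bar>\<nu> \<bullet> (z - z')\<bar> \<le> norm (z - z') / 2"
   "\<And>z. z \<in> Z \<Longrightarrow> norm z \<le> R0"
 obtains C where "C \<ge> 0" "\<And>Om a A R ph. rotation_invariant Om \<Longrightarrow> a \<in> borel_measurable borel \<Longrightarrow> \<forall>y. \<bar>a y\<bar> \<le> A \<and> (a y \<noteq> 0 \<longrightarrow> q y \<in> Z) \<Longrightarrow> R > 0 \<Longrightarrow>
   (LINT om|Om. (LINT y|Y. cutoff (Suc CARD('n)) \<nu> (\<eta>/4) om * (a y / (q y \<bullet> om)) * cos (R * (q y \<bullet> om) + ph))\<^sup>2)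
    \<le> C * A\<^sup>2 / R ^ (CARD('n) - 1)"
proof -
 let ?n = "CARD('n)"
 let ?K = "cutoff (Suc ?n) \<nu> (\<eta>/4)"
 obtain C1 where C1: "C1 \<ge> 0" "\<And>Om z z' R. rotation_invariant Om \<Longrightarrow> z \<in> Z \<Longrightarrow> z' \<in> Z \<Longrightarrow> R > 0 \<Longrightarrow>
   \<bar>LINT om|Om. (?K om / (z \<bullet> om)) * (?K om / (z' \<bullet> om)) * cos (R * (z \<bullet> om) - R * (z' \<bullet> om))\<bar> \<le> C1 / (1 + R * norm (z - z')) ^ ?n"
  by (rule stationary_kernel[OF \<nu> \<eta> c, of Z R0]) (erule Z(3), erule (1) Z(1), erule (1) Z(2), rule that)
 obtain r R1 where r: "R1 > 0" "\<And>y. y \<noteq> 0 \<Longrightarrow> rad y \<le> R1" by (rule rad_bounds) (rule that)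
 have nq: "norm (q y) \<le> R1" for y using norm_q[of y] r(2)[of y] r(1) by (cases "y = 0") (auto simp: q_def)
 obtain C2 where C2: "C2 > 0" "\<And>R z. R > 0 \<Longrightarrow> norm z \<le> R1 \<Longrightarrow> (LINT y|Y. 1 / (1 + R * norm (q y - z)) ^ ?n) \<le> C2 / R ^ (?n - 1)"
  by (rule schur_bound) (rule that)
 define V where "V = measure Y (space Y)"
 have V: "V \<ge> 0" by (simp add: V_def)
 have K0: "?K x = 0" if "x \<notin> ball \<nu> \<eta>" for x
  using that \<eta> by (intro cutoff_0) (auto simp: dist_norm norm_minus_commute)
 have K1: "\<bar>?K x\<bar> \<le> 1" for x using cutoff_range[of "\<eta>/4" "Suc ?n" \<nu> x] \<eta> by simp
 have Kc: "continuous_on UNIV ?K"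
  using UC_continuous[OF UC_cutoff[of "\<eta>/4" 0 "Suc ?n" "{()}" \<nu>], of "()"] \<eta> by simp
 then have Km[measurable]: "?K \<in> borel_measurable borel" by (rule borel_measurable_continuous_onI)
 show ?thesis
 proof (rule that[of "C1 * C2 * V"])
  show "C1 * C2 * V \<ge> 0" using C1 C2 V by simp
  fix Om :: "(real^'n) measure" and a :: "real^'n \<Rightarrow> real" and A R ph :: real
  assume Om: "rotation_invariant Om" and a[measurable]: "a \<in> borel_measurable borel" and aa: "\<forall>y. \<bar>a y\<bar> \<le> A \<and> (a y \<noteq> 0 \<longrightarrow> q y \<in> Z)" and R: "R > 0"
  have A: "\<bar>a y\<bar> \<le> A" and aZ: "a y \<noteq> 0 \<Longrightarrow> q y \<in> Z" for y using aa by auto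
  interpret prob_space Om using Om by (simp add: rotation_invariant_def)
  have so[measurable_cong]: "sets Om = sets borel" using Om by (simp add: rotation_invariant_def)
  have fin: "finite_measure Om" by unfold_locales
  have A0: "A \<ge> 0" using A order_trans[OF abs_ge_zero] by blast
  let ?A = "\<lambda>om y. ?K om * (a y / (q y \<bullet> om))"
  let ?Ker = "\<lambda>y y'. C1 * A\<^sup>2 * (1 / (1 + R * norm (q y' - q y)) ^ ?n)"
  have kb: "0 \<le> 1 / (1 + R * norm (q y' - q y)) ^ ?n" "1 / (1 + R * norm (q y' - q y)) ^ ?n \<le> 1" for y y'
  proof -
   have "1 \<le> (1 + R * norm (q y' - q y)) ^ ?n" using R by (intro one_le_power) simp
   then show "0 \<le> 1 / (1 + R * norm (q y' - q y)) ^ ?n" "1 / (1 + R * norm (q y' - q y)) ^ ?n \<le> 1" by auto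
  qed
  have Ab: "\<bar>?A om y\<bar> \<le> A / c" for om y
  proof (cases "om \<in> ball \<nu> \<eta> \<and> a y \<noteq> 0")
   case True
   then have "\<bar>q y \<bullet> om\<bar> \<ge> c" using Z(1) aZ by blast
   then have "\<bar>a y\<bar> / \<bar>q y \<bullet> om\<bar> \<le> A / c" using A A0 c by (intro frac_le) auto
   then have "\<bar>?K om\<bar> * (\<bar>a y\<bar> / \<bar>q y \<bullet> om\<bar>) \<le> 1 * (A / c)" using K1 by (intro mult_mono) auto
   then show ?thesis by (simp add: abs_mult)
  qed (use K0 A0 c in auto)
  have "(LINT om|Om. (LINT y|Y. ?A om y * cos (R * (q y \<bullet> om) + ph))\<^sup>2) \<le> (LINT y|Y. LINT y'|Y. ?Ker y y')"
  proof (rule TT_star[OF fin finite_Y _ Ab])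
   show "(\<lambda>x. ?A (fst x) (snd x)) \<in> borel_measurable (Om \<Otimes>\<^sub>M Y)" by measurable
   show "(\<lambda>x. R * (q (snd x) \<bullet> fst x)) \<in> borel_measurable (Om \<Otimes>\<^sub>M Y)" by measurable
   show "(\<lambda>x. ?Ker (fst x) (snd x)) \<in> borel_measurable (Y \<Otimes>\<^sub>M Y)" by measurable
   show "\<bar>?Ker y y'\<bar> \<le> C1 * A\<^sup>2 * 1" for y y'
   proof -
    have "?Ker y y' \<le> C1 * A\<^sup>2 * 1" using kb C1(1) by (intro mult_left_mono) auto
    moreover have "?Ker y y' \<ge> 0" using kb C1(1) by (intro mult_nonneg_nonneg) auto
    ultimately show ?thesis by simp
   qed
   fix y y'
   let ?J = "LINT om|Om. (?K om / (q y \<bullet> om)) * (?K om / (q y' \<bullet> om)) * cos (R * (q y \<bullet> om) - R * (q y' \<bullet> om))"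
   have "(LINT om|Om. ?A om y * ?A om y' * cos (R * (q y \<bullet> om) - R * (q y' \<bullet> om)))
     = (LINT om|Om. (a y * a y') * ((?K om / (q y \<bullet> om)) * (?K om / (q y' \<bullet> om)) * cos (R * (q y \<bullet> om) - R * (q y' \<bullet> om))))"
    by (rule Bochner_Integration.integral_cong) (auto simp: mult_ac)
   also have "\<dots> = (a y * a y') * ?J" by (rule integral_mult_right_zero)
   finally have e: "(LINT om|Om. ?A om y * ?A om y' * cos (R * (q y \<bullet> om) - R * (q y' \<bullet> om))) = (a y * a y') * ?J" .
   show "\<bar>LINT om|Om. ?A om y * ?A om y' * cos (R * (q y \<bullet> om) - R * (q y' \<bullet> om))\<bar> \<le> ?Ker y y'"
   proof (cases "a y \<noteq> 0 \<and> a y' \<noteq> 0")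
    case True
    have "\<bar>a y * a y'\<bar> \<le> A * A" unfolding abs_mult by (intro mult_mono A A0) auto
    moreover have "\<bar>?J\<bar> \<le> C1 / (1 + R * norm (q y - q y')) ^ ?n" using C1(2)[OF Om aZ aZ R] True by blast
    ultimately have "\<bar>a y * a y'\<bar> * \<bar>?J\<bar> \<le> (A * A) * (C1 / (1 + R * norm (q y - q y')) ^ ?n)"
     using A0 by (intro mult_mono) auto
    also have "\<dots> = ?Ker y y'" by (simp add: power2_eq_square norm_minus_commute)
    finally show ?thesis unfolding e by (simp add: abs_mult)
   next
    case False
    then have "a y * a y' = 0" by auto
    then show ?thesis unfolding e using kb(1)[of y' y] C1(1) by (simp only: mult_zero_left abs_zero) simp
   qed
  qed
  also have "\<dots> \<le> (LINT y|Y. C1 * A\<^sup>2 * (C2 / R ^ (?n - 1)))"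
  proof (rule integral_mono')
   show "integrable Y (\<lambda>y. C1 * A\<^sup>2 * (C2 / R ^ (?n - 1)))" using finite_measure.integrable_const[OF finite_Y] by simp
   show "(LINT y'|Y. ?Ker y y') \<le> C1 * A\<^sup>2 * (C2 / R ^ (?n - 1))" for y
    unfolding integral_mult_right_zero
    by (rule mult_left_mono[OF C2(2)[OF R nq[of y]]]) (use C1(1) in simp)
   show "0 \<le> C1 * A\<^sup>2 * (C2 / R ^ (?n - 1))" using C1 C2 R by simp
  qed
  also have "\<dots> = C1 * C2 * V * A\<^sup>2 / R ^ (?n - 1)" by (simp add: V_def)
  finally show "(LINT om|Om. (LINT y|Y. ?A om y * cos (R * (q y \<bullet> om) + ph))\<^sup>2) \<le> C1 * C2 * V * A\<^sup>2 / R ^ (?n - 1)" .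
 qed
qed

end

lemma measurable_pair_compose:
 fixes b :: "'a::topological_space \<Rightarrow> 'b::topological_space \<Rightarrow> 'c::topological_space"
 assumes "(\<lambda>x. b (fst x) (snd x)) \<in> measurable (borel \<Otimes>\<^sub>M borel) borel" "f \<in> measurable M borel" "g \<in> measurable M borel"
 shows "(\<lambda>x. b (f x) (g x)) \<in> measurable M borel"
proof -
 have "(\<lambda>x. (f x, g x)) \<in> measurable M (borel \<Otimes>\<^sub>M borel)" using assms by (intro measurable_Pair) auto
 from measurable_compose[OF this assms(1)] show ?thesis by simp
qed

context star_body
begin

abbreviation I01 :: "real measure" where "I01 \<equiv> uniform_on {0..1}"

lemma prob_I01: "prob_space I01"
proof (rule prob_spaceI)
 have "emeasure I01 UNIV = (\<integral>\<^sup>+x. ennreal (indicator {0..1::real} x) \<partial>lborel)"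
  by (simp add: uniform_on_def emeasure_density)
 also have "\<dots> = 1" by (simp add: ennreal_indicator)
 finally show "emeasure I01 (space I01) = 1" by (simp add: uniform_on_def)
qed

lemma finite_I01: "finite_measure I01"
 using prob_I01 prob_space_imp_sigma_finite by (simp add: prob_space.finite_measure)

lemma finite_D: "finite_measure (uniform_on D)"
 by (rule uniform_on_finite[OF body_borel bounded_body])

lemma polar_Y:
 fixes H :: "real^'n \<Rightarrow> real"
 assumes H[measurable]: "H \<in> borel_measurable borel" and B: "\<And>x. \<bar>H x\<bar> \<le> B"
 shows "(LINT x|uniform_on D. H x) = (LINT y|Y. LINT s|I01. real CARD('n) * s ^ (CARD('n) - 1) * rad y ^ CARD('n) * H (s *\<^sub>R q y))"
proof -
 let ?w = "\<lambda>y s. real CARD('n) * s ^ (CARD('n) - 1) * rad y ^ CARD('n) * H (s *\<^sub>R q y)"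
 have i: "integrable (uniform_on D) H" by (rule integrable_bounded_finite[OF finite_D _ B]) simp
 have in1: "(LINT s|lborel. pw y s * H (s *\<^sub>R q y)) = indicator (ball 0 1) y * (LINT s|I01. ?w y s)" for y
 proof -
  have "(LINT s|I01. ?w y s) = (LINT s|lborel. indicator {0..1} s * ?w y s)" by (rule integral_uniform_on) measurable
  then have "indicator (ball 0 1) y * (LINT s|I01. ?w y s) = (LINT s|lborel. indicator (ball 0 1) y * (indicator {0..1} s * ?w y s))"
   by (simp only: integral_mult_right_zero)
  also have "\<dots> = (LINT s|lborel. pw y s * H (s *\<^sub>R q y))"
   by (rule Bochner_Integration.integral_cong) (auto simp: pw_def indicator_def)
  finally show ?thesis by simp
 qed
 interpret I: finite_measure I01 by (rule finite_I01)
 have m: "(\<lambda>y. LINT s|I01. ?w y s) \<in> borel_measurable borel"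
  by (rule I.borel_measurable_lebesgue_integral) measurable
 show ?thesis unfolding polar_integral(1)[OF H i] in1
  by (rule integral_uniform_on[symmetric, OF _ m]) simp
qed

text \<open>The boundary term at s = 0 is removed by \<open>b 0 = 0\<close>, which will hold because
  the amplitude is supported away from the origin.\<close>

lemma radial_by_parts:
 fixes b b' :: "real \<Rightarrow> real"
 assumes d: "\<And>s. (b has_real_derivative b' s) (at s)" and c: "continuous_on UNIV b'" and b0: "b 0 = 0" and L: "L \<noteq> 0"
 shows "(LINT s|I01. b s * cos (s * L + ph)) = (b 1 * sin (L + ph) - (LINT s|I01. b' s * sin (s * L + ph))) / L"
proof -
 have bc: "continuous_on UNIV b" by (rule DERIV_continuous_on) (use d in auto)
 let ?f = "\<lambda>s. b' s * sin (s * L + ph) + L * (b s * cos (s * L + ph))"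
 have "((\<lambda>s. b s * sin (s * L + ph)) has_real_derivative ?f s) (at s)" for s
  by (rule derivative_eq_intros d refl)+ (simp add: algebra_simps)
 moreover have cf: "continuous_on UNIV ?f" by (intro continuous_intros c bc)
 ultimately have F: "(LINT s|lborel. ?f s * indicator {0..1} s) = b 1 * sin (1 * L + ph) - b 0 * sin (0 * L + ph)"
  by (intro integral_FTC_Icc_real) (auto simp: continuous_on_eq_continuous_at)
 have int: "integrable I01 g" if "continuous_on UNIV g" for g :: "real \<Rightarrow> real"
 proof -
  have m: "g \<in> borel_measurable borel" using that by (rule borel_measurable_continuous_onI)
  have "integrable lborel (\<lambda>x. indicator {0..1} x *\<^sub>R g x)"
   by (rule borel_integrable_compact) (use that continuous_on_subset in auto)
  then show ?thesis unfolding uniform_on_def using m by (subst integrable_real_density) auto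
 qed
 have mf: "?f \<in> borel_measurable borel" using cf by (rule borel_measurable_continuous_onI)
 have "(LINT s|I01. ?f s) = (LINT s|lborel. indicator {0..1} s * ?f s)" by (rule integral_uniform_on[OF _ mf]) simp
 then have "(LINT s|I01. ?f s) = b 1 * sin (L + ph)" using F b0 by (simp add: mult.commute)
 moreover have "(LINT s|I01. ?f s) = (LINT s|I01. b' s * sin (s * L + ph)) + L * (LINT s|I01. b s * cos (s * L + ph))"
  using c bc by (subst Bochner_Integration.integral_add) (auto intro!: int continuous_intros)
 ultimately show ?thesis using L by (simp add: field_simps)
qed

text \<open>The Fourier transform of \<open>h\<close> on the body at the frequency
  \<open>R *\<^sub>R om\<close>; the phases 0 and -pi/2 give its cosine and sine parts.\<close>

definition osc :: "(real^'n \<Rightarrow> real) \<Rightarrow> real \<Rightarrow> real \<Rightarrow> real^'n \<Rightarrow> real" where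
 "osc h R ph om = (LINT x|uniform_on D. h x * cos (R * (om \<bullet> x) + ph))"

text \<open>One radial integration by parts gains 1/R and leaves a boundary term and an integral
  over s. Both are superpositions over boundary points handled by
  \<open>stationary_operator\<close>, at frequencies R and R s. Altogether R^(-2) R^(-(n-1)) =
  R^(-(n+1)).\<close>

lemma stationary_L2:
 fixes \<nu> :: "real^'n"
 assumes \<nu>: "norm \<nu> = 1" and \<eta>: "\<eta> > 0" "\<eta> \<le> 1 / (8 * real CARD('n))" and c: "c > 0"
  and Z: "\<And>z x. z \<in> Z \<Longrightarrow> x \<in> ball \<nu> \<eta> \<Longrightarrow> \<bar>z \<bullet> x\<bar> \<ge> c"
   "\<And>z z'. z \<in> Z \<Longrightarrow> z' \<in> Z \<Longrightarrow> \<bar>\<nu> \<bullet> (z - z')\<bar> \<le> norm (z - z') / 2"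
   "\<And>z. z \<in> Z \<Longrightarrow> norm z \<le> R0"
  and h: "UC 1 {()} UNIV (\<lambda>_. h)" "\<And>x. x \<notin> Q \<Longrightarrow> h x = 0" "closed Q"
  and s0: "s0 > 0" and supp: "\<And>s y. 0 \<le> s \<Longrightarrow> s \<le> 1 \<Longrightarrow> s *\<^sub>R q y \<in> Q \<Longrightarrow> q y \<in> Z \<and> s \<ge> s0"
 obtains C where "\<And>Om R ph. rotation_invariant Om \<Longrightarrow> R \<ge> 1 \<Longrightarrow>
   (LINT om|Om. (cutoff (Suc CARD('n)) \<nu> (\<eta>/4) om * osc h R ph om)\<^sup>2) \<le> C / R ^ (CARD('n) + 1)"
proof -
 let ?n = "CARD('n)"
 let ?K = "cutoff (Suc ?n) \<nu> (\<eta>/4)"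
 obtain C1 where C1: "C1 \<ge> 0" "\<And>Om a A R ph. rotation_invariant Om \<Longrightarrow> a \<in> borel_measurable borel \<Longrightarrow> \<forall>y. \<bar>a y\<bar> \<le> A \<and> (a y \<noteq> 0 \<longrightarrow> q y \<in> Z) \<Longrightarrow> R > 0 \<Longrightarrow>
   (LINT om|Om. (LINT y|Y. ?K om * (a y / (q y \<bullet> om)) * cos (R * (q y \<bullet> om) + ph))\<^sup>2) \<le> C1 * A\<^sup>2 / R ^ (?n - 1)"
  by (rule stationary_operator[OF \<nu> \<eta> c, of Z R0]) (erule (1) Z(1), erule (1) Z(2), erule Z(3), rule that)
 obtain r R1 where R1: "R1 > 0" "\<And>y. y \<noteq> 0 \<Longrightarrow> rad y \<le> R1" by (rule rad_bounds) (rule that)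
 have nq: "norm (q y) \<le> R1" for y using norm_q[of y] R1(2)[of y] R1(1) by (cases "y = 0") (auto simp: q_def)
 have q0: "q 0 = 0" by (simp add: q_def)
 have zQ: "0 \<notin> Q" using supp[of 0 0] s0 by (auto simp: q0)
 obtain E0 where E0: "\<And>w x. w \<in> {()} \<Longrightarrow> x \<in> UNIV \<Longrightarrow> (h has_derivative (\<lambda>v. E0 w x \<bullet> v)) (at x)" "\<And>i. UC 0 {()} UNIV (\<lambda>w x. E0 w x $ i)"
  using UC_SucE[of 0 "{()}" UNIV "\<lambda>_. h"] h(1) by (metis One_nat_def)
 define E where "E = E0 ()"
 have E: "(h has_derivative (\<lambda>v. E x \<bullet> v)) (at x)" for x using E0(1)[of "()" x] by (simp add: E_def)
 have "continuous_on UNIV (\<lambda>x. \<chi> i. E x $ i)" using E0(2) by (intro continuous_on_vec_lambda) (auto simp: E_def)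
 then have Ec: "continuous_on UNIV E" by simp
 have hc: "continuous_on UNIV h" using UC_continuous[OF h(1), of "()"] by simp
 have Ez: "E x = 0" if "x \<notin> Q" for x by (rule gradient_zero_outside[OF h(3,2) E that])
 obtain Bh where Bh: "\<And>x. \<bar>h x\<bar> \<le> Bh" using UC_bounded[OF h(1)] by auto
 have "\<exists>B. \<forall>i x. \<bar>E x $ i\<bar> \<le> B"
 proof -
  have "\<exists>B. \<forall>x. \<bar>E x $ i\<bar> \<le> B" for i using E0(2)[of i] by (auto simp: E_def)
  then obtain B where B: "\<And>i x. \<bar>E x $ i\<bar> \<le> B i" by metis
  have "\<bar>E x $ i\<bar> \<le> (\<Sum>i\<in>UNIV. \<bar>B i\<bar>)" for i x
   using B[of x i] member_le_sum[of i UNIV "\<lambda>i. \<bar>B i\<bar>"] by simp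
  then show ?thesis by blast
 qed
 then obtain BE where BE: "\<And>i x. \<bar>E x $ i\<bar> \<le> BE" by blast
 define L where "L = real ?n * BE"
 have L: "norm (E x) \<le> L" for x
  using norm_le_l1_cart[of "E x"] sum_bounded_above[of UNIV "\<lambda>i. \<bar>E x $ i\<bar>" BE] BE by (simp add: L_def)
 have Bh0: "Bh \<ge> 0" and L0: "L \<ge> 0" using Bh[of 0] L[of 0] norm_ge_zero[of "E 0"] by linarith+
 note [measurable] = borel_measurable_continuous_onI[OF hc] borel_measurable_continuous_onI[OF Ec]
 define b where "b = (\<lambda>y s. real ?n * s ^ (?n - 1) * rad y ^ ?n * h (s *\<^sub>R q y))"
 define b' where "b' = (\<lambda>y s. real ?n * rad y ^ ?n * (real (?n - 1) * s ^ (?n - 1 - 1) * h (s *\<^sub>R q y) + s ^ (?n - 1) * (E (s *\<^sub>R q y) \<bullet> q y)))"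
 \<comment> \<open>Cut off to the unit interval, so that bounds and support properties hold for
   every real \<open>s\<close>.\<close>
 define bb where "bb = (\<lambda>y s. if 0 \<le> s \<and> s \<le> 1 then b' y s else 0)"
 define A where "A = real ?n * R1 ^ ?n * (real ?n * Bh + L * R1 + Bh)"
 have A0: "A \<ge> 0" using R1 Bh0 L0 by (simp add: A_def)
 have p01: "\<bar>s ^ k\<bar> \<le> 1" if "0 \<le> s" "s \<le> 1" for s :: real and k using that by (simp add: power_le_one)
 have bA: "\<bar>b y 1\<bar> \<le> A" for y
 proof (cases "y = 0")
  case True then show ?thesis using A0 h(2)[OF zQ] by (simp add: b_def q0)
 next
  case False
  have "rad y ^ ?n \<le> R1 ^ ?n" using R1(2)[OF False] rad_pos[OF False] by (intro power_mono) auto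
  then have "real ?n * rad y ^ ?n * \<bar>h (1 *\<^sub>R q y)\<bar> \<le> real ?n * R1 ^ ?n * (real ?n * Bh + L * R1 + Bh)"
   using Bh[of "1 *\<^sub>R q y"] Bh0 L0 R1(1) rad_pos[OF False] by (intro mult_mono) (auto intro!: add_increasing)
  then show ?thesis using rad_pos[OF False] by (simp add: b_def A_def abs_mult)
 qed
 have bbA: "\<bar>bb y s\<bar> \<le> A" for y s
 proof (cases "y \<noteq> 0 \<and> 0 \<le> s \<and> s \<le> 1")
  case False then show ?thesis using A0 h(2)[OF zQ] Ez[OF zQ] by (auto simp: bb_def b'_def q0)
 next
  case True
  then have y: "y \<noteq> 0" and s: "0 \<le> s" "s \<le> 1" by auto
  have rr: "rad y ^ ?n \<le> R1 ^ ?n" "0 \<le> rad y ^ ?n" using R1(2)[OF y] rad_pos[OF y] by (auto intro!: power_mono)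
  have "\<bar>real (?n - 1) * s ^ (?n - 1 - 1) * h (s *\<^sub>R q y)\<bar> \<le> (real ?n * 1) * Bh"
   unfolding abs_mult by (intro mult_mono Bh p01 s) auto
  moreover have "\<bar>E (s *\<^sub>R q y) \<bullet> q y\<bar> \<le> L * R1"
   using Cauchy_Schwarz_ineq2[of "E (s *\<^sub>R q y)" "q y"] mult_mono[OF L[of "s *\<^sub>R q y"] nq[of y]] L0 by simp
  then have "\<bar>s ^ (?n - 1) * (E (s *\<^sub>R q y) \<bullet> q y)\<bar> \<le> 1 * (L * R1)"
   unfolding abs_mult by (intro mult_mono p01 s) auto
  ultimately have "\<bar>real (?n - 1) * s ^ (?n - 1 - 1) * h (s *\<^sub>R q y) + s ^ (?n - 1) * (E (s *\<^sub>R q y) \<bullet> q y)\<bar> \<le> real ?n * Bh + L * R1 + Bh"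
   using Bh0 by linarith
  then have "(real ?n * rad y ^ ?n) * \<bar>real (?n - 1) * s ^ (?n - 1 - 1) * h (s *\<^sub>R q y) + s ^ (?n - 1) * (E (s *\<^sub>R q y) \<bullet> q y)\<bar> \<le> (real ?n * R1 ^ ?n) * (real ?n * Bh + L * R1 + Bh)"
   using rr by (intro mult_mono) auto
  then show ?thesis using True rr by (simp add: bb_def b'_def A_def abs_mult)
 qed
 have bZ: "q y \<in> Z \<and> s \<ge> s0" if "0 \<le> s" "s \<le> 1" "b y s \<noteq> 0 \<or> b' y s \<noteq> 0" for y s
 proof -
  have "s *\<^sub>R q y \<in> Q"
  proof (rule ccontr)
   assume "s *\<^sub>R q y \<notin> Q"
   then show False using that(3) h(2) Ez by (auto simp: b_def b'_def)
  qed
  then show ?thesis using supp that by blast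
 qed
 have bbZ: "q y \<in> Z \<and> s \<ge> s0 \<and> s \<le> 1" if "bb y s \<noteq> 0" for y s
  using bZ[of s y] that by (auto simp: bb_def split: if_splits)
 have mbb: "(\<lambda>x. bb (fst x) (snd x)) \<in> borel_measurable (borel \<Otimes>\<^sub>M borel)"
  unfolding bb_def b'_def by measurable
 have mb: "(\<lambda>x. b (fst x) (snd x)) \<in> borel_measurable (borel \<Otimes>\<^sub>M borel)"
  unfolding b_def by measurable
 note [measurable (raw)] = measurable_pair_compose[OF mb] measurable_pair_compose[OF mbb]
 have db: "(b y has_real_derivative b' y s) (at s)" for y s
 proof -
  have 1: "((\<lambda>s. s *\<^sub>R q y) has_derivative (\<lambda>t. t *\<^sub>R q y)) (at s)" by (auto intro!: derivative_eq_intros)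
  have "((\<lambda>s. h (s *\<^sub>R q y)) has_derivative (\<lambda>t. E (s *\<^sub>R q y) \<bullet> (t *\<^sub>R q y))) (at s)"
   by (rule has_derivative_compose[OF 1 E])
  then have hd: "((\<lambda>s. h (s *\<^sub>R q y)) has_real_derivative (E (s *\<^sub>R q y) \<bullet> q y)) (at s)"
   unfolding has_field_derivative_def by (rule has_derivative_eq_rhs) (auto simp: mult.commute)
  have "((\<lambda>s. s ^ (?n - 1) * h (s *\<^sub>R q y)) has_real_derivative (real (?n - 1) * s ^ (?n - 1 - 1) * h (s *\<^sub>R q y) + (E (s *\<^sub>R q y) \<bullet> q y) * s ^ (?n - 1))) (at s)"
   using DERIV_mult[OF DERIV_pow[of "?n - 1" s UNIV] hd] by simp
  from DERIV_cmult[OF this, of "real ?n * rad y ^ ?n"] show ?thesis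
   unfolding b_def b'_def by (simp add: mult_ac)
 qed
 have cb: "continuous_on UNIV (b' y)" for y
 proof -
  have "continuous_on UNIV (\<lambda>s. h (s *\<^sub>R q y))" "continuous_on UNIV (\<lambda>s. E (s *\<^sub>R q y))"
   by (rule continuous_on_compose2[OF hc], auto intro!: continuous_intros) (rule continuous_on_compose2[OF Ec], auto intro!: continuous_intros)
  then show ?thesis unfolding b'_def by (intro continuous_intros)
 qed
 have b0: "b y 0 = 0" for y using h(2)[OF zQ] by (simp add: b_def)
 have K0: "?K x = 0" if "x \<notin> ball \<nu> \<eta>" for x
  using that \<eta> by (intro cutoff_0) (auto simp: dist_norm norm_minus_commute)
 have K1: "\<bar>?K x\<bar> \<le> 1" for x using cutoff_range[of "\<eta>/4" "Suc ?n" \<nu> x] \<eta> by simp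
 have "continuous_on UNIV ?K"
  using UC_continuous[OF UC_cutoff[of "\<eta>/4" 0 "Suc ?n" "{()}" \<nu>], of "()"] \<eta> by simp
 then have Km[measurable]: "?K \<in> borel_measurable borel" by (rule borel_measurable_continuous_onI)
 define V where "V = measure Y (space Y)"
 define C where "C = 2 * (C1 * A\<^sup>2) * (1 + 1 / s0 ^ (?n - 1))"
 have by01: "AE s in I01. 0 \<le> s \<and> s \<le> 1"
  unfolding uniform_on_def by (subst AE_density) (auto simp: indicator_def)
 \<comment> \<open>If \<open>om\<close> is in the ball and \<open>q y\<close> in \<open>Z\<close>,
   the phase derivative q(y) . om is at least \<open>c\<close> in modulus and integration by parts
   is legitimate; otherwise both sides vanish. The sines appear as cosines with shifted phase, to
   fit the operator bound.\<close>
 have ibp: "?K om * (LINT s|I01. b y s * cos (R * (om \<bullet> (s *\<^sub>R q y)) + ph)) =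
   (1 / R) * (?K om * (b y 1 / (q y \<bullet> om)) * cos (R * (q y \<bullet> om) + (ph - pi/2))
    - (LINT s|I01. ?K om * (bb y s / (q y \<bullet> om)) * cos ((R * s) * (q y \<bullet> om) + (ph - pi/2))))" if R: "R > 0" for om y R ph
 proof (cases "om \<in> ball \<nu> \<eta> \<and> q y \<in> Z")
  case False
  have cs: "?K om = 0 \<or> q y \<notin> Z" using False K0 by blast
  have "?K om * (LINT s|I01. b y s * cos (R * (om \<bullet> (s *\<^sub>R q y)) + ph)) = 0"
  proof (cases "?K om = 0")
   case f: False
   have "(LINT s|I01. b y s * cos (R * (om \<bullet> (s *\<^sub>R q y)) + ph)) = 0"
    by (rule integral_eq_zero_AE) (use by01 in eventually_elim, use bZ cs f in force)
   then show ?thesis by simp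
  qed simp
  moreover have "?K om * (b y 1 / (q y \<bullet> om)) = 0" using bZ[of 1 y] cs by auto
  moreover have "?K om * (bb y s / (q y \<bullet> om)) = 0" for s using bbZ[of y s] cs by auto
  ultimately show ?thesis by (simp only: mult_zero_left mult_zero_right Bochner_Integration.integral_zero diff_self)
 next
  case True
  let ?L = "q y \<bullet> om"
  have L: "?L \<noteq> 0" using Z(1)[of "q y" om] True c by auto
  have RL: "R * ?L \<noteq> 0" using R L by simp
  have "(LINT s|I01. b y s * cos (R * (om \<bullet> (s *\<^sub>R q y)) + ph)) = (LINT s|I01. b y s * cos (s * (R * ?L) + ph))"
   by (simp add: inner_commute mult_ac)
  also have "\<dots> = (b y 1 * sin (R * ?L + ph) - (LINT s|I01. b' y s * sin (s * (R * ?L) + ph))) / (R * ?L)"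
   by (rule radial_by_parts[OF db cb b0 RL])
  also have "(LINT s|I01. b' y s * sin (s * (R * ?L) + ph)) = (LINT s|I01. bb y s * cos ((R * s) * ?L + (ph - pi/2)))"
  proof (rule integral_cong_AE)
   show "AE s in I01. b' y s * sin (s * (R * ?L) + ph) = bb y s * cos ((R * s) * ?L + (ph - pi/2))"
    using by01
   proof eventually_elim
    case (elim s)
    have "sin (s * (R * ?L) + ph) = cos ((R * s) * ?L + (ph - pi/2))"
     using cos_diff[of "(R * s) * ?L + ph" "pi/2"] by (simp add: algebra_simps)
    then show ?case using elim by (simp add: bb_def)
   qed
  qed (unfold b'_def bb_def, measurable)
  finally have e: "(LINT s|I01. b y s * cos (R * (om \<bullet> (s *\<^sub>R q y)) + ph))
    = (b y 1 * sin (R * ?L + ph) - (LINT s|I01. bb y s * cos ((R * s) * ?L + (ph - pi/2)))) / (R * ?L)" .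
  have s1: "sin (R * ?L + ph) = cos (R * ?L + (ph - pi/2))"
   using cos_diff[of "R * ?L + ph" "pi/2"] by (simp add: algebra_simps)
  have "(LINT s|I01. ?K om * (bb y s / ?L) * cos ((R * s) * ?L + (ph - pi/2))) = (LINT s|I01. (?K om / ?L) * (bb y s * cos ((R * s) * ?L + (ph - pi/2))))"
   by (rule Bochner_Integration.integral_cong) auto
  also have "\<dots> = (?K om / ?L) * (LINT s|I01. bb y s * cos ((R * s) * ?L + (ph - pi/2)))" by (rule integral_mult_right_zero)
  finally have s2: "(LINT s|I01. ?K om * (bb y s / ?L) * cos ((R * s) * ?L + (ph - pi/2))) = (?K om / ?L) * (LINT s|I01. bb y s * cos ((R * s) * ?L + (ph - pi/2)))" .
  show ?thesis unfolding e s1 s2 using R L by (simp add: field_simps)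
 qed
 show ?thesis
 proof (rule that[of C])
  fix Om :: "(real^'n) measure" and R ph :: real
  assume Om: "rotation_invariant Om" and R1': "R \<ge> 1"
  have R: "R > 0" using R1' by simp
  have pO: "prob_space Om" using Om by (simp add: rotation_invariant_def)
  interpret prob_space Om by (rule pO)
  have so[measurable_cong]: "sets Om = sets borel" using Om by (simp add: rotation_invariant_def)
  have fin: "finite_measure Om" by unfold_locales
  interpret YY: finite_measure Y by (rule finite_Y)
  interpret II: prob_space I01 by (rule prob_I01)
  define ph' where "ph' = ph - pi/2"
  define T1 where "T1 = (\<lambda>om. LINT y|Y. ?K om * (b y 1 / (q y \<bullet> om)) * cos (R * (q y \<bullet> om) + ph'))"
  define G where "G = (\<lambda>om s. LINT y|Y. ?K om * (bb y s / (q y \<bullet> om)) * cos ((R * s) * (q y \<bullet> om) + ph'))"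
  have Ac: "A / c \<ge> 0" using A0 c by simp
  have KA: "\<bar>?K om * (a / (q y \<bullet> om)) * cos t\<bar> \<le> A / c" if "\<bar>a\<bar> \<le> A" "a \<noteq> 0 \<longrightarrow> q y \<in> Z" for om y a t
  proof (cases "om \<in> ball \<nu> \<eta> \<and> a \<noteq> 0")
   case True
   then have "\<bar>q y \<bullet> om\<bar> \<ge> c" using Z(1) that by blast
   then have "\<bar>a\<bar> / \<bar>q y \<bullet> om\<bar> \<le> A / c" using that A0 c by (intro frac_le) auto
   then have "\<bar>?K om\<bar> * (\<bar>a\<bar> / \<bar>q y \<bullet> om\<bar>) * \<bar>cos t\<bar> \<le> 1 * (A / c) * 1" using K1 Ac by (intro mult_mono mult_nonneg_nonneg) auto
   then show ?thesis by (simp add: abs_mult)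
  qed (use K0 Ac in auto)
  have A1: "\<bar>?K om * (b y 1 / (q y \<bullet> om)) * cos t\<bar> \<le> A / c" for om y t
   by (rule KA[OF bA]) (use bZ[of 1 y] in auto)
  have A2: "\<bar>?K om * (bb y s / (q y \<bullet> om)) * cos t\<bar> \<le> A / c" for om y s t
   by (rule KA[OF bbA]) (use bbZ[of y s] in auto)
  have mT1[measurable]: "T1 \<in> borel_measurable borel"
   unfolding T1_def by (rule YY.borel_measurable_lebesgue_integral) measurable
  have mG: "(\<lambda>x. G (fst x) (snd x)) \<in> borel_measurable (borel \<Otimes>\<^sub>M borel)"
   unfolding G_def by (rule YY.borel_measurable_lebesgue_integral) measurable
  note [measurable (raw)] = measurable_pair_compose[OF mG]
  have bint: "\<bar>LINT y|Y. f y\<bar> \<le> A / c * V" if "\<And>y. \<bar>f y\<bar> \<le> A / c" "f \<in> borel_measurable borel" for f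
  proof -
   have i: "integrable Y f" by (rule integrable_bounded_finite[OF finite_Y _ that(1)]) (use that(2) in simp)
   have "\<bar>LINT y|Y. f y\<bar> \<le> (LINT y|Y. \<bar>f y\<bar>)" by (rule integral_abs_bound)
   also have "\<dots> \<le> (LINT y|Y. A / c)" by (rule integral_mono) (use i that in auto)
   finally show ?thesis by (simp add: V_def mult.commute)
  qed
  have T1b: "\<bar>T1 om\<bar> \<le> A / c * V" for om unfolding T1_def by (rule bint[OF A1]) measurable
  have Gb: "\<bar>G om s\<bar> \<le> A / c * V" for om s unfolding G_def by (rule bint[OF A2]) measurable
  have sq: "\<bar>x\<^sup>2\<bar> \<le> T\<^sup>2" if "\<bar>x\<bar> \<le> T" for x T :: real using power_mono[OF that, of 2] by simp
  define U where "U = (\<lambda>om. LINT s|I01. G om s)"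
  have mU[measurable]: "U \<in> borel_measurable borel"
   unfolding U_def by (rule II.borel_measurable_lebesgue_integral) measurable
  have iG: "integrable I01 (\<lambda>s. G om s)" for om
   by (rule integrable_bounded_finite[OF finite_I01 _ Gb]) measurable
  have Ub: "\<bar>U om\<bar> \<le> A / c * V" for om
  proof -
   have "\<bar>U om\<bar> \<le> (LINT s|I01. \<bar>G om s\<bar>)" unfolding U_def by (rule integral_abs_bound)
   also have "\<dots> \<le> (LINT s|I01. A / c * V)" by (rule integral_mono) (use iG Gb in auto)
   finally show ?thesis by (simp add: II.prob_space)
  qed
  have eq: "?K om * osc h R ph om = (1 / R) * (T1 om - U om)" for om
  proof -
   have hb: "\<bar>h x * cos (R * (om \<bullet> x) + ph)\<bar> \<le> Bh" for x
   proof -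
    have "\<bar>h x\<bar> * \<bar>cos (R * (om \<bullet> x) + ph)\<bar> \<le> Bh * 1" by (intro mult_mono Bh) (use Bh0 in auto)
    then show ?thesis by (simp add: abs_mult)
   qed
   have "osc h R ph om = (LINT y|Y. LINT s|I01. real ?n * s ^ (?n - 1) * rad y ^ ?n * (h (s *\<^sub>R q y) * cos (R * (om \<bullet> (s *\<^sub>R q y)) + ph)))"
    unfolding osc_def by (rule polar_Y[OF _ hb]) measurable
   also have "\<dots> = (LINT y|Y. LINT s|I01. b y s * cos (R * (om \<bullet> (s *\<^sub>R q y)) + ph))"
    unfolding b_def by (simp add: mult.assoc)
   finally have "?K om * osc h R ph om = (LINT y|Y. ?K om * (LINT s|I01. b y s * cos (R * (om \<bullet> (s *\<^sub>R q y)) + ph)))"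
    by simp
   also have "\<dots> = (LINT y|Y. (1 / R) * (?K om * (b y 1 / (q y \<bullet> om)) * cos (R * (q y \<bullet> om) + ph')
    - (LINT s|I01. ?K om * (bb y s / (q y \<bullet> om)) * cos ((R * s) * (q y \<bullet> om) + ph'))))"
    unfolding ibp[OF R] ph'_def ..
   also have "\<dots> = (1 / R) * (LINT y|Y. (?K om * (b y 1 / (q y \<bullet> om)) * cos (R * (q y \<bullet> om) + ph')
    - (LINT s|I01. ?K om * (bb y s / (q y \<bullet> om)) * cos ((R * s) * (q y \<bullet> om) + ph'))))"
    by (rule integral_mult_right_zero)
   also have "(LINT y|Y. (?K om * (b y 1 / (q y \<bullet> om)) * cos (R * (q y \<bullet> om) + ph')
    - (LINT s|I01. ?K om * (bb y s / (q y \<bullet> om)) * cos ((R * s) * (q y \<bullet> om) + ph')))) =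
     T1 om - (LINT y|Y. LINT s|I01. ?K om * (bb y s / (q y \<bullet> om)) * cos ((R * s) * (q y \<bullet> om) + ph'))"
    unfolding T1_def
   proof (rule Bochner_Integration.integral_diff)
    show "integrable Y (\<lambda>y. ?K om * (b y 1 / (q y \<bullet> om)) * cos (R * (q y \<bullet> om) + ph'))"
     by (rule integrable_bounded_finite[OF finite_Y _ A1]) measurable
    have mm: "(\<lambda>y. LINT s|I01. ?K om * (bb y s / (q y \<bullet> om)) * cos ((R * s) * (q y \<bullet> om) + ph')) \<in> borel_measurable borel"
     by (rule II.borel_measurable_lebesgue_integral) measurable
    have "\<bar>LINT s|I01. ?K om * (bb y s / (q y \<bullet> om)) * cos ((R * s) * (q y \<bullet> om) + ph')\<bar> \<le> A / c" for y
    proof -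
     have i: "integrable I01 (\<lambda>s. ?K om * (bb y s / (q y \<bullet> om)) * cos ((R * s) * (q y \<bullet> om) + ph'))"
      by (rule integrable_bounded_finite[OF finite_I01 _ A2]) measurable
     show ?thesis by (rule prob_abs_integral_le[OF prob_I01 i A2])
    qed
    then show "integrable Y (\<lambda>y. LINT s|I01. ?K om * (bb y s / (q y \<bullet> om)) * cos ((R * s) * (q y \<bullet> om) + ph'))"
     by (intro integrable_bounded_finite[OF finite_Y]) (use mm in auto)
   qed
   also have "(LINT y|Y. LINT s|I01. ?K om * (bb y s / (q y \<bullet> om)) * cos ((R * s) * (q y \<bullet> om) + ph')) = U om"
    unfolding U_def G_def by (rule Fubini_bounded(1)[OF finite_Y finite_I01 _ A2]) measurable
   finally show ?thesis .
  qed
  have iT: "integrable Om (\<lambda>om. (T1 om)\<^sup>2)" "integrable Om (\<lambda>om. (U om)\<^sup>2)"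
   by (rule integrable_bounded_finite[OF fin _ sq[OF T1b]], measurable) (rule integrable_bounded_finite[OF fin _ sq[OF Ub]], measurable)
  have I1: "(LINT om|Om. (T1 om)\<^sup>2) \<le> C1 * A\<^sup>2 / R ^ (?n - 1)"
   unfolding T1_def by (rule C1(2)[OF Om _ _ R]) (use bZ[of 1] bA in \<open>auto\<close>)
  \<comment> \<open>The square of the average over \<open>s\<close> is at most the average of the
    squares. For each \<open>s\<close> the operator bound holds at frequency R s, and only s at
    least \<open>s0\<close> contributes.\<close>
  have I2: "(LINT om|Om. (U om)\<^sup>2) \<le> C1 * A\<^sup>2 / (R * s0) ^ (?n - 1)"
  proof -
   have iG2: "integrable I01 (\<lambda>s. (G om s)\<^sup>2)" for om by (rule integrable_bounded_finite[OF finite_I01 _ sq[OF Gb]]) measurable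
   have "(LINT om|Om. (U om)\<^sup>2) \<le> (LINT om|Om. LINT s|I01. (G om s)\<^sup>2)"
   proof (rule integral_mono)
    show "integrable Om (\<lambda>om. (U om)\<^sup>2)" by (rule iT)
    show "(U om)\<^sup>2 \<le> (LINT s|I01. (G om s)\<^sup>2)" for om
     unfolding U_def by (rule square_integral_le[OF prob_I01 _ Gb]) measurable
    have mm: "(\<lambda>om. LINT s|I01. (G om s)\<^sup>2) \<in> borel_measurable borel"
     by (rule II.borel_measurable_lebesgue_integral) measurable
    have "\<bar>LINT s|I01. (G om s)\<^sup>2\<bar> \<le> (A / c * V)\<^sup>2" for om
    proof -
     have "(LINT s|I01. (G om s)\<^sup>2) \<le> (LINT s|I01. (A / c * V)\<^sup>2)" by (rule integral_mono) (use iG2 sq[OF Gb] in auto)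
     moreover have "0 \<le> (LINT s|I01. (G om s)\<^sup>2)" by simp
     ultimately show ?thesis by (simp add: II.prob_space)
    qed
    then show "integrable Om (\<lambda>om. LINT s|I01. (G om s)\<^sup>2)"
     by (intro integrable_bounded_finite[OF fin]) (use mm so in \<open>auto cong: measurable_cong_sets\<close>)
   qed
   also have "\<dots> = (LINT s|I01. LINT om|Om. (G om s)\<^sup>2)"
    by (rule Fubini_bounded(1)[OF fin finite_I01 _ sq[OF Gb]]) measurable
   also have "\<dots> \<le> (LINT s|I01. C1 * A\<^sup>2 / (R * s0) ^ (?n - 1))"
   proof (rule integral_mono')
    show "(LINT om|Om. (G om s)\<^sup>2) \<le> C1 * A\<^sup>2 / (R * s0) ^ (?n - 1)" for s
    proof (cases "\<exists>y. bb y s \<noteq> 0")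
     case False
     then have "G om s = 0" for om by (simp add: G_def)
     then show ?thesis using C1(1) R s0 by simp
    next
     case True
     then have s: "s \<ge> s0" using bbZ by blast
     then have Rs: "R * s > 0" using R s0 by simp
     have "(LINT om|Om. (G om s)\<^sup>2) \<le> C1 * A\<^sup>2 / (R * s) ^ (?n - 1)"
      unfolding G_def by (rule C1(2)[OF Om _ _ Rs]) (use bbZ bbA in \<open>auto\<close>)
     also have "\<dots> \<le> C1 * A\<^sup>2 / (R * s0) ^ (?n - 1)"
      using s R s0 C1(1) by (intro divide_left_mono power_mono mult_pos_pos) auto
     finally show ?thesis .
    qed
    show "0 \<le> C1 * A\<^sup>2 / (R * s0) ^ (?n - 1)" using C1(1) R s0 by simp
   qed simp
   also have "\<dots> = C1 * A\<^sup>2 / (R * s0) ^ (?n - 1)" by (simp add: II.prob_space)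
   finally show ?thesis .
  qed
  have "(LINT om|Om. (?K om * osc h R ph om)\<^sup>2) = (LINT om|Om. (1 / R)\<^sup>2 * (T1 om - U om)\<^sup>2)"
   unfolding eq power_mult_distrib ..
  also have "\<dots> \<le> (LINT om|Om. (1 / R)\<^sup>2 * (2 * (T1 om)\<^sup>2 + 2 * (U om)\<^sup>2))"
  proof (rule integral_mono')
   show "integrable Om (\<lambda>om. (1 / R)\<^sup>2 * (2 * (T1 om)\<^sup>2 + 2 * (U om)\<^sup>2))" using iT by simp
   have "(x - y)\<^sup>2 \<le> 2 * x\<^sup>2 + 2 * y\<^sup>2" for x y :: real
    using zero_le_power2[of "x + y"] by (simp add: power2_eq_square algebra_simps)
   then show "(1 / R)\<^sup>2 * (T1 om - U om)\<^sup>2 \<le> (1 / R)\<^sup>2 * (2 * (T1 om)\<^sup>2 + 2 * (U om)\<^sup>2)" for om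
    by (intro mult_left_mono) auto
  qed simp
  also have "\<dots> = (1 / R)\<^sup>2 * (2 * (LINT om|Om. (T1 om)\<^sup>2) + 2 * (LINT om|Om. (U om)\<^sup>2))" using iT by simp
  also have "\<dots> \<le> (1 / R)\<^sup>2 * (2 * (C1 * A\<^sup>2 / R ^ (?n - 1)) + 2 * (C1 * A\<^sup>2 / (R * s0) ^ (?n - 1)))"
   using I1 I2 by (intro mult_left_mono) auto
  also have "\<dots> = C / (R\<^sup>2 * R ^ (?n - 1))"
   using R s0 by (simp add: C_def power_mult_distrib power_divide field_simps)
  also have "R\<^sup>2 * R ^ (?n - 1) = R ^ (?n + 1)"
  proof -
   have "2 + (?n - 1) = ?n + 1" using zero_less_card_finite[where 'a='n] by linarith
   then show ?thesis by (metis power_add)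
  qed
  finally show "(LINT om|Om. (?K om * osc h R ph om)\<^sup>2) \<le> C / R ^ (?n + 1)" .
 qed
qed

end

context analytic_body
begin

text \<open>The constant is uniform over rotation-invariant measures, since orbits of many different
  unit vectors will be used. In mean square the rate is that of a boundary with nonvanishing
  curvature.\<close>

definition avg_decay :: "(real^'n \<Rightarrow> real) \<Rightarrow> bool" where
 "avg_decay h \<longleftrightarrow> (\<exists>C. \<forall>Om R ph. rotation_invariant Om \<longrightarrow> R \<ge> 1 \<longrightarrow>
   (LINT om|Om. (osc h R ph om)\<^sup>2) \<le> C / R ^ (CARD('n) + 1))"

lemma osc_measurable:
 assumes "UC 0 {()} UNIV (\<lambda>_. h)"
 shows "osc h R ph \<in> borel_measurable borel" "\<exists>B. \<forall>R ph om. \<bar>osc h R ph om\<bar> \<le> B"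
  "integrable (uniform_on D) (\<lambda>x. h x * cos (R * (om \<bullet> x) + ph))"
proof -
 have hc: "continuous_on UNIV h" using UC_continuous[OF assms, of "()"] by simp
 note [measurable] = borel_measurable_continuous_onI[OF hc]
 interpret FD: finite_measure "uniform_on D" by (rule finite_D)
 show "osc h R ph \<in> borel_measurable borel"
  unfolding osc_def by (rule FD.borel_measurable_lebesgue_integral) measurable
 obtain B where B: "\<And>x. \<bar>h x\<bar> \<le> B" using UC_bounded[OF assms] by auto
 have b: "\<bar>h x * cos t\<bar> \<le> B" for x t
 proof -
  have "\<bar>h x\<bar> * \<bar>cos t\<bar> \<le> B * 1" using order_trans[OF abs_ge_zero B] by (intro mult_mono B) auto
  then show ?thesis by (simp add: abs_mult)
 qed
 have i: "integrable (uniform_on D) (\<lambda>x. h x * cos (R * (om \<bullet> x) + ph))" for R ph om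
  by (rule integrable_bounded_finite[OF finite_D _ b]) measurable
 then show "integrable (uniform_on D) (\<lambda>x. h x * cos (R * (om \<bullet> x) + ph))" .
 have "\<bar>osc h R ph om\<bar> \<le> measure (uniform_on D) (space (uniform_on D)) * B" for R ph om
 proof -
  have "\<bar>osc h R ph om\<bar> \<le> (LINT x|uniform_on D. \<bar>h x * cos (R * (om \<bullet> x) + ph)\<bar>)"
   unfolding osc_def by (rule integral_abs_bound)
  also have "\<dots> \<le> (LINT x|uniform_on D. B)" by (rule integral_mono) (use i b in \<open>auto intro!: integrable_abs\<close>)
  finally show ?thesis by simp
 qed
 then show "\<exists>B. \<forall>R ph om. \<bar>osc h R ph om\<bar> \<le> B" by blast
qed

lemma osc_sq_integrable:
 assumes "UC 0 {()} UNIV (\<lambda>_. h)" "rotation_invariant Om"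
 shows "integrable Om (\<lambda>om. (osc h R ph om)\<^sup>2)"
proof -
 interpret prob_space Om using assms by (simp add: rotation_invariant_def)
 have so[measurable_cong]: "sets Om = sets borel" using assms by (simp add: rotation_invariant_def)
 have fin: "finite_measure Om" by unfold_locales
 obtain B where B: "\<And>om. \<bar>osc h R ph om\<bar> \<le> B" using osc_measurable(2)[OF assms(1)] by blast
 note [measurable] = osc_measurable(1)[OF assms(1)]
 have "\<bar>(osc h R ph om)\<^sup>2\<bar> \<le> B\<^sup>2" for om using power_mono[OF B[of om], of 2] by simp
 then show ?thesis by (intro integrable_bounded_finite[OF fin, where B="B\<^sup>2"]) measurable
qed

lemma avg_decay_add:
 assumes "UC 0 {()} UNIV (\<lambda>_. h)" "UC 0 {()} UNIV (\<lambda>_. g)" "avg_decay h" "avg_decay g"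
 shows "avg_decay (\<lambda>x. h x + g x)"
proof -
 obtain C1 where C1: "\<And>Om R ph. rotation_invariant Om \<Longrightarrow> R \<ge> 1 \<Longrightarrow> (LINT om|Om. (osc h R ph om)\<^sup>2) \<le> C1 / R ^ (CARD('n) + 1)"
  using assms(3) unfolding avg_decay_def by blast
 obtain C2 where C2: "\<And>Om R ph. rotation_invariant Om \<Longrightarrow> R \<ge> 1 \<Longrightarrow> (LINT om|Om. (osc g R ph om)\<^sup>2) \<le> C2 / R ^ (CARD('n) + 1)"
  using assms(4) unfolding avg_decay_def by blast
 have "(LINT om|Om. (osc (\<lambda>x. h x + g x) R ph om)\<^sup>2) \<le> (2 * C1 + 2 * C2) / R ^ (CARD('n) + 1)"
  if Om: "rotation_invariant Om" and R: "R \<ge> 1" for Om R ph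
 proof -
  note ih = osc_sq_integrable[OF assms(1) Om, of R ph] and ig = osc_sq_integrable[OF assms(2) Om, of R ph]
  have e: "osc (\<lambda>x. h x + g x) R ph om = osc h R ph om + osc g R ph om" for om
   unfolding osc_def distrib_right
   by (rule Bochner_Integration.integral_add) (rule osc_measurable(3)[OF assms(1)], rule osc_measurable(3)[OF assms(2)])
  have "(LINT om|Om. (osc (\<lambda>x. h x + g x) R ph om)\<^sup>2) \<le> (LINT om|Om. 2 * (osc h R ph om)\<^sup>2 + 2 * (osc g R ph om)\<^sup>2)"
  proof (rule integral_mono')
   show "integrable Om (\<lambda>om. 2 * (osc h R ph om)\<^sup>2 + 2 * (osc g R ph om)\<^sup>2)" using ih ig by simp
   have "(x + y)\<^sup>2 \<le> 2 * x\<^sup>2 + 2 * y\<^sup>2" for x y :: real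
    using zero_le_power2[of "x - y"] by (simp add: power2_eq_square algebra_simps)
   then show "(osc (\<lambda>x. h x + g x) R ph om)\<^sup>2 \<le> 2 * (osc h R ph om)\<^sup>2 + 2 * (osc g R ph om)\<^sup>2" for om
    unfolding e by blast
  qed simp
  also have "\<dots> = 2 * (LINT om|Om. (osc h R ph om)\<^sup>2) + 2 * (LINT om|Om. (osc g R ph om)\<^sup>2)" using ih ig by simp
  also have "\<dots> \<le> 2 * (C1 / R ^ (CARD('n) + 1)) + 2 * (C2 / R ^ (CARD('n) + 1))"
   using C1[OF Om R, of ph] C2[OF Om R, of ph] by linarith
  also have "\<dots> = (2 * C1 + 2 * C2) / R ^ (CARD('n) + 1)" by (simp add: add_divide_distrib)
  finally show ?thesis .
 qed
 then show ?thesis unfolding avg_decay_def by blast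
qed

lemma power_compare:
 assumes "(R::real) \<ge> 1" shows "(C / R ^ CARD('n))\<^sup>2 \<le> C\<^sup>2 / R ^ (CARD('n) + 1)"
proof -
 have "R ^ (CARD('n) + 1) \<le> R ^ (2 * CARD('n))" using assms card2 by (intro power_increasing) auto
 also have "\<dots> = (R ^ CARD('n))\<^sup>2" by (simp add: power_mult[symmetric] mult.commute)
 finally show ?thesis unfolding power_divide using assms by (intro divide_left_mono) auto
qed

text \<open>A unit vector has a coordinate of modulus at least 1/n, because its coordinates have
  absolute sum at least 1. The constant field in that coordinate direction serves for nonstationary
  phase, and the boundary is not met.\<close>

lemma osc_interior:
 assumes "cball x0 r \<subseteq> D" "UC CARD('n) {()} UNIV (\<lambda>_. h)" "\<And>x. x \<notin> cball x0 r \<Longrightarrow> h x = 0"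
 shows "\<exists>C. \<forall>om R ph. norm om = 1 \<longrightarrow> R \<ge> 1 \<longrightarrow> \<bar>osc h R ph om\<bar> \<le> C / R ^ CARD('n)"
proof -
 let ?n = "CARD('n)"
 define W where "W = (\<lambda>i. {om::real^'n. norm om = 1 \<and> \<bar>om $ i\<bar> \<ge> 1 / real ?n})"
 have nsp: "\<exists>C. \<forall>M w lam ph. w \<in> W i \<longrightarrow> lam > 0 \<longrightarrow> sets M = sets borel \<longrightarrow> finite_measure M \<longrightarrow> measure M UNIV \<le> measure lborel D \<longrightarrow>
    null_div M (cball x0 r) (\<lambda>_. axis i 1) (\<lambda>_. 0) \<longrightarrow> \<bar>LINT x|M. h x * cos (lam * (w \<bullet> x) + ph)\<bar> \<le> C / lam ^ ?n" for i
 proof (rule nonstationary_phase[where S=UNIV and c="1 / real ?n" and W="W i" and a="\<lambda>_. h" and u="\<lambda>w. w"])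
  show "UC ?n (W i) UNIV (\<lambda>w x. axis i 1 $ k)" for k by (rule UC_const[where M=1]) (auto simp: axis_def)
  show "UC ?n (W i) UNIV (\<lambda>w x. 0)" by (rule UC_const[where M=0]) auto
  show "UC ?n (W i) UNIV (\<lambda>_. h)" using UC_reindex[OF assms(2), of "W i" "\<lambda>_. ()"] by simp
 qed (use assms(3) in \<open>auto simp: W_def inner_axis\<close>)
 define PP where "PP = (\<lambda>i C. \<forall>M w lam ph. w \<in> W i \<longrightarrow> lam > 0 \<longrightarrow> sets M = sets borel \<longrightarrow> finite_measure M \<longrightarrow> measure M UNIV \<le> measure lborel D \<longrightarrow>
    null_div M (cball x0 r) (\<lambda>_. axis i 1) (\<lambda>_. 0) \<longrightarrow> \<bar>LINT x|M. h x * cos (lam * (w \<bullet> x) + ph)\<bar> \<le> C / lam ^ ?n)"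
 have "\<exists>C. PP i C" for i unfolding PP_def by (rule nsp)
 then obtain Cf where Cf: "\<And>i. PP i (Cf i)" by metis
 define C where "C = (\<Sum>i\<in>UNIV. \<bar>Cf i\<bar>)"
 have pw: "\<bar>osc h R ph om\<bar> \<le> C / R ^ ?n" if "norm om = 1" "R \<ge> 1" for om R ph
 proof -
  have "\<exists>i. \<bar>om $ i\<bar> \<ge> 1 / real ?n"
  proof (rule ccontr)
   assume "\<not> (\<exists>i. \<bar>om $ i\<bar> \<ge> 1 / real ?n)"
   then have "\<bar>om $ i\<bar> < 1 / real ?n" for i by (auto simp: not_le)
   then have "(\<Sum>i\<in>UNIV. \<bar>om $ i\<bar>) < (\<Sum>i\<in>(UNIV::'n set). 1 / real ?n)" by (intro sum_strict_mono) auto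
   then show False using norm_le_l1_cart[of om] \<open>norm om = 1\<close> by simp
  qed
  then obtain i where i: "\<bar>om $ i\<bar> \<ge> 1 / real ?n" by blast
  have fin: "finite_measure (uniform_on D)" "measure (uniform_on D) UNIV = measure lborel D"
   using uniform_on_finite[OF body_borel bounded_body] by auto
  have "\<bar>osc h R ph om\<bar> \<le> Cf i / R ^ ?n"
   using Cf[of i, unfolded PP_def] i that fin null_div_interior[OF compact_cball assms(1) body_borel, of i]
   unfolding osc_def W_def by simp
  also have "\<dots> \<le> C / R ^ ?n"
  proof (rule divide_right_mono)
   have "Cf i \<le> \<bar>Cf i\<bar>" by simp
   also have "\<dots> \<le> C" unfolding C_def by (rule member_le_sum) auto
   finally show "Cf i \<le> C" .
  qed (use that in simp)
  finally show ?thesis .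
 qed
 then show ?thesis by blast
qed

lemma avg_decay_interior:
 assumes "cball x0 r \<subseteq> D" "UC CARD('n) {()} UNIV (\<lambda>_. h)" "\<And>x. x \<notin> cball x0 r \<Longrightarrow> h x = 0"
 shows "avg_decay h"
proof -
 let ?n = "CARD('n)"
 obtain C where pw: "\<And>om R ph. norm om = 1 \<Longrightarrow> R \<ge> 1 \<Longrightarrow> \<bar>osc h R ph om\<bar> \<le> C / R ^ ?n"
  using osc_interior[OF assms] by blast
 have h0: "UC 0 {()} UNIV (\<lambda>_. h)" using UC_0[OF assms(2)] .
 have "(LINT om|Om. (osc h R ph om)\<^sup>2) \<le> C\<^sup>2 / R ^ (?n + 1)"
  if Om: "rotation_invariant Om" and R: "R \<ge> 1" for Om R ph
 proof -
  interpret prob_space Om using Om by (simp add: rotation_invariant_def)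
  have "(LINT om|Om. (osc h R ph om)\<^sup>2) \<le> (LINT om|Om. C\<^sup>2 / R ^ (?n + 1))"
  proof (rule integral_mono_AE)
   have "AE om in Om. norm om = 1" using Om by (simp add: rotation_invariant_def)
   then show "AE om in Om. (osc h R ph om)\<^sup>2 \<le> C\<^sup>2 / R ^ (?n + 1)"
   proof eventually_elim
    case (elim om)
    have "(osc h R ph om)\<^sup>2 \<le> (C / R ^ ?n)\<^sup>2" using power_mono[OF pw[OF elim R, of ph], of 2] by simp
    then show ?case using power_compare[OF R, of C] by linarith
   qed
  qed (use osc_sq_integrable[OF h0 Om] in auto)
  then show ?thesis by (simp add: prob_space)
 qed
 then show ?thesis unfolding avg_decay_def by blast
qed

text \<open>Directions are split by their distance from the two unit normals at \<open>p\<close>.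
  Near a normal the \<open>L^2\<close> estimate applies; away from both, a field tangent to the
  boundary is transversal to the direction and nonstationary phase gives pointwise decay R^(-n),
  whose square is good enough as 2n is at least n + 1.\<close>

lemma avg_decay_frontier:
 assumes p: "p \<in> frontier D"
 obtains r where "r > 0" "\<And>h. UC CARD('n) {()} UNIV (\<lambda>_. h) \<Longrightarrow> \<forall>x. x \<notin> cball p r \<longrightarrow> h x = 0 \<Longrightarrow> avg_decay h"
proof -
 let ?n = "CARD('n)"
 obtain F G H rc where rc: "rc > 0"
  and FU: "\<And>k. UC k {()} (ball p rc) (\<lambda>_. F)" and GU: "\<And>k i. UC k {()} (ball p rc) (\<lambda>_ x. G x $ i)"
  and HU: "\<And>k i j. UC k {()} (ball p rc) (\<lambda>_ x. H i x $ j)"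
  and FG: "\<And>x. x \<in> ball p rc \<Longrightarrow> (F has_derivative (\<lambda>v. G x \<bullet> v)) (at x)"
  and GH: "\<And>i x. x \<in> ball p rc \<Longrightarrow> ((\<lambda>x. G x $ i) has_derivative (\<lambda>v. H i x \<bullet> v)) (at x)"
  and Gp: "G p \<bullet> p \<noteq> 0" and Fz: "\<And>x. x \<in> ball p rc \<Longrightarrow> x \<in> frontier D \<Longrightarrow> F x = 0"
  and side: "AE x in lborel. x \<in> ball p rc \<longrightarrow> (x \<in> D \<longleftrightarrow> F x < 0)"
  by (rule frontier_chart[OF p]) (rule that)
 define g where "g = G p"
 have g0: "g \<noteq> 0" using Gp by (auto simp: g_def)
 have ng: "norm g > 0" using g0 by simp
 define \<nu> where "\<nu> = g /\<^sub>R norm g"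
 have \<nu>1: "norm \<nu> = 1" using g0 by (simp add: \<nu>_def)
 have g\<nu>: "g = norm g *\<^sub>R \<nu>" using g0 by (simp add: \<nu>_def)
 have p0: "p \<noteq> 0" using frontier_body_D[OF p] by simp
 define e where "e = \<bar>\<nu> \<bullet> p\<bar>"
 have e: "e > 0" using Gp g0 by (simp add: e_def \<nu>_def g_def)
 \<comment> \<open>The first bound is required by \<open>stationary_kernel\<close>; the second keeps
   z . x away from 0 for boundary points near \<open>p\<close> and directions near the
   normal.\<close>
 define \<eta> where "\<eta> = min (1 / (8 * real ?n)) (e / (8 * norm p))"
 have \<eta>: "\<eta> > 0" "\<eta> \<le> 1 / (8 * real ?n)" "\<eta> * norm p \<le> e / 8"
 proof -
  show "\<eta> > 0" "\<eta> \<le> 1 / (8 * real ?n)" using e p0 by (auto simp: \<eta>_def)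
  have "\<eta> * norm p \<le> e / (8 * norm p) * norm p" by (intro mult_right_mono) (auto simp: \<eta>_def)
  then show "\<eta> * norm p \<le> e / 8" using p0 by simp
 qed
 have n1: "real ?n \<ge> 1" using zero_less_card_finite[where 'a='n] by linarith
 have \<eta>1: "\<eta> \<le> 1" 
 proof -
  have "1 \<le> 8 * real ?n" using n1 by linarith
  then have "1 / (8 * real ?n) \<le> 1" by simp
  then show ?thesis using \<eta>(2) by linarith
 qed
 \<comment> \<open>A unit vector at distance at least \<eta>/4 from both normals satisfies |om .
   \<nu>| \<le> 1 - t, since the squared distances are 2 - 2 om . \<nu> and 2 + 2 om .
   \<nu>.\<close>
 define t where "t = \<eta>\<^sup>2 / 32"
 have t: "t > 0" "t \<le> 1" using \<eta>(1) power_le_one[of \<eta> 2] \<eta>1 by (auto simp: t_def)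
 \<comment> \<open>The size of the minor that \<open>exists_wedge\<close> then provides.\<close>
 define c2 where "c2 = sqrt t / real ?n"
 have c2: "c2 > 0" using t by (simp add: c2_def)
 have "continuous_on (ball p rc) (\<lambda>x. \<chi> i. G x $ i)"
  using UC_continuous[OF GU[of 0], of "()"] by (intro continuous_on_vec_lambda) auto
 then have "continuous_on (ball p rc) G" by simp
 then have "isCont G p" using rc by (simp add: continuous_on_eq_continuous_at)
 \<comment> \<open>Closeness of the gradient to \<open>g\<close> within 1/2 of its length makes
   secants nearly tangent; within c2/4 it keeps the tangential fields transversal to far directions,
   since two such errors leave half of the minor.\<close>
 moreover have "norm g * min (1/2) (c2 / 4) > 0" using ng c2 by simp
 ultimately have "\<forall>\<^sub>F x in nhds p. dist (G x) (G p) < norm g * min (1/2) (c2 / 4)"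
  by (simp add: isCont_def eventually_nhds_conv_at tendstoD del: min_less_iff_conj)
 then obtain d1 where d1: "d1 > 0" "\<And>x. dist x p < d1 \<Longrightarrow> dist (G x) (G p) < norm g * min (1/2) (c2 / 4)"
  unfolding eventually_nhds_metric by blast
 define \<delta>3 where "\<delta>3 = min rc d1"
 have \<delta>3: "\<delta>3 > 0" "ball p \<delta>3 \<subseteq> ball p rc" using rc d1 by (auto simp: \<delta>3_def)
 have Gn: "norm (G x - g) \<le> norm g / 2" "norm (G x - g) \<le> norm g * (c2 / 4)" if "x \<in> ball p \<delta>3" for x
 proof -
  have "norm (G x - g) < norm g * min (1/2) (c2 / 4)"
   using d1(2)[of x] that by (simp add: \<delta>3_def dist_commute[of x] g_def dist_norm[of "G x"])
  moreover have "norm g * min (1/2) (c2 / 4) \<le> norm g * (1/2)" "norm g * min (1/2) (c2 / 4) \<le> norm g * (c2 / 4)"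
   by (intro mult_left_mono; simp)+
  ultimately show "norm (G x - g) \<le> norm g / 2" "norm (G x - g) \<le> norm g * (c2 / 4)" by auto
 qed
 define \<delta>' where "\<delta>' = min (\<delta>3 / 2) (e / 8)"
 have \<delta>': "\<delta>' > 0" "\<delta>' < \<delta>3" "\<delta>' \<le> e / 8" using \<delta>3 e by (auto simp: \<delta>'_def)
 define Z where "Z = frontier D \<inter> cball p \<delta>'"
 have Zb: "z \<in> ball p \<delta>3" if "z \<in> Z" for z using that \<delta>' by (auto simp: Z_def)
 have Z1: "\<bar>z \<bullet> x\<bar> \<ge> e / 2" if z: "z \<in> Z" and x: "x \<in> ball \<nu> \<eta>" for z x
 proof -
  have zp: "norm (z - p) \<le> e / 8" using z \<delta>' by (auto simp: Z_def dist_norm norm_minus_commute)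
  have xn: "norm (x - \<nu>) \<le> \<eta>" using x by (simp add: dist_norm norm_minus_commute)
  have "norm x \<le> 2" using norm_triangle_ineq2[of x \<nu>] xn \<nu>1 \<eta>1 by linarith
  then have "\<bar>(z - p) \<bullet> x\<bar> \<le> e / 8 * 2"
   using Cauchy_Schwarz_ineq2[of "z - p" x] mult_mono[OF zp, of "norm x" 2] e by simp
  moreover have "\<bar>p \<bullet> (x - \<nu>)\<bar> \<le> e / 8"
   using Cauchy_Schwarz_ineq2[of p "x - \<nu>"] mult_left_mono[OF xn, of "norm p"] \<eta>(3) by (simp add: mult.commute)
  moreover have "z \<bullet> x = p \<bullet> \<nu> + (z - p) \<bullet> x + p \<bullet> (x - \<nu>)" by (simp add: inner_diff_left inner_diff_right)
  moreover have "\<bar>p \<bullet> \<nu>\<bar> = e" by (simp add: e_def inner_commute)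
  ultimately show ?thesis using e by linarith
 qed
 \<comment> \<open>\<open>F\<close> vanishes at both points, so \<open>g \<bullet> (z - z')\<close>
   equals, up to sign, the increment of \<open>F x - g \<bullet> x\<close>, a function whose
   gradient is small.\<close>
 have Z2: "\<bar>\<nu> \<bullet> (z - z')\<bar> \<le> norm (z - z') / 2" if z: "z \<in> Z" "z' \<in> Z" for z z'
 proof -
  have "norm ((F z - g \<bullet> z) - (F z' - g \<bullet> z')) \<le> norm g / 2 * norm (z - z')"
  proof (rule differentiable_bound[OF convex_ball, where f="\<lambda>x. F x - g \<bullet> x" and f'="\<lambda>x v. (G x - g) \<bullet> v"])
   fix x assume x: "x \<in> ball p \<delta>3"
   have "((\<lambda>x. F x - g \<bullet> x) has_derivative (\<lambda>v. G x \<bullet> v - g \<bullet> v)) (at x)"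
    using x \<delta>3 by (intro has_derivative_diff FG has_derivative_inner_right has_derivative_ident) auto
   then show "((\<lambda>x. F x - g \<bullet> x) has_derivative (\<lambda>v. (G x - g) \<bullet> v)) (at x within ball p \<delta>3)"
    unfolding inner_diff_left by (rule has_derivative_at_withinI)
   show "onorm (\<lambda>v. (G x - g) \<bullet> v) \<le> norm g / 2"
   proof (rule onorm_bound)
    show "norm ((G x - g) \<bullet> v) \<le> norm g / 2 * norm v" for v
     using Cauchy_Schwarz_ineq2[of "G x - g" v] mult_right_mono[OF Gn(1)[OF x] norm_ge_zero[of v]] by simp
   qed simp
  qed (use Zb z in auto)
  moreover have "F z = 0" "F z' = 0" using Fz Zb[OF z(1)] Zb[OF z(2)] z \<delta>3 by (auto simp: Z_def)
  ultimately have "\<bar>g \<bullet> (z - z')\<bar> \<le> norm g / 2 * norm (z - z')" by (simp add: inner_diff_right abs_minus_commute)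
  moreover have "g \<bullet> (z - z') = norm g * (\<nu> \<bullet> (z - z'))"
   using arg_cong[OF g\<nu>, of "\<lambda>v. v \<bullet> (z - z')"] by (simp only: inner_scaleR_left)
  then have "\<bar>g \<bullet> (z - z')\<bar> = norm g * \<bar>\<nu> \<bullet> (z - z')\<bar>" by (simp add: abs_mult)
  ultimately have "norm g * \<bar>\<nu> \<bullet> (z - z')\<bar> \<le> norm g * (norm (z - z') / 2)" by simp
  then show ?thesis using ng by (simp only: mult_le_cancel_left_pos)
 qed
 have Z3: "norm z \<le> norm p + \<delta>'" if "z \<in> Z" for z
  using that norm_triangle_ineq2[of z p] by (auto simp: Z_def dist_norm norm_minus_commute)
 \<comment> \<open>The opposite normal is equally stationary; the hypotheses are symmetric under the
   change of sign.\<close>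
 have Z1m: "\<bar>z \<bullet> x\<bar> \<ge> e / 2" if z: "z \<in> Z" and x: "x \<in> ball (- \<nu>) \<eta>" for z x
 proof -
  have "- x \<in> ball \<nu> \<eta>" using x by (simp add: dist_norm) (metis add.commute minus_diff_eq norm_minus_cancel uminus_add_conv_diff diff_minus_eq_add)
  from Z1[OF z this] show ?thesis by simp
 qed
 have Z2m: "\<bar>- \<nu> \<bullet> (z - z')\<bar> \<le> norm (z - z') / 2" if z: "z \<in> Z" "z' \<in> Z" for z z' using Z2[OF z] by simp
 have "isCont q p" using q_cont p0 continuous_on_eq_continuous_at[of "- {0}" q] by auto
 then have "\<forall>\<^sub>F x in nhds p. dist (q x) (q p) < \<delta>'" using \<delta>'(1)
  by (simp add: isCont_def eventually_nhds_conv_at tendstoD)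
 then obtain r1 where r1: "r1 > 0" "\<And>x. dist x p < r1 \<Longrightarrow> dist (q x) p < \<delta>'"
  unfolding eventually_nhds_metric frontier_body_D(3)[OF p] by blast
 obtain r0 R1 where R1: "R1 > 0" "\<And>y. y \<noteq> 0 \<Longrightarrow> rad y \<le> R1" by (rule rad_bounds) (rule that)
 define r where "r = min (min (r1 / 2) (\<delta>3 / 2)) (norm p / 2)"
 have r: "r > 0" "r < r1" "r < \<delta>3" "r \<le> norm p / 2" using r1 \<delta>3 p0 by (auto simp: r_def)
 \<comment> \<open>On the support the norm is at least half that of \<open>p\<close>, while
   \<open>q y\<close> has norm at most \<open>R1\<close>.\<close>
 define s0 where "s0 = norm p / (2 * R1)"
 have s0: "s0 > 0" using p0 R1 by (simp add: s0_def)
 have supp: "q y \<in> Z \<and> s \<ge> s0" if s: "0 \<le> s" "s \<le> 1" and m: "s *\<^sub>R q y \<in> cball p r" for s y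
 proof -
  have "norm p \<le> norm (s *\<^sub>R q y) + r" using m norm_triangle_ineq2[of p "s *\<^sub>R q y"] by (simp add: dist_norm)
  then have nb: "norm (s *\<^sub>R q y) \<ge> norm p / 2" using r by linarith
  then have sy: "s *\<^sub>R q y \<noteq> 0" using p0 by auto
  then have sp: "s > 0" "q y \<noteq> 0" using s by (auto simp: less_le)
  then have y0: "y \<noteq> 0" by (auto simp: q_def)
  have rp: "rad y / norm y > 0" using rad_pos[OF y0] y0 by simp
  have "q (s *\<^sub>R q y) = q (q y)" by (rule q_scale[OF sp(1)])
  also have "\<dots> = q y" unfolding q_def[of y] by (rule trans[OF q_scale[OF rp]]) (simp add: q_def)
  finally have "dist (q y) p < \<delta>'" using r1(2)[of "s *\<^sub>R q y"] m r by (simp add: dist_commute)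
  then have "q y \<in> Z" using q_frontier[OF y0] by (simp add: Z_def dist_commute)
  moreover have "norm p / 2 \<le> s * rad y" using nb norm_q[OF y0] sp(1) by simp
  then have "norm p / 2 \<le> s * R1" using mult_left_mono[OF R1(2)[OF y0], of s] sp(1) by linarith
  then have "s0 \<le> s" using R1 by (simp add: s0_def field_simps)
  ultimately show ?thesis by simp
 qed
 show ?thesis
 proof (rule that[OF r(1)])
  fix h assume hU: "UC ?n {()} UNIV (\<lambda>_. h)" and h0': "\<forall>x. x \<notin> cball p r \<longrightarrow> h x = 0"
  have h0: "h x = 0" if "x \<notin> cball p r" for x using h0' that by blast
  have h1: "UC 1 {()} UNIV (\<lambda>_. h)" using UC_mono_k[OF hU] card2 by simp
  have hu0: "UC 0 {()} UNIV (\<lambda>_. h)" using UC_0[OF hU] .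
  have e2: "e / 2 > 0" using e by simp
  have \<nu>m: "norm (- \<nu>) = 1" using \<nu>1 by simp
  obtain Ca where Ca: "\<And>Om R ph. rotation_invariant Om \<Longrightarrow> R \<ge> 1 \<Longrightarrow>
    (LINT om|Om. (cutoff (Suc ?n) \<nu> (\<eta>/4) om * osc h R ph om)\<^sup>2) \<le> Ca / R ^ (?n + 1)"
   by (rule stationary_L2[OF \<nu>1 \<eta>(1,2) e2, of Z "norm p + \<delta>'" h "cball p r" s0])
     (erule (1) Z1, erule (1) Z2, erule Z3, rule h1, erule h0, rule closed_cball, rule s0, erule (2) supp, rule that)
  obtain Cb where Cb: "\<And>Om R ph. rotation_invariant Om \<Longrightarrow> R \<ge> 1 \<Longrightarrow>
    (LINT om|Om. (cutoff (Suc ?n) (- \<nu>) (\<eta>/4) om * osc h R ph om)\<^sup>2) \<le> Cb / R ^ (?n + 1)"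
   by (rule stationary_L2[OF \<nu>m \<eta>(1,2) e2, of Z "norm p + \<delta>'" h "cball p r" s0])
     (erule (1) Z1m, erule (1) Z2m, erule Z3, rule h1, erule h0, rule closed_cball, rule s0, erule (2) supp, rule that)
  define V where "V = (\<lambda>i j x. G x $ j *\<^sub>R axis i (1::real) - G x $ i *\<^sub>R axis j 1)"
  define d where "d = (\<lambda>i j x. H j x $ i - H i x $ j)"
  define W where "W = (\<lambda>i j. {om::real^'n. norm om = 1 \<and> \<bar>om $ j * \<nu> $ i - om $ i * \<nu> $ j\<bar> \<ge> c2})"
  have UW: "UC k X (ball p \<delta>3) (\<lambda>_. f)" if "UC k {()} (ball p rc) (\<lambda>_. f)" for k f and X :: "(real^'n) set"
   using UC_reindex[OF UC_subset[OF that order_refl \<delta>3(2)], of X "\<lambda>_. ()"] by simp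
  have nsp: "\<exists>C. \<forall>M w lam ph. w \<in> W i j \<longrightarrow> lam > 0 \<longrightarrow> sets M = sets borel \<longrightarrow> finite_measure M \<longrightarrow> measure M UNIV \<le> measure lborel D \<longrightarrow>
    null_div M (cball p r) (V i j) (d i j) \<longrightarrow> \<bar>LINT x|M. h x * cos (lam * (w \<bullet> x) + ph)\<bar> \<le> C / lam ^ ?n" for i j
  proof (rule nonstationary_phase[where S="ball p \<delta>3" and c="norm g * c2 / 2" and W="W i j" and a="\<lambda>_. h" and u="\<lambda>w. w"])
   show "UC ?n (W i j) (ball p \<delta>3) (\<lambda>w x. V i j x $ k)" for k
   proof -
    have "UC ?n (W i j) (ball p \<delta>3) (\<lambda>w x. G x $ j * axis i 1 $ k - G x $ i * axis j 1 $ k)"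
     by (intro UC_diff UC_mult UW GU UC_const[where M=1]) (auto simp: axis_def)
    then show ?thesis by (simp add: V_def)
   qed
   show "UC ?n (W i j) (ball p \<delta>3) (\<lambda>w x. d i j x)" unfolding d_def by (intro UC_diff UW HU)
   show "UC ?n (W i j) UNIV (\<lambda>_. h)" using UC_reindex[OF hU, of "W i j" "\<lambda>_. ()"] by simp
   show "cball p r \<subseteq> ball p \<delta>3" using r by (auto simp: subset_iff)
   fix w x assume w: "w \<in> W i j" and x: "x \<in> ball p \<delta>3"
   have wc: "\<bar>w $ k\<bar> \<le> 1" for k using component_le_norm_cart[of w k] w by (simp add: W_def)
   have Gc: "\<bar>G x $ k - g $ k\<bar> \<le> norm g * (c2 / 4)" for k
    using order_trans[OF component_le_norm_cart[of "G x - g" k] Gn(2)[OF x]] by simp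
   have "\<bar>w $ i * (G x $ j - g $ j)\<bar> \<le> 1 * (norm g * (c2 / 4))" "\<bar>w $ j * (G x $ i - g $ i)\<bar> \<le> 1 * (norm g * (c2 / 4))"
    unfolding abs_mult by (intro mult_mono wc Gc; simp)+
   moreover have "w \<bullet> V i j x = - (w $ j * g $ i - w $ i * g $ j) + w $ i * (G x $ j - g $ j) - w $ j * (G x $ i - g $ i)"
    by (simp add: V_def inner_diff_right inner_axis algebra_simps)
   moreover have "\<bar>w $ j * g $ i - w $ i * g $ j\<bar> \<ge> norm g * c2"
   proof -
    have "g $ k = norm g * \<nu> $ k" for k using arg_cong[OF g\<nu>, of "\<lambda>v. v $ k"] by simp
    then have "w $ j * g $ i - w $ i * g $ j = norm g * (w $ j * \<nu> $ i - w $ i * \<nu> $ j)" by (simp add: algebra_simps)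
    then show ?thesis using w ng by (simp add: W_def abs_mult)
   qed
   ultimately show "\<bar>w \<bullet> V i j x\<bar> \<ge> norm g * c2 / 2" by (simp add: abs_if split: if_splits)
  qed (use h0 ng c2 in \<open>auto simp: W_def\<close>)
  define PP where "PP = (\<lambda>i j C. \<forall>M w lam ph. w \<in> W i j \<longrightarrow> lam > 0 \<longrightarrow> sets M = sets borel \<longrightarrow> finite_measure M \<longrightarrow> measure M UNIV \<le> measure lborel D \<longrightarrow>
    null_div M (cball p r) (V i j) (d i j) \<longrightarrow> \<bar>LINT x|M. h x * cos (lam * (w \<bullet> x) + ph)\<bar> \<le> C / lam ^ ?n)"
  have "\<exists>C. PP i j C" for i j unfolding PP_def by (rule nsp)
  then obtain Cf where Cf: "\<And>i j. PP i j (Cf i j)" by metis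
  define C where "C = (\<Sum>i\<in>UNIV. \<Sum>j\<in>UNIV. \<bar>Cf i j\<bar>)"
  have CfC: "Cf i j \<le> C" for i j
  proof -
   have "Cf i j \<le> \<bar>Cf i j\<bar>" by simp
   also have "\<dots> \<le> (\<Sum>j\<in>UNIV. \<bar>Cf i j\<bar>)" by (rule member_le_sum) auto
   also have "\<dots> \<le> C" unfolding C_def by (rule member_le_sum[of i UNIV "\<lambda>i. \<Sum>j\<in>UNIV. \<bar>Cf i j\<bar>"]) (auto intro: sum_nonneg)
   finally show ?thesis .
  qed
  have fin: "finite_measure (uniform_on D)" "measure (uniform_on D) UNIV = measure lborel D"
   using uniform_on_finite[OF body_borel bounded_body] by auto
  have nd: "null_div (uniform_on D) (cball p r) (V i j) (d i j)" for i j
   unfolding V_def d_def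
  proof (rule null_div_boundary[where S="ball p rc" and F=F])
   show "cball p r \<subseteq> ball p rc" using r \<delta>3 by (auto simp: subset_iff \<delta>3_def)
  qed (use FU GU HU FG GH side in auto)
  \<comment> \<open>Far from both normals a pair of indices with large minor exists; it selects the
    tangential field along which to integrate by parts.\<close>
  have nonst: "\<bar>osc h R ph om\<bar> \<le> C / R ^ ?n" if w: "norm om = 1" and R: "R \<ge> 1" and far: "norm (om - \<nu>) \<ge> \<eta>/4" "norm (om + \<nu>) \<ge> \<eta>/4" for om R ph
  proof -
   have sq: "(norm (om - \<nu>))\<^sup>2 = 2 - 2 * (om \<bullet> \<nu>)" "(norm (om + \<nu>))\<^sup>2 = 2 + 2 * (om \<bullet> \<nu>)"
    using w \<nu>1 by (simp_all add: power2_norm_eq_inner inner_diff_left inner_diff_right inner_add_left inner_add_right inner_commute norm_eq_1)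
   have "(\<eta>/4)\<^sup>2 \<le> (norm (om - \<nu>))\<^sup>2" "(\<eta>/4)\<^sup>2 \<le> (norm (om + \<nu>))\<^sup>2" using far \<eta>(1) by (auto intro!: power_mono)
   moreover have "(\<eta>/4)\<^sup>2 = 2 * t" by (simp add: t_def power_divide)
   ultimately have "om \<bullet> \<nu> \<le> 1 - t" "- (om \<bullet> \<nu>) \<le> 1 - t" using sq by auto
   then have "\<bar>om \<bullet> \<nu>\<bar> \<le> 1 - t" by linarith
   then have "\<bar>om \<bullet> \<nu>\<bar>\<^sup>2 \<le> (1 - t)\<^sup>2" by (rule power_mono) simp
   also have "(1 - t)\<^sup>2 \<le> 1 - t" using t by (simp add: power2_eq_square mult_left_le)
   finally have dot: "(om \<bullet> \<nu>)\<^sup>2 \<le> 1 - t" by simp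
   then have "(om \<bullet> \<nu>)\<^sup>2 < 1" using t by linarith
   from exists_wedge[OF w \<nu>1 this] obtain i j where ij: "i \<noteq> j"
    "(real ?n)\<^sup>2 * (om $ j * \<nu> $ i - om $ i * \<nu> $ j)\<^sup>2 \<ge> 1 - (om \<bullet> \<nu>)\<^sup>2" by blast
   have "(sqrt t)\<^sup>2 \<le> (real ?n * \<bar>om $ j * \<nu> $ i - om $ i * \<nu> $ j\<bar>)\<^sup>2"
    using ij(2) dot t unfolding power_mult_distrib power2_abs by simp
   then have "sqrt t \<le> real ?n * \<bar>om $ j * \<nu> $ i - om $ i * \<nu> $ j\<bar>" by (rule power2_le_imp_le) simp
   then have "om \<in> W i j" using w n1 by (simp add: W_def c2_def pos_divide_le_eq mult.commute)
   then have "\<bar>osc h R ph om\<bar> \<le> Cf i j / R ^ ?n"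
    using Cf[of i j, unfolded PP_def] R fin nd[of i j] unfolding osc_def by simp
   also have "\<dots> \<le> C / R ^ ?n" using CfC R by (intro divide_right_mono) auto
   finally show ?thesis .
  qed
  have "(LINT om|Om. (osc h R ph om)\<^sup>2) \<le> (Ca + Cb + C\<^sup>2) / R ^ (?n + 1)" if Om: "rotation_invariant Om" and R: "R \<ge> 1" for Om R ph
  proof -
   interpret prob_space Om using Om by (simp add: rotation_invariant_def)
   have so[measurable_cong]: "sets Om = sets borel" using Om by (simp add: rotation_invariant_def)
   have finO: "finite_measure Om" by unfold_locales
   let ?A = "\<lambda>om. cutoff (Suc ?n) \<nu> (\<eta>/4) om * osc h R ph om" and ?B = "\<lambda>om. cutoff (Suc ?n) (- \<nu>) (\<eta>/4) om * osc h R ph om"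
   have i: "integrable Om (\<lambda>om. (cutoff (Suc ?n) \<nu>' (\<eta>/4) om * osc h R ph om)\<^sup>2)" for \<nu>'
   proof -
    have cr: "\<bar>cutoff (Suc ?n) \<nu>' (\<eta>/4) om\<bar> \<le> 1" for om using cutoff_range[of "\<eta>/4" "Suc ?n" \<nu>' om] \<eta> by simp
    have "continuous_on UNIV (cutoff (Suc ?n) \<nu>' (\<eta>/4))"
     using UC_continuous[OF UC_cutoff[of "\<eta>/4" 0 "Suc ?n" "{()}" \<nu>'], of "()"] \<eta> by simp
    then have [measurable]: "cutoff (Suc ?n) \<nu>' (\<eta>/4) \<in> borel_measurable borel" by (rule borel_measurable_continuous_onI)
    note [measurable] = osc_measurable(1)[OF hu0]
    obtain B where B: "\<And>om. \<bar>osc h R ph om\<bar> \<le> B" using osc_measurable(2)[OF hu0] by blast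
    have "\<bar>cutoff (Suc ?n) \<nu>' (\<eta>/4) om * osc h R ph om\<bar> \<le> 1 * B" for om
     unfolding abs_mult by (intro mult_mono cr B) auto
    then have "\<bar>(cutoff (Suc ?n) \<nu>' (\<eta>/4) om * osc h R ph om)\<^sup>2\<bar> \<le> (1 * B)\<^sup>2" for om
     using power_mono[of "\<bar>cutoff (Suc ?n) \<nu>' (\<eta>/4) om * osc h R ph om\<bar>" "1 * B" 2] by simp
    then show ?thesis by (intro integrable_bounded_finite[OF finO, where B="(1 * B)\<^sup>2"]) measurable
   qed
   have "(LINT om|Om. (osc h R ph om)\<^sup>2) \<le> (LINT om|Om. (?A om)\<^sup>2 + (?B om)\<^sup>2 + C\<^sup>2 / R ^ (?n + 1))"
   proof (rule integral_mono_AE)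
    show "integrable Om (\<lambda>om. (?A om)\<^sup>2 + (?B om)\<^sup>2 + C\<^sup>2 / R ^ (?n + 1))" using i by simp
    have "AE om in Om. norm om = 1" using Om by (simp add: rotation_invariant_def)
    then show "AE om in Om. (osc h R ph om)\<^sup>2 \<le> (?A om)\<^sup>2 + (?B om)\<^sup>2 + C\<^sup>2 / R ^ (?n + 1)"
    proof eventually_elim
     case (elim om)
     have pos: "0 \<le> (?A om)\<^sup>2" "0 \<le> (?B om)\<^sup>2" "0 \<le> C\<^sup>2 / R ^ (?n + 1)" using R by auto
     consider "norm (om - \<nu>) \<le> \<eta>/4" | "norm (om - - \<nu>) \<le> \<eta>/4" | "norm (om - \<nu>) \<ge> \<eta>/4" "norm (om + \<nu>) \<ge> \<eta>/4" by fastforce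
     then show ?case
     proof cases
      case 1
      then have "cutoff (Suc ?n) \<nu> (\<eta>/4) om = 1" using \<eta> by (intro cutoff_1) auto
      then have "(osc h R ph om)\<^sup>2 = (?A om)\<^sup>2" by simp
      then show ?thesis using pos by linarith
     next
      case 2
      then have "cutoff (Suc ?n) (- \<nu>) (\<eta>/4) om = 1" using \<eta> by (intro cutoff_1) auto
      then have "(osc h R ph om)\<^sup>2 = (?B om)\<^sup>2" by simp
      then show ?thesis using pos by linarith
     next
      case 3
      have "(osc h R ph om)\<^sup>2 \<le> (C / R ^ ?n)\<^sup>2" using power_mono[OF nonst[OF elim R 3, of ph], of 2] by simp
      then show ?thesis using power_compare[OF R, of C] pos by linarith
     qed
    qed
   qed (use osc_sq_integrable[OF hu0 Om] in auto)
   also have "\<dots> = (LINT om|Om. (?A om)\<^sup>2) + (LINT om|Om. (?B om)\<^sup>2) + C\<^sup>2 / R ^ (?n + 1)" using i by (simp add: prob_space)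
   also have "\<dots> \<le> Ca / R ^ (?n + 1) + Cb / R ^ (?n + 1) + C\<^sup>2 / R ^ (?n + 1)"
    using Ca[OF Om R, of ph] Cb[OF Om R, of ph] by linarith
   also have "\<dots> = (Ca + Cb + C\<^sup>2) / R ^ (?n + 1)" by (simp add: add_divide_distrib)
   finally show ?thesis .
  qed
  then show "avg_decay h" unfolding avg_decay_def by blast
 qed
qed

text \<open>Instead of a partition of unity, one cutoff at a time is split off along a finite cover:
  the part near \<open>p\<close> is covered by the local results, and the rest vanishes on one more
  ball.\<close>

lemma avg_decay_smooth:
 assumes "UC CARD('n) {()} UNIV (\<lambda>_. h)"
 shows "avg_decay h"
proof -
 let ?n = "CARD('n)"
 define good where "good = (\<lambda>p r. r > 0 \<and> (\<forall>h. UC ?n {()} UNIV (\<lambda>_. h) \<longrightarrow> (\<forall>x. x \<notin> cball p r \<longrightarrow> h x = 0) \<longrightarrow> avg_decay h))"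
 have "\<exists>r. good p r" if "p \<in> D" for p
 proof (cases "p \<in> frontier D")
  case True
  show ?thesis unfolding good_def by (rule avg_decay_frontier[OF True]) blast
 next
  case False
  then have "p \<in> interior D" using that closure_subset by (auto simp: frontier_def)
  then obtain r where "r > 0" "cball p r \<subseteq> D" unfolding mem_interior_cball by blast
  then show ?thesis unfolding good_def using avg_decay_interior[of p r] by blast
 qed
 then obtain r where "\<And>p. p \<in> D \<Longrightarrow> good p (r p)" by metis
 then have r: "\<And>p. p \<in> D \<Longrightarrow> r p > 0"
  "\<And>p h. p \<in> D \<Longrightarrow> UC ?n {()} UNIV (\<lambda>_. h) \<Longrightarrow> \<forall>x. x \<notin> cball p (r p) \<longrightarrow> h x = 0 \<Longrightarrow> avg_decay h"
  unfolding good_def by blast+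
 have cov: "D \<subseteq> (\<Union>p\<in>D. ball p (r p / 2))" using r(1) by force
 obtain J where J: "J \<subseteq> D" "finite J" "D \<subseteq> (\<Union>p\<in>J. ball p (r p / 2))"
  by (rule compactE_image[OF compact_body open_ball cov])
 \<comment> \<open>The covering condition concerns only points of \<open>D\<close>, because the
   transform does not see \<open>h\<close> elsewhere. The cutoff is 1 on the ball of radius r/2 and
   lives in the ball of radius r.\<close>
 have "avg_decay h" if "finite K" "K \<subseteq> D" "UC ?n {()} UNIV (\<lambda>_. h)" "\<forall>x\<in>D. h x \<noteq> 0 \<longrightarrow> (\<exists>p\<in>K. x \<in> ball p (r p / 2))" for K h
  using that
 proof (induction K arbitrary: h rule: finite_induct)
  case empty
  then have z: "h x = 0" if "x \<in> D" for x using that by auto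
  have "osc h R ph om = 0" for R ph om
  proof -
   have "continuous_on UNIV h" using UC_continuous[OF empty(2), of "()"] by simp
   note [measurable] = borel_measurable_continuous_onI[OF this]
   have "osc h R ph om = (LINT x|lborel. indicator D x * (h x * cos (R * (om \<bullet> x) + ph)))"
    unfolding osc_def by (rule integral_uniform_on[OF body_borel]) measurable
   also have "\<dots> = (LINT x|(lborel :: (real^'n) measure). 0)" by (rule Bochner_Integration.integral_cong) (use z in \<open>auto simp: indicator_def\<close>)
   finally show ?thesis by simp
  qed
  then show ?case unfolding avg_decay_def by (intro exI[of _ 0]) simp
 next
  case (insert p K)
  have p: "p \<in> D" using insert by auto
  let ?\<chi> = "cutoff (Suc ?n) p (r p / 2)"
  have rp: "r p / 2 > 0" using r(1)[OF p] by simp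
  have \<chi>U: "UC ?n {()} UNIV (\<lambda>_. ?\<chi>)" by (rule UC_cutoff[OF rp]) simp
  have one: "UC ?n {()} UNIV (\<lambda>_ _. 1)" by (rule UC_const[where M=1]) auto
  have U1: "UC ?n {()} UNIV (\<lambda>_ x. h x * ?\<chi> x)" by (intro UC_mult insert.prems(2) \<chi>U)
  have U2: "UC ?n {()} UNIV (\<lambda>_ x. h x * (1 - ?\<chi> x))" by (intro UC_mult UC_diff insert.prems(2) \<chi>U one)
  have "avg_decay (\<lambda>x. h x * ?\<chi> x)"
  proof (rule r(2)[OF p U1], intro allI impI)
   fix x assume "x \<notin> cball p (r p)"
   then have "?\<chi> x = 0" using rp by (intro cutoff_0) (auto simp: dist_norm norm_minus_commute)
   then show "h x * ?\<chi> x = 0" by simp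
  qed
  moreover have "avg_decay (\<lambda>x. h x * (1 - ?\<chi> x))"
  proof (rule insert.IH)
   show "\<forall>x\<in>D. h x * (1 - ?\<chi> x) \<noteq> 0 \<longrightarrow> (\<exists>p\<in>K. x \<in> ball p (r p / 2))"
   proof (intro ballI impI)
    fix x assume x: "x \<in> D" "h x * (1 - ?\<chi> x) \<noteq> 0"
    then have "\<not> norm (x - p) \<le> r p / 2" using cutoff_1[OF rp, of "Suc ?n" x p] by auto
    then have "x \<notin> ball p (r p / 2)" by (simp add: dist_norm norm_minus_commute)
    then show "\<exists>p\<in>K. x \<in> ball p (r p / 2)" using insert.prems(3) x by auto
   qed
  qed (use insert.prems U2 in auto)
  ultimately have "avg_decay (\<lambda>x. h x * ?\<chi> x + h x * (1 - ?\<chi> x))"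
   by (intro avg_decay_add UC_0[OF U1] UC_0[OF U2])
  then show ?case by (simp add: algebra_simps)
 qed
 from this[OF J(2,1) assms] show ?thesis using J(3) by blast
qed

end

subsection \<open>The weight\<close>

text \<open>The common factor 4^K cancels. This exact scaling is what makes the dyadic recursion at
  the origin an identity.\<close>

lemma cutoff_double: "cutoff K 0 s (2 *\<^sub>R x) = cutoff K 0 (s/2) x"
proof -
 have m: "max 0 (4 * a) ^ K = 4 ^ K * max 0 a ^ K" for a :: real
  by (simp add: power_mult_distrib[symmetric] max_mult_distrib_left)
 let ?a = "4 * (s/2)\<^sup>2 - (norm x)\<^sup>2" and ?b = "(norm x)\<^sup>2 - (s/2)\<^sup>2"
 have e: "4 * s\<^sup>2 - (norm (2 *\<^sub>R x))\<^sup>2 = 4 * ?a" "(norm (2 *\<^sub>R x))\<^sup>2 - s\<^sup>2 = 4 * ?b"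
  by (simp_all add: power_mult_distrib power_divide)
 have "cutoff K 0 s (2 *\<^sub>R x) = (4 ^ K * max 0 ?a ^ K) / (4 ^ K * max 0 ?a ^ K + 4 ^ K * max 0 ?b ^ K)"
  unfolding cutoff_def diff_zero e m ..
 also have "\<dots> = (4 ^ K * max 0 ?a ^ K) / (4 ^ K * (max 0 ?a ^ K + max 0 ?b ^ K))" by (simp add: distrib_left)
 also have "\<dots> = max 0 ?a ^ K / (max 0 ?a ^ K + max 0 ?b ^ K)" by simp
 finally show ?thesis by (simp add: cutoff_def)
qed

lemma lborel_integral_scale:
 fixes F :: "real^'n \<Rightarrow> real"
 assumes "F \<in> borel_measurable borel" "c > 0"
 shows "(LINT x|lborel. F (c *\<^sub>R x)) = (1 / c ^ CARD('n)) * (LINT x|lborel. F x)"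
proof -
 have "(LINT x|lborel. F x) = c ^ CARD('n) * (LINT x|lborel. F (c *\<^sub>R x))"
  using assms by (subst lborel_affine[of c 0]) (auto simp: integral_density integral_distr integral_real_density)
 then show ?thesis using assms(2) by simp
qed

text \<open>Left invariance is the relevant one, because (A \<gamma>) e = A (\<gamma> e). It turns
  averages over rotations into averages over directions.\<close>

lemma haar_orbit:
 fixes \<mu> :: "(real^'n^'n) measure"
  and e :: "real^'n"
 assumes "haar_SO \<mu>" "norm e = 1"
 shows "rotation_invariant (distr \<mu> borel (\<lambda>\<gamma>. \<gamma> *v e))"
proof -
 have p: "prob_space \<mu>" and s: "sets \<mu> = sets borel" and one: "emeasure \<mu> SOn = 1"
  and inv: "\<And>g. g \<in> SOn \<Longrightarrow> distr \<mu> borel (\<lambda>A. g ** A) = \<mu>" using assms by (auto simp: haar_SO_def)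
 interpret prob_space \<mu> by fact
 note [measurable_cong] = s
 have mv: "continuous_on UNIV (\<lambda>\<gamma>::real^'n^'n. \<gamma> *v e)"
  unfolding matrix_vector_mult_def by (intro continuous_intros)
 have [measurable]: "(\<lambda>\<gamma>::real^'n^'n. \<gamma> *v e) \<in> measurable borel borel" using mv by (rule borel_measurable_continuous_onI)
 have mA: "(\<lambda>x. A *v x) \<in> measurable borel borel" for A :: "real^'n^'n"
  by (rule borel_measurable_continuous_onI) (simp add: matrix_vector_mult_def, intro continuous_intros)
 have mAA: "(\<lambda>B. A ** B) \<in> measurable borel borel" for A :: "real^'n^'n"
  by (rule borel_measurable_continuous_onI) (simp add: matrix_matrix_mult_def, intro continuous_intros)
 have AE_SO: "AE \<gamma> in \<mu>. \<gamma> \<in> SOn"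
 proof -
  \<comment> \<open>A non-measurable set would have measure 0 by convention, contradicting the value
    1.\<close>
  have "SOn \<in> sets \<mu>"
  proof (rule ccontr)
   assume "SOn \<notin> sets \<mu>"
   then have "emeasure \<mu> SOn = 0" by (rule emeasure_notin_sets)
   then show False using one by simp
  qed
  moreover have "measure \<mu> SOn = 1" using one by (simp add: measure_def)
  ultimately show ?thesis by (intro AE_prob_1)
 qed
 show ?thesis unfolding rotation_invariant_def
 proof (intro conjI ballI)
  show "prob_space (distr \<mu> borel (\<lambda>\<gamma>. \<gamma> *v e))" by (rule prob_space_distr) measurable
  have "AE \<gamma> in \<mu>. norm (\<gamma> *v e) = 1"
   using AE_SO
  proof eventually_elim
   case (elim \<gamma>)
   then have "orthogonal_matrix \<gamma>" by (simp add: SOn_def)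
   then have "orthogonal_transformation ((*v) \<gamma>)"
    by (simp add: orthogonal_transformation_matrix matrix_vector_mul_linear)
   then show ?case using assms(2) by (simp add: orthogonal_transformation)
  qed
  then show "AE x in distr \<mu> borel (\<lambda>\<gamma>. \<gamma> *v e). norm x = 1" by (subst AE_distr_iff) auto
  fix A :: "real^'n^'n" assume A: "A \<in> SOn"
  have "distr (distr \<mu> borel (\<lambda>\<gamma>. \<gamma> *v e)) borel (\<lambda>x. A *v x) = distr \<mu> borel (\<lambda>\<gamma>. A *v (\<gamma> *v e))"
   by (subst distr_distr) (use mA in \<open>auto simp: o_def\<close>)
  also have "\<dots> = distr \<mu> borel (\<lambda>\<gamma>. (A ** \<gamma>) *v e)" by (simp add: matrix_vector_mul_assoc)
  also have "\<dots> = distr (distr \<mu> borel (\<lambda>\<gamma>. A ** \<gamma>)) borel (\<lambda>\<gamma>. \<gamma> *v e)"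
  proof -
   have "(\<lambda>\<gamma>. A ** \<gamma>) \<in> measurable \<mu> borel" using mAA[of A] s by (simp cong: measurable_cong_sets)
   then show ?thesis by (subst distr_distr) (auto simp: o_def)
  qed
  also have "\<dots> = distr \<mu> borel (\<lambda>\<gamma>. \<gamma> *v e)" using inv[OF A] by simp
  finally show "distr (distr \<mu> borel (\<lambda>\<gamma>. \<gamma> *v e)) borel (\<lambda>x. A *v x) = distr \<mu> borel (\<lambda>\<gamma>. \<gamma> *v e)" .
 qed simp
qed

locale weighted_body = analytic_body m for m :: "real^'n \<Rightarrow> real" +
 fixes f :: "real^'n \<Rightarrow> real"
 assumes f_smooth: "smooth_on_sphere f"
begin

text \<open>The weight extended to be constant along rays; the origin is in general a singular
  point.\<close>

definition ft :: "real^'n \<Rightarrow> real" where "ft x = f (x /\<^sub>R norm x)"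

lemma ft_scale: "c > 0 \<Longrightarrow> ft (c *\<^sub>R x) = ft x"
proof -
 assume c: "c > 0"
 have "(c *\<^sub>R x) /\<^sub>R norm (c *\<^sub>R x) = x /\<^sub>R norm x" using c by (simp add: field_simps)
 then show ?thesis by (simp only: ft_def)
qed

lemma ft_UC:
 assumes "0 < a"
 shows "UC k {()} {x. a < norm x \<and> norm x < b} (\<lambda>_. ft)"
proof -
 let ?S = "{x::real^'n. a < norm x \<and> norm x < b}"
 obtain U g where U: "sphere 0 1 \<subseteq> U" "smooth_on U g" "\<And>x. x \<in> sphere 0 1 \<Longrightarrow> f x = g x"
  using f_smooth unfolding smooth_on_sphere_def by blast
 have bS: "bounded ?S" unfolding bounded_iff by (intro exI[of _ b]) auto
 have oS: "open ?S" by (intro open_Collect_conj open_Collect_less continuous_intros)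
 have nU: "UC k {()} ?S (\<lambda>w x. norm x)" by (rule UC_norm[OF bS assms]) auto
 have iU: "UC k {()} ?S (\<lambda>w x. 1 / norm x)" by (rule UC_inverse[OF assms nU]) auto
 have "UC k {()} ?S (\<lambda>w x. g (x /\<^sub>R norm x))"
 proof (rule UC_compose[where T="sphere 0 1" and g="\<lambda>_. g" and \<pi>="\<lambda>_ x. x /\<^sub>R norm x"])
  show "UC k {()} (sphere 0 1) (\<lambda>_. g)"
   by (rule Ck_on_imp_UC[OF compact_sphere U(1) order_refl]) (use U(2) in \<open>simp add: smooth_on_def\<close>)
  show "UC k {()} ?S (\<lambda>w x. (x /\<^sub>R norm x) $ i)" for i
   using UC_mult[OF iU UC_coord[OF bS, of k "{()}" i]] by (simp add: inverse_eq_divide)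
  show "x /\<^sub>R norm x \<in> sphere 0 1" if "x \<in> ?S" for x using that assms by (intro unit_sphere) auto
 qed
 then show ?thesis
 proof (rule UC_cong[OF _ oS])
  fix x assume "x \<in> ?S"
  then have "x /\<^sub>R norm x \<in> sphere 0 1" using assms by (intro unit_sphere) auto
  from U(3)[OF this] show "g (x /\<^sub>R norm x) = ft x" by (simp add: ft_def)
 qed
qed

lemma ft_cont: "continuous_on (- {0}) ft"
proof -
 have "isCont ft x" if "x \<noteq> 0" for x
 proof -
  let ?S = "{y::real^'n. norm x / 2 < norm y \<and> norm y < 2 * norm x}"
  have "continuous_on ?S ft" using UC_continuous[OF ft_UC[of "norm x / 2" 0 "2 * norm x"], of "()"] that by simp
  moreover have "open ?S" by (intro open_Collect_conj open_Collect_less continuous_intros)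
  ultimately show ?thesis using that by (auto simp: continuous_on_eq_continuous_at)
 qed
 then show ?thesis by (intro continuous_at_imp_continuous_on) auto
qed

lemma ft_measurable [measurable]: "ft \<in> borel_measurable borel"
proof -
 have "(\<lambda>y. if y \<in> - {0} then ft y else ft 0) \<in> borel_measurable borel"
  by (rule borel_measurable_continuous_on_if) (auto intro: ft_cont)
 moreover have "(\<lambda>y. if y \<in> - {0} then ft y else ft 0) = ft" by auto
 ultimately show ?thesis by simp
qed

lemma ft_bounded: obtains B where "B > 0" "\<And>x. \<bar>ft x\<bar> \<le> B"
proof -
 have "bounded (ft ` sphere 0 1)"
  by (rule compact_imp_bounded[OF compact_continuous_image[OF continuous_on_subset[OF ft_cont] compact_sphere]]) auto
 then obtain B where B: "\<And>x. x \<in> sphere 0 1 \<Longrightarrow> \<bar>ft x\<bar> \<le> B" unfolding bounded_iff by force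
 have "\<bar>ft x\<bar> \<le> max (max B \<bar>ft 0\<bar>) 1" for x
 proof (cases "x = 0")
  case False
  have "ft x = ft (x /\<^sub>R norm x)" using ft_scale[of "inverse (norm x)" x] False by simp
  then show ?thesis using B[OF unit_sphere[OF False]] by simp
 qed simp
 then show ?thesis by (intro that[of "max (max B \<bar>ft 0\<bar>) 1"]) auto
qed

text \<open>The difference of two cutoffs removes the singular origin as well as infinity.\<close>

lemma ft_annulus_UC:
 assumes "0 < s" "s \<le> B"
 shows "UC CARD('n) {()} UNIV (\<lambda>_ x. ft x * (cutoff (Suc CARD('n)) 0 B x - cutoff (Suc CARD('n)) 0 s x))"
proof -
 let ?n = "CARD('n)"
 let ?S = "{x::real^'n. s/2 < norm x \<and> norm x < 3 * B}"
 let ?Q = "{x::real^'n. s \<le> norm x \<and> norm x \<le> 2 * B}"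
 have B: "B > 0" using assms by simp
 have oS: "open ?S" by (intro open_Collect_conj open_Collect_less continuous_intros)
 have cQ: "closed ?Q" by (intro closed_Collect_conj closed_Collect_le continuous_intros)
 have "UC ?n {()} ?S (\<lambda>_ x. ft x * (cutoff (Suc ?n) 0 B x - cutoff (Suc ?n) 0 s x))"
 proof (intro UC_mult UC_diff)
  show "UC ?n {()} ?S (\<lambda>_. ft)" by (rule ft_UC) (use assms in simp)
  show "UC ?n {()} ?S (\<lambda>_. cutoff (Suc ?n) 0 B)" using UC_subset[OF UC_cutoff[OF B, of ?n "Suc ?n" "{()}" 0]] by blast
  show "UC ?n {()} ?S (\<lambda>_. cutoff (Suc ?n) 0 s)" using UC_subset[OF UC_cutoff[OF assms(1), of ?n "Suc ?n" "{()}" 0]] by blast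
 qed
 then show ?thesis
 proof (rule UC_extend[OF oS cQ, rotated])
  show "?Q \<subseteq> ?S" using assms B by auto
  fix x assume "x \<notin> ?Q"
  then consider "norm x < s" | "norm x > 2 * B" by fastforce
  then show "ft x * (cutoff (Suc ?n) 0 B x - cutoff (Suc ?n) 0 s x) = 0"
  proof cases
   case 1
   then have "cutoff (Suc ?n) 0 B x = 1" "cutoff (Suc ?n) 0 s x = 1" using assms B by (auto intro!: cutoff_1)
   then show ?thesis by simp
  next
   case 2
   then have "cutoff (Suc ?n) 0 B x = 0" "cutoff (Suc ?n) 0 s x = 0" using assms B by (auto intro!: cutoff_0)
   then show ?thesis by simp
  qed
 qed
qed

text \<open>Near the origin the weight is not smooth but invariant under doubling. With
  \<open>v\<close> the part in a dyadic annulus, u(x) = v(x) + u(2x), so the transform of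
  \<open>u\<close> at R is that of \<open>v\<close> at R plus 2^(-n) times that of \<open>u\<close>
  at R/2. The transform of \<open>v\<close> decays like R^(-n) as its support is interior, and
  iteration preserves any slower rate, in particular (n+1)/2.\<close>

lemma apex_decay:
 assumes s: "0 < s" "cball 0 (2 * s) \<subseteq> D"
 shows "\<exists>C. \<forall>om R ph. norm om = 1 \<longrightarrow> R \<ge> 1 \<longrightarrow>
  \<bar>osc (\<lambda>x. ft x * cutoff (Suc CARD('n)) 0 s x) R ph om\<bar> \<le> C * R powr (- (real CARD('n) + 1) / 2)"
proof -
 let ?n = "CARD('n)"
 let ?c = "cutoff (Suc ?n) (0::real^'n) s"
 define u where "u = (\<lambda>x. ft x * ?c x)"
 define v where "v = (\<lambda>x. ft x * (cutoff (Suc ?n) 0 s x - cutoff (Suc ?n) 0 (s/2) x))"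
 define a where "a = (real ?n + 1) / 2"
 have n2: "real ?n \<ge> 2" using card2 by simp
 have cc: "continuous_on UNIV ?c" using UC_continuous[OF UC_cutoff[of s 0 "Suc ?n" "{()}" 0], of "()"] s by simp
 have [measurable]: "?c \<in> borel_measurable borel" using cc by (rule borel_measurable_continuous_onI)
 have um[measurable]: "u \<in> borel_measurable borel" unfolding u_def by measurable
 have u0: "u x = 0" if "x \<notin> D" for x
 proof -
  have "norm x \<ge> 2 * s" using that s by (force simp: subset_iff)
  then show ?thesis using s by (simp add: u_def cutoff_0)
 qed
 obtain B where B: "B > 0" "\<And>x. \<bar>ft x\<bar> \<le> B" by (rule ft_bounded) (rule that)
 have ub: "\<bar>u x * t\<bar> \<le> B" if "\<bar>t\<bar> \<le> 1" for x t
 proof -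
  have "\<bar>ft x\<bar> * \<bar>?c x\<bar> * \<bar>t\<bar> \<le> B * 1 * 1"
   using cutoff_range[of s "Suc ?n" 0 x] s B that by (intro mult_mono) auto
  then show ?thesis by (simp add: u_def abs_mult)
 qed
 have vU: "UC ?n {()} UNIV (\<lambda>_. v)" unfolding v_def by (rule ft_annulus_UC) (use s in auto)
 have v0: "v x = 0" if "x \<notin> cball 0 (2 * s)" for x
 proof -
  have "norm x \<ge> 2 * s" using that by simp
  then show ?thesis using s by (simp add: v_def cutoff_0)
 qed
 obtain C1 where C1: "\<And>om R ph. norm om = 1 \<Longrightarrow> R \<ge> 1 \<Longrightarrow> \<bar>osc v R ph om\<bar> \<le> C1 / R ^ ?n"
  using osc_interior[OF s(2) vU v0] by blast
 have vc: "continuous_on UNIV v" using UC_continuous[OF vU, of "()"] by simp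
 note [measurable] = borel_measurable_continuous_onI[OF vc]
 have uv: "u x = v x + u (2 *\<^sub>R x)" for x
  using ft_scale[of 2 x] unfolding u_def v_def cutoff_double by (simp add: algebra_simps)
 have osc_u: "osc u R ph om = (LINT x|lborel. u x * cos (R * (om \<bullet> x) + ph))" for R ph om
 proof -
  have "osc u R ph om = (LINT x|lborel. indicator D x * (u x * cos (R * (om \<bullet> x) + ph)))"
   unfolding osc_def by (rule integral_uniform_on[OF body_borel]) measurable
  also have "\<dots> = (LINT x|lborel. u x * cos (R * (om \<bullet> x) + ph))"
   by (rule Bochner_Integration.integral_cong) (use u0 in \<open>auto simp: indicator_def\<close>)
  finally show ?thesis .
 qed
 have vD: "v x = 0" if "x \<notin> D" for x using v0[of x] s(2) that by blast
 have osc_v: "osc v R ph om = (LINT x|lborel. v x * cos (R * (om \<bullet> x) + ph))" for R ph om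
 proof -
  have "osc v R ph om = (LINT x|lborel. indicator D x * (v x * cos (R * (om \<bullet> x) + ph)))"
   unfolding osc_def by (rule integral_uniform_on[OF body_borel]) measurable
  also have "\<dots> = (LINT x|lborel. v x * cos (R * (om \<bullet> x) + ph))"
   by (rule Bochner_Integration.integral_cong) (use vD in \<open>auto simp: indicator_def\<close>)
  finally show ?thesis .
 qed
 have intD: "integrable lborel (\<lambda>x. w x * cos (R * (om \<bullet> x) + ph))"
  if w: "w \<in> borel_measurable borel" "\<And>x. x \<notin> D \<Longrightarrow> w x = 0" "\<And>x. \<bar>w x\<bar> \<le> T" for w R ph om T
 proof -
  have b: "\<bar>w x * cos (R * (om \<bullet> x) + ph)\<bar> \<le> T" for x
  proof -
   have "\<bar>w x\<bar> * \<bar>cos (R * (om \<bullet> x) + ph)\<bar> \<le> T * 1" using order_trans[OF abs_ge_zero w(3)] by (intro mult_mono w) auto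
   then show ?thesis by (simp add: abs_mult)
  qed
  note [measurable] = w(1)
  have "integrable (uniform_on D) (\<lambda>x. w x * cos (R * (om \<bullet> x) + ph))"
   by (rule integrable_bounded_finite[OF finite_D _ b]) measurable
  then have "integrable lborel (\<lambda>x. indicator D x * (w x * cos (R * (om \<bullet> x) + ph)))"
   unfolding uniform_on_def by (subst (asm) integrable_real_density) auto
  moreover have "(\<lambda>x. indicator D x * (w x * cos (R * (om \<bullet> x) + ph))) = (\<lambda>x. w x * cos (R * (om \<bullet> x) + ph))"
   using w(2) by (auto simp: fun_eq_iff indicator_def)
  ultimately show ?thesis by simp
 qed
 have ubb: "\<bar>u x\<bar> \<le> B" for x using ub[of 1 x] by simp
 have rec: "osc u R ph om = osc v R ph om + (1 / 2 ^ ?n) * osc u (R / 2) ph om" for R ph om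
 proof -
  obtain T where T: "\<And>x. \<bar>v x\<bar> \<le> T" using UC_bounded[OF vU] by auto
  have iv: "integrable lborel (\<lambda>x. v x * cos (R * (om \<bullet> x) + ph))"
   by (rule intD[OF _ vD T]) measurable
  have iu: "integrable lborel (\<lambda>x. u x * cos (R * (om \<bullet> x) + ph))" by (rule intD[OF um u0 ubb])
  have e: "u x * cos (R * (om \<bullet> x) + ph) = v x * cos (R * (om \<bullet> x) + ph) + u (2 *\<^sub>R x) * cos ((R / 2) * (om \<bullet> (2 *\<^sub>R x)) + ph)" for x
   using uv[of x] by (simp add: distrib_right)
  have iu2: "integrable lborel (\<lambda>x. u (2 *\<^sub>R x) * cos ((R / 2) * (om \<bullet> (2 *\<^sub>R x)) + ph))"
   using Bochner_Integration.integrable_diff[OF iu iv] unfolding e by simp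
  have "osc u R ph om = (LINT x|lborel. v x * cos (R * (om \<bullet> x) + ph)) + (LINT x|lborel. u (2 *\<^sub>R x) * cos ((R / 2) * (om \<bullet> (2 *\<^sub>R x)) + ph))"
   unfolding osc_u e by (rule Bochner_Integration.integral_add[OF iv iu2])
  also have "(LINT x|lborel. u (2 *\<^sub>R x) * cos ((R / 2) * (om \<bullet> (2 *\<^sub>R x)) + ph)) = (1 / 2 ^ ?n) * osc u (R / 2) ph om"
  proof -
   have m: "(\<lambda>x. u x * cos ((R / 2) * (om \<bullet> x) + ph)) \<in> borel_measurable borel" by measurable
   show ?thesis unfolding osc_u by (rule lborel_integral_scale[OF m]) simp
  qed
  finally show ?thesis unfolding osc_v .
 qed
 define V where "V = measure (uniform_on D) (space (uniform_on D)) * B"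
 have triv: "\<bar>osc u R ph om\<bar> \<le> V" for R ph om
 proof -
  interpret FD: finite_measure "uniform_on D" by (rule finite_D)
  have b: "\<bar>u x * cos (R * (om \<bullet> x) + ph)\<bar> \<le> B" for x by (rule ub) simp
  have i: "integrable (uniform_on D) (\<lambda>x. u x * cos (R * (om \<bullet> x) + ph))"
   by (rule integrable_bounded_finite[OF finite_D _ b]) measurable
  have "\<bar>osc u R ph om\<bar> \<le> (LINT x|uniform_on D. \<bar>u x * cos (R * (om \<bullet> x) + ph)\<bar>)" unfolding osc_def by (rule integral_abs_bound)
  also have "\<dots> \<le> (LINT x|uniform_on D. B)" by (rule integral_mono) (use integrable_abs[OF i] b in \<open>auto simp: abs_mult\<close>)
  finally show ?thesis by (simp add: V_def)
 qed
 have V0: "V \<ge> 0" using order_trans[OF abs_ge_zero triv] .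
 \<comment> \<open>The contraction factor of the recursion for the rate R powr (-a). It is below 1
   because a = (n+1)/2 is less than n for n at least 2.\<close>
 define th where "th = 2 powr (a - real ?n)"
 have th: "0 < th" "th < 1"
 proof -
  show "0 < th" by (simp add: th_def)
  have "2 powr (a - real ?n) < 2 powr 0" by (rule powr_less_mono) (use n2 in \<open>auto simp: a_def\<close>)
  then show "th < 1" by (simp add: th_def)
 qed
 \<comment> \<open>The first entry covers 1 \<le> R < 2 by the trivial bound; the second ensures max
   C1 0 + th C \<le> C, so that the induction reproduces the constant.\<close>
 define C where "C = max (V * 2 powr a) (max C1 0 / (1 - th))"
 have main: "\<bar>osc u R ph om\<bar> \<le> C * R powr (- a)" if w: "norm om = 1" and R: "R \<ge> 1" "R < 2 ^ k" for k om R ph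
  using R
 proof (induction k arbitrary: R)
  case 0 then show ?case by simp
 next
  case (Suc k)
  show ?case
  proof (cases "R < 2")
   case True
   have "R powr a \<le> 2 powr a" using True Suc.prems n2 by (intro powr_mono2) (auto simp: a_def)
   then have "V \<le> (V * 2 powr a) * R powr (- a)"
    using V0 Suc.prems by (simp add: powr_minus field_simps mult_left_mono)
   also have "\<dots> \<le> C * R powr (- a)" by (intro mult_right_mono) (auto simp: C_def)
   finally show ?thesis using triv[of R ph om] by linarith
  next
   case False
   have IH: "\<bar>osc u (R / 2) ph om\<bar> \<le> C * (R / 2) powr (- a)" by (rule Suc.IH) (use False Suc.prems in auto)
   have c1: "C1 / R ^ ?n \<le> max C1 0 * R powr (- a)"
   proof -
    have "R powr a \<le> R powr (real ?n)" using Suc.prems n2 by (intro powr_mono) (auto simp: a_def)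
    then have "R powr a \<le> R ^ ?n" using Suc.prems by (simp add: powr_realpow)
    then have "1 / R ^ ?n \<le> 1 / R powr a" using Suc.prems by (intro divide_left_mono) auto
    then have "max C1 0 * (1 / R ^ ?n) \<le> max C1 0 * (1 / R powr a)" by (intro mult_left_mono) auto
    moreover have "C1 / R ^ ?n \<le> max C1 0 / R ^ ?n" using Suc.prems by (intro divide_right_mono) auto
    ultimately show ?thesis by (simp add: powr_minus_divide)
   qed
   have half: "(1 / 2 ^ ?n) * (C * (R / 2) powr (- a)) = th * C * R powr (- a)"
   proof -
    have "(R / 2) powr (- a) = R powr (- a) * 2 powr a" using Suc.prems by (simp add: powr_divide powr_minus field_simps)
    moreover have "2 powr a / 2 ^ ?n = th" by (simp add: th_def powr_diff powr_realpow)
    ultimately show ?thesis by (simp add: field_simps)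
   qed
   have "\<bar>osc u R ph om\<bar> \<le> \<bar>osc v R ph om\<bar> + (1 / 2 ^ ?n) * \<bar>osc u (R / 2) ph om\<bar>"
    unfolding rec[of R] using abs_triangle_ineq[of "osc v R ph om" "(1 / 2 ^ ?n) * osc u (R / 2) ph om"] by (simp add: abs_mult)
   also have "\<dots> \<le> max C1 0 * R powr (- a) + (1 / 2 ^ ?n) * (C * (R / 2) powr (- a))"
    using C1[OF w Suc.prems(1), of ph] c1 IH by (intro add_mono mult_left_mono) auto
   also have "\<dots> = (max C1 0 + th * C) * R powr (- a)" unfolding half by (simp add: distrib_right)
   also have "\<dots> \<le> C * R powr (- a)"
   proof (rule mult_right_mono)
    have "max C1 0 / (1 - th) \<le> C" by (simp add: C_def)
    then have "max C1 0 \<le> C * (1 - th)" using th by (simp only: pos_divide_le_eq diff_gt_0_iff_gt)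
    then show "max C1 0 + th * C \<le> C" by (simp add: algebra_simps)
   qed simp
   finally show ?thesis .
  qed
 qed
 have "\<bar>osc u R ph om\<bar> \<le> C * R powr (- (real ?n + 1) / 2)" if "norm om = 1" "R \<ge> 1" for om R ph
 proof -
  obtain k where "R < 2 ^ k" using real_arch_pow[of 2 R] by auto
  moreover have "- (real ?n + 1) / 2 = - a" by (simp add: a_def minus_divide_left)
  ultimately show ?thesis using main[OF that(1,2)] by metis
 qed
 then show ?thesis unfolding u_def by blast
qed

text \<open>The weight is split by cutoffs into a smooth part and the part at the origin. The first
  decays in mean square and thus in mean, the second pointwise. Only the mean of the modulus is
  needed for the sum over the lattice.\<close>

lemma ft_L1_decay:
 "\<exists>C\<ge>0. \<forall>Om R ph. rotation_invariant Om \<longrightarrow> R \<ge> 1 \<longrightarrow>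
   osc ft R ph \<in> borel_measurable borel \<and> integrable Om (osc ft R ph) \<and>
   (LINT om|Om. \<bar>osc ft R ph om\<bar>) \<le> C * R powr (- (real CARD('n) + 1) / 2)"
proof -
 let ?n = "CARD('n)"
 define a where "a = (real ?n + 1) / 2"
 have ae: "- (real ?n + 1) / 2 = - a" by (simp add: a_def minus_divide_left)
 obtain r where r: "r > 0" "cball 0 r \<subseteq> D" by (rule ball_in_body)
 define s where "s = r / 2"
 have s: "s > 0" "cball 0 (2 * s) \<subseteq> D" using r by (auto simp: s_def)
 obtain B0 where B0: "\<And>x. x \<in> D \<Longrightarrow> norm x \<le> B0" using bounded_body unfolding bounded_iff by blast
 \<comment> \<open>Large enough that the outer cutoff equals 1 on the body.\<close>
 define B where "B = max B0 s"
 have B: "s \<le> B" "\<And>x. x \<in> D \<Longrightarrow> norm x \<le> B" using B0 by (force simp: B_def)+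
 define h where "h = (\<lambda>x. ft x * (cutoff (Suc ?n) 0 B x - cutoff (Suc ?n) 0 s x))"
 define u where "u = (\<lambda>x. ft x * cutoff (Suc ?n) 0 s x)"
 have hU: "UC ?n {()} UNIV (\<lambda>_. h)" unfolding h_def by (rule ft_annulus_UC[OF s(1) B(1)])
 have h0: "UC 0 {()} UNIV (\<lambda>_. h)" using UC_0[OF hU] .
 obtain C1 where C1: "\<And>Om R ph. rotation_invariant Om \<Longrightarrow> R \<ge> 1 \<Longrightarrow> (LINT om|Om. (osc h R ph om)\<^sup>2) \<le> C1 / R ^ (?n + 1)"
  using avg_decay_smooth[OF hU] unfolding avg_decay_def by blast
 obtain C2 where C2: "\<And>om R ph. norm om = 1 \<Longrightarrow> R \<ge> 1 \<Longrightarrow> \<bar>osc u R ph om\<bar> \<le> C2 * R powr (- a)"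
  using apex_decay[OF s] unfolding u_def ae by blast
 have "continuous_on UNIV (cutoff (Suc ?n) (0::real^'n) s)" using UC_continuous[OF UC_cutoff[of s 0 "Suc ?n" "{()}" 0], of "()"] s by simp
 then have [measurable]: "cutoff (Suc ?n) (0::real^'n) s \<in> borel_measurable borel" by (rule borel_measurable_continuous_onI)
 have um[measurable]: "u \<in> borel_measurable borel" unfolding u_def by measurable
 interpret FD: finite_measure "uniform_on D" by (rule finite_D)
 obtain T where T: "T > 0" "\<And>x. \<bar>ft x\<bar> \<le> T" by (rule ft_bounded) (rule that)
 have ub: "\<bar>u x * cos t\<bar> \<le> T" for x t
 proof -
  have "\<bar>ft x\<bar> * \<bar>cutoff (Suc ?n) 0 s x\<bar> * \<bar>cos t\<bar> \<le> T * 1 * 1"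
   using cutoff_range[of s "Suc ?n" 0 x] s T by (intro mult_mono) auto
  then show ?thesis by (simp add: u_def abs_mult)
 qed
 have iu: "integrable (uniform_on D) (\<lambda>x. u x * cos (R * (om \<bullet> x) + ph))" for R ph om
  by (rule integrable_bounded_finite[OF finite_D _ ub]) measurable
 have mu[measurable]: "osc u R ph \<in> borel_measurable borel" for R ph
  unfolding osc_def by (rule FD.borel_measurable_lebesgue_integral) measurable
 have mh[measurable]: "osc h R ph \<in> borel_measurable borel" for R ph by (rule osc_measurable(1)[OF h0])
 have hc: "continuous_on UNIV h" using UC_continuous[OF h0, of "()"] by simp
 note [measurable] = borel_measurable_continuous_onI[OF hc]
 have split: "osc ft R ph om = osc h R ph om + osc u R ph om" for R ph om
 proof -
  have "osc ft R ph om = (LINT x|lborel. indicator D x * (ft x * cos (R * (om \<bullet> x) + ph)))"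
   unfolding osc_def by (rule integral_uniform_on[OF body_borel]) measurable
  also have "\<dots> = (LINT x|lborel. indicator D x * (h x * cos (R * (om \<bullet> x) + ph) + u x * cos (R * (om \<bullet> x) + ph)))"
  proof (rule Bochner_Integration.integral_cong[OF refl])
   fix x
   show "indicator D x * (ft x * cos (R * (om \<bullet> x) + ph)) = indicator D x * (h x * cos (R * (om \<bullet> x) + ph) + u x * cos (R * (om \<bullet> x) + ph))"
   proof (cases "x \<in> D")
    case True
    have "cutoff (Suc ?n) 0 B x = 1" using B(2)[OF True] B(1) s by (intro cutoff_1) auto
    then show ?thesis by (simp add: h_def u_def algebra_simps)
   qed simp
  qed
  also have "\<dots> = (LINT x|uniform_on D. h x * cos (R * (om \<bullet> x) + ph) + u x * cos (R * (om \<bullet> x) + ph))"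
   by (rule integral_uniform_on[OF body_borel, symmetric]) measurable
  also have "\<dots> = osc h R ph om + osc u R ph om"
   unfolding osc_def by (rule Bochner_Integration.integral_add[OF osc_measurable(3)[OF h0] iu])
  finally show ?thesis .
 qed
 obtain Bh where Bh: "\<And>R ph om. \<bar>osc h R ph om\<bar> \<le> Bh" using osc_measurable(2)[OF h0] by blast
 have mft: "osc ft R ph \<in> borel_measurable borel" for R ph
 proof -
  have "osc ft R ph = (\<lambda>om. osc h R ph om + osc u R ph om)" using split by auto
  then show ?thesis by simp
 qed
 define C where "C = 1 + \<bar>C1\<bar> + \<bar>C2\<bar>"
 have "osc ft R ph \<in> borel_measurable borel \<and> integrable Om (osc ft R ph) \<and>
   (LINT om|Om. \<bar>osc ft R ph om\<bar>) \<le> C * R powr (- a)" if Om: "rotation_invariant Om" and R: "R \<ge> 1" for Om R ph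
 proof (intro conjI)
  interpret prob_space Om using Om by (simp add: rotation_invariant_def)
  have so[measurable_cong]: "sets Om = sets borel" using Om by (simp add: rotation_invariant_def)
  have fin: "finite_measure Om" by unfold_locales
  have n1: "AE om in Om. norm om = 1" using Om by (simp add: rotation_invariant_def)
  let ?t = "R powr (- a)"
  have t0: "?t > 0" using R by simp
  have t2: "?t\<^sup>2 = 1 / R ^ (?n + 1)"
  proof -
   have "?t\<^sup>2 = R powr (- a + - a)" unfolding power2_eq_square using R by (simp add: powr_add[symmetric])
   also have "- a + - a = - real (?n + 1)" by (simp add: a_def)
   also have "R powr (- real (?n + 1)) = 1 / R ^ (?n + 1)" using R by (simp only: powr_minus_divide powr_realpow)
   finally show ?thesis .
  qed
  show "osc ft R ph \<in> borel_measurable borel" by (rule mft)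
  have ih: "integrable Om (osc h R ph)" by (rule integrable_bounded_finite[OF fin _ Bh]) measurable
  have "integrable Om (osc u R ph)"
   by (rule integrable_const_bound[where B="C2 * ?t"]) (use n1 C2 R in \<open>auto elim!: eventually_mono\<close>)
  with ih have "integrable Om (\<lambda>om. osc h R ph om + osc u R ph om)" by (rule Bochner_Integration.integrable_add)
  moreover have "osc ft R ph = (\<lambda>om. osc h R ph om + osc u R ph om)" using split by auto
  ultimately show ift: "integrable Om (osc ft R ph)" by simp
  have i2: "integrable Om (\<lambda>om. (osc h R ph om)\<^sup>2)" by (rule osc_sq_integrable[OF h0 Om])
  have "(LINT om|Om. \<bar>osc ft R ph om\<bar>) \<le> (LINT om|Om. ?t + (osc h R ph om)\<^sup>2 / ?t + \<bar>C2\<bar> * ?t)"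
  proof (rule integral_mono_AE)
   show "integrable Om (\<lambda>om. \<bar>osc ft R ph om\<bar>)" using ift by simp
   show "integrable Om (\<lambda>om. ?t + (osc h R ph om)\<^sup>2 / ?t + \<bar>C2\<bar> * ?t)" using i2 by simp
   show "AE om in Om. \<bar>osc ft R ph om\<bar> \<le> ?t + (osc h R ph om)\<^sup>2 / ?t + \<bar>C2\<bar> * ?t"
    using n1
   proof eventually_elim
    case (elim om)
    \<comment> \<open>Passage from mean square to mean; the optimal \<open>t\<close> is the expected
      size R powr (-a), whose square is exactly the mean square rate R^(-(n+1)).\<close>
    have amgm: "\<bar>x\<bar> \<le> t + x\<^sup>2 / t" if "t > 0" for x t :: real
    proof -
     have "2 * (\<bar>x\<bar> * t) \<le> t\<^sup>2 + x\<^sup>2"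
      using zero_le_power2[of "\<bar>x\<bar> - t"] by (simp add: power2_eq_square algebra_simps)
     moreover have "0 \<le> \<bar>x\<bar> * t" using that by simp
     ultimately have "\<bar>x\<bar> * t \<le> t\<^sup>2 + x\<^sup>2" by linarith
     then show ?thesis using that by (simp add: field_simps power2_eq_square)
    qed
    have "\<bar>osc u R ph om\<bar> \<le> C2 * ?t" by (rule C2[OF elim R])
    also have "\<dots> \<le> \<bar>C2\<bar> * ?t" using t0 by (intro mult_right_mono) auto
    finally show ?case using amgm[OF t0, of "osc h R ph om"] split[of R ph om] by linarith
   qed
  qed
  also have "\<dots> = ?t + (LINT om|Om. (osc h R ph om)\<^sup>2) / ?t + \<bar>C2\<bar> * ?t" using i2 by (simp add: prob_space)
  also have "\<dots> \<le> ?t + \<bar>C1\<bar> * ?t + \<bar>C2\<bar> * ?t"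
  proof -
   have "(LINT om|Om. (osc h R ph om)\<^sup>2) \<le> C1 * ?t\<^sup>2" using C1[OF Om R, of ph] unfolding t2 by simp
   also have "\<dots> \<le> \<bar>C1\<bar> * ?t\<^sup>2" by (intro mult_right_mono) auto
   finally have "(LINT om|Om. (osc h R ph om)\<^sup>2) / ?t \<le> \<bar>C1\<bar> * ?t" using t0 by (simp add: field_simps power2_eq_square)
   then show ?thesis by linarith
  qed
  also have "\<dots> = C * ?t" by (simp add: C_def algebra_simps)
  finally show "(LINT om|Om. \<bar>osc ft R ph om\<bar>) \<le> C * ?t" .
 qed
 then show ?thesis unfolding ae by (intro exI[of _ C]) (auto simp: C_def)
qed

end

subsection \<open>The Fourier series of the triangle function\<close>

definition CJ :: "nat \<Rightarrow> real \<Rightarrow> real" where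
 "CJ J x = (\<Sum>j<J. cos (2 * pi * real (Suc j) * x) / (real (Suc j))\<^sup>2)"

text \<open>On the unit interval this is pi^2 times the second Bernoulli polynomial.\<close>

definition CC :: "real \<Rightarrow> real" where
 "CC x = (\<Sum>j. cos (2 * pi * real (Suc j) * x) / (real (Suc j))\<^sup>2)"

lemma summable_inverse_squares: "summable (\<lambda>j. 1 / (real (Suc j))\<^sup>2)"
 using sums_summable[OF inverse_squares_sums] by (simp add: add.commute)

lemma CJ_uniform: "uniform_limit UNIV CJ CC sequentially"
proof -
 have "uniform_limit UNIV (\<lambda>J x. \<Sum>j<J. cos (2 * pi * real (Suc j) * x) / (real (Suc j))\<^sup>2)
   (\<lambda>x. \<Sum>j. cos (2 * pi * real (Suc j) * x) / (real (Suc j))\<^sup>2) sequentially"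
  by (rule Weierstrass_m_test[OF _ summable_inverse_squares])
    (auto intro!: divide_right_mono simp del: of_nat_Suc)
 then show ?thesis by (simp add: CJ_def[abs_def] CC_def[abs_def])
qed

lemma CJ_tendsto: "(\<lambda>J. CJ J x) \<longlonglongrightarrow> CC x"
 using CJ_uniform by (rule tendsto_uniform_limitI) simp

lemma CC_continuous: "continuous_on UNIV CC"
 by (rule uniform_limit_theorem[OF _ CJ_uniform])
   (auto simp: CJ_def simp del: of_nat_Suc intro!: always_eventually continuous_intros)

lemma dirichlet_kernel:
 "sin (pi * x) * (1 + 2 * (\<Sum>j<J. cos (2 * pi * real (Suc j) * x))) = sin ((2 * real J + 1) * pi * x)"
proof (induction J)
 case (Suc J)
 have "2 * sin (pi * x) * cos (2 * pi * real (Suc J) * x) = sin ((2 * real (Suc J) + 1) * pi * x) - sin ((2 * real J + 1) * pi * x)"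
 proof -
  have a: "(2 * real (Suc J) + 1) * pi * x = 2 * pi * real (Suc J) * x + pi * x"
   "(2 * real J + 1) * pi * x = 2 * pi * real (Suc J) * x - pi * x" by (simp_all add: algebra_simps)
  show ?thesis unfolding a sin_add sin_diff by simp
 qed
 then show ?case using Suc by (simp add: algebra_simps)
qed simp

text \<open>The derivative of the error is the Dirichlet kernel sin(N pi x)/sin(pi x), which is
  bounded away from the integers but oscillates; a primitive of its main part is of order 1/N. The
  error vanishes at the midpoint, from where it is integrated.\<close>

lemma sawtooth_bound:
 assumes d: "0 < \<delta>" "\<delta> < 1/2"
 obtains K where "\<And>J x. \<delta> \<le> x \<Longrightarrow> x \<le> 1 - \<delta> \<Longrightarrow>
  \<bar>(\<Sum>j<J. sin (2 * pi * real (Suc j) * x) / (pi * real (Suc j))) - (1/2 - x)\<bar> \<le> K / (2 * real J + 1)"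
proof -
 define \<sigma> where "\<sigma> = sin (pi * \<delta>)"
 have \<sigma>: "\<sigma> > 0" unfolding \<sigma>_def using d by (intro sin_gt_zero) (auto simp: field_simps)
 have sl: "\<sigma> \<le> sin (pi * x)" if "\<delta> \<le> x" "x \<le> 1 - \<delta>" for x
 proof (cases "x \<le> 1/2")
  case True
  have p: "pi * \<delta> \<le> pi * x" "pi * x \<le> pi * (1/2)" "0 \<le> pi * \<delta>" using that d True by (simp_all add: mult_left_mono)
  show ?thesis unfolding \<sigma>_def by (rule sin_monotone_2pi_le) (use p pi_gt_zero in linarith)+
 next
  case False
  have "sin (pi * x) = sin (pi * (1 - x))" by (simp add: right_diff_distrib sin_diff)
  moreover have "\<sigma> \<le> sin (pi * (1 - x))" 
  proof -
   have p: "pi * \<delta> \<le> pi * (1 - x)" "pi * (1 - x) \<le> pi * (1/2)" "0 \<le> pi * \<delta>" using that d False by (simp_all add: mult_left_mono del: mult_le_cancel_left_pos)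
   show ?thesis unfolding \<sigma>_def by (rule sin_monotone_2pi_le) (use p pi_gt_zero in linarith)+
  qed
  ultimately show ?thesis by simp
 qed
 define K where "K = 1 / \<sigma>\<^sup>2 + 2 / (pi * \<sigma>)"
 have "\<bar>(\<Sum>j<J. sin (2 * pi * real (Suc j) * x) / (pi * real (Suc j))) - (1/2 - x)\<bar> \<le> K / (2 * real J + 1)"
  if x: "\<delta> \<le> x" "x \<le> 1 - \<delta>" for J x
 proof -
  define N where "N = 2 * real J + 1"
  have N: "N > 0" by (simp add: N_def)
  define E where "E = (\<lambda>x. (\<Sum>j<J. sin (2 * pi * real (Suc j) * x) / (pi * real (Suc j))) - (1/2 - x))"
  \<comment> \<open>The added term cancels the oscillating main part of the derivative of
    \<open>E\<close>, leaving a derivative of order 1/N.\<close>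
  define Y where "Y = (\<lambda>x. E x + cos (N * pi * x) / (N * pi * sin (pi * x)))"
  have dE: "(E has_real_derivative 1 + 2 * (\<Sum>j<J. cos (2 * pi * real (Suc j) * x))) (at x)" for x
  proof -
   have "((\<lambda>x. sin (2 * pi * real (Suc j) * x) / (pi * real (Suc j))) has_real_derivative 2 * cos (2 * pi * real (Suc j) * x)) (at x)" for j
   proof -
    have "((\<lambda>x. sin (2 * pi * real (Suc j) * x)) has_real_derivative cos (2 * pi * real (Suc j) * x) * (2 * pi * real (Suc j))) (at x)"
     by (auto intro!: derivative_eq_intros simp del: of_nat_Suc)
    from DERIV_cdivide[OF this, of "pi * real (Suc j)"] show ?thesis by (simp add: field_simps del: of_nat_Suc)
   qed
   then have "((\<lambda>x. \<Sum>j<J. sin (2 * pi * real (Suc j) * x) / (pi * real (Suc j))) has_real_derivative (\<Sum>j<J. 2 * cos (2 * pi * real (Suc j) * x))) (at x)"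
    by (intro DERIV_sum) auto
   moreover have "((\<lambda>x::real. 1/2 - x) has_real_derivative -1) (at x)" by (auto intro!: derivative_eq_intros)
   ultimately have "(E has_real_derivative (\<Sum>j<J. 2 * cos (2 * pi * real (Suc j) * x)) - (-1)) (at x)"
    unfolding E_def by (rule DERIV_diff)
   then show ?thesis by (simp add: sum_distrib_left add.commute)
  qed
  have dY: "(Y has_real_derivative - (cos (N * pi * z) * cos (pi * z)) / (N * (sin (pi * z))\<^sup>2)) (at z)" if z: "\<delta> \<le> z" "z \<le> 1 - \<delta>" for z
  proof -
   have s0: "sin (pi * z) > 0" using sl[OF z] \<sigma> by linarith
   have e1: "1 + 2 * (\<Sum>j<J. cos (2 * pi * real (Suc j) * z)) = sin (N * pi * z) / sin (pi * z)"
    using dirichlet_kernel[of z J] s0 unfolding N_def by (simp add: field_simps)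
   have c: "((\<lambda>z. cos (N * pi * z)) has_real_derivative - sin (N * pi * z) * (N * pi)) (at z)" by (auto intro!: derivative_eq_intros)
   have s: "((\<lambda>z. N * pi * sin (pi * z)) has_real_derivative N * pi * (cos (pi * z) * pi)) (at z)" by (auto intro!: derivative_eq_intros)
   have nz: "N * pi * sin (pi * z) \<noteq> 0" using s0 N by simp
   have "(Y has_real_derivative sin (N * pi * z) / sin (pi * z) +
     (- sin (N * pi * z) * (N * pi) * (N * pi * sin (pi * z)) - cos (N * pi * z) * (N * pi * (cos (pi * z) * pi))) / ((N * pi * sin (pi * z)) * (N * pi * sin (pi * z)))) (at z)"
    unfolding Y_def using DERIV_add[OF dE[of z, unfolded e1] DERIV_divide[OF c s nz]] .
   moreover have "sin (N * pi * z) / sin (pi * z) +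
     (- sin (N * pi * z) * (N * pi) * (N * pi * sin (pi * z)) - cos (N * pi * z) * (N * pi * (cos (pi * z) * pi))) / ((N * pi * sin (pi * z)) * (N * pi * sin (pi * z)))
     = - (cos (N * pi * z) * cos (pi * z)) / (N * (sin (pi * z))\<^sup>2)"
    using s0 N by (simp add: field_simps power2_eq_square)
   ultimately show ?thesis by simp
  qed
  have bY: "\<bar>- (cos (N * pi * z) * cos (pi * z)) / (N * (sin (pi * z))\<^sup>2)\<bar> \<le> 1 / (N * \<sigma>\<^sup>2)" if z: "\<delta> \<le> z" "z \<le> 1 - \<delta>" for z
  proof -
   have "\<bar>cos (N * pi * z)\<bar> * \<bar>cos (pi * z)\<bar> \<le> 1 * 1" by (intro mult_mono) auto
   moreover have "\<sigma>\<^sup>2 \<le> (sin (pi * z))\<^sup>2" using sl[OF z] \<sigma> by (intro power_mono) auto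
   ultimately have "\<bar>cos (N * pi * z)\<bar> * \<bar>cos (pi * z)\<bar> / (N * (sin (pi * z))\<^sup>2) \<le> 1 / (N * \<sigma>\<^sup>2)"
    using N \<sigma> by (intro frac_le mult_left_mono) auto
   then show ?thesis using N by (simp add: abs_mult)
  qed
  have half: "\<delta> \<le> 1/2" "1/2 \<le> 1 - \<delta>" using d by auto
  have "norm (Y x - Y (1/2)) \<le> 1 / (N * \<sigma>\<^sup>2) * norm (x - 1/2)"
   by (rule field_differentiable_bound[of "{\<delta>..1-\<delta>}" Y])
     (use dY bY x half in \<open>auto intro: has_field_derivative_at_within\<close>)
  also have "\<dots> \<le> 1 / (N * \<sigma>\<^sup>2) * 1" using x d N \<sigma> by (intro mult_left_mono) (auto simp: abs_le_iff)
  finally have Yd: "\<bar>Y x - Y (1/2)\<bar> \<le> 1 / (N * \<sigma>\<^sup>2)" by simp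
  \<comment> \<open>Every sine vanishes at the midpoint, as does 1/2 - x.\<close>
  have E12: "E (1/2) = 0"
  proof -
   have "sin (2 * pi * real (Suc j) * (1/2)) = 0" for j
   proof -
    have "2 * pi * real (Suc j) * (1/2) = real (Suc j) * pi" by simp
    then show ?thesis using sin_npi[of "Suc j"] by metis
   qed
   then show ?thesis unfolding E_def by simp
  qed
  have cb: "\<bar>cos (N * pi * z) / (N * pi * sin (pi * z))\<bar> \<le> 1 / (N * pi * \<sigma>)" if z: "\<delta> \<le> z" "z \<le> 1 - \<delta>" for z
  proof -
   have s0: "sin (pi * z) > 0" using sl[OF z] \<sigma> by linarith
   have "\<bar>cos (N * pi * z)\<bar> / (N * pi * sin (pi * z)) \<le> 1 / (N * pi * \<sigma>)"
    using N \<sigma> sl[OF z] by (intro frac_le mult_left_mono) auto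
   then show ?thesis using N s0 by (simp add: abs_mult)
  qed
  have "\<bar>E x\<bar> \<le> 1 / (N * \<sigma>\<^sup>2) + 1 / (N * pi * \<sigma>) + 1 / (N * pi * \<sigma>)"
   using Yd cb[OF x] cb[OF half] E12 unfolding Y_def by linarith
  also have "\<dots> = K / N" using N \<sigma> by (simp add: K_def field_simps)
  finally show ?thesis by (simp add: E_def N_def)
 qed
 then show ?thesis by (rule that)
qed

text \<open>The difference of the two sides has partial sums whose derivatives tend to 0 uniformly
  away from the endpoints, so it is constant inside, and by continuity up to the endpoints. The
  value \<open>CC 0\<close> may stay unevaluated since only second differences will be
  taken.\<close>

lemma CC_quadratic:
 assumes "0 \<le> x" "x \<le> 1"
 shows "CC x = CC 0 + pi\<^sup>2 * (x\<^sup>2 - x)"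
proof -
 define Z where "Z = (\<lambda>x. CC x - pi\<^sup>2 * (x\<^sup>2 - x))"
 have inner: "Z x = Z y" if xy: "0 < x" "x < 1" "0 < y" "y < 1" for x y
 proof -
  define \<delta> where "\<delta> = min (min x (1 - x)) (min (min y (1 - y)) (1/4))"
  have "0 < \<delta>" "\<delta> \<le> x" "\<delta> \<le> 1 - x" "\<delta> \<le> y" "\<delta> \<le> 1 - y" using xy by (auto simp: \<delta>_def min_le_iff_disj)
  moreover have "\<delta> \<le> 1/4" unfolding \<delta>_def by linarith
  ultimately have d: "0 < \<delta>" "\<delta> < 1/2" "\<delta> \<le> x" "x \<le> 1 - \<delta>" "\<delta> \<le> y" "y \<le> 1 - \<delta>" by linarith+
  obtain K where K: "\<And>J x. \<delta> \<le> x \<Longrightarrow> x \<le> 1 - \<delta> \<Longrightarrow>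
   \<bar>(\<Sum>j<J. sin (2 * pi * real (Suc j) * x) / (pi * real (Suc j))) - (1/2 - x)\<bar> \<le> K / (2 * real J + 1)"
   by (rule sawtooth_bound[OF d(1,2)]) (rule that)
  define ZJ where "ZJ = (\<lambda>J x. CJ J x - pi\<^sup>2 * (x\<^sup>2 - x))"
  have dZ: "(ZJ J has_real_derivative - (2 * pi\<^sup>2) * ((\<Sum>j<J. sin (2 * pi * real (Suc j) * z) / (pi * real (Suc j))) - (1/2 - z))) (at z)" for J z
  proof -
   have "((\<lambda>x. cos (2 * pi * real (Suc j) * x) / (real (Suc j))\<^sup>2) has_real_derivative - (2 * pi\<^sup>2) * (sin (2 * pi * real (Suc j) * z) / (pi * real (Suc j)))) (at z)" for j
   proof -
    have "((\<lambda>x. cos (2 * pi * real (Suc j) * x)) has_real_derivative - sin (2 * pi * real (Suc j) * z) * (2 * pi * real (Suc j))) (at z)"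
     by (auto intro!: derivative_eq_intros simp del: of_nat_Suc)
    from DERIV_cdivide[OF this, of "(real (Suc j))\<^sup>2"] show ?thesis by (simp add: field_simps power2_eq_square del: of_nat_Suc)
   qed
   then have "(CJ J has_real_derivative (\<Sum>j<J. - (2 * pi\<^sup>2) * (sin (2 * pi * real (Suc j) * z) / (pi * real (Suc j))))) (at z)"
    unfolding CJ_def[abs_def] by (intro DERIV_sum) auto
   moreover have "((\<lambda>x. pi\<^sup>2 * (x\<^sup>2 - x)) has_real_derivative pi\<^sup>2 * (2 * z - 1)) (at z)" by (auto intro!: derivative_eq_intros)
   ultimately have "(ZJ J has_real_derivative (\<Sum>j<J. - (2 * pi\<^sup>2) * (sin (2 * pi * real (Suc j) * z) / (pi * real (Suc j)))) - pi\<^sup>2 * (2 * z - 1)) (at z)"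
    unfolding ZJ_def by (rule DERIV_diff)
   moreover have "(\<Sum>j<J. - (2 * pi\<^sup>2) * (sin (2 * pi * real (Suc j) * z) / (pi * real (Suc j)))) - pi\<^sup>2 * (2 * z - 1) =
     - (2 * pi\<^sup>2) * ((\<Sum>j<J. sin (2 * pi * real (Suc j) * z) / (pi * real (Suc j))) - (1/2 - z))"
    unfolding sum_distrib_left[symmetric] by (simp add: algebra_simps)
   ultimately show ?thesis by simp
  qed
  have bd: "\<bar>ZJ J x - ZJ J y\<bar> \<le> 2 * pi\<^sup>2 * K / (2 * real J + 1)" for J
  proof -
   have K0: "K / (2 * real J + 1) \<ge> 0" using order_trans[OF abs_ge_zero K[OF d(3,4)]] .
   have "norm (ZJ J x - ZJ J y) \<le> 2 * pi\<^sup>2 * (K / (2 * real J + 1)) * norm (x - y)"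
   proof (rule field_differentiable_bound[of "{\<delta>..1-\<delta>}" "ZJ J"])
    fix z assume z: "z \<in> {\<delta>..1-\<delta>}"
    show "(ZJ J has_real_derivative - (2 * pi\<^sup>2) * ((\<Sum>j<J. sin (2 * pi * real (Suc j) * z) / (pi * real (Suc j))) - (1/2 - z))) (at z within {\<delta>..1-\<delta>})"
     by (rule has_field_derivative_at_within[OF dZ])
    have "2 * pi\<^sup>2 * \<bar>(\<Sum>j<J. sin (2 * pi * real (Suc j) * z) / (pi * real (Suc j))) - (1/2 - z)\<bar> \<le> 2 * pi\<^sup>2 * (K / (2 * real J + 1))"
     using K[of z J] z by (intro mult_left_mono) auto
    then show "norm (- (2 * pi\<^sup>2) * ((\<Sum>j<J. sin (2 * pi * real (Suc j) * z) / (pi * real (Suc j))) - (1/2 - z))) \<le> 2 * pi\<^sup>2 * (K / (2 * real J + 1))"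
     by (simp only: norm_mult real_norm_def abs_minus_cancel abs_mult abs_power2 abs_numeral power2_abs)
   qed (use d in auto)
   also have "\<dots> \<le> 2 * pi\<^sup>2 * (K / (2 * real J + 1)) * 1" using xy K0 by (intro mult_left_mono mult_nonneg_nonneg[OF _ K0]) (auto simp: abs_le_iff)
   finally show ?thesis by simp
  qed
  have "(\<lambda>J. ZJ J x - ZJ J y) \<longlonglongrightarrow> Z x - Z y"
   unfolding ZJ_def Z_def by (intro tendsto_intros CJ_tendsto)
  moreover have "(\<lambda>J. ZJ J x - ZJ J y) \<longlonglongrightarrow> 0"
  proof (rule Lim_null_comparison)
   show "\<forall>\<^sub>F J in sequentially. norm (ZJ J x - ZJ J y) \<le> 2 * pi\<^sup>2 * K / (2 * real J + 1)" using bd by (intro always_eventually) auto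
   show "(\<lambda>J. 2 * pi\<^sup>2 * K / (2 * real J + 1)) \<longlonglongrightarrow> 0"
    by (rule real_tendsto_divide_at_top[OF tendsto_const filterlim_at_top_mono[OF filterlim_real_sequentially]]) auto
  qed
  ultimately show ?thesis using LIMSEQ_unique by fastforce
 qed
 have cZ: "continuous_on {0..1} Z" unfolding Z_def
  by (intro continuous_intros continuous_on_subset[OF CC_continuous]) auto
 have cl: "closure {0<..<1::real} = {0..1}" by simp
 have Zh: "Z x = Z (1/2)" if "x \<in> {0..1}" for x
 proof (rule continuous_constant_on_closure[of "{0<..<1}" Z "Z (1/2)" x])
  show "continuous_on (closure {0<..<1}) Z" using cZ unfolding cl .
  show "x \<in> closure {0<..<1}" using that unfolding cl .
  show "Z x = Z (1/2)" if "x \<in> {0<..<1}" for x using inner[of x "1/2"] that by simp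
 qed
 have "Z x = Z 0" using Zh[of x] Zh[of 0] assms by simp
 then show ?thesis by (simp add: Z_def)
qed

text \<open>The Fourier coefficients of the periodised triangle \<open>tri\<close>: squares of sinc
  values, hence nonnegative and of order 1/j^2.\<close>

definition fc :: "real \<Rightarrow> nat \<Rightarrow> real" where
 "fc eps j = (if j = 0 then 1 else (sin (pi * real j * eps) / (pi * real j * eps))\<^sup>2)"

definition TP :: "real \<Rightarrow> nat \<Rightarrow> real \<Rightarrow> real" where
 "TP eps J t = 1 + 2 * (\<Sum>j<J. fc eps (Suc j) * cos (2 * pi * real (Suc j) * t))"

text \<open>The triangle of half-width \<open>eps\<close> and integral 1, made periodic by measuring
  from the nearest integer.\<close>

definition tri :: "real \<Rightarrow> real \<Rightarrow> real" where
 "tri eps t = max 0 (eps - \<bar>t - of_int (round t)\<bar>) / eps\<^sup>2"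

lemma fc_nonneg: "fc eps j \<ge> 0" by (simp add: fc_def)

lemma fc_bounds:
 assumes "eps > 0"
 shows "fc eps j \<le> 1" "j > 0 \<Longrightarrow> fc eps j \<le> 1 / (eps * real j)\<^sup>2"
proof -
 show "fc eps j \<le> 1"
 proof (cases "j = 0")
  case False
  then have p: "pi * real j * eps > 0" using assms by simp
  have "\<bar>sin (pi * real j * eps) / (pi * real j * eps)\<bar> \<le> 1"
   using abs_sin_x_le_abs_x[of "pi * real j * eps"] p by (simp add: divide_le_eq_1)
  then have "\<bar>sin (pi * real j * eps) / (pi * real j * eps)\<bar>\<^sup>2 \<le> 1\<^sup>2" by (intro power_mono) auto
  then show ?thesis using False by (simp add: fc_def del: abs_divide)
 qed (simp add: fc_def)
 assume j: "j > 0"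
 have "\<bar>sin (pi * real j * eps)\<bar> / (pi * real j * eps) \<le> 1 / (eps * real j)"
 proof (rule frac_le)
  have "1 * (eps * real j) \<le> pi * (eps * real j)" using j assms pi_ge_two by (intro mult_right_mono) auto
  then show "eps * real j \<le> pi * real j * eps" by (simp add: mult_ac)
 qed (use j assms in auto)
 then have "(\<bar>sin (pi * real j * eps)\<bar> / (pi * real j * eps))\<^sup>2 \<le> (1 / (eps * real j))\<^sup>2"
  using j assms by (intro power_mono) auto
 then show "fc eps j \<le> 1 / (eps * real j)\<^sup>2" using j by (simp add: fc_def power_divide)
qed

lemma TP_bounded:
 assumes "eps > 0"
 obtains M where "M \<ge> 1" "\<And>J t. \<bar>TP eps J t\<bar> \<le> M"
proof -
 define S where "S = (\<Sum>j. 1 / (real (Suc j))\<^sup>2)"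
 have b: "\<bar>TP eps J t\<bar> \<le> 1 + 2 * (S / eps\<^sup>2)" for J t
 proof -
  have "\<bar>\<Sum>j<J. fc eps (Suc j) * cos (2 * pi * real (Suc j) * t)\<bar> \<le> (\<Sum>j<J. (1 / eps\<^sup>2) * (1 / (real (Suc j))\<^sup>2))"
  proof (rule order_trans[OF sum_abs], rule sum_mono)
   fix j
   have "\<bar>fc eps (Suc j) * cos (2 * pi * real (Suc j) * t)\<bar> \<le> fc eps (Suc j) * 1"
    unfolding abs_mult by (intro mult_mono) (auto simp: fc_nonneg)
   also have "\<dots> \<le> 1 / (eps * real (Suc j))\<^sup>2" using fc_bounds(2)[OF assms, of "Suc j"] by simp
   finally show "\<bar>fc eps (Suc j) * cos (2 * pi * real (Suc j) * t)\<bar> \<le> (1 / eps\<^sup>2) * (1 / (real (Suc j))\<^sup>2)"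
    by (simp add: power_mult_distrib del: of_nat_Suc)
  qed
  also have "\<dots> = (1 / eps\<^sup>2) * (\<Sum>j<J. 1 / (real (Suc j))\<^sup>2)" by (simp only: sum_distrib_left)
  also have "\<dots> \<le> (1 / eps\<^sup>2) * S"
   unfolding S_def by (intro mult_left_mono sum_le_suminf summable_inverse_squares) auto
  finally show ?thesis unfolding TP_def by simp
 qed
 have "S \<ge> 0" unfolding S_def by (intro suminf_nonneg summable_inverse_squares) auto
 then show ?thesis using b assms by (intro that[of "1 + 2 * (S / eps\<^sup>2)"]) auto
qed

text \<open>The identity cos b - (cos(b + 2a) + cos(b - 2a))/2 = 2 sin(a)^2 cos b turns the
  sinc-squared coefficients into a second difference of the series with coefficients 1/j^2.\<close>

lemma TP_CJ:
 assumes "eps > 0"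
 shows "TP eps J t = 1 + (1 / (pi\<^sup>2 * eps\<^sup>2)) * (CJ J t - (CJ J (t + eps) + CJ J (t - eps)) / 2)"
proof -
 have "2 * (fc eps (Suc j) * cos (2 * pi * real (Suc j) * t)) =
   (1 / (pi\<^sup>2 * eps\<^sup>2)) * (cos (2 * pi * real (Suc j) * t) / (real (Suc j))\<^sup>2 -
    (cos (2 * pi * real (Suc j) * (t + eps)) / (real (Suc j))\<^sup>2 + cos (2 * pi * real (Suc j) * (t - eps)) / (real (Suc j))\<^sup>2) / 2)" for j
 proof -
  define a where "a = pi * real (Suc j) * eps"
  define b where "b = 2 * pi * real (Suc j) * t"
  define n where "n = real (Suc j)"
  have n: "n > 0" by (simp add: n_def)
  have e: "2 * pi * real (Suc j) * (t + eps) = b + 2 * a" "2 * pi * real (Suc j) * (t - eps) = b - 2 * a"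
   by (simp_all add: a_def b_def algebra_simps)
  have cs: "cos (b + 2 * a) + cos (b - 2 * a) = 2 * cos b * (1 - 2 * (sin a)\<^sup>2)"
   unfolding cos_add cos_diff by (simp add: cos_double_sin)
  have s: "cos b - (cos (b + 2 * a) + cos (b - 2 * a)) / 2 = 2 * (sin a)\<^sup>2 * cos b" unfolding cs by (simp add: field_simps)
  have "(1 / (pi\<^sup>2 * eps\<^sup>2)) * (cos b / n\<^sup>2 - (cos (b + 2 * a) / n\<^sup>2 + cos (b - 2 * a) / n\<^sup>2) / 2)
    = (1 / (pi\<^sup>2 * eps\<^sup>2)) * ((cos b - (cos (b + 2 * a) + cos (b - 2 * a)) / 2) / n\<^sup>2)"
   by (simp only: diff_divide_distrib add_divide_distrib divide_divide_eq_left mult.commute)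
  also have "\<dots> = 2 * ((sin a / (pi * n * eps))\<^sup>2 * cos b)" unfolding s by (simp add: power_mult_distrib power_divide mult_ac)
  finally have "(1 / (pi\<^sup>2 * eps\<^sup>2)) * (cos b / n\<^sup>2 - (cos (b + 2 * a) / n\<^sup>2 + cos (b - 2 * a) / n\<^sup>2) / 2) = 2 * ((sin a / (pi * n * eps))\<^sup>2 * cos b)" .
  then show ?thesis unfolding e b_def[symmetric] fc_def n_def a_def by (simp del: of_nat_Suc)
 qed
 then have "2 * (\<Sum>j<J. fc eps (Suc j) * cos (2 * pi * real (Suc j) * t)) =
   (\<Sum>j<J. (1 / (pi\<^sup>2 * eps\<^sup>2)) * (cos (2 * pi * real (Suc j) * t) / (real (Suc j))\<^sup>2 -
    (cos (2 * pi * real (Suc j) * (t + eps)) / (real (Suc j))\<^sup>2 + cos (2 * pi * real (Suc j) * (t - eps)) / (real (Suc j))\<^sup>2) / 2))"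
  unfolding sum_distrib_left by (intro sum.cong refl)
 also have "\<dots> = (1 / (pi\<^sup>2 * eps\<^sup>2)) * (CJ J t - (CJ J (t + eps) + CJ J (t - eps)) / 2)"
  unfolding CJ_def by (simp only: sum_distrib_left[symmetric] sum_subtractf sum.distrib sum_divide_distrib[symmetric])
 finally show ?thesis by (simp add: TP_def)
qed

lemma CC_even: "CC (- x) = CC x" by (simp add: CC_def)

text \<open>The triangle is a second difference of a piecewise quadratic function. By periodicity
  and evenness, \<open>t\<close> is replaced by its distance \<open>s\<close> to the nearest
  integer; then s + eps stays in the unit interval.\<close>

lemma TP_tendsto:
 assumes e: "0 < eps" "eps \<le> 1/2"
 shows "(\<lambda>J. TP eps J t) \<longlonglongrightarrow> tri eps t"
proof -
 define s where "s = \<bar>t - of_int (round t)\<bar>"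
 have s: "0 \<le> s" "s \<le> 1/2" using of_int_round_abs_le[of t] by (auto simp: s_def abs_minus_commute)
 have TPs: "TP eps J t = TP eps J s" for J
 proof -
  have "cos (2 * pi * real (Suc j) * t) = cos (2 * pi * real (Suc j) * s)" for j
  proof -
   have "cos (2 * pi * real (Suc j) * s) = cos (2 * pi * real (Suc j) * (t - of_int (round t)))"
   proof (cases "t - of_int (round t) \<ge> 0")
    case False
    then have "2 * pi * real (Suc j) * s = - (2 * pi * real (Suc j) * (t - of_int (round t)))"
     unfolding s_def by (simp only: abs_of_neg not_le mult_minus_right)
    then show ?thesis by (simp only: cos_minus)
   qed (simp add: s_def)
   also have "2 * pi * real (Suc j) * (t - of_int (round t)) = 2 * pi * real (Suc j) * t - 2 * pi * of_int (int (Suc j) * round t)"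
    by (simp add: algebra_simps)
   also have "cos \<dots> = cos (2 * pi * real (Suc j) * t)"
    unfolding cos_diff using cos_int_2pin[of "int (Suc j) * round t"] sin_int_2pin[of "int (Suc j) * round t"] by simp
   finally show ?thesis by simp
  qed
  then show ?thesis by (simp add: TP_def)
 qed
 have "(\<lambda>J. TP eps J s) \<longlonglongrightarrow> 1 + (1 / (pi\<^sup>2 * eps\<^sup>2)) * (CC s - (CC (s + eps) + CC (s - eps)) / 2)"
  unfolding TP_CJ[OF e(1)] by (intro tendsto_intros CJ_tendsto) auto
 moreover have "1 + (1 / (pi\<^sup>2 * eps\<^sup>2)) * (CC s - (CC (s + eps) + CC (s - eps)) / 2) = tri eps t"
 proof -
  have q1: "CC s = CC 0 + pi\<^sup>2 * (s\<^sup>2 - s)" by (rule CC_quadratic) (use s in auto)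
  have q2: "CC (s + eps) = CC 0 + pi\<^sup>2 * ((s + eps)\<^sup>2 - (s + eps))" by (rule CC_quadratic) (use s e in auto)
  have p: "pi\<^sup>2 * eps\<^sup>2 \<noteq> 0" using e by simp
  show ?thesis
  proof (cases "s \<ge> eps")
   case True
   have q3: "CC (s - eps) = CC 0 + pi\<^sup>2 * ((s - eps)\<^sup>2 - (s - eps))" by (rule CC_quadratic) (use s e True in auto)
   have "CC s - (CC (s + eps) + CC (s - eps)) / 2 = - (pi\<^sup>2 * eps\<^sup>2)"
    unfolding q1 q2 q3 by (simp add: power2_eq_square field_simps)
   then have "1 + (1 / (pi\<^sup>2 * eps\<^sup>2)) * (CC s - (CC (s + eps) + CC (s - eps)) / 2) = 0" using p by simp
   then show ?thesis using True by (simp add: tri_def s_def)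
  next
   case False
   \<comment> \<open>Inside the triangle the argument s - eps is negative, outside the range of the
     quadratic formula; evenness brings it back and produces the kink.\<close>
   have "CC (s - eps) = CC (eps - s)" using CC_even[of "eps - s"] by simp
   also have "\<dots> = CC 0 + pi\<^sup>2 * ((eps - s)\<^sup>2 - (eps - s))" by (rule CC_quadratic) (use s e False in auto)
   finally have q3: "CC (s - eps) = CC 0 + pi\<^sup>2 * ((eps - s)\<^sup>2 - (eps - s))" .
   have "CC s - (CC (s + eps) + CC (s - eps)) / 2 = pi\<^sup>2 * (eps - s) - pi\<^sup>2 * eps\<^sup>2"
    unfolding q1 q2 q3 by (simp add: power2_eq_square field_simps)
   then have "1 + (1 / (pi\<^sup>2 * eps\<^sup>2)) * (CC s - (CC (s + eps) + CC (s - eps)) / 2) = 1 + (pi\<^sup>2 * (eps - s) - pi\<^sup>2 * eps\<^sup>2) / (pi\<^sup>2 * eps\<^sup>2)" by simp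
   also have "\<dots> = (eps - s) / eps\<^sup>2" using e by (simp add: diff_divide_distrib)
   finally show ?thesis using False by (simp add: tri_def s_def)
  qed
 qed
 ultimately show ?thesis using TPs by simp
qed

lemma sum_int_symmetric:
 fixes g :: "int \<Rightarrow> 'a::comm_monoid_add"
 shows "(\<Sum>j\<in>{- int J..int J}. g j) = g 0 + (\<Sum>j<J. g (int (Suc j)) + g (- int (Suc j)))"
proof (induction J)
 case (Suc J)
 have "{- int (Suc J)..int (Suc J)} = insert (int (Suc J)) (insert (- int (Suc J)) {- int J..int J})" by auto
 then have "(\<Sum>j\<in>{- int (Suc J)..int (Suc J)}. g j) = g (int (Suc J)) + (g (- int (Suc J)) + (\<Sum>j\<in>{- int J..int J}. g j))" by simp
 then show ?case using Suc by (simp add: ac_simps)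
qed simp

lemma TP_cis: "complex_of_real (TP eps J t) = (\<Sum>j\<in>{- int J..int J}. of_real (fc eps (nat \<bar>j\<bar>)) * cis (2 * pi * of_int j * t))"
proof -
 have "of_real (fc eps (Suc j)) * cis (2 * pi * real (Suc j) * t) + of_real (fc eps (Suc j)) * cis (- (2 * pi * real (Suc j) * t))
   = complex_of_real (2 * (fc eps (Suc j) * cos (2 * pi * real (Suc j) * t)))" for j
  by (simp add: complex_eq_iff del: of_nat_Suc)
 then show ?thesis unfolding sum_int_symmetric TP_def
  by (simp add: sum_distrib_left fc_def[of _ 0] del: of_nat_Suc of_real_mult)
qed

text \<open>Written with complex exponentials, the product of the one-dimensional sums expands over
  the box of frequencies; the real part is then taken.\<close>

lemma prod_TP:
 fixes x :: "real^'n"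
 shows "(\<Prod>i\<in>UNIV. TP eps J (x $ i)) =
  (\<Sum>k\<in>PiE UNIV (\<lambda>_. {- int J..int J}). (\<Prod>i\<in>UNIV. fc eps (nat \<bar>k i\<bar>)) * cos (2 * pi * (\<Sum>i\<in>(UNIV::'n set). of_int (k i) * x $ i)))"
proof -
 have cp: "(\<Prod>i\<in>(UNIV::'n set). cis (a i)) = cis (\<Sum>i\<in>UNIV. a i)" for a
 proof -
  have "(\<Prod>i\<in>I. cis (a i)) = cis (\<Sum>i\<in>I. a i)" if "finite I" for I :: "'n set"
   using that by (induction I rule: finite_induct) (auto simp: cis_mult)
  then show ?thesis by simp
 qed
 have "complex_of_real (\<Prod>i\<in>UNIV. TP eps J (x $ i)) = (\<Prod>i\<in>UNIV. \<Sum>j\<in>{- int J..int J}. of_real (fc eps (nat \<bar>j\<bar>)) * cis (2 * pi * of_int j * x $ i))"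
  by (simp only: of_real_prod TP_cis)
 also have "\<dots> = (\<Sum>k\<in>PiE UNIV (\<lambda>_. {- int J..int J}). \<Prod>i\<in>UNIV. of_real (fc eps (nat \<bar>k i\<bar>)) * cis (2 * pi * of_int (k i) * x $ i))"
  by (rule prod_sum_PiE) auto
 also have "\<dots> = (\<Sum>k\<in>PiE UNIV (\<lambda>_. {- int J..int J}). of_real (\<Prod>i\<in>UNIV. fc eps (nat \<bar>k i\<bar>)) * cis (2 * pi * (\<Sum>i\<in>UNIV. of_int (k i) * x $ i)))"
  by (simp add: prod.distrib cp sum_distrib_left mult.assoc)
 finally have "Re (complex_of_real (\<Prod>i\<in>UNIV. TP eps J (x $ i))) = Re (\<Sum>k\<in>PiE UNIV (\<lambda>_. {- int J..int J}). of_real (\<Prod>i\<in>UNIV. fc eps (nat \<bar>k i\<bar>)) * cis (2 * pi * (\<Sum>i\<in>UNIV. of_int (k i) * x $ i)))"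
  by simp
 then show ?thesis by (simp add: Re_sum del: of_real_prod)
qed

subsection \<open>Sums over the lattice\<close>

lemma sum_powr_le:
 assumes a: "0 < a" "a < 1"
 shows "(\<Sum>j<N. real (Suc j) powr (- a)) \<le> real N powr (1 - a) / (1 - a)"
proof (induction N)
 case (Suc N)
 have step: "real (Suc N) powr (- a) \<le> (real (Suc N) powr (1 - a) - real N powr (1 - a)) / (1 - a)"
 proof (cases "N = 0")
  case True then show ?thesis using a by simp
 next
  case False
  have "\<exists>z. real N < z \<and> z < real (Suc N) \<and> real (Suc N) powr (1 - a) - real N powr (1 - a) = (real (Suc N) - real N) * ((1 - a) * z powr (1 - a - 1))"
  proof (rule MVT2)
   fix x assume "real N \<le> x"
   then have "x > 0" using False by (meson less_le_trans of_nat_0_less_iff not_gr0)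
   then show "((\<lambda>x. x powr (1 - a)) has_real_derivative (1 - a) * x powr (1 - a - 1)) (at x)" by (rule has_real_derivative_powr)
  qed simp
  then obtain z where z: "real N < z" "z < real (Suc N)" "real (Suc N) powr (1 - a) - real N powr (1 - a) = (1 - a) * z powr (- a)" by auto
  have "real (Suc N) powr (- a) \<le> z powr (- a)" using z a False by (intro powr_mono2') auto
  then show ?thesis using z(3) a by simp
 qed
 have "(\<Sum>j<Suc N. real (Suc j) powr (- a)) = (\<Sum>j<N. real (Suc j) powr (- a)) + real (Suc N) powr (- a)" by simp
 also have "\<dots> \<le> real N powr (1 - a) / (1 - a) + (real (Suc N) powr (1 - a) - real N powr (1 - a)) / (1 - a)"
  using Suc step by linarith
 also have "\<dots> = real (Suc N) powr (1 - a) / (1 - a)" by (simp add: add_divide_distrib[symmetric])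
 finally show ?case .
qed simp

lemma sum_inverse_squares_tail:
 assumes "N > 0"
 shows "(\<Sum>j\<in>{N..<J}. 1 / (real (Suc j))\<^sup>2) \<le> 1 / real N"
proof (cases "N \<le> J")
 case True
 have "(\<Sum>j\<in>{N..<J}. 1 / (real (Suc j))\<^sup>2) \<le> 1 / real N - 1 / real J"
  using True
 proof (induction J rule: dec_induct)
  case (step J)
  have J: "real J > 0" using step assms by simp
  have "1 / (real (Suc J))\<^sup>2 \<le> 1 / (real J * real (Suc J))"
   using J by (intro divide_left_mono) (auto simp: power2_eq_square)
  also have "\<dots> = 1 / real J - 1 / real (Suc J)" using J by (simp add: field_simps)
  finally have "1 / (real (Suc J))\<^sup>2 \<le> 1 / real J - 1 / real (Suc J)" .
  then show ?case using step by simp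
 qed simp
 also have "\<dots> \<le> 1 / real N" by simp
 finally show ?thesis .
qed (use assms in simp)

text \<open>The coefficients are bounded by 1 up to |j| about 1/eps and by 1/(eps j)^2 beyond. Both
  ranges contribute the order eps powr (a - 1), which uses a < 1 for the first.\<close>

lemma fc_sum_bound:
 assumes a: "0 < a" "a < 1"
 obtains K where "K > 0" "\<And>eps J. 0 < eps \<Longrightarrow> eps \<le> 1/2 \<Longrightarrow>
   (\<Sum>j\<in>{- int J..int J}. fc eps (nat \<bar>j\<bar>) * (1 + real_of_int \<bar>j\<bar>) powr (- a)) \<le> K * eps powr (a - 1)"
proof -
 define K where "K = 1 + 2 * (1 / (1 - a) + 2)"
 have K: "K > 0" using a by (simp add: K_def add_pos_nonneg)
 moreover have "(\<Sum>j\<in>{- int J..int J}. fc eps (nat \<bar>j\<bar>) * (1 + real_of_int \<bar>j\<bar>) powr (- a)) \<le> K * eps powr (a - 1)"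
  if e: "0 < eps" "eps \<le> 1/2" for eps J
 proof -
  \<comment> \<open>The crossover between the two bounds for \<open>fc\<close>. As
    \<open>eps \<le> 1/2\<close> it is positive and comparable to 1/eps.\<close>
  define N where "N = nat \<lfloor>1 / eps\<rfloor>"
  have e2: "1 / eps \<ge> 2" using e by (simp add: field_simps)
  have Nr: "real N \<le> 1 / eps" "1 / eps < real N + 1" using e2 unfolding N_def by linarith+
  have N0: "N > 0" and N2: "1 / eps \<le> 2 * real N" using Nr e2 by linarith+
  let ?t = "\<lambda>j. fc eps (Suc j) * real (Suc j) powr (- a)"
  have t0: "?t j \<ge> 0" for j using fc_nonneg by simp
  have "(\<Sum>j<J. ?t j) \<le> (\<Sum>j\<in>{..<N} \<union> {N..<J}. ?t j)"
   by (rule sum_mono2) (use t0 in auto)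
  also have "\<dots> = (\<Sum>j<N. ?t j) + (\<Sum>j\<in>{N..<J}. ?t j)" by (rule sum.union_disjoint) auto
  also have "(\<Sum>j<N. ?t j) \<le> eps powr (a - 1) / (1 - a)"
  proof -
   have "(\<Sum>j<N. ?t j) \<le> (\<Sum>j<N. real (Suc j) powr (- a))"
   proof (rule sum_mono)
    fix j show "?t j \<le> real (Suc j) powr (- a)" using mult_right_mono[OF fc_bounds(1)[OF e(1), of "Suc j"], of "real (Suc j) powr (- a)"] by simp
   qed
   also have "\<dots> \<le> real N powr (1 - a) / (1 - a)" by (rule sum_powr_le[OF a])
   also have "real N powr (1 - a) \<le> (1 / eps) powr (1 - a)" using Nr a by (intro powr_mono2) auto
   also have "(1 / eps) powr (1 - a) = eps powr (a - 1)" using e powr_minus_divide[of eps "1 - a"] by (simp add: powr_divide)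
   finally show ?thesis using a by (simp add: divide_right_mono)
  qed
  also have "(\<Sum>j\<in>{N..<J}. ?t j) \<le> 2 * eps powr (a - 1)"
  proof -
   have "(\<Sum>j\<in>{N..<J}. ?t j) \<le> (\<Sum>j\<in>{N..<J}. eps powr (a - 2) * (1 / (real (Suc j))\<^sup>2))"
   proof (rule sum_mono)
    fix j assume j: "j \<in> {N..<J}"
    have "1 / eps \<le> real (Suc j)" using Nr j by simp
    then have "real (Suc j) powr (- a) \<le> (1 / eps) powr (- a)" using e a by (intro powr_mono2') auto
    also have "(1 / eps) powr (- a) = eps powr a" using e by (simp add: powr_divide powr_minus field_simps)
    finally have p: "real (Suc j) powr (- a) \<le> eps powr a" .
    have "?t j \<le> (1 / (eps * real (Suc j))\<^sup>2) * eps powr a"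
     by (rule mult_mono[OF fc_bounds(2)[OF e(1)] p]) auto
    also have "\<dots> = (eps powr a / eps\<^sup>2) * (1 / (real (Suc j))\<^sup>2)" by (simp add: power_mult_distrib del: of_nat_Suc)
    also have "eps powr a / eps\<^sup>2 = eps powr (a - 2)" using e by (simp add: powr_diff)
    finally show "?t j \<le> eps powr (a - 2) * (1 / (real (Suc j))\<^sup>2)" .
   qed
   also have "\<dots> = eps powr (a - 2) * (\<Sum>j\<in>{N..<J}. 1 / (real (Suc j))\<^sup>2)" by (simp only: sum_distrib_left)
   also have "\<dots> \<le> eps powr (a - 2) * (1 / real N)" by (intro mult_left_mono sum_inverse_squares_tail N0) auto
   also have "\<dots> \<le> eps powr (a - 2) * (2 * eps)" using N2 N0 e by (intro mult_left_mono) (auto simp: field_simps)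
   also have "\<dots> = 2 * eps powr (a - 1)" using e powr_mult_base[of eps "a - 2"] by (simp add: mult.commute mult.left_commute)
   finally show ?thesis .
  qed
  finally have S: "(\<Sum>j<J. ?t j) \<le> (1 / (1 - a) + 2) * eps powr (a - 1)" by (simp add: algebra_simps)
  have one: "1 \<le> eps powr (a - 1)"
  proof -
   have "eps powr 0 \<le> eps powr (a - 1)" using e a by (intro powr_mono') auto
   then show ?thesis using e by simp
  qed
  have "(\<Sum>j\<in>{- int J..int J}. fc eps (nat \<bar>j\<bar>) * (1 + real_of_int \<bar>j\<bar>) powr (- a)) = 1 + (\<Sum>j<J. 2 * (fc eps (Suc j) * (1 + real (Suc j)) powr (- a)))"
   unfolding sum_int_symmetric by (simp add: fc_def[of _ 0] del: of_nat_Suc)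
  also have "\<dots> \<le> 1 + (\<Sum>j<J. 2 * ?t j)"
  proof -
   have "(1 + real (Suc j)) powr (- a) \<le> real (Suc j) powr (- a)" for j using a by (intro powr_mono2') auto
   then show ?thesis by (intro add_left_mono sum_mono mult_left_mono) (auto simp: fc_nonneg)
  qed
  also have "\<dots> = 1 + 2 * (\<Sum>j<J. ?t j)" by (simp only: sum_distrib_left)
  also have "\<dots> \<le> eps powr (a - 1) + 2 * ((1 / (1 - a) + 2) * eps powr (a - 1))" using S one by linarith
  also have "\<dots> = K * eps powr (a - 1)" by (simp add: K_def algebra_simps)
  finally show ?thesis .
 qed
 ultimately show ?thesis by (rule that)
qed

lemma int_sum_powr_le:
 assumes a: "0 < a" "a < 1" and N: "N > 0"
 shows "(\<Sum>j\<in>{- int N..int N}. (1 + real_of_int \<bar>j\<bar>) powr (- a)) \<le> (1 + 2 / (1 - a)) * real N powr (1 - a)"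
proof -
 have "(\<Sum>j\<in>{- int N..int N}. (1 + real_of_int \<bar>j\<bar>) powr (- a)) = 1 + (\<Sum>j<N. 2 * (1 + real (Suc j)) powr (- a))"
  unfolding sum_int_symmetric by (simp del: of_nat_Suc)
 also have "\<dots> \<le> 1 + (\<Sum>j<N. 2 * real (Suc j) powr (- a))"
  using a by (intro add_left_mono sum_mono mult_left_mono powr_mono2') auto
 also have "\<dots> = 1 + 2 * (\<Sum>j<N. real (Suc j) powr (- a))" by (simp only: sum_distrib_left)
 also have "\<dots> \<le> real N powr (1 - a) + 2 * (real N powr (1 - a) / (1 - a))"
 proof -
  have "1 \<le> real N powr (1 - a)" using N a by (intro ge_one_powr_ge_zero) auto
  then show ?thesis using sum_powr_le[OF a, of N] by linarith
 qed
 also have "\<dots> = (1 + 2 / (1 - a)) * real N powr (1 - a)" by (simp add: algebra_simps)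
 finally show ?thesis .
qed

definition ivec :: "('n \<Rightarrow> int) \<Rightarrow> real^'n" where "ivec k = (\<chi> i. of_int (k i))"

lemma ivec_norm_ge1: "k \<noteq> (\<lambda>_. 0) \<Longrightarrow> norm (ivec k) \<ge> 1"
proof -
 assume "k \<noteq> (\<lambda>_. 0)"
 then obtain i where "k i \<noteq> 0" by auto
 then have "1 \<le> \<bar>real_of_int (k i)\<bar>" by linarith
 then show ?thesis using component_le_norm_cart[of "ivec k" i] by (simp add: ivec_def)
qed

text \<open>Each 1 + |k_i| is at most 2 |k|, so the power of the norm is distributed evenly over the
  coordinates. A lattice sum then becomes a product of one-dimensional sums.\<close>

lemma ivec_powr_le:
 fixes k :: "'n::finite \<Rightarrow> int"
 assumes "k \<noteq> (\<lambda>_. 0)" "b > 0"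
 shows "norm (ivec k) powr (- b) \<le> 2 powr b * (\<Prod>i\<in>UNIV. (1 + real_of_int \<bar>k i\<bar>) powr (- (b / real CARD('n))))"
proof -
 let ?n = "real CARD('n)"
 have n1: "norm (ivec k) \<ge> 1" by (rule ivec_norm_ge1[OF assms(1)])
 have "1 + real_of_int \<bar>k i\<bar> \<le> 2 * norm (ivec k)" for i
  using component_le_norm_cart[of "ivec k" i] n1 by (simp add: ivec_def)
 then have "(2 * norm (ivec k)) powr (- (b / ?n)) \<le> (1 + real_of_int \<bar>k i\<bar>) powr (- (b / ?n))" for i
  using assms(2) by (intro powr_mono2') auto
 then have "(\<Prod>i\<in>(UNIV::'n set). (2 * norm (ivec k)) powr (- (b / ?n))) \<le> (\<Prod>i\<in>UNIV. (1 + real_of_int \<bar>k i\<bar>) powr (- (b / ?n)))"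
  by (intro prod_mono) auto
 moreover have "(\<Prod>i\<in>(UNIV::'n set). (2 * norm (ivec k)) powr (- (b / ?n))) = (2 * norm (ivec k)) powr (- b)"
 proof -
  have "(\<Prod>i\<in>(UNIV::'n set). (2 * norm (ivec k)) powr (- (b / ?n))) = (2 * norm (ivec k)) powr (?n * - (b / ?n))"
   using n1 powr_realpow[of "(2 * norm (ivec k)) powr (- (b / ?n))" "CARD('n)"] by (cases "ivec k = 0") (auto simp: powr_powr mult.commute)
  then show ?thesis by simp
 qed
 ultimately have "(2 * norm (ivec k)) powr (- b) \<le> (\<Prod>i\<in>UNIV. (1 + real_of_int \<bar>k i\<bar>) powr (- (b / ?n)))" by simp
 then have "2 powr b * (2 * norm (ivec k)) powr (- b) \<le> 2 powr b * (\<Prod>i\<in>UNIV. (1 + real_of_int \<bar>k i\<bar>) powr (- (b / ?n)))"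
  by (intro mult_left_mono) auto
 moreover have "2 powr b * (2 * norm (ivec k)) powr (- b) = norm (ivec k) powr (- b)"
  using n1 by (simp add: powr_mult powr_minus field_simps)
 ultimately show ?thesis by simp
qed

text \<open>After distributing the exponent (n+1)/2 over n coordinates each gets less than 1, so
  every one-dimensional sum is dominated by frequencies up to 1/eps. The n factors multiply to the
  power (n+1)/2 - n = -(n-1)/2 of eps.\<close>

lemma lattice_fourier_sum:
 assumes "CARD('n::finite) \<ge> 2"
 obtains C where "C > 0" "\<And>eps J. 0 < eps \<Longrightarrow> eps \<le> 1/2 \<Longrightarrow>
   (\<Sum>k\<in>PiE UNIV (\<lambda>_::'n. {- int J..int J}) - {\<lambda>_. 0}. (\<Prod>i\<in>UNIV. fc eps (nat \<bar>k i\<bar>)) * norm (ivec k) powr (- (real CARD('n) + 1) / 2))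
    \<le> C * eps powr (- (real CARD('n) - 1) / 2)"
proof -
 let ?n = "real CARD('n)"
 define b where "b = (?n + 1) / 2"
 define a where "a = b / ?n"
 have n2: "?n \<ge> 2" using assms by simp
 have a: "0 < a" "a < 1" using n2 by (auto simp: a_def b_def field_simps)
 have b0: "b > 0" using n2 by (simp add: b_def)
 have eb: "- (?n + 1) / 2 = - b" by (simp add: b_def minus_divide_left)
 obtain K where K: "K > 0" "\<And>eps J. 0 < eps \<Longrightarrow> eps \<le> 1/2 \<Longrightarrow>
   (\<Sum>j\<in>{- int J..int J}. fc eps (nat \<bar>j\<bar>) * (1 + real_of_int \<bar>j\<bar>) powr (- a)) \<le> K * eps powr (a - 1)"
  by (rule fc_sum_bound[OF a]) (rule that)
 show ?thesis
 proof (rule that[of "2 powr b * K ^ CARD('n)"])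
  show "2 powr b * K ^ CARD('n) > 0" using K by simp
  fix eps :: real and J assume e: "0 < eps" "eps \<le> 1/2"
  let ?P = "PiE UNIV (\<lambda>_::'n. {- int J..int J})"
  let ?F = "\<lambda>k::'n\<Rightarrow>int. \<Prod>i\<in>UNIV. fc eps (nat \<bar>k i\<bar>)"
  have fin: "finite ?P" by (intro finite_PiE) auto
  have F0: "?F k \<ge> 0" for k by (intro prod_nonneg) (auto simp: fc_nonneg)
  let ?G = "\<lambda>k::'n\<Rightarrow>int. \<Prod>i\<in>UNIV. fc eps (nat \<bar>k i\<bar>) * (1 + real_of_int \<bar>k i\<bar>) powr (- a)"
  have G0: "?G k \<ge> 0" for k by (intro prod_nonneg) (auto simp: fc_nonneg)
  have "(\<Sum>k\<in>?P - {\<lambda>_. 0}. ?F k * norm (ivec k) powr (- (?n + 1) / 2)) \<le> (\<Sum>k\<in>?P - {\<lambda>_. 0}. 2 powr b * ?G k)"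
  proof (rule sum_mono)
   fix k assume "k \<in> ?P - {\<lambda>_. 0}"
   then have "norm (ivec k) powr (- b) \<le> 2 powr b * (\<Prod>i\<in>UNIV. (1 + real_of_int \<bar>k i\<bar>) powr (- a))"
    unfolding a_def using ivec_powr_le[OF _ b0, of k] by auto
   from mult_left_mono[OF this F0[of k]] show "?F k * norm (ivec k) powr (- (?n + 1) / 2) \<le> 2 powr b * ?G k"
    unfolding eb by (simp add: prod.distrib mult_ac)
  qed
  also have "\<dots> = 2 powr b * (\<Sum>k\<in>?P - {\<lambda>_. 0}. ?G k)" by (simp only: sum_distrib_left)
  also have "\<dots> \<le> 2 powr b * (\<Sum>k\<in>?P. ?G k)" by (intro mult_left_mono sum_mono2 fin G0) auto
  also have "(\<Sum>k\<in>?P. ?G k) = (\<Prod>i\<in>(UNIV::'n set). \<Sum>j\<in>{- int J..int J}. fc eps (nat \<bar>j\<bar>) * (1 + real_of_int \<bar>j\<bar>) powr (- a))"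
   by (rule prod_sum_PiE[symmetric]) auto
  also have "\<dots> \<le> (\<Prod>i\<in>(UNIV::'n set). K * eps powr (a - 1))"
   by (intro prod_mono conjI K e sum_nonneg) (auto simp: fc_nonneg)
  also have "\<dots> = K ^ CARD('n) * eps powr (?n * (a - 1))" using e by (simp add: power_mult_distrib powr_power)
  also have "?n * (a - 1) = - (?n - 1) / 2" using n2 by (simp add: a_def b_def field_simps)
  finally show "(\<Sum>k\<in>?P - {\<lambda>_. 0}. ?F k * norm (ivec k) powr (- (?n + 1) / 2)) \<le> 2 powr b * K ^ CARD('n) * eps powr (- (?n - 1) / 2)"
   by (simp add: mult.assoc mult_left_mono)
 qed
qed

text \<open>Used for the error of replacing the weight at a lattice point by its values nearby: the
  weight varies at the rate 1/|k|.\<close>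

lemma lattice_inverse_norm_sum:
 assumes "CARD('n::finite) \<ge> 2"
 obtains C where "C > 0" "\<And>N. N > 0 \<Longrightarrow>
   (\<Sum>k\<in>PiE UNIV (\<lambda>_::'n. {- int N..int N}) - {\<lambda>_. 0}. 1 / norm (ivec k)) \<le> C * real N powr (real CARD('n) - 1)"
proof -
 let ?n = "real CARD('n)"
 define a where "a = 1 / ?n"
 have n2: "?n \<ge> 2" using assms by simp
 have a: "0 < a" "a < 1" using n2 by (auto simp: a_def field_simps)
 define K where "K = 1 + 2 / (1 - a)"
 have K: "K > 0" using a by (simp add: K_def add_pos_nonneg)
 show ?thesis
 proof (rule that[of "2 * K ^ CARD('n)"])
  show "2 * K ^ CARD('n) > 0" using K by simp
  fix N :: nat assume N: "N > 0"
  let ?P = "PiE UNIV (\<lambda>_::'n. {- int N..int N})"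
  have fin: "finite ?P" by (intro finite_PiE) auto
  let ?G = "\<lambda>k::'n\<Rightarrow>int. \<Prod>i\<in>UNIV. (1 + real_of_int \<bar>k i\<bar>) powr (- a)"
  have G0: "?G k \<ge> 0" for k by (intro prod_nonneg) auto
  have "(\<Sum>k\<in>?P - {\<lambda>_. 0}. 1 / norm (ivec k)) \<le> (\<Sum>k\<in>?P - {\<lambda>_. 0}. 2 * ?G k)"
  proof (rule sum_mono)
   fix k assume k: "k \<in> ?P - {\<lambda>_. 0}"
   then have "norm (ivec k) \<ge> 1" using ivec_norm_ge1 by auto
   then have "1 / norm (ivec k) = norm (ivec k) powr (- 1)" by (simp add: powr_minus_divide)
   then show "1 / norm (ivec k) \<le> 2 * ?G k" using ivec_powr_le[of k 1] k by (simp add: a_def)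
  qed
  also have "\<dots> = 2 * (\<Sum>k\<in>?P - {\<lambda>_. 0}. ?G k)" by (simp only: sum_distrib_left)
  also have "\<dots> \<le> 2 * (\<Sum>k\<in>?P. ?G k)" by (intro mult_left_mono sum_mono2 fin G0) auto
  also have "(\<Sum>k\<in>?P. ?G k) = (\<Prod>i\<in>(UNIV::'n set). \<Sum>j\<in>{- int N..int N}. (1 + real_of_int \<bar>j\<bar>) powr (- a))"
   by (rule prod_sum_PiE[symmetric]) auto
  also have "\<dots> \<le> (\<Prod>i\<in>(UNIV::'n set). K * real N powr (1 - a))"
   unfolding K_def by (intro prod_mono conjI int_sum_powr_le a N sum_nonneg) auto
  also have "\<dots> = K ^ CARD('n) * real N powr (?n * (1 - a))" using N by (simp add: power_mult_distrib powr_power)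
  also have "?n * (1 - a) = ?n - 1" using n2 by (simp add: a_def field_simps)
  finally show "(\<Sum>k\<in>?P - {\<lambda>_. 0}. 1 / norm (ivec k)) \<le> 2 * K ^ CARD('n) * real N powr (?n - 1)"
   by simp
 qed
qed

subsection \<open>Rotations, bumps and dilations\<close>

lemma nn_integral_lborel_translate:
 fixes g :: "'a::euclidean_space \<Rightarrow> ennreal"
 assumes [measurable]: "g \<in> borel_measurable borel"
 shows "(\<integral>\<^sup>+x. g (x + a) \<partial>lborel) = (\<integral>\<^sup>+x. g x \<partial>lborel)"
proof -
 have "(\<integral>\<^sup>+x. g x \<partial>lborel) = (\<integral>\<^sup>+x. g x \<partial>distr lborel borel ((+) a))" by (simp only: lborel_distr_plus)
 also have "\<dots> = (\<integral>\<^sup>+x. g (a + x) \<partial>lborel)" by (rule nn_integral_distr) simp_all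
 finally show ?thesis by (simp add: add.commute)
qed

lemma orthogonal_matrix_isometry:
 fixes \<gamma> :: "real^'n^'n"
 assumes "orthogonal_matrix \<gamma>"
 shows "norm (\<gamma> *v x) = norm x" "(\<gamma> *v x) \<bullet> (\<gamma> *v y) = x \<bullet> y" "\<gamma> *v (transpose \<gamma> *v x) = x"
proof -
 have o: "orthogonal_transformation ((*v) \<gamma>)"
  using assms by (simp add: orthogonal_transformation_matrix matrix_vector_mul_linear)
 show "norm (\<gamma> *v x) = norm x" using o by (simp add: orthogonal_transformation)
 show "(\<gamma> *v x) \<bullet> (\<gamma> *v y) = x \<bullet> y" using o unfolding orthogonal_transformation_def by blast
 show "\<gamma> *v (transpose \<gamma> *v x) = x"
  using assms by (simp add: matrix_vector_mul_assoc orthogonal_matrix_def del: transpose_matrix_vector)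
qed

lemma matrix_vector_measurable [measurable]: "(\<lambda>x. (\<gamma>::real^'n^'n) *v x) \<in> borel_measurable borel"
 by (rule borel_measurable_continuous_onI) (simp add: matrix_vector_mult_def, intro continuous_intros)

text \<open>Up to a constant factor there is only one translation invariant measure; the unit ball,
 which is invariant under \<open>\<gamma>\<close>, shows that the factor is \<open>1\<close>.\<close>

lemma lborel_distr_orthogonal:
 fixes \<gamma> :: "real^'n^'n"
 assumes \<gamma>: "orthogonal_matrix \<gamma>"
 shows "distr lborel borel (\<lambda>x. \<gamma> *v x) = lborel"
proof -
 have key: "(\<integral>\<^sup>+x. g (\<gamma> *v x) \<partial>lborel) = (\<integral>\<^sup>+x. g x \<partial>lborel)" if [measurable]: "g \<in> borel_measurable borel" for g :: "real^'n \<Rightarrow> ennreal"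
 proof -
  let ?B = "\<lambda>x::real^'n. indicator (ball 0 1) x :: ennreal"
  have [measurable]: "ball (0::real^'n) 1 \<in> sets borel" by simp
  have Bn: "?B (\<gamma> *v x) = ?B x" "?B (- x) = ?B x" for x
   using orthogonal_matrix_isometry(1)[OF \<gamma>] by (auto simp: indicator_def)
  define b where "b = (\<integral>\<^sup>+x. ?B x \<partial>lborel)"
  have b: "b \<noteq> 0" "b \<noteq> \<infinity>"
  proof -
   have e: "b = emeasure lborel (ball (0::real^'n) 1)" by (simp add: b_def)
   show "b \<noteq> 0" unfolding e using content_ball_pos[of 1 "0::real^'n"] by (auto simp: measure_def)
   show "b \<noteq> \<infinity>" unfolding e using emeasure_bounded_finite[of "ball (0::real^'n) 1"] by auto
  qed
  have "b * (\<integral>\<^sup>+x. g (\<gamma> *v x) \<partial>lborel) = (\<integral>\<^sup>+x. \<integral>\<^sup>+y. g (\<gamma> *v x) * ?B y \<partial>lborel \<partial>lborel)"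
  proof -
   have "(\<integral>\<^sup>+x. \<integral>\<^sup>+y. g (\<gamma> *v x) * ?B y \<partial>lborel \<partial>lborel) = (\<integral>\<^sup>+x. g (\<gamma> *v x) * b \<partial>lborel)"
    unfolding b_def by (intro nn_integral_cong nn_integral_cmult) measurable
   also have "\<dots> = (\<integral>\<^sup>+x. g (\<gamma> *v x) \<partial>lborel) * b" by (rule nn_integral_multc) measurable
   finally show ?thesis by (simp add: mult.commute)
  qed
  also have "\<dots> = (\<integral>\<^sup>+x. \<integral>\<^sup>+y. g (\<gamma> *v x) * ?B (y + - (\<gamma> *v x)) \<partial>lborel \<partial>lborel)"
   by (intro nn_integral_cong nn_integral_lborel_translate[symmetric]) measurable
  also have "\<dots> = (\<integral>\<^sup>+y. \<integral>\<^sup>+x. g (\<gamma> *v x) * ?B (y + - (\<gamma> *v x)) \<partial>lborel \<partial>lborel)"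
   by (rule lborel_pair.Fubini'[symmetric, where f="\<lambda>x y. g (\<gamma> *v x) * ?B (y + - (\<gamma> *v x))"]) measurable
  also have "\<dots> = (\<integral>\<^sup>+y. \<integral>\<^sup>+x. g (\<gamma> *v x + y) * ?B (- (\<gamma> *v x)) \<partial>lborel \<partial>lborel)"
  proof (rule nn_integral_cong)
   fix y :: "real^'n"
   have "(\<integral>\<^sup>+x. g (\<gamma> *v x) * ?B (y + - (\<gamma> *v x)) \<partial>lborel) = (\<integral>\<^sup>+x. g (\<gamma> *v (x + transpose \<gamma> *v y)) * ?B (y + - (\<gamma> *v (x + transpose \<gamma> *v y))) \<partial>lborel)"
    by (rule nn_integral_lborel_translate[symmetric]) measurable
   then show "(\<integral>\<^sup>+x. g (\<gamma> *v x) * ?B (y + - (\<gamma> *v x)) \<partial>lborel) = (\<integral>\<^sup>+x. g (\<gamma> *v x + y) * ?B (- (\<gamma> *v x)) \<partial>lborel)"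
    by (simp add: matrix_vector_right_distrib orthogonal_matrix_isometry(3)[OF \<gamma>] del: transpose_matrix_vector)
  qed
  also have "\<dots> = (\<integral>\<^sup>+x. \<integral>\<^sup>+y. g (\<gamma> *v x + y) * ?B x \<partial>lborel \<partial>lborel)"
   unfolding Bn by (rule lborel_pair.Fubini'[where f="\<lambda>x y. g (\<gamma> *v x + y) * ?B x"]) measurable
  also have "\<dots> = (\<integral>\<^sup>+x. (\<integral>\<^sup>+y. g y \<partial>lborel) * ?B x \<partial>lborel)"
  proof (rule nn_integral_cong)
   fix x :: "real^'n"
   have "(\<integral>\<^sup>+y. g (y + \<gamma> *v x) * ?B x \<partial>lborel) = (\<integral>\<^sup>+y. g (y + \<gamma> *v x) \<partial>lborel) * ?B x" by (rule nn_integral_multc) measurable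
   then show "(\<integral>\<^sup>+y. g (\<gamma> *v x + y) * ?B x \<partial>lborel) = (\<integral>\<^sup>+y. g y \<partial>lborel) * ?B x"
    by (simp add: nn_integral_lborel_translate add.commute)
  qed
  also have "\<dots> = b * (\<integral>\<^sup>+y. g y \<partial>lborel)" unfolding b_def by (simp add: nn_integral_cmult mult.commute)
  finally show ?thesis using b by (simp add: ennreal_mult_cancel_left)
 qed
 show ?thesis
 proof (rule measure_eqI)
  fix A assume "A \<in> sets (distr lborel borel (\<lambda>x. \<gamma> *v x))"
  then have A[measurable]: "A \<in> sets borel" by simp
  have "emeasure (distr lborel borel (\<lambda>x. \<gamma> *v x)) A = (\<integral>\<^sup>+x. indicator A x \<partial>distr lborel borel (\<lambda>x. \<gamma> *v x))" by simp
  also have "\<dots> = (\<integral>\<^sup>+x. indicator A (\<gamma> *v x) \<partial>lborel)" by (rule nn_integral_distr) measurable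
  also have "\<dots> = emeasure lborel A" by (subst key) simp_all
  finally show "emeasure (distr lborel borel (\<lambda>x. \<gamma> *v x)) A = emeasure lborel A" .
 qed simp
qed

lemma lborel_integral_orthogonal:
 fixes g :: "real^'n \<Rightarrow> real"
 assumes "orthogonal_matrix \<gamma>" "g \<in> borel_measurable borel"
 shows "(LINT x|lborel. g (\<gamma> *v x)) = (LINT x|lborel. g x)"
proof -
 have "(LINT x|distr lborel borel (\<lambda>x. \<gamma> *v x). g x) = (LINT x|lborel. g (\<gamma> *v x))"
  by (rule integral_distr) (use assms in measurable)
 then show ?thesis by (simp only: lborel_distr_orthogonal[OF assms(1)])
qed

definition bump :: "real \<Rightarrow> real^'n \<Rightarrow> real" where
 "bump eps x = (\<Prod>i\<in>UNIV. max 0 (eps - \<bar>x $ i\<bar>) / eps\<^sup>2)"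

lemma bump_nonneg: "bump eps x \<ge> 0"
 unfolding bump_def by (intro prod_nonneg) auto

lemma bump_measurable [measurable]: "bump eps \<in> borel_measurable borel"
 unfolding bump_def[abs_def] divide_inverse by (intro borel_measurable_continuous_onI continuous_intros)

lemma bump_support:
 fixes x :: "real^'n"
 assumes "bump eps x \<noteq> 0" "eps > 0"
 shows "norm x \<le> eps * sqrt (real CARD('n))"
proof -
 have "\<bar>x $ i\<bar> \<le> eps" for i
 proof (rule ccontr)
  assume "\<not> \<bar>x $ i\<bar> \<le> eps"
  then have "max 0 (eps - \<bar>x $ i\<bar>) / eps\<^sup>2 = 0" by simp
  then have "bump eps x = 0" unfolding bump_def by (intro prod_zero) (auto intro!: bexI[of _ i])
  then show False using assms by simp
 qed
 then have "(\<Sum>i\<in>UNIV. (x $ i)\<^sup>2) \<le> (\<Sum>i\<in>(UNIV::'n set). eps\<^sup>2)"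
  using assms(2) by (intro sum_mono abs_le_square_iff[THEN iffD1]) simp
 then have "(norm x)\<^sup>2 \<le> (eps * sqrt (real CARD('n)))\<^sup>2"
  by (simp add: norm_vec_def L2_set_def sum_nonneg power_mult_distrib mult.commute)
 moreover have "0 \<le> eps * sqrt (real CARD('n))" using assms(2) by simp
 ultimately show ?thesis by (rule power2_le_imp_le)
qed

lemma triangle_integral:
 assumes "eps > 0"
 shows "(\<integral>\<^sup>+t. ennreal (max 0 (eps - \<bar>t\<bar>) / eps\<^sup>2) \<partial>lborel) = 1"
proof -
 let ?f = "\<lambda>t. (eps + t) / eps\<^sup>2" and ?g = "\<lambda>t. (eps - t) / eps\<^sup>2"
 have I: "(\<integral>\<^sup>+t. ennreal (?f t) * indicator {-eps..0} t \<partial>lborel) = ennreal ((eps * 0 + 0\<^sup>2 / 2) / eps\<^sup>2 - (eps * (-eps) + (-eps)\<^sup>2 / 2) / eps\<^sup>2)"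
  by (rule nn_integral_FTC_Icc[where F="\<lambda>t. (eps * t + t\<^sup>2 / 2) / eps\<^sup>2"])
    (use assms in \<open>auto intro!: derivative_eq_intros DERIV_cdivide\<close>)
 have G: "(\<integral>\<^sup>+t. ennreal (?g t) * indicator {0..eps} t \<partial>lborel) = ennreal ((eps * eps - eps\<^sup>2 / 2) / eps\<^sup>2 - (eps * 0 - 0\<^sup>2 / 2) / eps\<^sup>2)"
  by (rule nn_integral_FTC_Icc[where F="\<lambda>t. (eps * t - t\<^sup>2 / 2) / eps\<^sup>2"])
    (use assms in \<open>auto intro!: derivative_eq_intros DERIV_cdivide\<close>)
 have h: "(eps * 0 + 0\<^sup>2 / 2) / eps\<^sup>2 - (eps * (-eps) + (-eps)\<^sup>2 / 2) / eps\<^sup>2 = 1/2" "(eps * eps - eps\<^sup>2 / 2) / eps\<^sup>2 - (eps * 0 - 0\<^sup>2 / 2) / eps\<^sup>2 = 1/2"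
  using assms by (simp_all add: power2_eq_square field_simps)
 have "(\<integral>\<^sup>+t. ennreal (max 0 (eps - \<bar>t\<bar>) / eps\<^sup>2) \<partial>lborel) = (\<integral>\<^sup>+t. ennreal (?f t) * indicator {-eps..0} t + ennreal (?g t) * indicator {0..eps} t \<partial>lborel)"
 proof (rule nn_integral_cong_AE)
  show "AE t in lborel. ennreal (max 0 (eps - \<bar>t\<bar>) / eps\<^sup>2) = ennreal (?f t) * indicator {-eps..0} t + ennreal (?g t) * indicator {0..eps} t"
   using AE_lborel_singleton[of "0::real"] by eventually_elim (auto simp: indicator_def)
 qed
 also have "\<dots> = ennreal (1/2) + ennreal (1/2)"
  by (subst nn_integral_add) (use I G in \<open>simp_all only: h\<close>, measurable)
 also have "\<dots> = 1" by (subst ennreal_plus[symmetric]) simp_all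
 finally show ?thesis .
qed

lemma bump_integral:
 assumes "eps > 0"
 shows "integrable lborel (\<lambda>x::real^'n. bump eps (x - a))" "(LINT x|lborel. bump eps (x - a)) = 1"
proof -
 have "(\<integral>\<^sup>+(x::real^'n). ennreal (bump eps x) \<partial>lborel) = (\<integral>\<^sup>+(x::real^'n). (\<Prod>b\<in>Basis. ennreal (max 0 (eps - \<bar>x \<bullet> b\<bar>) / eps\<^sup>2)) \<partial>lborel)"
 proof (rule nn_integral_cong)
  fix x :: "real^'n"
  have B: "(Basis :: (real^'n) set) = range (\<lambda>i. axis i 1)" by (auto simp: Basis_vec_def)
  have inj: "inj (\<lambda>i::'n. axis i (1::real))" by (auto simp: inj_def axis_eq_axis)
  show "ennreal (bump eps x) = (\<Prod>b\<in>Basis. ennreal (max 0 (eps - \<bar>x \<bullet> b\<bar>) / eps\<^sup>2))"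
   unfolding B bump_def by (simp add: prod.reindex[OF inj] inner_axis prod_ennreal)
 qed
 also have "\<dots> = (\<Prod>b\<in>(Basis :: (real^'n) set). \<integral>\<^sup>+t. ennreal (max 0 (eps - \<bar>t\<bar>) / eps\<^sup>2) \<partial>lborel)"
  by (rule nn_integral_lborel_prod) simp_all
 also have "\<dots> = 1" by (simp add: triangle_integral[OF assms])
 finally have "(\<integral>\<^sup>+(x::real^'n). ennreal (bump eps x) \<partial>lborel) = 1" .
 moreover have "(\<integral>\<^sup>+(x::real^'n). ennreal (bump eps (x + - a)) \<partial>lborel) = (\<integral>\<^sup>+(x::real^'n). ennreal (bump eps x) \<partial>lborel)"
  by (rule nn_integral_lborel_translate[where g="\<lambda>x. ennreal (bump eps x)"]) measurable
 ultimately have n: "(\<integral>\<^sup>+(x::real^'n). ennreal (bump eps (x - a)) \<partial>lborel) = ennreal 1" by simp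
 have "has_bochner_integral lborel (\<lambda>x::real^'n. bump eps (x - a)) 1"
  by (rule has_bochner_integral_nn_integral[OF _ _ _ n]) (auto simp: bump_nonneg)
 then show "integrable lborel (\<lambda>x::real^'n. bump eps (x - a))" "(LINT x|lborel. bump eps (x - a)) = 1"
  by (auto dest: has_bochner_integral_integral_eq simp: has_bochner_integral_iff)
qed

text \<open>Since \<open>eps \<le> 1/2\<close>, only the translate at the coordinatewise nearest
  lattice point can be nonzero at \<open>x\<close>; the box merely has to contain that
  point.\<close>

lemma prod_tri_eq_sum_bump:
 fixes x :: "real^'n"
 assumes e: "0 < eps" "eps \<le> 1/2" and N: "\<And>i. \<bar>round (x $ i)\<bar> \<le> int N"
 shows "(\<Prod>i\<in>UNIV. tri eps (x $ i)) = (\<Sum>k\<in>PiE UNIV (\<lambda>_. {- int N..int N}). bump eps (x - ivec k))"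
proof -
 define k0 where "k0 = (\<lambda>i. round (x $ i))"
 let ?P = "PiE UNIV (\<lambda>_::'n. {- int N..int N})"
 have fin: "finite ?P" by (intro finite_PiE) auto
 have k0: "k0 \<in> ?P" using N by (auto simp: k0_def PiE_iff abs_le_iff) (metis minus_le_iff)
 have z: "bump eps (x - ivec k) = (if k = k0 then bump eps (x - ivec k0) else 0)" for k
 proof (cases "k = k0")
  case False
  then obtain i where i: "k i \<noteq> round (x $ i)" by (auto simp: k0_def)
  then have "\<not> \<bar>x $ i - of_int (k i)\<bar> < 1/2" using round_unique' by metis
  then have "max 0 (eps - \<bar>(x - ivec k) $ i\<bar>) / eps\<^sup>2 = 0" using e by (simp add: ivec_def)
  then show ?thesis using False unfolding bump_def by (auto intro!: prod_zero bexI[of _ i])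
 qed simp
 have "(\<Sum>k\<in>?P. bump eps (x - ivec k)) = (\<Sum>k\<in>?P. if k = k0 then bump eps (x - ivec k0) else 0)"
  by (rule sum.cong[OF refl z])
 also have "\<dots> = bump eps (x - ivec k0)" using k0 fin by simp
 also have "\<dots> = (\<Prod>i\<in>UNIV. tri eps (x $ i))" by (simp add: bump_def tri_def ivec_def k0_def)
 finally show ?thesis by simp
qed

lemma tri_measurable [measurable]: "tri eps \<in> borel_measurable borel"
proof -
 have [measurable]: "(\<lambda>t::real. real_of_int (round t)) \<in> borel_measurable borel" unfolding round_def by measurable
 show ?thesis unfolding tri_def[abs_def] by measurable
qed

lemma TP_measurable [measurable]: "TP eps J \<in> borel_measurable borel"
 unfolding TP_def[abs_def] by (intro borel_measurable_continuous_onI continuous_intros)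

context weighted_body
begin

text \<open>Constancy along rays reduces the claim to \<open>norm z = 1\<close>, where a ball of
  radius 1/2 stays in an annulus on which the gradient is bounded.\<close>

lemma ft_lipschitz:
 obtains L where "L \<ge> 0" "\<And>y z. z \<noteq> 0 \<Longrightarrow> norm (y - z) \<le> norm z / 2 \<Longrightarrow> \<bar>ft y - ft z\<bar> \<le> L * norm (y - z) / norm z"
proof -
 let ?S = "{x::real^'n. 1/4 < norm x \<and> norm x < 2}"
 have U: "UC (Suc 0) {()} ?S (\<lambda>_. ft)" by (rule ft_UC) simp
 obtain G where G: "\<And>w x. w \<in> {()} \<Longrightarrow> x \<in> ?S \<Longrightarrow> (ft has_derivative (\<lambda>v. G w x \<bullet> v)) (at x)"
  "\<And>i. UC 0 {()} ?S (\<lambda>w x. G w x $ i)" by (rule UC_SucE[OF U]) blast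
 have "\<forall>i. \<exists>M. \<forall>x\<in>?S. \<bar>G () x $ i\<bar> \<le> M" using UC_bounded[OF G(2)] by auto
 then obtain M where M: "\<And>i x. x \<in> ?S \<Longrightarrow> \<bar>G () x $ i\<bar> \<le> M i" by metis
 define L where "L = (\<Sum>i\<in>UNIV. \<bar>M i\<bar>)"
 have L0: "L \<ge> 0" unfolding L_def by (intro sum_nonneg) auto
 have GL: "norm (G () x) \<le> L" if "x \<in> ?S" for x
 proof -
  have "norm (G () x) \<le> (\<Sum>i\<in>UNIV. \<bar>G () x $ i\<bar>)" by (rule norm_le_l1_cart)
  also have "\<dots> \<le> L" unfolding L_def by (intro sum_mono) (use M[OF that] in \<open>meson abs_ge_self order_trans\<close>)
  finally show ?thesis .
 qed
 have unit: "\<bar>ft y - ft z\<bar> \<le> L * norm (y - z)" if z: "norm z = 1" "norm (y - z) \<le> 1/2" for y z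
 proof -
  have sub: "cball z (1/2) \<subseteq> ?S"
  proof
   fix x assume "x \<in> cball z (1/2)"
   then have "norm (x - z) \<le> 1/2" by (simp add: dist_norm norm_minus_commute)
   then show "x \<in> ?S" using norm_triangle_ineq2[of x z] norm_triangle_ineq2[of z x] z by (simp add: norm_minus_commute)
  qed
  have "norm (ft y - ft z) \<le> L * norm (y - z)"
  proof (rule differentiable_bound[of "cball z (1/2)" ft "\<lambda>x v. G () x \<bullet> v"])
   fix x assume x: "x \<in> cball z (1/2)"
   then have xS: "x \<in> ?S" using sub by blast
   show "(ft has_derivative (\<lambda>v. G () x \<bullet> v)) (at x within cball z (1/2))"
    using G(1)[OF _ xS, of "()"] by (simp add: has_derivative_at_withinI)
   show "onorm (\<lambda>v. G () x \<bullet> v) \<le> L"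
   proof (rule onorm_le)
    fix v show "norm (G () x \<bullet> v) \<le> L * norm v"
     using Cauchy_Schwarz_ineq2[of "G () x" v] mult_right_mono[OF GL[OF xS], of "norm v"] by simp
   qed
  qed (use z in \<open>auto simp: dist_norm norm_minus_commute\<close>)
  then show ?thesis by simp
 qed
 show ?thesis
 proof (rule that[OF L0])
  fix y z :: "real^'n" assume z: "z \<noteq> 0" "norm (y - z) \<le> norm z / 2"
  let ?c = "inverse (norm z)"
  have c: "?c > 0" using z by simp
  have e: "norm (?c *\<^sub>R y - ?c *\<^sub>R z) = norm (y - z) / norm z"
   unfolding scaleR_diff_right[symmetric] by (simp add: divide_inverse mult.commute)
  have "norm (?c *\<^sub>R y - ?c *\<^sub>R z) \<le> 1/2" unfolding e using z by (simp add: field_simps)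
  moreover have "norm (?c *\<^sub>R z) = 1" using z by simp
  ultimately have "\<bar>ft (?c *\<^sub>R y) - ft (?c *\<^sub>R z)\<bar> \<le> L * (norm (y - z) / norm z)" using unit[of "?c *\<^sub>R z" "?c *\<^sub>R y"] unfolding e by blast
  then show "\<bar>ft y - ft z\<bar> \<le> L * norm (y - z) / norm z" by (simp add: ft_scale[OF c])
 qed
qed

text \<open>Convexity gives R D + \<delta> D \<subseteq> (R + \<delta>) D, and the hypothesis on
  \<open>v\<close> places it in \<delta> D. This is how smoothing is absorbed into a change of
  dilation.\<close>

lemma dilate_body_add:
 assumes r: "cball 0 r \<subseteq> D" "r > 0" and R: "R > 0" "\<delta> > 0" and y: "y /\<^sub>R R \<in> D" and v: "norm v \<le> r * \<delta>"
 shows "(y + v) /\<^sub>R (R + \<delta>) \<in> D"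
proof -
 have "norm (v /\<^sub>R \<delta>) \<le> r" using v R by (simp add: field_simps)
 then have "v /\<^sub>R \<delta> \<in> D" using r by auto
 then have "(R / (R + \<delta>)) *\<^sub>R (y /\<^sub>R R) + (\<delta> / (R + \<delta>)) *\<^sub>R (v /\<^sub>R \<delta>) \<in> D"
  using y R by (intro convexD[OF convex_body]) (auto simp: field_simps add_divide_distrib[symmetric])
 moreover have "(R / (R + \<delta>)) *\<^sub>R (y /\<^sub>R R) + (\<delta> / (R + \<delta>)) *\<^sub>R (v /\<^sub>R \<delta>) = (y + v) /\<^sub>R (R + \<delta>)"
 proof -
  have "R / (R + \<delta>) * inverse R = inverse (R + \<delta>)" "\<delta> / (R + \<delta>) * inverse \<delta> = inverse (R + \<delta>)"
   using R by (simp_all add: divide_inverse)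
  then show ?thesis by (simp only: scaleR_scaleR scaleR_add_right)
 qed
 ultimately show ?thesis by simp
qed

definition vol :: real where "vol = (LINT x|uniform_on D. ft x)"

text \<open>Identifies the main term. In polar coordinates the weight does not depend on
  \<open>s\<close>, so the radial integral of n s^(n-1) is 1 and \<open>rad y ^ n\<close> gives back
  \<open>m\<close>.\<close>

lemma sphere_integral_eq_vol: "sphere_integral (\<lambda>\<theta>. f \<theta> * m \<theta>) = real CARD('n) * vol"
proof -
 let ?n = "CARD('n)"
 obtain B where B: "\<And>x. \<bar>ft x\<bar> \<le> B" by (rule ft_bounded) blast
 define G where "G = (\<lambda>y. f (y /\<^sub>R norm y) * m (y /\<^sub>R norm y))"
 have Ge: "G = (\<lambda>y. if y = 0 then f 0 * m 0 else ft y * rad y ^ ?n)"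
  by (auto simp: G_def fun_eq_iff ft_def rad_power)
 have Gm[measurable]: "G \<in> borel_measurable borel" unfolding Ge by measurable
 have one: "(LINT s|I01. real ?n * s ^ (?n - 1)) = 1"
 proof -
  have "(LINT s|I01. real ?n * s ^ (?n - 1)) = (LINT s|lborel. indicator {0..1} s * (real ?n * s ^ (?n - 1)))"
   by (rule integral_uniform_on) measurable
  also have "\<dots> = real ?n * (LINT s|lborel. s ^ (?n - 1) * indicator {0..1} s)"
   by (simp only: integral_mult_right_zero[symmetric]) (simp add: mult_ac)
  also have "\<dots> = 1" by (subst integral_power) (simp_all add: power_0_left)
  finally show ?thesis .
 qed
 have "vol = (LINT y|Y. LINT s|I01. real ?n * s ^ (?n - 1) * rad y ^ ?n * ft (s *\<^sub>R q y))"
  unfolding vol_def by (rule polar_Y[OF ft_measurable B])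
 also have "\<dots> = (LINT y|Y. G y)"
 proof (rule Bochner_Integration.integral_cong_AE)
  interpret I: finite_measure I01 by (rule finite_I01)
  show "(\<lambda>y. LINT s|I01. real ?n * s ^ (?n - 1) * rad y ^ ?n * ft (s *\<^sub>R q y)) \<in> borel_measurable Y"
   by (rule I.borel_measurable_lebesgue_integral) measurable
  have "AE y in Y. y \<noteq> 0" unfolding uniform_on_def by (subst AE_density) (use AE_lborel_singleton[of "0::real^'n"] in \<open>auto elim: eventually_mono intro!: borel_measurable_indicator\<close>)
  then show "AE y in Y. (LINT s|I01. real ?n * s ^ (?n - 1) * rad y ^ ?n * ft (s *\<^sub>R q y)) = G y"
  proof eventually_elim
   case (elim y)
   have "(LINT s|I01. real ?n * s ^ (?n - 1) * rad y ^ ?n * ft (s *\<^sub>R q y)) = (LINT s|I01. (real ?n * s ^ (?n - 1)) * (rad y ^ ?n * ft y))"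
   proof (rule Bochner_Integration.integral_cong_AE)
    have "AE s in I01. s \<in> {0..1} \<and> s \<noteq> 0" unfolding uniform_on_def by (subst AE_density) (use AE_lborel_singleton[of "0::real"] in \<open>auto elim: eventually_mono simp: indicator_def\<close>)
    then show "AE s in I01. real ?n * s ^ (?n - 1) * rad y ^ ?n * ft (s *\<^sub>R q y) = (real ?n * s ^ (?n - 1)) * (rad y ^ ?n * ft y)"
    proof eventually_elim
     case (elim s)
     then have "ft (s *\<^sub>R q y) = ft (q y)" by (intro ft_scale) auto
     also have "\<dots> = ft y" unfolding q_def by (intro ft_scale) (use \<open>y \<noteq> 0\<close> rad_pos in simp)
     finally show ?case by (simp only: mult.assoc)
    qed
   qed measurable
   also have "\<dots> = (LINT s|I01. real ?n * s ^ (?n - 1)) * (rad y ^ ?n * ft y)" by (rule integral_mult_left_zero)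
   finally show ?case unfolding one Ge using elim by simp
  qed
 qed measurable
 also have "\<dots> = (LINT x|lborel. indicator (ball 0 1) x * G x)" by (rule integral_uniform_on) measurable
 finally show ?thesis unfolding sphere_integral_def set_lebesgue_integral_def G_def by simp
qed

end

subsection \<open>The smoothed lattice sum\<close>

abbreviation icube :: "nat \<Rightarrow> ('n \<Rightarrow> int) set" where
 "icube N \<equiv> PiE UNIV (\<lambda>_. {- int N..int N})"

lemma finite_icube: "finite (icube N :: ('n::finite \<Rightarrow> int) set)"
 by (intro finite_PiE) auto

lemma ivec_inner: "ivec k \<bullet> x = (\<Sum>i\<in>UNIV. of_int (k i) * x $ i)"
 by (simp add: ivec_def inner_vec_def)

lemma ivec_0 [simp]: "ivec (\<lambda>_. 0) = 0"
 by (simp add: ivec_def vec_eq_iff)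

lemma abs_power_diff_le:
 fixes x y M :: real
 assumes "\<bar>x\<bar> \<le> M" "\<bar>y\<bar> \<le> M" "M > 0"
 shows "\<bar>x ^ Suc k - y ^ Suc k\<bar> \<le> real (Suc k) * M ^ k * \<bar>x - y\<bar>"
proof -
 have "\<bar>(x / M) ^ Suc k - (y / M) ^ Suc k\<bar> \<le> real (Suc k) * \<bar>x / M - y / M\<bar>"
  using norm_power_diff[of "x / M" "y / M" "Suc k"] assms by simp
 then have "\<bar>x ^ Suc k - y ^ Suc k\<bar> / M ^ Suc k \<le> real (Suc k) * (\<bar>x - y\<bar> / M)"
  using assms by (simp only: power_divide diff_divide_distrib[symmetric] abs_divide abs_power_minus power_abs)
 then have "\<bar>x ^ Suc k - y ^ Suc k\<bar> \<le> real (Suc k) * (\<bar>x - y\<bar> / M) * M ^ Suc k"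
  using assms by (simp only: pos_divide_le_eq zero_less_power)
 also have "\<dots> = real (Suc k) * M ^ k * \<bar>x - y\<bar>" using assms by simp
 finally show ?thesis .
qed

context weighted_body
begin

definition gR :: "real \<Rightarrow> real^'n \<Rightarrow> real" where
 "gR R y = indicator D (y /\<^sub>R R) * ft y"

definition smoothed :: "real \<Rightarrow> real \<Rightarrow> real^'n^'n \<Rightarrow> real" where
 "smoothed eps R \<gamma> = (LINT x|lborel. gR R (\<gamma> *v x) * (\<Prod>i\<in>UNIV. tri eps (x $ i)))"

text \<open>The nonzero frequencies in the J-th partial Fourier sum of the smoothed count; the
  frequency 0 is the main term.\<close>

definition fterm :: "real \<Rightarrow> real \<Rightarrow> nat \<Rightarrow> real^'n^'n \<Rightarrow> real" where
 "fterm eps R J \<gamma> = (\<Sum>k\<in>icube J - {\<lambda>_. 0}. (\<Prod>i\<in>UNIV. fc eps (nat \<bar>k i\<bar>)) *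
   (R ^ CARD('n) * osc ft (2 * pi * R * norm (ivec k)) 0 (\<gamma> *v (ivec k /\<^sub>R norm (ivec k)))))"

lemma gR_measurable [measurable]: "gR R \<in> borel_measurable borel"
 unfolding gR_def[abs_def] by measurable

text \<open>Rotate by \<gamma>, then rescale by R; the weight is unaffected by the scaling.\<close>

lemma fourier_coefficient:
 assumes \<gamma>: "orthogonal_matrix \<gamma>" and R: "R > 0"
 shows "(LINT x|lborel. gR R (\<gamma> *v x) * cos (2 * pi * (ivec k \<bullet> x))) =
  R ^ CARD('n) * (LINT z|uniform_on D. ft z * cos (2 * pi * R * ((\<gamma> *v ivec k) \<bullet> z)))"
proof -
 define H where "H = (\<lambda>y. gR R y * cos (2 * pi * ((\<gamma> *v ivec k) \<bullet> y)))"
 have Hm[measurable]: "H \<in> borel_measurable borel" unfolding H_def by measurable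
 have "(LINT x|lborel. gR R (\<gamma> *v x) * cos (2 * pi * (ivec k \<bullet> x))) = (LINT x|lborel. H (\<gamma> *v x))"
  unfolding H_def orthogonal_matrix_isometry(2)[OF \<gamma>] ..
 also have "\<dots> = (LINT y|lborel. H y)" by (rule lborel_integral_orthogonal[OF \<gamma> Hm])
 also have "\<dots> = R ^ CARD('n) * (LINT z|lborel. H (R *\<^sub>R z))"
  unfolding lborel_integral_scale[OF Hm R] using R by simp
 also have "(\<lambda>z. H (R *\<^sub>R z)) = (\<lambda>z. indicator D z * (ft z * cos (2 * pi * R * ((\<gamma> *v ivec k) \<bullet> z))))"
  using R by (simp add: H_def gR_def ft_scale mult_ac fun_eq_iff)
 also have "(LINT z|lborel. indicator D z * (ft z * cos (2 * pi * R * ((\<gamma> *v ivec k) \<bullet> z)))) =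
   (LINT z|uniform_on D. ft z * cos (2 * pi * R * ((\<gamma> *v ivec k) \<bullet> z)))"
  by (rule integral_uniform_on[symmetric, OF body_borel]) measurable
 finally show ?thesis .
qed

lemma gR_support:
 assumes "orthogonal_matrix \<gamma>" "R > 0" "\<And>x. x \<in> D \<Longrightarrow> norm x \<le> b" "gR R (\<gamma> *v x) \<noteq> 0"
 shows "norm x \<le> R * b"
proof -
 have "(\<gamma> *v x) /\<^sub>R R \<in> D" using assms(4) by (auto simp: gR_def indicator_def split: if_splits)
 from assms(3)[OF this] have "norm x / R \<le> b"
  using assms(2) orthogonal_matrix_isometry(1)[OF assms(1)] by (simp add: divide_inverse mult.commute)
 then show ?thesis using assms(2) by (simp add: field_simps)
qed

lemma gR_le: assumes "\<And>x. \<bar>ft x\<bar> \<le> B" shows "\<bar>gR R y\<bar> \<le> B"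
 using assms[of y] assms[of y, THEN order_trans[OF abs_ge_zero]] by (simp add: gR_def indicator_def)

text \<open>Poisson summation as dominated convergence: the partial sums \<open>TP\<close> of the
  periodised triangle are uniformly bounded and converge pointwise, while the weighted dilate has
  bounded support. Convergence in J is obtained for each rotation separately.\<close>

lemma fourier_limit:
 assumes \<gamma>: "orthogonal_matrix \<gamma>" and R: "R > 0" and e: "0 < eps" "eps \<le> 1/2"
 shows "(\<lambda>J. fterm eps R J \<gamma>) \<longlonglongrightarrow> smoothed eps R \<gamma> - R ^ CARD('n) * vol"
proof -
 let ?n = "CARD('n)"
 obtain B where B: "B > 0" "\<And>x. \<bar>ft x\<bar> \<le> B" by (rule ft_bounded) (rule that)
 obtain b where b: "\<And>x. x \<in> D \<Longrightarrow> norm x \<le> b" using bounded_body unfolding bounded_iff by blast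
 obtain M where M: "M \<ge> 1" "\<And>J t. \<bar>TP eps J t\<bar> \<le> M" by (rule TP_bounded[OF e(1)]) (rule that)
 define F where "F = (\<lambda>x. gR R (\<gamma> *v x))"
 define w where "w = (indicator (cball 0 (R * b)) :: real^'n \<Rightarrow> real)"
 have Fm[measurable]: "F \<in> borel_measurable borel" unfolding F_def by measurable
 have wm[measurable]: "w \<in> borel_measurable borel" unfolding w_def by (rule borel_measurable_indicator) simp
 have wi: "integrable lborel w" unfolding w_def
  by (subst integrable_indicator_iff) (use emeasure_bounded_finite[OF bounded_cball] in auto)
 have Fw: "\<bar>F x\<bar> \<le> B * w x" for x
 proof (cases "F x = 0")
  case False
  then have "norm x \<le> R * b" unfolding F_def using gR_support[OF \<gamma> R b] by blast
  then show ?thesis using gR_le[OF B(2), of R "\<gamma> *v x"] by (simp add: F_def w_def)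
 qed (use B in \<open>simp add: w_def\<close>)
 have Fb: "\<bar>F x * c\<bar> \<le> B * T * w x" if "\<bar>c\<bar> \<le> T" for x c T
 proof -
  have "\<bar>F x\<bar> * \<bar>c\<bar> \<le> (B * w x) * T" using Fw that B by (intro mult_mono) (auto simp: w_def)
  then show ?thesis by (simp add: abs_mult mult_ac)
 qed
 have int: "integrable lborel (\<lambda>x. F x * cos (2 * pi * (ivec k \<bullet> x)))" for k
 proof (rule Bochner_Integration.integrable_bound)
  show "integrable lborel (\<lambda>x. B * 1 * w x)" using wi by simp
  show "AE x in lborel. norm (F x * cos (2 * pi * (ivec k \<bullet> x))) \<le> norm (B * 1 * w x)"
   using Fb[of _ 1] B by (intro always_eventually) (force simp: w_def)
 qed measurable
 have PM: "\<bar>\<Prod>i\<in>UNIV. TP eps J (x $ i)\<bar> \<le> M ^ ?n" for J and x :: "real^'n"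
 proof -
  have "(\<Prod>i\<in>UNIV. \<bar>TP eps J (x $ i)\<bar>) \<le> (\<Prod>i\<in>(UNIV::'n set). M)" by (intro prod_mono) (use M in auto)
  then show ?thesis by (simp add: abs_prod)
 qed
 have lim: "(\<lambda>J. LINT x|lborel. F x * (\<Prod>i\<in>UNIV. TP eps J (x $ i))) \<longlonglongrightarrow> (LINT x|lborel. F x * (\<Prod>i\<in>UNIV. tri eps (x $ i)))"
 proof (rule integral_dominated_convergence)
  show "integrable lborel (\<lambda>x. B * M ^ ?n * w x)" using wi by simp
  show "AE x in lborel. (\<lambda>J. F x * (\<Prod>i\<in>UNIV. TP eps J (x $ i))) \<longlonglongrightarrow> F x * (\<Prod>i\<in>UNIV. tri eps (x $ i))"
   by (intro always_eventually allI tendsto_mult tendsto_const tendsto_prod TP_tendsto e)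
  show "AE x in lborel. norm (F x * (\<Prod>i\<in>UNIV. TP eps J (x $ i))) \<le> B * M ^ ?n * w x" for J
   using Fb[OF PM] by (intro always_eventually allI) simp
 qed measurable
 have "(LINT x|lborel. F x * (\<Prod>i\<in>UNIV. TP eps J (x $ i))) = R ^ ?n * vol + fterm eps R J \<gamma>" for J
 proof -
  let ?c = "\<lambda>k::'n \<Rightarrow> int. \<Prod>i\<in>UNIV. fc eps (nat \<bar>k i\<bar>)"
  let ?I = "\<lambda>k. R ^ ?n * (LINT z|uniform_on D. ft z * cos (2 * pi * R * ((\<gamma> *v ivec k) \<bullet> z)))"
  have "(LINT x|lborel. F x * (\<Prod>i\<in>UNIV. TP eps J (x $ i))) = (LINT x|lborel. (\<Sum>k\<in>icube J. ?c k * (F x * cos (2 * pi * (ivec k \<bullet> x)))))"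
   unfolding prod_TP ivec_inner sum_distrib_left by (simp only: mult.left_commute)
  also have "\<dots> = (\<Sum>k\<in>icube J. ?c k * (LINT x|lborel. F x * cos (2 * pi * (ivec k \<bullet> x))))"
   by (subst Bochner_Integration.integral_sum) (use int in \<open>auto intro!: integrable_mult_right\<close>)
  also have "\<dots> = (\<Sum>k\<in>icube J. ?c k * ?I k)" unfolding F_def fourier_coefficient[OF \<gamma> R] ..
  also have "\<dots> = ?c (\<lambda>_. 0) * ?I (\<lambda>_. 0) + (\<Sum>k\<in>icube J - {\<lambda>_. 0}. ?c k * ?I k)"
   by (rule sum.remove[OF finite_icube]) (auto simp: PiE_iff)
  also have "?c (\<lambda>_. 0) * ?I (\<lambda>_. 0) = R ^ ?n * vol" by (simp add: fc_def vol_def)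
  also have "(\<Sum>k\<in>icube J - {\<lambda>_. 0}. ?c k * ?I k) = fterm eps R J \<gamma>"
   unfolding fterm_def
  proof (rule sum.cong[OF refl])
   fix k :: "'n \<Rightarrow> int" assume "k \<in> icube J - {\<lambda>_. 0}"
   then have n0: "norm (ivec k) \<noteq> 0" using ivec_norm_ge1[of k] by fastforce
   have "2 * pi * R * ((\<gamma> *v ivec k) \<bullet> z) = 2 * pi * R * norm (ivec k) * ((\<gamma> *v (ivec k /\<^sub>R norm (ivec k))) \<bullet> z) + 0" for z
    using n0 by (simp add: matrix_vector_mult_scaleR)
   then show "?c k * ?I k = ?c k * (R ^ ?n * osc ft (2 * pi * R * norm (ivec k)) 0 (\<gamma> *v (ivec k /\<^sub>R norm (ivec k))))"
    unfolding osc_def by presburger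
  qed
  finally show ?thesis .
 qed
 then have "fterm eps R J \<gamma> = (LINT x|lborel. F x * (\<Prod>i\<in>UNIV. TP eps J (x $ i))) - R ^ ?n * vol" for J by simp
 then show ?thesis using tendsto_diff[OF lim tendsto_const, of "R ^ ?n * vol"] unfolding smoothed_def F_def by simp
qed

text \<open>For each lattice frequency the average over rotations is an average over directions,
  with mean size (R |k|) powr (-(n+1)/2); the coefficients being nonnegative, these add up by the
  lattice sum estimate. Fatou's lemma passes from partial sums to the limit inferior, whose
  measurability is automatic.\<close>

lemma fterm_bound:
 assumes \<mu>: "haar_SO \<mu>"
 shows "\<exists>C\<ge>0. \<forall>eps R. 0 < eps \<longrightarrow> eps \<le> 1/2 \<longrightarrow> R \<ge> 1 \<longrightarrow>
  (\<lambda>\<gamma>. liminf (\<lambda>J. ennreal \<bar>fterm eps R J \<gamma>\<bar>)) \<in> borel_measurable \<mu> \<and>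
  (\<integral>\<^sup>+\<gamma>. liminf (\<lambda>J. ennreal \<bar>fterm eps R J \<gamma>\<bar>) \<partial>\<mu>)
   \<le> ennreal (C * (R powr ((real CARD('n) - 1) / 2) * eps powr (- (real CARD('n) - 1) / 2)))"
proof -
 let ?n = "real CARD('n)"
 define a where "a = (?n + 1) / 2"
 have ae: "- (?n + 1) / 2 = - a" by (simp add: a_def minus_divide_left)
 obtain C1 where C1: "C1 \<ge> 0" "\<And>Om R ph. rotation_invariant Om \<Longrightarrow> R \<ge> 1 \<Longrightarrow> osc ft R ph \<in> borel_measurable borel \<and>
   integrable Om (osc ft R ph) \<and> (LINT om|Om. \<bar>osc ft R ph om\<bar>) \<le> C1 * R powr (- a)"
  using ft_L1_decay unfolding ae by blast
 obtain C2 where C2: "C2 > 0" "\<And>eps J. 0 < eps \<Longrightarrow> eps \<le> 1/2 \<Longrightarrow>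
   (\<Sum>k\<in>icube J - {\<lambda>_::'n. 0::int}. (\<Prod>i\<in>UNIV. fc eps (nat \<bar>k i\<bar>)) * norm (ivec k) powr (- a)) \<le> C2 * eps powr (- (?n - 1) / 2)"
  using lattice_fourier_sum[OF card2] unfolding ae by blast
 have sb[measurable_cong]: "sets \<mu> = sets borel" using \<mu> by (simp add: haar_SO_def)
 have "(\<lambda>\<gamma>. liminf (\<lambda>J. ennreal \<bar>fterm eps R J \<gamma>\<bar>)) \<in> borel_measurable \<mu> \<and>
  (\<integral>\<^sup>+\<gamma>. liminf (\<lambda>J. ennreal \<bar>fterm eps R J \<gamma>\<bar>) \<partial>\<mu>) \<le> ennreal (C1 * C2 * (R powr ((?n - 1) / 2) * eps powr (- (?n - 1) / 2)))"
  if e: "0 < eps" "eps \<le> 1/2" and R: "R \<ge> 1" for eps R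
 proof -
  define h where "h = (\<lambda>(k::'n \<Rightarrow> int) (\<gamma>::real^'n^'n). \<bar>osc ft (2 * pi * R * norm (ivec k)) 0 (\<gamma> *v (ivec k /\<^sub>R norm (ivec k)))\<bar>)"
  define c where "c = (\<lambda>k::'n \<Rightarrow> int. (\<Prod>i\<in>UNIV. fc eps (nat \<bar>k i\<bar>)))"
  have c0: "c k \<ge> 0" for k unfolding c_def by (intro prod_nonneg) (auto simp: fc_nonneg)
  have hk: "(\<lambda>\<gamma>. osc ft (2 * pi * R * norm (ivec k)) 0 (\<gamma> *v (ivec k /\<^sub>R norm (ivec k)))) \<in> borel_measurable \<mu> \<and>
    (\<integral>\<^sup>+\<gamma>. ennreal (h k \<gamma>) \<partial>\<mu>) \<le> ennreal (C1 * (R powr (- a) * norm (ivec k) powr (- a)))" if k: "k \<noteq> (\<lambda>_. 0)" for k :: "'n \<Rightarrow> int"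
  proof
   let ?N = "norm (ivec k)" and ?e = "ivec k /\<^sub>R norm (ivec k)"
   let ?O = "distr \<mu> borel (\<lambda>\<gamma>. \<gamma> *v ?e)"
   have N1: "?N \<ge> 1" by (rule ivec_norm_ge1[OF k])
   then have "norm ?e = 1" by (cases "ivec k = 0") auto
   then have O: "rotation_invariant ?O" by (rule haar_orbit[OF \<mu>])
   have RN: "R * ?N \<ge> 1" using mult_mono[of 1 R 1 ?N] R N1 by simp
   have RN2: "R * ?N \<le> 2 * pi * R * ?N"
    using mult_right_mono[of 1 "2 * pi" "R * ?N"] RN pi_ge_two by (simp add: mult.assoc)
   have R1: "2 * pi * R * ?N \<ge> 1" using RN RN2 by linarith
   note D = C1(2)[OF O R1, of 0]
   have mv: "(\<lambda>\<gamma>::real^'n^'n. \<gamma> *v ?e) \<in> borel_measurable \<mu>"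
    unfolding measurable_cong_sets[OF sb refl]
    by (rule borel_measurable_continuous_onI) (simp only: matrix_vector_mult_def, intro continuous_intros)
   show "(\<lambda>\<gamma>. osc ft (2 * pi * R * ?N) 0 (\<gamma> *v ?e)) \<in> borel_measurable \<mu>"
    using measurable_compose[OF mv conjunct1[OF D]] .
   have [measurable]: "osc ft (2 * pi * R * ?N) 0 \<in> borel_measurable borel" using D by blast
   have ms: "(\<lambda>om. ennreal \<bar>osc ft (2 * pi * R * ?N) 0 om\<bar>) \<in> borel_measurable ?O" by measurable
   have "(\<integral>\<^sup>+\<gamma>. ennreal (h k \<gamma>) \<partial>\<mu>) = (\<integral>\<^sup>+om. ennreal \<bar>osc ft (2 * pi * R * ?N) 0 om\<bar> \<partial>?O)"
    unfolding h_def using nn_integral_distr[OF mv ms] by simp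
   also have "\<dots> = ennreal (LINT om|?O. \<bar>osc ft (2 * pi * R * ?N) 0 om\<bar>)"
    by (rule nn_integral_eq_integral) (use D in auto)
   also have "\<dots> \<le> ennreal (C1 * (2 * pi * R * ?N) powr (- a))" using D by (intro ennreal_leI) blast
   also have "\<dots> \<le> ennreal (C1 * (R * ?N) powr (- a))"
    using C1 RN RN2 by (intro ennreal_leI mult_left_mono powr_mono2') (auto simp: a_def)
   also have "(R * ?N) powr (- a) = R powr (- a) * ?N powr (- a)" using R N1 by (simp add: powr_mult)
   finally show "(\<integral>\<^sup>+\<gamma>. ennreal (h k \<gamma>) \<partial>\<mu>) \<le> ennreal (C1 * (R powr (- a) * ?N powr (- a)))" .
  qed
  have mf: "(\<lambda>\<gamma>. fterm eps R J \<gamma>) \<in> borel_measurable \<mu>" for J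
   unfolding fterm_def by (intro borel_measurable_sum borel_measurable_times borel_measurable_const conjunct1[OF hk]) auto
  have hm: "(\<lambda>\<gamma>. ennreal (h k \<gamma>)) \<in> borel_measurable \<mu>" if "k \<noteq> (\<lambda>_. 0)" for k
   unfolding h_def using conjunct1[OF hk[OF that]] by measurable
  have bJ: "(\<integral>\<^sup>+\<gamma>. ennreal \<bar>fterm eps R J \<gamma>\<bar> \<partial>\<mu>) \<le> ennreal (C1 * C2 * (R powr ((?n - 1) / 2) * eps powr (- (?n - 1) / 2)))" for J
  proof -
   let ?K = "icube J - {\<lambda>_::'n. 0::int}"
   have cR: "c k * R ^ CARD('n) \<ge> 0" for k using c0 R by simp
   have "(\<integral>\<^sup>+\<gamma>. ennreal \<bar>fterm eps R J \<gamma>\<bar> \<partial>\<mu>) \<le> (\<integral>\<^sup>+\<gamma>. (\<Sum>k\<in>?K. ennreal (c k * R ^ CARD('n)) * ennreal (h k \<gamma>)) \<partial>\<mu>)"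
   proof (rule nn_integral_mono)
    fix \<gamma>
    have "\<bar>fterm eps R J \<gamma>\<bar> \<le> (\<Sum>k\<in>?K. (c k * R ^ CARD('n)) * h k \<gamma>)"
     unfolding fterm_def by (rule order_trans[OF sum_abs]) (use c0 R in \<open>simp add: abs_mult h_def c_def mult.assoc\<close>)
    then have "ennreal \<bar>fterm eps R J \<gamma>\<bar> \<le> ennreal (\<Sum>k\<in>?K. (c k * R ^ CARD('n)) * h k \<gamma>)" by (rule ennreal_leI)
    also have "\<dots> = (\<Sum>k\<in>?K. ennreal ((c k * R ^ CARD('n)) * h k \<gamma>))"
     by (rule sum_ennreal[symmetric]) (use cR in \<open>simp add: h_def\<close>)
    also have "\<dots> = (\<Sum>k\<in>?K. ennreal (c k * R ^ CARD('n)) * ennreal (h k \<gamma>))"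
     by (intro sum.cong refl ennreal_mult cR) (simp add: h_def)
    finally show "ennreal \<bar>fterm eps R J \<gamma>\<bar> \<le> (\<Sum>k\<in>?K. ennreal (c k * R ^ CARD('n)) * ennreal (h k \<gamma>))" .
   qed
   also have "\<dots> = (\<Sum>k\<in>?K. \<integral>\<^sup>+\<gamma>. ennreal (c k * R ^ CARD('n)) * ennreal (h k \<gamma>) \<partial>\<mu>)"
    by (rule nn_integral_sum) (intro borel_measurable_times_ennreal borel_measurable_const hm, auto)
   also have "\<dots> = (\<Sum>k\<in>?K. ennreal (c k * R ^ CARD('n)) * (\<integral>\<^sup>+\<gamma>. ennreal (h k \<gamma>) \<partial>\<mu>))"
    by (intro sum.cong refl nn_integral_cmult hm) auto
   also have "\<dots> \<le> (\<Sum>k\<in>?K. ennreal (c k * R ^ CARD('n)) * ennreal (C1 * (R powr (- a) * norm (ivec k) powr (- a))))"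
    by (intro sum_mono mult_left_mono conjunct2[OF hk]) auto
   also have "\<dots> = (\<Sum>k\<in>?K. ennreal ((c k * R ^ CARD('n)) * (C1 * (R powr (- a) * norm (ivec k) powr (- a)))))"
    using C1 by (intro sum.cong refl ennreal_mult[symmetric] cR) auto
   also have "\<dots> = ennreal (\<Sum>k\<in>?K. (c k * R ^ CARD('n)) * (C1 * (R powr (- a) * norm (ivec k) powr (- a))))"
    using C1 cR by (intro sum_ennreal) auto
   also have "(\<Sum>k\<in>?K. (c k * R ^ CARD('n)) * (C1 * (R powr (- a) * norm (ivec k) powr (- a)))) =
     (C1 * (R ^ CARD('n) * R powr (- a))) * (\<Sum>k\<in>?K. c k * norm (ivec k) powr (- a))"
    unfolding sum_distrib_left by (simp only: mult_ac)
   also have "R ^ CARD('n) * R powr (- a) = R powr ((?n - 1) / 2)"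
   proof -
    have "R ^ CARD('n) * R powr (- a) = R powr (?n + - a)" using R by (simp only: powr_add powr_realpow)
    also have "?n + - a = (?n - 1) / 2" by (simp add: a_def field_simps)
    finally show ?thesis .
   qed
   also have "ennreal (C1 * R powr ((?n - 1) / 2) * (\<Sum>k\<in>?K. c k * norm (ivec k) powr (- a)))
     \<le> ennreal (C1 * R powr ((?n - 1) / 2) * (C2 * eps powr (- (?n - 1) / 2)))"
    unfolding c_def using C1 by (intro ennreal_leI mult_left_mono C2(2)[OF e]) auto
   also have "C1 * R powr ((?n - 1) / 2) * (C2 * eps powr (- (?n - 1) / 2)) = C1 * C2 * (R powr ((?n - 1) / 2) * eps powr (- (?n - 1) / 2))"
    by (simp only: mult_ac)
   finally show ?thesis .
  qed
  have mfe: "(\<lambda>\<gamma>. ennreal \<bar>fterm eps R J \<gamma>\<bar>) \<in> borel_measurable \<mu>" for J using mf[of J] by measurable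
  have "(\<lambda>\<gamma>. liminf (\<lambda>J. ennreal \<bar>fterm eps R J \<gamma>\<bar>)) \<in> borel_measurable \<mu>"
   by (rule borel_measurable_liminf[OF mfe])
  moreover have "(\<integral>\<^sup>+\<gamma>. liminf (\<lambda>J. ennreal \<bar>fterm eps R J \<gamma>\<bar>) \<partial>\<mu>) \<le> liminf (\<lambda>J. \<integral>\<^sup>+\<gamma>. ennreal \<bar>fterm eps R J \<gamma>\<bar> \<partial>\<mu>)"
   by (rule nn_integral_liminf[OF mfe])
  moreover have "liminf (\<lambda>J. \<integral>\<^sup>+\<gamma>. ennreal \<bar>fterm eps R J \<gamma>\<bar> \<partial>\<mu>) \<le> liminf (\<lambda>J::nat. ennreal (C1 * C2 * (R powr ((?n - 1) / 2) * eps powr (- (?n - 1) / 2))))"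
   by (intro Liminf_mono always_eventually allI bJ)
  ultimately show ?thesis by (simp add: Liminf_const)
 qed
 then show ?thesis using C1(1) C2(1) by (intro exI[of _ "C1 * C2"]) simp
qed

end

section \<open>Comparison of the sharp and the smoothed sum\<close>

context weighted_body
begin

lemma N_D_eq_sum:
 assumes \<gamma>: "orthogonal_matrix \<gamma>" and \<rho>: "\<rho> > 0"
 shows "N_D f D \<rho> \<gamma> = (\<Sum>k\<in>{k. k \<noteq> (\<lambda>_. 0) \<and> (\<gamma> *v ivec k) /\<^sub>R \<rho> \<in> D}. ft (\<gamma> *v ivec k))"
proof -
 let ?P = "{k. k \<noteq> (\<lambda>_. 0) \<and> (\<gamma> *v ivec k) /\<^sub>R \<rho> \<in> D}"
 have lat: "int_lattice = range (ivec :: _ \<Rightarrow> real^'n)"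
 proof
  show "int_lattice \<subseteq> range (ivec :: _ \<Rightarrow> real^'n)"
  proof
   fix x :: "real^'n" assume "x \<in> int_lattice"
   then have "\<forall>i. \<exists>j. x $ i = of_int j" by (auto simp: int_lattice_def Ints_def)
   then obtain k where "\<And>i. x $ i = of_int (k i)" by metis
   then have "x = ivec k" by (simp add: ivec_def vec_eq_iff)
   then show "x \<in> range ivec" by simp
  qed
 qed (auto simp: int_lattice_def ivec_def)
 have inj: "inj (\<lambda>k. \<gamma> *v ivec k)"
 proof (rule injI)
  fix k l :: "'n \<Rightarrow> int" assume "\<gamma> *v ivec k = \<gamma> *v ivec l"
  then have "norm (\<gamma> *v (ivec k - ivec l)) = 0" by (simp add: matrix_vector_mult_diff_distrib)
  then have "ivec k = ivec l" using orthogonal_matrix_isometry(1)[OF \<gamma>] by simp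
  then show "k = l" by (auto simp: ivec_def vec_eq_iff fun_eq_iff)
 qed
 have z: "\<gamma> *v ivec k = 0 \<longleftrightarrow> k = (\<lambda>_. 0)" for k
 proof -
  have "\<gamma> *v ivec (\<lambda>_. 0) = 0" by simp
  then show ?thesis using injD[OF inj, of k "\<lambda>_. 0"] by metis
 qed
 have im: "y \<in> (\<lambda>x. \<rho> *\<^sub>R x) ` D \<longleftrightarrow> y /\<^sub>R \<rho> \<in> D" for y
 proof
  assume "y /\<^sub>R \<rho> \<in> D"
  moreover have "y = \<rho> *\<^sub>R (y /\<^sub>R \<rho>)" using \<rho> by simp
  ultimately show "y \<in> (\<lambda>x. \<rho> *\<^sub>R x) ` D" by blast
 qed (use \<rho> in auto)
 have "{N. N \<in> (\<lambda>k. \<gamma> *v k) ` int_lattice \<and> N \<noteq> 0 \<and> N \<in> (\<lambda>x. \<rho> *\<^sub>R x) ` D} = (\<lambda>k. \<gamma> *v ivec k) ` ?P"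
  unfolding im lat by (auto simp: z)
 then show ?thesis unfolding N_D_def using sum.reindex[OF inj_on_subset[OF inj], of ?P "\<lambda>N. f (N /\<^sub>R norm N)"]
  by (simp add: ft_def)
qed

text \<open>The smoothed sum is a sum over lattice points of averages of the cut-off weight over a
  small neighbourhood. For a slightly larger body the average at a point of \<rho> D sees no cutoff;
  for a slightly smaller one the average at a point outside \<rho> D is 0. Nonnegativity allows the
  points in the boundary layer to be added or dropped. The remaining errors are the variation of the
  weight and the origin.\<close>

lemma sandwich:
 assumes f0: "\<And>\<theta>. \<theta> \<in> sphere 0 1 \<Longrightarrow> f \<theta> \<ge> 0" and r: "r > 0" "cball 0 r \<subseteq> D"
 obtains C where "C \<ge> 0" "\<And>eps \<rho> \<gamma>. orthogonal_matrix \<gamma> \<Longrightarrow> 0 < eps \<Longrightarrow> eps * sqrt (real CARD('n)) \<le> 1/2 \<Longrightarrow>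
   sqrt (real CARD('n)) / r * eps \<le> 1 \<Longrightarrow> \<rho> \<ge> 2 \<Longrightarrow>
   N_D f D \<rho> \<gamma> \<le> smoothed eps (\<rho> + sqrt (real CARD('n)) / r * eps) \<gamma> + C * (eps * \<rho> powr (real CARD('n) - 1) + 1) \<and>
   smoothed eps (\<rho> - sqrt (real CARD('n)) / r * eps) \<gamma> - C * (eps * \<rho> powr (real CARD('n) - 1) + 1) \<le> N_D f D \<rho> \<gamma>"
proof -
 let ?n = "real CARD('n)"
 obtain B where B: "B > 0" "\<And>x. \<bar>ft x\<bar> \<le> B" by (rule ft_bounded) (rule that)
 obtain b0 where b0: "\<And>x. x \<in> D \<Longrightarrow> norm x \<le> b0" using bounded_body unfolding bounded_iff by blast
 define b where "b = max 1 b0"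
 have b: "b \<ge> 1" "\<And>x. x \<in> D \<Longrightarrow> norm x \<le> b" using b0 by (force simp: b_def)+
 obtain L where L: "L \<ge> 0" "\<And>y z. z \<noteq> 0 \<Longrightarrow> norm (y - z) \<le> norm z / 2 \<Longrightarrow> \<bar>ft y - ft z\<bar> \<le> L * norm (y - z) / norm z"
  by (rule ft_lipschitz) (rule that)
 obtain C1 where C1: "C1 > 0" "\<And>N. N > 0 \<Longrightarrow> (\<Sum>k\<in>icube N - {\<lambda>_::'n. 0::int}. 1 / norm (ivec k)) \<le> C1 * real N powr (?n - 1)"
  using lattice_inverse_norm_sum[OF card2] by blast
 define C where "C = L * sqrt ?n * (C1 * (2 * b + 2) powr (?n - 1)) + B"
 have ft0: "ft y \<ge> 0" if "y \<noteq> 0" for y unfolding ft_def by (rule f0[OF unit_sphere[OF that]])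
 show ?thesis
 proof (rule that[of C])
  show "C \<ge> 0" unfolding C_def using L C1 B by simp
  fix eps \<rho> :: real and \<gamma> :: "real^'n^'n"
  assume \<gamma>: "orthogonal_matrix \<gamma>" and e: "0 < eps" and en: "eps * sqrt ?n \<le> 1/2" and d1: "sqrt ?n / r * eps \<le> 1" and \<rho>: "\<rho> \<ge> 2"
  \<comment> \<open>Chosen so that r \<delta> is the radius of the support of the bump.\<close>
  define \<delta> where "\<delta> = sqrt ?n / r * eps"
  have n1: "sqrt ?n \<ge> 1" using card2 by simp
  have \<delta>: "\<delta> > 0" "\<delta> \<le> 1" "r * \<delta> = eps * sqrt ?n" using d1 e r n1 by (auto simp: \<delta>_def)
  have e2: "eps \<le> 1/2" 
  proof -
   have "eps * 1 \<le> eps * sqrt ?n" using n1 e by (intro mult_left_mono) auto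
   then show ?thesis using en by linarith
  qed
  \<comment> \<open>A box containing the nearest lattice point of every \<open>x\<close> in the
    support of the weighted dilate. The radius \<rho> + 1 allows for \<rho> + \<delta>, and the
    summand 1 absorbs rounding.\<close>
  define N where "N = nat \<lceil>b * (\<rho> + 1)\<rceil> + 1"
  have bp: "b * (\<rho> + 1) \<ge> 1" using mult_mono[of 1 b 1 "\<rho> + 1"] b \<rho> by simp
  have Nr: "b * (\<rho> + 1) + 1 \<le> real N" "real N \<le> b * (\<rho> + 1) + 2" using bp unfolding N_def by linarith+
  have N0: "N > 0" by (simp add: N_def)
  let ?K = "icube N :: ('n \<Rightarrow> int) set"
  let ?Kz = "icube N - {\<lambda>_::'n. 0::int}"
  note iso = orthogonal_matrix_isometry[OF \<gamma>]
  \<comment> \<open>The Lipschitz bound for the weight over the support of the bump at the lattice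
    point \<open>k\<close>.\<close>
  define \<eta> where "\<eta> = (\<lambda>k. L * (eps * sqrt ?n) / norm (ivec k :: real^'n))"
  have \<eta>0: "\<eta> k \<ge> 0" for k unfolding \<eta>_def using L e by simp
  have E: "(\<Sum>k\<in>?Kz. \<eta> k) + B \<le> C * (eps * \<rho> powr (?n - 1) + 1)"
  proof -
   have "real N \<le> (2 * b + 2) * \<rho>"
   proof -
    have "b * (\<rho> + 1) + 2 \<le> b * (\<rho> + \<rho>) + 2 * \<rho>" using b \<rho> by (intro add_mono mult_left_mono) auto
    then show ?thesis using Nr by (simp add: algebra_simps)
   qed
   then have "real N powr (?n - 1) \<le> ((2 * b + 2) * \<rho>) powr (?n - 1)" using card2 by (intro powr_mono2) auto
   also have "\<dots> = (2 * b + 2) powr (?n - 1) * \<rho> powr (?n - 1)" using b \<rho> by (simp add: powr_mult)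
   finally have "(\<Sum>k\<in>?Kz. 1 / norm (ivec k)) \<le> C1 * ((2 * b + 2) powr (?n - 1) * \<rho> powr (?n - 1))"
    using C1(2)[OF N0] mult_left_mono[of _ _ C1] C1(1) by (meson less_imp_le order_trans)
   then have "L * (eps * sqrt ?n) * (\<Sum>k\<in>?Kz. 1 / norm (ivec k)) \<le> L * (eps * sqrt ?n) * (C1 * ((2 * b + 2) powr (?n - 1) * \<rho> powr (?n - 1)))"
    using L e by (intro mult_left_mono) auto
   moreover have "(\<Sum>k\<in>?Kz. \<eta> k) = L * (eps * sqrt ?n) * (\<Sum>k\<in>?Kz. 1 / norm (ivec k))"
    unfolding \<eta>_def sum_distrib_left by simp
   moreover have "0 \<le> B * (eps * \<rho> powr (?n - 1))" "0 \<le> L * sqrt ?n * (C1 * (2 * b + 2) powr (?n - 1))" using B e L C1 by simp_all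
   ultimately show ?thesis unfolding C_def by (simp add: algebra_simps)
  qed
  have near: "\<gamma> *v x \<noteq> 0 \<and> \<bar>ft (\<gamma> *v x) - ft (\<gamma> *v ivec k)\<bar> \<le> \<eta> k" if k: "k \<noteq> (\<lambda>_. 0)" and bx: "bump eps (x - ivec k) \<noteq> 0" for x and k :: "'n \<Rightarrow> int"
  proof -
   have k1: "norm (ivec k) \<ge> 1" by (rule ivec_norm_ge1[OF k])
   have xk: "norm (x - ivec k) \<le> eps * sqrt ?n" by (rule bump_support[OF bx e])
   have d: "norm (\<gamma> *v x - \<gamma> *v ivec k) = norm (x - ivec k)" using iso(1)[of "x - ivec k"] by (simp add: matrix_vector_mult_diff_distrib)
   have "norm (\<gamma> *v ivec k) = norm (ivec k)" by (rule iso)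
   moreover have "norm (\<gamma> *v x) = norm x" by (rule iso)
   moreover have "norm x \<ge> 1/2" using norm_triangle_ineq2[of "ivec k" x] xk en k1 by (simp add: norm_minus_commute)
   moreover have "\<gamma> *v ivec k \<noteq> 0" using calculation(1) k1 by auto
   ultimately have "\<bar>ft (\<gamma> *v x) - ft (\<gamma> *v ivec k)\<bar> \<le> L * norm (x - ivec k) / norm (ivec k)"
    using L(2)[of "\<gamma> *v ivec k" "\<gamma> *v x"] d xk en k1 by simp
   also have "\<dots> \<le> \<eta> k" unfolding \<eta>_def using L xk by (intro divide_right_mono mult_left_mono) auto
   finally have "\<bar>ft (\<gamma> *v x) - ft (\<gamma> *v ivec k)\<bar> \<le> \<eta> k" .
   moreover have "\<gamma> *v x \<noteq> 0"
    using \<open>norm (\<gamma> *v x) = norm x\<close> \<open>norm x \<ge> 1/2\<close> by auto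
   ultimately show ?thesis by simp
  qed
  \<comment> \<open>The local average attached to \<open>k\<close>: the bump has integral 1, so
    pointwise bounds for the integrand turn into bounds for \<open>a R k\<close>.\<close>
  define a where "a = (\<lambda>R k. LINT x|lborel. gR R (\<gamma> *v x) * bump eps (x - ivec k))"
  have bi: "integrable lborel (\<lambda>x. bump eps (x - ivec k))" "(LINT x|lborel. bump eps (x - ivec k)) = 1" for k :: "'n \<Rightarrow> int"
   by (rule bump_integral[OF e])+
  have ai: "integrable lborel (\<lambda>x. gR R (\<gamma> *v x) * bump eps (x - ivec k))" for R k
  proof (rule Bochner_Integration.integrable_bound)
   show "integrable lborel (\<lambda>x. B * bump eps (x - ivec k))" using bi by simp
   show "AE x in lborel. norm (gR R (\<gamma> *v x) * bump eps (x - ivec k)) \<le> norm (B * bump eps (x - ivec k))"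
    using gR_le[OF B(2)] B(1) by (intro always_eventually allI) (simp add: abs_mult bump_nonneg mult_right_mono)
  qed measurable
  have le: "t * 1 \<le> a R k" if "\<And>x. t * bump eps (x - ivec k) \<le> gR R (\<gamma> *v x) * bump eps (x - ivec k)" for t R k
  proof -
   have "(LINT x|lborel. t * bump eps (x - ivec k)) \<le> a R k" unfolding a_def
    by (rule integral_mono) (use bi ai that in auto)
   then show ?thesis using bi by simp
  qed
  have ge: "a R k \<le> t * 1" if "\<And>x. gR R (\<gamma> *v x) * bump eps (x - ivec k) \<le> t * bump eps (x - ivec k)" for t R k
  proof -
   have "a R k \<le> (LINT x|lborel. t * bump eps (x - ivec k))" unfolding a_def
    by (rule integral_mono) (use bi ai that in auto)
   then show ?thesis using bi by simp
  qed
  \<comment> \<open>Needed for k = 0, which contributes to the smoothed sum but is excluded from the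
    sharp one.\<close>
  have zero: "- B \<le> a R k" "a R k \<le> B" for R k
  proof -
   have g: "- B \<le> gR R y" "gR R y \<le> B" for y using gR_le[OF B(2), of R y] by auto
   have "- B * 1 \<le> a R k" by (rule le) (intro mult_right_mono g bump_nonneg)
   moreover have "a R k \<le> B * 1" by (rule ge) (intro mult_right_mono g bump_nonneg)
   ultimately show "- B \<le> a R k" "a R k \<le> B" by simp_all
  qed
  \<comment> \<open>The weight is known to be nonnegative only away from the origin, which the
    support of the bump avoids for k different from 0.\<close>
  have nonneg: "a R k \<ge> 0" if "k \<noteq> (\<lambda>_. 0)" for R k
  proof -
   have "0 * bump eps (x - ivec k) \<le> gR R (\<gamma> *v x) * bump eps (x - ivec k)" for x
   proof (cases "bump eps (x - ivec k) = 0")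
    case False
    then have "gR R (\<gamma> *v x) \<ge> 0" using near[OF that False] ft0 by (simp add: gR_def)
    then show ?thesis by (simp add: bump_nonneg)
   qed simp
   from le[OF this] show ?thesis by simp
  qed
  have upper: "a R k \<le> ft (\<gamma> *v ivec k) + \<eta> k" if "k \<noteq> (\<lambda>_. 0)" for R k
  proof -
   have "gR R (\<gamma> *v x) * bump eps (x - ivec k) \<le> (ft (\<gamma> *v ivec k) + \<eta> k) * bump eps (x - ivec k)" for x
   proof (cases "bump eps (x - ivec k) = 0")
    case False
    note nr = near[OF that False]
    have "gR R (\<gamma> *v x) \<le> ft (\<gamma> *v x)" using nr ft0[of "\<gamma> *v x"] by (simp add: gR_def indicator_def)
    also have "\<dots> \<le> ft (\<gamma> *v ivec k) + \<eta> k" using nr by linarith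
    finally show ?thesis by (intro mult_right_mono bump_nonneg)
   qed simp
   from ge[OF this] show ?thesis by simp
  qed
  define P where "P = {k. k \<noteq> (\<lambda>_. 0) \<and> (\<gamma> *v ivec k) /\<^sub>R \<rho> \<in> D}"
  have ND: "N_D f D \<rho> \<gamma> = (\<Sum>k\<in>P. ft (\<gamma> *v ivec k))" unfolding P_def by (rule N_D_eq_sum[OF \<gamma>]) (use \<rho> in simp)
  have rb: "\<bar>y\<bar> \<le> b * (\<rho> + 1) \<Longrightarrow> \<bar>round y\<bar> \<le> int N" for y
   using of_int_round_abs_le[of y] Nr(1) by linarith
  have PK: "P \<subseteq> ?Kz"
  proof
   fix k assume k: "k \<in> P"
   then have "norm ((\<gamma> *v ivec k) /\<^sub>R \<rho>) \<le> b" unfolding P_def using b by blast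
   then have "norm (ivec k) / \<rho> \<le> b" using iso \<rho> by (simp add: divide_inverse mult.commute)
   then have nk: "norm (ivec k) \<le> b * (\<rho> + 1)" using \<rho> b by (simp add: field_simps)
   have "\<bar>k i\<bar> \<le> int N" for i
   proof -
    have "\<bar>real_of_int (k i)\<bar> \<le> b * (\<rho> + 1)" using component_le_norm_cart[of "ivec k" i] nk by (simp add: ivec_def)
    from rb[OF this] show ?thesis by simp
   qed
   then have "k \<in> icube N" by (auto simp: PiE_iff abs_le_iff) (metis minus_le_iff)
   then show "k \<in> ?Kz" using k by (simp add: P_def)
  qed
  have fin: "finite ?Kz" using finite_icube by blast
  have S: "smoothed eps R \<gamma> = a R (\<lambda>_. 0) + (\<Sum>k\<in>?Kz. a R k)" if R: "0 < R" "R \<le> \<rho> + 1" for R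
  proof -
   have "smoothed eps R \<gamma> = (LINT x|lborel. (\<Sum>k\<in>?K. gR R (\<gamma> *v x) * bump eps (x - ivec k)))"
    unfolding smoothed_def
   proof (rule Bochner_Integration.integral_cong[OF refl])
    fix x
    show "gR R (\<gamma> *v x) * (\<Prod>i\<in>UNIV. tri eps (x $ i)) = (\<Sum>k\<in>?K. gR R (\<gamma> *v x) * bump eps (x - ivec k))"
    proof (cases "gR R (\<gamma> *v x) = 0")
     case False
     have "norm x \<le> R * b" by (rule gR_support[OF \<gamma> R(1) b(2) False])
     also have "\<dots> \<le> b * (\<rho> + 1)" using R b mult_right_mono[of R "\<rho> + 1" b] by (simp add: mult.commute)
     finally have "\<bar>round (x $ i)\<bar> \<le> int N" for i using component_le_norm_cart[of x i] by (intro rb) simp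
     from prod_tri_eq_sum_bump[OF e e2 this] show ?thesis by (simp only: sum_distrib_left)
    qed simp
   qed
   also have "\<dots> = (\<Sum>k\<in>?K. a R k)" unfolding a_def by (rule Bochner_Integration.integral_sum) (rule ai)
   also have "\<dots> = a R (\<lambda>_. 0) + (\<Sum>k\<in>?Kz. a R k)" by (rule sum.remove[OF finite_icube]) (auto simp: PiE_iff)
   finally show ?thesis .
  qed
  have "N_D f D \<rho> \<gamma> \<le> smoothed eps (\<rho> + \<delta>) \<gamma> + ((\<Sum>k\<in>?Kz. \<eta> k) + B)"
  proof -
   have "ft (\<gamma> *v ivec k) \<le> a (\<rho> + \<delta>) k + \<eta> k" if k: "k \<in> P" for k
   proof -
    have k0: "k \<noteq> (\<lambda>_. 0)" and kD: "(\<gamma> *v ivec k) /\<^sub>R \<rho> \<in> D" using k by (auto simp: P_def)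
    have "(ft (\<gamma> *v ivec k) - \<eta> k) * bump eps (x - ivec k) \<le> gR (\<rho> + \<delta>) (\<gamma> *v x) * bump eps (x - ivec k)" for x
    proof (cases "bump eps (x - ivec k) = 0")
     case False
     have "norm (\<gamma> *v (x - ivec k)) \<le> r * \<delta>" unfolding \<delta>(3) iso by (rule bump_support[OF False e])
     from dilate_body_add[OF r(2,1) _ \<delta>(1) kD this] \<rho>
     have "(\<gamma> *v x) /\<^sub>R (\<rho> + \<delta>) \<in> D" by (simp add: matrix_vector_mult_diff_distrib)
     then have "gR (\<rho> + \<delta>) (\<gamma> *v x) = ft (\<gamma> *v x)" by (simp add: gR_def)
     moreover have "ft (\<gamma> *v ivec k) - \<eta> k \<le> ft (\<gamma> *v x)" using near[OF k0 False] by linarith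
     ultimately show ?thesis by (simp only:) (intro mult_right_mono bump_nonneg)
    qed simp
    from le[OF this] show ?thesis by simp
   qed
   then have "N_D f D \<rho> \<gamma> \<le> (\<Sum>k\<in>P. a (\<rho> + \<delta>) k + \<eta> k)" unfolding ND by (intro sum_mono)
   also have "\<dots> \<le> (\<Sum>k\<in>?Kz. a (\<rho> + \<delta>) k + \<eta> k)"
    by (rule sum_mono2[OF fin PK]) (use nonneg \<eta>0 in auto)
   also have "\<dots> = (\<Sum>k\<in>?Kz. a (\<rho> + \<delta>) k) + (\<Sum>k\<in>?Kz. \<eta> k)" by (rule sum.distrib)
   finally show ?thesis using S[of "\<rho> + \<delta>"] zero(1)[of "\<rho> + \<delta>" "\<lambda>_. 0"] \<rho> \<delta> by linarith
  qed
  moreover have "smoothed eps (\<rho> - \<delta>) \<gamma> - ((\<Sum>k\<in>?Kz. \<eta> k) + B) \<le> N_D f D \<rho> \<gamma>"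
  proof -
   \<comment> \<open>If the smaller body met the support of the bump at \<open>k\<close>, dilating
     back by \<delta> would place \<open>k\<close> in the body itself.\<close>
   have out: "a (\<rho> - \<delta>) k = 0" if k: "k \<in> ?Kz - P" for k
   proof -
    have "gR (\<rho> - \<delta>) (\<gamma> *v x) * bump eps (x - ivec k) = 0" for x
    proof (rule ccontr)
     assume nz: "gR (\<rho> - \<delta>) (\<gamma> *v x) * bump eps (x - ivec k) \<noteq> 0"
     then have bx: "bump eps (x - ivec k) \<noteq> 0" and xD: "(\<gamma> *v x) /\<^sub>R (\<rho> - \<delta>) \<in> D"
      by (auto simp: gR_def indicator_def split: if_splits)
     have "norm (\<gamma> *v (ivec k - x)) \<le> r * \<delta>" unfolding \<delta>(3) iso using bump_support[OF bx e] by (simp add: norm_minus_commute)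
     from dilate_body_add[OF r(2,1) _ \<delta>(1) xD this] \<rho> \<delta>
     have "(\<gamma> *v ivec k) /\<^sub>R \<rho> \<in> D" by (simp add: matrix_vector_mult_diff_distrib)
     then show False using k by (auto simp: P_def)
    qed
    then show ?thesis unfolding a_def by (simp only: Bochner_Integration.integral_zero)
   qed
   have "(\<Sum>k\<in>?Kz. a (\<rho> - \<delta>) k) = (\<Sum>k\<in>P. a (\<rho> - \<delta>) k)"
    by (rule sum.mono_neutral_right[OF fin PK]) (use out in blast)
   also have "\<dots> \<le> (\<Sum>k\<in>P. ft (\<gamma> *v ivec k) + \<eta> k)" by (intro sum_mono upper) (simp add: P_def)
   also have "\<dots> = N_D f D \<rho> \<gamma> + (\<Sum>k\<in>P. \<eta> k)" unfolding ND by (rule sum.distrib)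
   also have "(\<Sum>k\<in>P. \<eta> k) \<le> (\<Sum>k\<in>?Kz. \<eta> k)" by (rule sum_mono2[OF fin PK]) (rule \<eta>0)
   finally show ?thesis using S[of "\<rho> - \<delta>"] zero(2)[of "\<rho> - \<delta>" "\<lambda>_. 0"] \<rho> \<delta> by linarith
  qed
  ultimately show "N_D f D \<rho> \<gamma> \<le> smoothed eps (\<rho> + sqrt ?n / r * eps) \<gamma> + C * (eps * \<rho> powr (?n - 1) + 1) \<and>
   smoothed eps (\<rho> - sqrt ?n / r * eps) \<gamma> - C * (eps * \<rho> powr (?n - 1) + 1) \<le> N_D f D \<rho> \<gamma>"
   using E unfolding \<delta>_def[symmetric] by linarith
 qed
qed

end

section \<open>The mean of the remainder\<close>

context weighted_body
begin

text \<open>The exponents balance for \<open>eps = \<rho> powr (- (n - 1) / (n + 1))\<close>: the Fourier term and the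
 boundary layer of width \<open>eps\<close> then both have size \<open>\<rho> powr (n (n - 1) / (n + 1))\<close>.\<close>

lemma remainder_majorant:
 assumes f0: "\<And>\<theta>. \<theta> \<in> sphere 0 1 \<Longrightarrow> f \<theta> \<ge> 0" and \<mu>: "haar_SO \<mu>"
 shows "\<exists>C\<ge>0. \<exists>\<rho>0. \<forall>\<rho>\<ge>\<rho>0. \<exists>M. M \<in> borel_measurable \<mu> \<and> (AE \<gamma> in \<mu>. ennreal \<bar>R_D f m \<rho> \<gamma>\<bar> \<le> M \<gamma>) \<and>
   (\<integral>\<^sup>+ \<gamma>. M \<gamma> \<partial>\<mu>) \<le> ennreal (C * \<rho> powr (- 2 * real CARD('n) / (real CARD('n) + 1)))"
proof -
 let ?n = "real CARD('n)"
 obtain k where kn: "CARD('n) = Suc k" using card2 by (cases "CARD('n)") auto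
 obtain r where r: "r > 0" "cball 0 r \<subseteq> D" by (rule ball_in_body)
 define c where "c = sqrt ?n / r"
 have c0: "c > 0" using r by (simp add: c_def)
 obtain C1 where C1: "C1 \<ge> 0" "\<And>eps \<rho> \<gamma>. orthogonal_matrix \<gamma> \<Longrightarrow> 0 < eps \<Longrightarrow> eps * sqrt ?n \<le> 1/2 \<Longrightarrow> c * eps \<le> 1 \<Longrightarrow> \<rho> \<ge> 2 \<Longrightarrow>
   N_D f D \<rho> \<gamma> \<le> smoothed eps (\<rho> + c * eps) \<gamma> + C1 * (eps * \<rho> powr (?n - 1) + 1) \<and>
   smoothed eps (\<rho> - c * eps) \<gamma> - C1 * (eps * \<rho> powr (?n - 1) + 1) \<le> N_D f D \<rho> \<gamma>"
  by (rule sandwich[OF f0 r, folded c_def]) (assumption, rule that)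
 obtain C2 where C2: "C2 \<ge> 0" "\<And>eps R. 0 < eps \<Longrightarrow> eps \<le> 1/2 \<Longrightarrow> R \<ge> 1 \<Longrightarrow>
  (\<lambda>\<gamma>. liminf (\<lambda>J. ennreal \<bar>fterm eps R J \<gamma>\<bar>)) \<in> borel_measurable \<mu> \<and>
  (\<integral>\<^sup>+\<gamma>. liminf (\<lambda>J. ennreal \<bar>fterm eps R J \<gamma>\<bar>) \<partial>\<mu>) \<le> ennreal (C2 * (R powr ((?n - 1) / 2) * eps powr (- (?n - 1) / 2)))"
  using fterm_bound[OF \<mu>] by blast
 have pr: "prob_space \<mu>" and one: "emeasure \<mu> SOn = 1" using \<mu> by (auto simp: haar_SO_def)
 interpret prob_space \<mu> by (rule pr)
 have AE_SO: "AE \<gamma> in \<mu>. orthogonal_matrix \<gamma>"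
 proof -
  have "SOn \<in> sets \<mu>" using one emeasure_notin_sets[of SOn \<mu>] by auto
  moreover have "measure \<mu> SOn = 1" using one by (simp add: measure_def)
  ultimately have "AE \<gamma> in \<mu>. \<gamma> \<in> SOn" by (intro AE_prob_1)
  then show ?thesis by (rule eventually_mono) (simp add: SOn_def)
 qed
 define s where "s = (?n - 1) / (?n + 1)"
 define t where "t = ?n * (?n - 1) / (?n + 1)"
 have n2: "?n \<ge> 2" using card2 by simp
 have s0: "s > 0" using n2 by (simp add: s_def)
 \<comment> \<open>The smallness of \<open>eps\<close> that the enclosure demands; it holds for
   large \<rho> since \<open>eps\<close> tends to 0.\<close>
 define d0 where "d0 = min (1 / (2 * sqrt ?n)) (1 / c)"
 have d0: "d0 > 0" using c0 by (simp add: d0_def)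
 have "((\<lambda>\<rho>. \<rho> powr (- s)) \<longlongrightarrow> 0) at_top" by (rule tendsto_neg_powr) (use s0 filterlim_ident in auto)
 then have "eventually (\<lambda>\<rho>. \<rho> powr (- s) < d0) at_top" using d0 by (rule order_tendstoD)
 then obtain \<rho>1 where \<rho>1: "\<And>\<rho>. \<rho> \<ge> \<rho>1 \<Longrightarrow> \<rho> powr (- s) < d0" unfolding eventually_at_top_linorder by blast
 \<comment> \<open>Twice \<open>C1\<close> because the enclosure error W + 1 is at most 2 W, and one
   change of volume for each of the two auxiliary radii.\<close>
 define C3 where "C3 = 2 * C1 + 2 * (\<bar>vol\<bar> * (?n * 2 ^ k * c))"
 define C4 where "C4 = C2 * 2 powr ((?n - 1) / 2)"
 have C3: "C3 \<ge> 0" and C4: "C4 \<ge> 0" using C1 C2 c0 by (simp_all add: C3_def C4_def)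
 have "\<exists>M. M \<in> borel_measurable \<mu> \<and> (AE \<gamma> in \<mu>. ennreal \<bar>R_D f m \<rho> \<gamma>\<bar> \<le> M \<gamma>) \<and>
   (\<integral>\<^sup>+ \<gamma>. M \<gamma> \<partial>\<mu>) \<le> ennreal ((?n * (C4 + C4 + C3)) * \<rho> powr (- 2 * ?n / (?n + 1)))" if \<rho>': "\<rho> \<ge> max 2 \<rho>1" for \<rho>
 proof -
  have \<rho>: "\<rho> \<ge> 2" "\<rho> powr (- s) < d0" using \<rho>' \<rho>1 by auto
  define eps where "eps = \<rho> powr (- s)"
  define W where "W = \<rho> powr t"
  have e0: "eps > 0" using \<rho> by (simp add: eps_def)
  have en: "eps * sqrt ?n \<le> 1/2" and ec: "c * eps \<le> 1"
  proof -
   have "eps \<le> 1 / (2 * sqrt ?n)" "eps \<le> 1 / c" using \<rho>(2) by (auto simp: eps_def d0_def)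
   then show "eps * sqrt ?n \<le> 1/2" "c * eps \<le> 1" using c0 n2 by (simp_all add: field_simps)
  qed
  have e2: "eps \<le> 1/2"
  proof -
   have "eps * 1 \<le> eps * sqrt ?n" using n2 e0 by (intro mult_left_mono) auto
   then show ?thesis using en by linarith
  qed
  have W: "eps * \<rho> powr (?n - 1) = W"
  proof -
   have "eps * \<rho> powr (?n - 1) = \<rho> powr (- s + (?n - 1))" by (simp only: eps_def powr_add)
   also have "- s + (?n - 1) = t" using n2 by (simp add: s_def t_def field_simps)
   finally show ?thesis by (simp only: W_def)
  qed
  have W1: "W \<ge> 1" unfolding W_def using \<rho> n2 by (intro ge_one_powr_ge_zero) (auto simp: t_def)
  let ?L = "\<lambda>R \<gamma>. liminf (\<lambda>J. ennreal \<bar>fterm eps R J \<gamma>\<bar>)"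
  define Rp where "Rp = \<rho> + c * eps"
  define Rm where "Rm = \<rho> - c * eps"
  have ce: "c * eps > 0" using c0 e0 by simp
  have Rp: "1 \<le> Rp" "Rp \<le> 2 * \<rho>" and Rm: "1 \<le> Rm" "Rm \<le> 2 * \<rho>" using ec ce \<rho> by (auto simp: Rp_def Rm_def)
  have LR: "(\<integral>\<^sup>+\<gamma>. ?L R \<gamma> \<partial>\<mu>) \<le> ennreal (C4 * W)" if R: "1 \<le> R" "R \<le> 2 * \<rho>" for R
  proof -
   have "R powr ((?n - 1) / 2) * eps powr (- (?n - 1) / 2) \<le> (2 * \<rho>) powr ((?n - 1) / 2) * eps powr (- (?n - 1) / 2)"
    using R n2 by (intro mult_right_mono powr_mono2) auto
   also have "\<dots> = 2 powr ((?n - 1) / 2) * (\<rho> powr ((?n - 1) / 2) * eps powr (- (?n - 1) / 2))"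
    using \<rho> by (simp add: powr_mult)
   also have "\<rho> powr ((?n - 1) / 2) * eps powr (- (?n - 1) / 2) = W"
   proof -
    have "\<rho> powr ((?n - 1) / 2) * eps powr (- (?n - 1) / 2) = \<rho> powr ((?n - 1) / 2 + - s * (- (?n - 1) / 2))"
     by (simp only: eps_def powr_add powr_powr)
    also have "(?n - 1) / 2 + - s * (- (?n - 1) / 2) = t"
    proof -
     have "(?n - 1) / 2 + - s * (- (?n - 1) / 2) = (?n - 1) / 2 * (1 + s)" by (simp add: field_simps)
     also have "1 + s = 2 * ?n / (?n + 1)" using n2 by (simp add: s_def field_simps)
     finally show ?thesis by (simp add: t_def)
    qed
    finally show ?thesis by (simp only: W_def)
   qed
   finally have "C2 * (R powr ((?n - 1) / 2) * eps powr (- (?n - 1) / 2)) \<le> C4 * W"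
    unfolding C4_def mult.assoc using C2(1) by (intro mult_left_mono) auto
   then have "ennreal (C2 * (R powr ((?n - 1) / 2) * eps powr (- (?n - 1) / 2))) \<le> ennreal (C4 * W)" by (rule ennreal_leI)
   with conjunct2[OF C2(2)[OF e0 e2 R(1)]] show ?thesis by (rule order_trans)
  qed
  have Lm: "?L R \<in> borel_measurable \<mu>" if "R \<ge> 1" for R using C2(2)[OF e0 e2 that] by blast
  have pw: "\<bar>R ^ CARD('n) - \<rho> ^ CARD('n)\<bar> \<le> ?n * 2 ^ k * c * W" if R: "1 \<le> R" "R \<le> 2 * \<rho>" "\<bar>R - \<rho>\<bar> = c * eps" for R
  proof -
   have "\<bar>R ^ Suc k - \<rho> ^ Suc k\<bar> \<le> real (Suc k) * (2 * \<rho>) ^ k * \<bar>R - \<rho>\<bar>"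
    by (rule abs_power_diff_le) (use R \<rho> in auto)
   also have "\<dots> = ?n * 2 ^ k * c * (eps * \<rho> ^ k)" unfolding R(3) kn by (simp add: power_mult_distrib)
   also have "\<rho> ^ k = \<rho> powr (?n - 1)" using \<rho> unfolding kn by (simp add: powr_realpow)
   finally show ?thesis using W unfolding kn by (simp only:)
  qed
  \<comment> \<open>The deviations at both auxiliary radii are added, as either side of the
    enclosure may be the binding one. The factor n/\<rho>^n is the normalisation of the
    remainder.\<close>
  define M where "M = (\<lambda>\<gamma>. ennreal (?n / \<rho> ^ CARD('n)) * (?L Rp \<gamma> + ?L Rm \<gamma> + ennreal (C3 * W)))"
  have Mm: "M \<in> borel_measurable \<mu>" unfolding M_def
   by (intro borel_measurable_times_ennreal borel_measurable_add borel_measurable_const Lm Rp Rm)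
  have MA: "AE \<gamma> in \<mu>. ennreal \<bar>R_D f m \<rho> \<gamma>\<bar> \<le> M \<gamma>"
   using AE_SO
  proof eventually_elim
   case (elim \<gamma>)
   let ?T = "\<lambda>R. smoothed eps R \<gamma> - R ^ CARD('n) * vol"
   \<comment> \<open>For each orthogonal \<gamma> the partial sums converge, so the limit inferior
     is the actual deviation of the smoothed sum.\<close>
   have LT: "?L R \<gamma> = ennreal \<bar>?T R\<bar>" if "R \<ge> 1" for R
   proof -
    have "(\<lambda>J. fterm eps R J \<gamma>) \<longlonglongrightarrow> ?T R" by (rule fourier_limit[OF elim _ e0 e2]) (use that in simp)
    then have "(\<lambda>J. ennreal \<bar>fterm eps R J \<gamma>\<bar>) \<longlonglongrightarrow> ennreal \<bar>?T R\<bar>" by (intro tendsto_ennrealI tendsto_rabs)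
    then show ?thesis by (intro lim_imp_Liminf) auto
   qed
   define Ap where "Ap = Rp ^ CARD('n) * vol"
   define Am where "Am = Rm ^ CARD('n) * vol"
   define A where "A = \<rho> ^ CARD('n) * vol"
   have vv: "\<bar>R ^ CARD('n) * vol - A\<bar> \<le> \<bar>vol\<bar> * (?n * 2 ^ k * c) * W" if "1 \<le> R" "R \<le> 2 * \<rho>" "\<bar>R - \<rho>\<bar> = c * eps" for R
   proof -
    have "\<bar>R ^ CARD('n) * vol - A\<bar> = \<bar>vol\<bar> * \<bar>R ^ CARD('n) - \<rho> ^ CARD('n)\<bar>"
     unfolding A_def left_diff_distrib[symmetric] abs_mult by (rule mult.commute)
    also have "\<dots> \<le> \<bar>vol\<bar> * (?n * 2 ^ k * c * W)" by (intro mult_left_mono pw that) simp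
    finally show ?thesis by (simp only: mult.assoc)
   qed
   have v1: "\<bar>Ap - A\<bar> \<le> \<bar>vol\<bar> * (?n * 2 ^ k * c) * W" unfolding Ap_def by (rule vv[OF Rp]) (use ce in \<open>simp add: Rp_def\<close>)
   have v2: "\<bar>Am - A\<bar> \<le> \<bar>vol\<bar> * (?n * 2 ^ k * c) * W" unfolding Am_def by (rule vv[OF Rm]) (use ce in \<open>simp add: Rm_def\<close>)
   have C1W: "C1 * (W + 1) \<le> 2 * C1 * W" using mult_left_mono[OF W1 C1(1)] by (simp add: algebra_simps)
   note sw = C1(2)[OF elim e0 en ec \<rho>(1), folded Rp_def Rm_def, unfolded W]
   have C3W: "C3 * W = 2 * C1 * W + (\<bar>vol\<bar> * (?n * 2 ^ k * c) * W + \<bar>vol\<bar> * (?n * 2 ^ k * c) * W)" by (simp add: C3_def algebra_simps)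
   have key: "\<bar>A - N_D f D \<rho> \<gamma>\<bar> \<le> \<bar>?T Rp\<bar> + \<bar>?T Rm\<bar> + C3 * W"
    using sw v1 v2 C1W C3W unfolding Ap_def[symmetric] Am_def[symmetric] by linarith
   have "R_D f m \<rho> \<gamma> = (?n / \<rho> ^ CARD('n)) * (A - N_D f D \<rho> \<gamma>)"
    unfolding R_D_def sphere_integral_eq_vol A_def using \<rho> by (simp add: right_diff_distrib)
   then have "\<bar>R_D f m \<rho> \<gamma>\<bar> = (?n / \<rho> ^ CARD('n)) * \<bar>A - N_D f D \<rho> \<gamma>\<bar>" using \<rho> by (simp add: abs_mult)
   also have "\<dots> \<le> (?n / \<rho> ^ CARD('n)) * (\<bar>?T Rp\<bar> + \<bar>?T Rm\<bar> + C3 * W)"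
    using \<rho> by (intro mult_left_mono key) auto
   finally have "ennreal \<bar>R_D f m \<rho> \<gamma>\<bar> \<le> ennreal ((?n / \<rho> ^ CARD('n)) * (\<bar>?T Rp\<bar> + \<bar>?T Rm\<bar> + C3 * W))" by (rule ennreal_leI)
   also have "\<dots> = M \<gamma>"
   proof -
    have "0 \<le> C3 * W" using C3 W1 by simp
    moreover have "0 \<le> ?n / \<rho> ^ CARD('n)" using \<rho> by simp
    ultimately show ?thesis unfolding M_def LT[OF Rp(1)] LT[OF Rm(1)] by (simp only: ennreal_mult ennreal_plus abs_ge_zero add_nonneg_nonneg)
   qed
   finally show ?case .
  qed
  have "(\<integral>\<^sup>+ \<gamma>. M \<gamma> \<partial>\<mu>) = ennreal (?n / \<rho> ^ CARD('n)) * ((\<integral>\<^sup>+ \<gamma>. ?L Rp \<gamma> \<partial>\<mu>) + (\<integral>\<^sup>+ \<gamma>. ?L Rm \<gamma> \<partial>\<mu>) + ennreal (C3 * W))"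
  proof -
   have "(\<integral>\<^sup>+ \<gamma>. M \<gamma> \<partial>\<mu>) = ennreal (?n / \<rho> ^ CARD('n)) * (\<integral>\<^sup>+ \<gamma>. ?L Rp \<gamma> + ?L Rm \<gamma> + ennreal (C3 * W) \<partial>\<mu>)"
    unfolding M_def by (intro nn_integral_cmult borel_measurable_add borel_measurable_const Lm Rp Rm)
   also have "(\<integral>\<^sup>+ \<gamma>. ?L Rp \<gamma> + ?L Rm \<gamma> + ennreal (C3 * W) \<partial>\<mu>) = (\<integral>\<^sup>+ \<gamma>. ?L Rp \<gamma> + ?L Rm \<gamma> \<partial>\<mu>) + (\<integral>\<^sup>+ \<gamma>. ennreal (C3 * W) \<partial>\<mu>)"
    by (rule nn_integral_add) (intro borel_measurable_add borel_measurable_const Lm Rp Rm)+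
   also have "(\<integral>\<^sup>+ \<gamma>. ?L Rp \<gamma> + ?L Rm \<gamma> \<partial>\<mu>) = (\<integral>\<^sup>+ \<gamma>. ?L Rp \<gamma> \<partial>\<mu>) + (\<integral>\<^sup>+ \<gamma>. ?L Rm \<gamma> \<partial>\<mu>)"
    by (rule nn_integral_add) (intro Lm Rp Rm)+
   finally show ?thesis by (simp add: emeasure_space_1)
  qed
  also have "\<dots> \<le> ennreal (?n / \<rho> ^ CARD('n)) * (ennreal (C4 * W) + ennreal (C4 * W) + ennreal (C3 * W))"
   by (intro mult_left_mono add_mono LR Rp Rm order_refl) simp
  also have "\<dots> = ennreal ((?n / \<rho> ^ CARD('n)) * (C4 * W + C4 * W + C3 * W))"
  proof -
   have "0 \<le> C3 * W" "0 \<le> C4 * W" using C3 C4 W1 by simp_all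
   moreover have "0 \<le> ?n / \<rho> ^ CARD('n)" using \<rho> by simp
   ultimately show ?thesis by (simp only: ennreal_mult ennreal_plus add_nonneg_nonneg)
  qed
  also have "(?n / \<rho> ^ CARD('n)) * (C4 * W + C4 * W + C3 * W) = (?n * (C4 + C4 + C3)) * (W / \<rho> ^ CARD('n))"
   by (simp add: algebra_simps add_divide_distrib)
  also have "W / \<rho> ^ CARD('n) = \<rho> powr (- 2 * ?n / (?n + 1))"
  proof -
   have "W / \<rho> ^ CARD('n) = \<rho> powr (t - ?n)" unfolding W_def powr_diff using \<rho> by (simp add: powr_realpow)
   also have "t - ?n = - 2 * ?n / (?n + 1)" using n2 by (simp add: t_def field_simps)
   finally show ?thesis .
  qed
  finally show ?thesis using Mm MA by blast
 qed
 moreover have "?n * (C4 + C4 + C3) \<ge> 0" using C3 C4 by simp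
 ultimately show ?thesis by blast
qed

end

lemma Ck_on_add_const: "Ck_on k S g \<Longrightarrow> Ck_on k S (\<lambda>x. g x + c)"
proof (cases k)
 case (Suc j)
 have "frechet_derivative (\<lambda>x. g x + c) (at x) = frechet_derivative g (at x)" for x
 proof -
  have "((\<lambda>x. g x + c) has_derivative d) (at x) \<longleftrightarrow> (g has_derivative d) (at x)" for d
   using has_derivative_add_const[of g d "at x" c] has_derivative_add_const[of "\<lambda>x. g x + c" d "at x" "- c"] by auto
  then show ?thesis unfolding frechet_derivative_def by simp
 qed
 then show "Ck_on k S g \<Longrightarrow> ?thesis" unfolding Suc by (auto intro!: continuous_intros derivative_intros)
qed (auto intro: continuous_intros)

lemma Ck_on_const: "Ck_on k S (\<lambda>_. c)"
 by (induction k arbitrary: c) auto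

theorem theoremA:
  fixes m f :: "real^'n \<Rightarrow> real" and \<mu> :: "(real^'n^'n) measure"
  assumes "CARD('n) \<ge> 2"
    and "continuous_on (sphere 0 1) m"
    and "\<forall>\<theta>\<in>sphere 0 1. m \<theta> > 0"
    and "piecewise_smooth_on_sphere m"
    and "convex (body m)"
    and "real_analytic_hypersurface (frontier (body m))"
    and "smooth_on_sphere f"
    and "haar_SO \<mu>"
  shows "\<exists>C \<rho>0. \<forall>\<rho>\<ge>\<rho>0.
           (\<integral>\<^sup>+ \<gamma>. ennreal \<bar>R_D f m \<rho> \<gamma>\<bar> \<partial>\<mu>)
             \<le> ennreal (C * \<rho> powr (- 2 * real CARD('n) / (real CARD('n) + 1)))"
proof -
 let ?p = "- 2 * real CARD('n) / (real CARD('n) + 1)"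
 interpret F: weighted_body m f using assms by unfold_locales auto
 obtain B where B: "B > 0" "\<And>x. \<bar>F.ft x\<bar> \<le> B" by (rule F.ft_bounded) (rule that)
 obtain U g where U: "sphere 0 1 \<subseteq> U" "smooth_on U g" "\<And>x. x \<in> sphere 0 1 \<Longrightarrow> f x = g x"
  using assms(7) unfolding smooth_on_sphere_def by blast
 \<comment> \<open>Adding the bound \<open>B\<close> makes the weight nonnegative on the sphere, and
   the constant \<open>B\<close> is itself an admissible weight.\<close>
 have s1: "smooth_on_sphere (\<lambda>x. f x + B)" unfolding smooth_on_sphere_def
  by (intro exI[of _ U] exI[of _ "\<lambda>x. g x + B"]) (use U in \<open>auto simp: smooth_on_def Ck_on_add_const\<close>)
 have s2: "smooth_on_sphere (\<lambda>_::real^'n. B)" unfolding smooth_on_sphere_def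
  by (intro exI[of _ UNIV] exI[of _ "\<lambda>_. B"]) (auto simp: smooth_on_def Ck_on_const)
 interpret G: weighted_body m "\<lambda>x. f x + B" using s1 by unfold_locales
 interpret H: weighted_body m "\<lambda>_. B" using s2 by unfold_locales
 have fB: "f \<theta> + B \<ge> 0" if "\<theta> \<in> sphere 0 1" for \<theta>
  using B(2)[of \<theta>] that unfolding F.ft_def by simp
 obtain C1 \<rho>1 where 1: "C1 \<ge> 0" "\<And>\<rho>. \<rho> \<ge> \<rho>1 \<Longrightarrow> \<exists>M. M \<in> borel_measurable \<mu> \<and> (AE \<gamma> in \<mu>. ennreal \<bar>R_D (\<lambda>x. f x + B) m \<rho> \<gamma>\<bar> \<le> M \<gamma>) \<and>
   (\<integral>\<^sup>+ \<gamma>. M \<gamma> \<partial>\<mu>) \<le> ennreal (C1 * \<rho> powr ?p)"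
  using G.remainder_majorant[OF fB assms(8)] by blast
 obtain C2 \<rho>2 where 2: "C2 \<ge> 0" "\<And>\<rho>. \<rho> \<ge> \<rho>2 \<Longrightarrow> \<exists>M. M \<in> borel_measurable \<mu> \<and> (AE \<gamma> in \<mu>. ennreal \<bar>R_D (\<lambda>_. B) m \<rho> \<gamma>\<bar> \<le> M \<gamma>) \<and>
   (\<integral>\<^sup>+ \<gamma>. M \<gamma> \<partial>\<mu>) \<le> ennreal (C2 * \<rho> powr ?p)"
  using H.remainder_majorant[OF less_imp_le[OF B(1)] assms(8)] by blast
 \<comment> \<open>The remainder is linear in the weight, both in the main term and in the finite or
   infinite counting sum as the latter is defined.\<close>
 have lin: "R_D f m \<rho> \<gamma> = R_D (\<lambda>x. f x + B) m \<rho> \<gamma> - R_D (\<lambda>_. B) m \<rho> \<gamma>" for \<rho> \<gamma>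
 proof -
  interpret I: finite_measure "uniform_on (body m)" by (rule F.finite_D)
  have "integrable (uniform_on (body m)) F.ft" by (rule integrable_bounded_finite[OF F.finite_D _ B(2)]) measurable
  then have "G.vol = F.vol + H.vol" unfolding F.vol_def G.vol_def H.vol_def F.ft_def[abs_def] G.ft_def H.ft_def
   by (subst Bochner_Integration.integral_add) auto
  moreover have "N_D (\<lambda>x. f x + B) (body m) \<rho> \<gamma> = N_D f (body m) \<rho> \<gamma> + N_D (\<lambda>_. B) (body m) \<rho> \<gamma>"
   unfolding N_D_def by (rule sum.distrib)
  ultimately show ?thesis
   unfolding R_D_def F.sphere_integral_eq_vol G.sphere_integral_eq_vol H.sphere_integral_eq_vol by (simp add: algebra_simps)
 qed
 have "(\<integral>\<^sup>+ \<gamma>. ennreal \<bar>R_D f m \<rho> \<gamma>\<bar> \<partial>\<mu>) \<le> ennreal ((C1 + C2) * \<rho> powr ?p)" if \<rho>: "\<rho> \<ge> max \<rho>1 \<rho>2" for \<rho>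
 proof -
  obtain M1 where M1: "M1 \<in> borel_measurable \<mu>" "AE \<gamma> in \<mu>. ennreal \<bar>R_D (\<lambda>x. f x + B) m \<rho> \<gamma>\<bar> \<le> M1 \<gamma>"
   "(\<integral>\<^sup>+ \<gamma>. M1 \<gamma> \<partial>\<mu>) \<le> ennreal (C1 * \<rho> powr ?p)" using 1(2)[of \<rho>] \<rho> by auto
  obtain M2 where M2: "M2 \<in> borel_measurable \<mu>" "AE \<gamma> in \<mu>. ennreal \<bar>R_D (\<lambda>_. B) m \<rho> \<gamma>\<bar> \<le> M2 \<gamma>"
   "(\<integral>\<^sup>+ \<gamma>. M2 \<gamma> \<partial>\<mu>) \<le> ennreal (C2 * \<rho> powr ?p)" using 2(2)[of \<rho>] \<rho> by auto
  \<comment> \<open>Only monotonicity is applied to the remainder; additivity is reserved for the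
    majorants, whose measurability is known.\<close>
  have "(\<integral>\<^sup>+ \<gamma>. ennreal \<bar>R_D f m \<rho> \<gamma>\<bar> \<partial>\<mu>) \<le> (\<integral>\<^sup>+ \<gamma>. M1 \<gamma> + M2 \<gamma> \<partial>\<mu>)"
  proof (rule nn_integral_mono_AE)
   show "AE \<gamma> in \<mu>. ennreal \<bar>R_D f m \<rho> \<gamma>\<bar> \<le> M1 \<gamma> + M2 \<gamma>"
    using M1(2) M2(2)
   proof eventually_elim
    case (elim \<gamma>)
    have "ennreal \<bar>R_D f m \<rho> \<gamma>\<bar> \<le> ennreal (\<bar>R_D (\<lambda>x. f x + B) m \<rho> \<gamma>\<bar> + \<bar>R_D (\<lambda>_. B) m \<rho> \<gamma>\<bar>)"
     unfolding lin[of \<rho> \<gamma>] by (intro ennreal_leI abs_triangle_ineq4)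
    also have "\<dots> = ennreal \<bar>R_D (\<lambda>x. f x + B) m \<rho> \<gamma>\<bar> + ennreal \<bar>R_D (\<lambda>_. B) m \<rho> \<gamma>\<bar>" by (rule ennreal_plus) auto
    also have "\<dots> \<le> M1 \<gamma> + M2 \<gamma>" using elim by (rule add_mono)
    finally show ?case .
   qed
  qed
  also have "\<dots> = (\<integral>\<^sup>+ \<gamma>. M1 \<gamma> \<partial>\<mu>) + (\<integral>\<^sup>+ \<gamma>. M2 \<gamma> \<partial>\<mu>)" by (rule nn_integral_add[OF M1(1) M2(1)])
  also have "\<dots> \<le> ennreal (C1 * \<rho> powr ?p) + ennreal (C2 * \<rho> powr ?p)" by (rule add_mono[OF M1(3) M2(3)])
  also have "\<dots> = ennreal (C1 * \<rho> powr ?p + C2 * \<rho> powr ?p)" using 1(1) 2(1) by (intro ennreal_plus[symmetric]) auto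
  finally show ?thesis by (simp add: distrib_right)
 qed
 then show ?thesis by blast
qed

end
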